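(* Let $A$ be a commutative ring, let $\mathfrak{a}$ be a weakly proregular ideal in $A$, and let $P$ be an $\mathfrak{a}$-adically complete $A$-module. For $k \geq 0$ define the ring $A_k := A/\mathfrak{a}^{k+1}$ and the $A_k$-module $P_k := A_k \otimes_A P$. Then the following three conditions are equivalent: (i) The $A$-module $P$ is $\mathfrak{a}$-adically flat. (ii) The functor $P \otimes_A (-)$ is exact on $\mathfrak{a}$-torsion $A$-modules. (iii) For every $k \geq 0$ the $A_k$-module $P_k$ is flat.
   Context: All rings are commutative. Weak proregularity: for $a \in A$ let $\operatorname{K}(A;a)$ be the Koszul complex $0 \to A \xrightarrow{a\cdot(-)} A \to 0$ concentrated in degrees $-1$ and $0$. For a finite sequence $\boldsymbol{a}=(a_1,\ldots,a_p)$ in $A$, $p \ge 1$, let $\operatorname{K}(A;\boldsymbol{a}) := \operatorname{K}(A;a_1)\otimes_A\cdots\otimes_A \operatorname{K}(A;a_p)$, and $\boldsymbol{a}^j := (a_1^j,\ldots,a_p^j)$. For $j_1\ge j_0\ge 1$ there is a homomorphism of complexes $\operatorname{K}(A;\boldsymbol{a}^{j_1})\to \operatorname{K}(A;\boldsymbol{a}^{j_0})$, the tensor product over $i$ of the homomorphisms $\operatorname{K}(A;a_i^{j_1})\to \operatorname{K}(A;a_i^{j_0})$ that are the identity in degree $0$ and multiplication by $a_i^{j_1-j_0}$ in degree $-1$. An inverse system of modules $\{N_j\}$ is pro-zero if for every $j_0$ there is $j_1\ge j_0$ such that $N_{j_1}\to N_{j_0}$ is zero. The sequence $\boldsymbol{a}$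 is weakly proregular if for every $i\le -1$ the inverse system $\{\operatorname{H}^i(\operatorname{K}(A;\boldsymbol{a}^j))\}_{j\ge 1}$ is pro-zero. An ideal is weakly proregular if it is generated by some (finite) weakly proregular sequence. Completion and torsion: $\Lambda_{\mathfrak a}(M) := \lim_{\leftarrow k} (A/\mathfrak{a}^{k+1})\otimes_A M$, with canonical homomorphism $\tau_M : M\to\Lambda_{\mathfrak a}(M)$; $M$ is $\mathfrak{a}$-adically complete if $\tau_M$ is an isomorphism. An $A$-module $N$ is $\mathfrak{a}$-torsion if every element of $N$ is annihilated by some power $\mathfrak{a}^i$, $i \ge 1$. An $A$-module $P$ is $\mathfrak{a}$-adically flat if $\operatorname{Tor}^A_i(P,N)=0$ for every $\mathfrak{a}$-torsion $A$-module $N$ and every $i>0$. *)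

theory Defs
  imports "HOL.Hull" "HOL-Algebra.Module" "HOL-Algebra.QuotRing" "HOL-Algebra.Ideal_Product"
begin

text \<open>
  Modules are the records of HOL-Algebra, in which the \<open>mult\<close> and \<open>one\<close> fields of a module carry
  no meaning.
\<close>

section \<open>Modules and homomorphisms\<close>

definition mod_hom ::
  "('a, 'r) ring_scheme \<Rightarrow> ('a, 'm, 's) module_scheme \<Rightarrow> ('a, 'n, 't) module_scheme \<Rightarrow> ('m \<Rightarrow> 'n) set"
  where "mod_hom R M N =
    {f. f \<in> carrier M \<rightarrow> carrier N
      \<and> (\<forall>x\<in>carrier M. \<forall>y\<in>carrier M. f (x \<oplus>\<^bsub>M\<^esub> y) = f x \<oplus>\<^bsub>N\<^esub> f y)
      \<and> (\<forall>a\<in>carrier R. \<forall>x\<in>carrier M. f (a \<odot>\<^bsub>M\<^esub> x) = a \<odot>\<^bsub>N\<^esub> f x)}"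

definition mod_iso ::
  "('a, 'r) ring_scheme \<Rightarrow> ('a, 'm, 's) module_scheme \<Rightarrow> ('a, 'n, 't) module_scheme \<Rightarrow> ('m \<Rightarrow> 'n) set"
  where "mod_iso R M N = {f \<in> mod_hom R M N. bij_betw f (carrier M) (carrier N)}"

definition short_exact ::
  "('a, 'r) ring_scheme \<Rightarrow> ('a, 'l, 's) module_scheme \<Rightarrow> ('a, 'm, 't) module_scheme
    \<Rightarrow> ('a, 'n, 'v) module_scheme \<Rightarrow> ('l \<Rightarrow> 'm) \<Rightarrow> ('m \<Rightarrow> 'n) \<Rightarrow> bool"
  where "short_exact R L M N f g \<longleftrightarrow>
    f \<in> mod_hom R L M \<and> g \<in> mod_hom R M N
    \<and> inj_on f (carrier L)
    \<and> f ` carrier L = {x \<in> carrier M. g x = \<zero>\<^bsub>N\<^esub>}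
    \<and> g ` carrier M = carrier N"

definition self_module :: "('a, 'r) ring_scheme \<Rightarrow> ('a, 'a) module"
  where "self_module R =
    \<lparr>carrier = carrier R, mult = mult R, one = one R, zero = zero R, add = add R,
     smult = mult R\<rparr>"

definition quot_module :: "('a, 'm, 's) module_scheme \<Rightarrow> 'm set \<Rightarrow> ('a, 'm set) module"
  where "quot_module M N =
    \<lparr>carrier = a_rcosets\<^bsub>M\<^esub> N, mult = undefined, one = undefined,
     zero = N, add = set_add M,
     smult = (\<lambda>a X. \<Union>x\<in>X. N +>\<^bsub>M\<^esub> (a \<odot>\<^bsub>M\<^esub> x))\<rparr>"

text \<open>The map into the quotient of \<open>M'\<close> by \<open>N'\<close> induced by a map \<open>f\<close> into \<open>M'\<close>.\<close>

definition quot_map ::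
  "('a, 'n, 's) module_scheme \<Rightarrow> 'n set \<Rightarrow> ('m \<Rightarrow> 'n) \<Rightarrow> 'm set \<Rightarrow> 'n set"
  where "quot_map M' N' f X = (\<Union>x\<in>X. N' +>\<^bsub>M'\<^esub> f x)"

text \<open>The free module on \<open>X\<close>: the finitely supported functions from \<open>X\<close> to \<open>R\<close>.\<close>

definition free_module :: "('a, 'r) ring_scheme \<Rightarrow> 'x set \<Rightarrow> ('a, 'x \<Rightarrow> 'a) module"
  where "free_module R X =
    \<lparr>carrier = {f. (\<forall>x. f x \<in> carrier R) \<and> (\<forall>x. x \<notin> X \<longrightarrow> f x = \<zero>\<^bsub>R\<^esub>) \<and> finite {x. f x \<noteq> \<zero>\<^bsub>R\<^esub>}},
     mult = undefined, one = undefined,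
     zero = (\<lambda>_. \<zero>\<^bsub>R\<^esub>), add = (\<lambda>f g x. f x \<oplus>\<^bsub>R\<^esub> g x),
     smult = (\<lambda>a f x. a \<otimes>\<^bsub>R\<^esub> f x)\<rparr>"

definition basis_vec :: "('a, 'r) ring_scheme \<Rightarrow> 'x \<Rightarrow> 'x \<Rightarrow> 'a"
  where "basis_vec R x = (\<lambda>y. if y = x then \<one>\<^bsub>R\<^esub> else \<zero>\<^bsub>R\<^esub>)"

text \<open>The linear map from a free module to \<open>M\<close> with prescribed values \<open>\<phi>\<close> on the basis.\<close>

definition lin_ext ::
  "('a, 'r) ring_scheme \<Rightarrow> ('a, 'm, 's) module_scheme \<Rightarrow> ('x \<Rightarrow> 'm) \<Rightarrow> ('x \<Rightarrow> 'a) \<Rightarrow> 'm"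
  where "lin_ext R M \<phi> f = (\<Oplus>\<^bsub>M\<^esub> x \<in> {x. f x \<noteq> \<zero>\<^bsub>R\<^esub>}. f x \<odot>\<^bsub>M\<^esub> \<phi> x)"


section \<open>Tensor products\<close>

definition tensor_rels ::
  "('a, 'r) ring_scheme \<Rightarrow> ('a, 'm, 's) module_scheme \<Rightarrow> ('a, 'n, 't) module_scheme
    \<Rightarrow> ('m \<times> 'n \<Rightarrow> 'a) set"
  where "tensor_rels R M N =
    (let F = free_module R (carrier M \<times> carrier N); e = (\<lambda>m n. basis_vec R (m, n)) in
      {e (m \<oplus>\<^bsub>M\<^esub> m') n \<ominus>\<^bsub>F\<^esub> (e m n \<oplus>\<^bsub>F\<^esub> e m' n) | m m' n.
         m \<in> carrier M \<and> m' \<in> carrier M \<and> n \<in> carrier N}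
      \<union> {e m (n \<oplus>\<^bsub>N\<^esub> n') \<ominus>\<^bsub>F\<^esub> (e m n \<oplus>\<^bsub>F\<^esub> e m n') | m n n'.
         m \<in> carrier M \<and> n \<in> carrier N \<and> n' \<in> carrier N}
      \<union> {e (a \<odot>\<^bsub>M\<^esub> m) n \<ominus>\<^bsub>F\<^esub> (a \<odot>\<^bsub>F\<^esub> e m n) | a m n.
         a \<in> carrier R \<and> m \<in> carrier M \<and> n \<in> carrier N}
      \<union> {e m (a \<odot>\<^bsub>N\<^esub> n) \<ominus>\<^bsub>F\<^esub> (a \<odot>\<^bsub>F\<^esub> e m n) | a m n.
         a \<in> carrier R \<and> m \<in> carrier M \<and> n \<in> carrier N})"

definition tensor_ker ::
  "('a, 'r) ring_scheme \<Rightarrow> ('a, 'm, 's) module_scheme \<Rightarrow> ('a, 'n, 't) module_scheme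
    \<Rightarrow> ('m \<times> 'n \<Rightarrow> 'a) set"
  where "tensor_ker R M N =
    (\<lambda>H. submodule H R (free_module R (carrier M \<times> carrier N))) hull tensor_rels R M N"

definition tensor ::
  "('a, 'r) ring_scheme \<Rightarrow> ('a, 'm, 's) module_scheme \<Rightarrow> ('a, 'n, 't) module_scheme
    \<Rightarrow> ('a, ('m \<times> 'n \<Rightarrow> 'a) set) module"
  where "tensor R M N =
    quot_module (free_module R (carrier M \<times> carrier N)) (tensor_ker R M N)"

definition pure_tensor ::
  "('a, 'r) ring_scheme \<Rightarrow> ('a, 'm, 's) module_scheme \<Rightarrow> ('a, 'n, 't) module_scheme
    \<Rightarrow> 'm \<Rightarrow> 'n \<Rightarrow> ('m \<times> 'n \<Rightarrow> 'a) set"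
  where "pure_tensor R M N m n =
    tensor_ker R M N +>\<^bsub>free_module R (carrier M \<times> carrier N)\<^esub> basis_vec R (m, n)"

text \<open>
  The map \<open>f \<otimes> g\<close> into \<open>tensor R M' N'\<close>. It depends on the source only through the
  argument, a coset in the free module on the pairs.
\<close>

definition tensor_map ::
  "('a, 'r) ring_scheme \<Rightarrow> ('a, 'm', 's) module_scheme \<Rightarrow> ('a, 'n', 't) module_scheme
    \<Rightarrow> ('m \<Rightarrow> 'm') \<Rightarrow> ('n \<Rightarrow> 'n') \<Rightarrow> ('m \<times> 'n \<Rightarrow> 'a) set \<Rightarrow> ('m' \<times> 'n' \<Rightarrow> 'a) set"
  where "tensor_map R M' N' f g =
    (let F' = free_module R (carrier M' \<times> carrier N') in
      quot_map F' (tensor_ker R M' N')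
        (lin_ext R F' (\<lambda>(m, n). basis_vec R (f m, g n))))"

text \<open>
  Exactness of \<open>P \<otimes> -\<close> on a class \<open>\<C>\<close> of modules: it preserves the short exact sequences
  with all three terms in \<open>\<C>\<close>. HOL cannot quantify over types inside a formula, so \<open>\<C>\<close>
  consists of modules with elements in one type \<open>'u\<close>, which plays the role of a universe.
  A theorem about all modules is then stated for every type \<open>'u\<close> large enough to contain a
  copy of the base ring; without that condition \<open>'u\<close> could be too small to hold any modules
  that test flatness.
\<close>

definition tensor_exact_on ::
  "('a, 'r) ring_scheme \<Rightarrow> ('a, 'p, 's) module_scheme \<Rightarrow> ('a, 'u) module set \<Rightarrow> bool"
  where "tensor_exact_on R P \<C> \<longleftrightarrow>
    (\<forall>L\<in>\<C>. \<forall>M\<in>\<C>. \<forall>N\<in>\<C>. \<forall>f g. short_exact R L M N f g \<longrightarrow>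
      short_exact R (tensor R P L) (tensor R P M) (tensor R P N)
        (tensor_map R P M id f) (tensor_map R P N id g))"

definition flat_module ::
  "'u itself \<Rightarrow> ('a, 'r) ring_scheme \<Rightarrow> ('a, 'p, 's) module_scheme \<Rightarrow> bool"
  where "flat_module _ R P \<longleftrightarrow> tensor_exact_on R P {N :: ('a, 'u) module. module R N}"


section \<open>Complexes and homology\<close>

text \<open>
  A complex concentrated in cohomological degrees \<open>\<le> 0\<close> is given by its modules
  \<open>C n\<close>, in degree \<open>-n\<close>, and the maps \<open>d n\<close> from \<open>C (Suc n)\<close> to \<open>C n\<close>.
\<close>

fun cycles ::
  "(nat \<Rightarrow> ('a, 'c, 's) module_scheme) \<Rightarrow> (nat \<Rightarrow> 'c \<Rightarrow> 'c) \<Rightarrow> nat \<Rightarrow> 'c set"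
  where
    "cycles C d 0 = carrier (C 0)"
  | "cycles C d (Suc n) = {x \<in> carrier (C (Suc n)). d n x = \<zero>\<^bsub>C n\<^esub>}"

definition boundaries ::
  "(nat \<Rightarrow> ('a, 'c, 's) module_scheme) \<Rightarrow> (nat \<Rightarrow> 'c \<Rightarrow> 'c) \<Rightarrow> nat \<Rightarrow> 'c set"
  where "boundaries C d n = d n ` carrier (C (Suc n))"

definition homology ::
  "(nat \<Rightarrow> ('a, 'c, 's) module_scheme) \<Rightarrow> (nat \<Rightarrow> 'c \<Rightarrow> 'c) \<Rightarrow> nat \<Rightarrow> ('a, 'c set) module"
  where "homology C d n = quot_module ((C n)\<lparr>carrier := cycles C d n\<rparr>) (boundaries C d n)"

text \<open>The map into the homology of \<open>(C', d')\<close> induced by a chain map \<open>\<phi>\<close>.\<close>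

definition homology_map ::
  "(nat \<Rightarrow> ('a, 'e, 's) module_scheme) \<Rightarrow> (nat \<Rightarrow> 'e \<Rightarrow> 'e) \<Rightarrow> (nat \<Rightarrow> 'c \<Rightarrow> 'e) \<Rightarrow> nat
    \<Rightarrow> 'c set \<Rightarrow> 'e set"
  where "homology_map C' d' \<phi> n =
    quot_map ((C' n)\<lparr>carrier := cycles C' d' n\<rparr>) (boundaries C' d' n) (\<phi> n)"


section \<open>Tor\<close>

text \<open>
  The free resolution \<open>\<dots> \<rightarrow> F 1 \<rightarrow> F 0 \<rightarrow> P\<close> in which \<open>F 0\<close> is free on the elements of \<open>P\<close>
  and \<open>F (n + 1)\<close> is free on the formal linear combinations of basis elements of \<open>F n\<close> that
  lie in the kernel of the preceding map. The type of cells holds the bases of all the \<open>F n\<close>.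
\<close>

datatype ('p, 'a) cell = Point 'p | Syz "('a \<times> ('p, 'a) cell) list"

primrec lin_comb :: "('a, 'r) ring_scheme \<Rightarrow> ('a \<times> 'x) list \<Rightarrow> 'x \<Rightarrow> 'a"
  where
    "lin_comb R [] = (\<lambda>_. \<zero>\<^bsub>R\<^esub>)"
  | "lin_comb R (c # cs) = (\<lambda>y. fst c \<otimes>\<^bsub>R\<^esub> basis_vec R (snd c) y \<oplus>\<^bsub>R\<^esub> lin_comb R cs y)"

fun cell_bd :: "('a, 'r) ring_scheme \<Rightarrow> ('p, 'a) cell \<Rightarrow> ('p, 'a) cell \<Rightarrow> 'a"
  where
    "cell_bd R (Syz cs) = lin_comb R cs"
  | "cell_bd R (Point p) = (\<lambda>_. \<zero>\<^bsub>R\<^esub>)"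

fun cell_pt :: "('a, 'p, 's) module_scheme \<Rightarrow> ('p, 'a) cell \<Rightarrow> 'p"
  where
    "cell_pt P (Point p) = p"
  | "cell_pt P (Syz cs) = \<zero>\<^bsub>P\<^esub>"

fun res_basis :: "('a, 'r) ring_scheme \<Rightarrow> ('a, 'p, 's) module_scheme \<Rightarrow> nat \<Rightarrow> ('p, 'a) cell set"
  where
    "res_basis R P 0 = Point ` carrier P"
  | "res_basis R P (Suc 0) =
      {Syz cs | cs. set cs \<subseteq> carrier R \<times> res_basis R P 0
        \<and> lin_ext R P (cell_pt P) (lin_comb R cs) = \<zero>\<^bsub>P\<^esub>}"
  | "res_basis R P (Suc (Suc n)) =
      {Syz cs | cs. set cs \<subseteq> carrier R \<times> res_basis R P (Suc n)
        \<and> lin_ext R (free_module R (res_basis R P n)) (cell_bd R) (lin_comb R cs) = (\<lambda>_. \<zero>\<^bsub>R\<^esub>)}"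

definition res_mod ::
  "('a, 'r) ring_scheme \<Rightarrow> ('a, 'p, 's) module_scheme \<Rightarrow> nat \<Rightarrow> ('a, ('p, 'a) cell \<Rightarrow> 'a) module"
  where "res_mod R P n = free_module R (res_basis R P n)"

definition res_d ::
  "('a, 'r) ring_scheme \<Rightarrow> ('a, 'p, 's) module_scheme \<Rightarrow> nat
    \<Rightarrow> (('p, 'a) cell \<Rightarrow> 'a) \<Rightarrow> (('p, 'a) cell \<Rightarrow> 'a)"
  where "res_d R P n = lin_ext R (res_mod R P n) (cell_bd R)"

definition Tor ::
  "('a, 'r) ring_scheme \<Rightarrow> nat \<Rightarrow> ('a, 'p, 's) module_scheme \<Rightarrow> ('a, 'n, 't) module_scheme
    \<Rightarrow> ('a, ((('p, 'a) cell \<Rightarrow> 'a) \<times> 'n \<Rightarrow> 'a) set set) module"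
  where "Tor R i P N =
    homology (\<lambda>n. tensor R (res_mod R P n) N)
      (\<lambda>n. tensor_map R (res_mod R P n) N (res_d R P n) id) i"


section \<open>Weakly proregular ideals\<close>

text \<open>
  The Koszul complex \<open>K(R; a\<^sub>1) \<otimes> \<dots> \<otimes> K(R; a\<^sub>p)\<close>. Its terms would have a type depending on
  \<open>p\<close>, so we use the identification \<open>R \<otimes> X = X\<close>: each factor has the basis
  \<open>e_False\<close> in degree \<open>0\<close> and \<open>e_True\<close> in degree \<open>-1\<close>, with \<open>d e_True = a\<^sub>i e_False\<close>, and the
  tensor product has as basis the words \<open>s\<close> of length \<open>p\<close> in \<open>False\<close>, \<open>True\<close>, where \<open>s\<close>
  stands for \<open>e_(s\<^sub>1) \<otimes> \<dots> \<otimes> e_(s\<^sub>p)\<close> and has degree minus the number of \<open>True\<close>.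
  The recursion for the differential is the rule \<open>d (x \<otimes> y) = d x \<otimes> y + (-1)^(deg x) x \<otimes> d y\<close>
  on \<open>K(R; a\<^sub>1) \<otimes> (K(R; a\<^sub>2) \<otimes> \<dots>)\<close>: an element \<open>e_False \<otimes> g + e_True \<otimes> h\<close> is sent to
  \<open>e_False \<otimes> (d g + a\<^sub>1 h) - e_True \<otimes> d h\<close>.
\<close>

definition koszul_mod :: "('a, 'r) ring_scheme \<Rightarrow> 'a list \<Rightarrow> nat \<Rightarrow> ('a, bool list \<Rightarrow> 'a) module"
  where "koszul_mod R as n = free_module R {s. length s = length as \<and> count_list s True = n}"

fun koszul_d :: "('a, 'r) ring_scheme \<Rightarrow> 'a list \<Rightarrow> (bool list \<Rightarrow> 'a) \<Rightarrow> bool list \<Rightarrow> 'a"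
  where
    "koszul_d R [] f s = \<zero>\<^bsub>R\<^esub>"
  | "koszul_d R (a # as) f [] = \<zero>\<^bsub>R\<^esub>"
  | "koszul_d R (a # as) f (False # s) =
      koszul_d R as (\<lambda>t. f (False # t)) s \<oplus>\<^bsub>R\<^esub> a \<otimes>\<^bsub>R\<^esub> f (True # s)"
  | "koszul_d R (a # as) f (True # s) = \<ominus>\<^bsub>R\<^esub> koszul_d R as (\<lambda>t. f (True # t)) s"

definition seq_pow :: "('a, 'r) ring_scheme \<Rightarrow> 'a list \<Rightarrow> nat \<Rightarrow> 'a list"
  where "seq_pow R as j = map (\<lambda>a. a [^]\<^bsub>R\<^esub> j) as"

text \<open>
  The tensor product of the maps that are the identity on \<open>e_False\<close> and multiplication by
  \<open>a\<^sub>i ^ e\<close> on \<open>e_True\<close> is diagonal, with the following eigenvalue on the word \<open>s\<close>.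
\<close>

fun koszul_weight :: "('a, 'r) ring_scheme \<Rightarrow> nat \<Rightarrow> 'a list \<Rightarrow> bool list \<Rightarrow> 'a"
  where
    "koszul_weight R e (a # as) (b # s) =
      (if b then a [^]\<^bsub>R\<^esub> e else \<one>\<^bsub>R\<^esub>) \<otimes>\<^bsub>R\<^esub> koszul_weight R e as s"
  | "koszul_weight R e _ _ = \<one>\<^bsub>R\<^esub>"

definition koszul_trans ::
  "('a, 'r) ring_scheme \<Rightarrow> 'a list \<Rightarrow> nat \<Rightarrow> nat \<Rightarrow> (bool list \<Rightarrow> 'a) \<Rightarrow> (bool list \<Rightarrow> 'a)"
  where "koszul_trans R as j1 j0 f = (\<lambda>s. koszul_weight R (j1 - j0) as s \<otimes>\<^bsub>R\<^esub> f s)"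

definition koszul_homology ::
  "('a, 'r) ring_scheme \<Rightarrow> 'a list \<Rightarrow> nat \<Rightarrow> ('a, (bool list \<Rightarrow> 'a) set) module"
  where "koszul_homology R as n = homology (koszul_mod R as) (\<lambda>_. koszul_d R as) n"

text \<open>Inverse systems are indexed by the integers \<open>j \<ge> 1\<close>; \<open>\<phi> j1 j0\<close> maps \<open>N j1\<close> to \<open>N j0\<close>.\<close>

definition pro_zero ::
  "(nat \<Rightarrow> ('a, 'n, 's) module_scheme) \<Rightarrow> (nat \<Rightarrow> nat \<Rightarrow> 'n \<Rightarrow> 'n) \<Rightarrow> bool"
  where "pro_zero N \<phi> \<longleftrightarrow>
    (\<forall>j0\<ge>1. \<exists>j1\<ge>j0. \<forall>x\<in>carrier (N j1). \<phi> j1 j0 x = \<zero>\<^bsub>N j0\<^esub>)"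

definition weakly_proregular_seq :: "('a, 'r) ring_scheme \<Rightarrow> 'a list \<Rightarrow> bool"
  where "weakly_proregular_seq R as \<longleftrightarrow>
    (\<forall>n\<ge>1. pro_zero (\<lambda>j. koszul_homology R (seq_pow R as j) n)
      (\<lambda>j1 j0. homology_map (koszul_mod R (seq_pow R as j0)) (\<lambda>_. koszul_d R (seq_pow R as j0))
        (\<lambda>_. koszul_trans R as j1 j0) n))"

definition weakly_proregular_ideal :: "('a, 'r) ring_scheme \<Rightarrow> 'a set \<Rightarrow> bool"
  where "weakly_proregular_ideal R I \<longleftrightarrow>
    (\<exists>as. as \<noteq> [] \<and> set as \<subseteq> carrier R \<and> I = Idl\<^bsub>R\<^esub> (set as) \<and> weakly_proregular_seq R as)"


section \<open>Completion, torsion and adic flatness\<close>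

abbreviation ideal_pow :: "('a, 'r) ring_scheme \<Rightarrow> 'a set \<Rightarrow> nat \<Rightarrow> 'a set"
  where "ideal_pow R I n \<equiv> I [^]\<^bsub>ideals_set R\<^esub> n"

definition quot_ring :: "('a, 'r) ring_scheme \<Rightarrow> 'a set \<Rightarrow> nat \<Rightarrow> 'a set ring"
  where "quot_ring R I k = R Quot (ideal_pow R I (k + 1))"

text \<open>The same quotient as an \<open>R\<close>-module.\<close>

definition quot_ring_module :: "('a, 'r) ring_scheme \<Rightarrow> 'a set \<Rightarrow> nat \<Rightarrow> ('a, 'a set) module"
  where "quot_ring_module R I k = quot_module (self_module R) (ideal_pow R I (k + 1))"

text \<open>
  \<open>P\<^sub>k = R\<^sub>k \<otimes> P\<close> over \<open>R\<^sub>k = R / I ^ (k + 1)\<close>: the tensor product over \<open>R\<close>, on which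
  \<open>X \<in> R\<^sub>k\<close> acts through multiplication by \<open>X\<close> on the first factor.
\<close>

definition adic_reduction ::
  "('a, 'r) ring_scheme \<Rightarrow> 'a set \<Rightarrow> ('a, 'p, 's) module_scheme \<Rightarrow> nat
    \<Rightarrow> ('a set, ('a set \<times> 'p \<Rightarrow> 'a) set) module"
  where "adic_reduction R I P k =
    (let Rk = quot_ring_module R I k; T = tensor R Rk P in
      \<lparr>carrier = carrier T, mult = undefined, one = undefined, zero = zero T, add = add T,
       smult = (\<lambda>X. tensor_map R Rk P (\<lambda>Y. X \<otimes>\<^bsub>quot_ring R I k\<^esub> Y) id)\<rparr>)"

definition completion_trans ::
  "('a, 'r) ring_scheme \<Rightarrow> 'a set \<Rightarrow> ('a, 'p, 's) module_scheme \<Rightarrow> nat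
    \<Rightarrow> ('a set \<times> 'p \<Rightarrow> 'a) set \<Rightarrow> ('a set \<times> 'p \<Rightarrow> 'a) set"
  where "completion_trans R I M k =
    tensor_map R (quot_ring_module R I k) M
      (quot_map (self_module R) (ideal_pow R I (k + 1)) id) id"

definition completion ::
  "('a, 'r) ring_scheme \<Rightarrow> 'a set \<Rightarrow> ('a, 'p, 's) module_scheme
    \<Rightarrow> ('a, nat \<Rightarrow> ('a set \<times> 'p \<Rightarrow> 'a) set) module"
  where "completion R I M =
    (let T = (\<lambda>k. tensor R (quot_ring_module R I k) M) in
      \<lparr>carrier = {\<xi>. \<forall>k. \<xi> k \<in> carrier (T k) \<and> completion_trans R I M k (\<xi> (Suc k)) = \<xi> k},
       mult = undefined, one = undefined,
       zero = (\<lambda>k. \<zero>\<^bsub>T k\<^esub>), add = (\<lambda>\<xi> \<eta> k. \<xi> k \<oplus>\<^bsub>T k\<^esub> \<eta> k),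
       smult = (\<lambda>a \<xi> k. a \<odot>\<^bsub>T k\<^esub> \<xi> k)\<rparr>)"

definition completion_unit ::
  "('a, 'r) ring_scheme \<Rightarrow> 'a set \<Rightarrow> ('a, 'p, 's) module_scheme
    \<Rightarrow> 'p \<Rightarrow> nat \<Rightarrow> ('a set \<times> 'p \<Rightarrow> 'a) set"
  where "completion_unit R I M m =
    (\<lambda>k. pure_tensor R (quot_ring_module R I k) M \<one>\<^bsub>quot_ring R I k\<^esub> m)"

definition adically_complete ::
  "('a, 'r) ring_scheme \<Rightarrow> 'a set \<Rightarrow> ('a, 'p, 's) module_scheme \<Rightarrow> bool"
  where "adically_complete R I M \<longleftrightarrow> completion_unit R I M \<in> mod_iso R M (completion R I M)"

definition torsion_module ::
  "('a, 'r) ring_scheme \<Rightarrow> 'a set \<Rightarrow> ('a, 'n, 's) module_scheme \<Rightarrow> bool"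
  where "torsion_module R I N \<longleftrightarrow>
    module R N \<and> (\<forall>x\<in>carrier N. \<exists>i\<ge>1. \<forall>r\<in>ideal_pow R I i. r \<odot>\<^bsub>N\<^esub> x = \<zero>\<^bsub>N\<^esub>)"

definition adically_flat ::
  "'u itself \<Rightarrow> ('a, 'r) ring_scheme \<Rightarrow> 'a set \<Rightarrow> ('a, 'p, 's) module_scheme \<Rightarrow> bool"
  where "adically_flat _ R I P \<longleftrightarrow>
    (\<forall>N :: ('a, 'u) module. torsion_module R I N \<longrightarrow>
      (\<forall>i>0. carrier (Tor R i P N) = {\<zero>\<^bsub>Tor R i P N\<^esub>}))"

end

theory Submission
  imports Defs
begin

text \<open>
  Each of the three conditions says that \<open>P / I\<^sup>j P\<close> is flat over \<open>A / I\<^sup>j\<close> for all \<open>j \<ge> 1\<close>. The proof compares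
  them through an equational form of this property, the predicate \<open>flat_eq\<close>: every relation
  \<open>\<Sum> r\<^sub>i q\<^sub>i \<in> I\<^sup>j P\<close> is a consequence of relations between the \<open>r\<^sub>i\<close> in \<open>A\<close> modulo \<open>I\<^sup>j\<close>. That this criterion is
  equivalent to exactness of the tensor product is classical (\<open>exact_iff_flat_eq\<close>). It is applied over \<open>A\<close>
  to the modules annihilated elementwise by powers of \<open>I\<close>, which gives condition (ii), and over
  \<open>A / I\<^sup>j\<close> to all modules, which gives condition (iii). Condition (i) implies the criterion because
  a relation modulo \<open>I\<^sup>j\<close> is a syzygy modulo \<open>I\<^sup>j\<close>, and such syzygies are controlled by \<open>Tor\<^sub>1(P, A/J)\<close> with
  \<open>J = (r\<^sub>i) + I\<^sup>j\<close> (\<open>Tor_zero_imp_flat_eq\<close>).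

  Completeness and weak proregularity enter in the converse, where flatness modulo powers of \<open>I\<close> has
  to be lifted to information on the higher Tor modules. The Koszul complexes \<open>K(A; a\<^sup>j)\<close> serve for this.
  Weak proregularity implies an Artin--Rees property over \<open>A\<close>: cycles with entries in a high power of
  \<open>I\<close> are boundaries of elements with entries in a prescribed power (\<open>koszul_artin_rees\<close>). This comes from a zigzag in
  the double complex of two Koszul complexes. As \<open>P\<close> satisfies the criterion, cycles with coefficients
  in \<open>P\<close> are combinations of near cycles over \<open>A\<close>, which the Artin--Rees property corrects to cycles up to
  smaller errors, and completeness allows one to sum the corrections. Hence the Koszul homology with
  coefficients in \<open>P\<close> is pro-zero as well (\<open>complete_pro_zero\<close>).

  Now let \<open>0 \<rightarrow> K \<rightarrow> F \<rightarrow> P \<rightarrow> 0\<close> be exact with \<open>F\<close> free. That the Koszul homology of \<open>P\<close> is pro-zero in degree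
  \<open>-1\<close> gives, for every \<open>m\<close>, some \<open>N\<close> with \<open>K \<inter> I\<^sup>N F \<subseteq> I\<^sup>m K\<close> (\<open>syzygy_artin_rees\<close>). Together with the
  criterion for \<open>P\<close> this yields that \<open>K\<close> is pure in \<open>F\<close> as far as torsion modules can see (\<open>syzygy_pure\<close>), and that
  \<open>K\<close> inherits the criterion and the pro-zero property from \<open>P\<close>. By induction this holds for all syzygies in the
  free resolution that defines Tor, and purity turns every cycle in \<open>F\<^sub>i \<otimes> N\<close>, for \<open>N\<close> torsion and
  \<open>i > 0\<close>, into a boundary (\<open>Tor_torsion_zero\<close>).
\<close>

section \<open>Linear maps\<close>

lemma mod_homI:
  assumes "\<And>x. x \<in> carrier M \<Longrightarrow> f x \<in> carrier N"
    and "\<And>x y. x \<in> carrier M \<Longrightarrow> y \<in> carrier M \<Longrightarrow> f (x \<oplus>\<^bsub>M\<^esub> y) = f x \<oplus>\<^bsub>N\<^esub> f y"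
    and "\<And>a x. a \<in> carrier R \<Longrightarrow> x \<in> carrier M \<Longrightarrow> f (a \<odot>\<^bsub>M\<^esub> x) = a \<odot>\<^bsub>N\<^esub> f x"
  shows "f \<in> mod_hom R M N"
  using assms by (auto simp: mod_hom_def)

lemma mod_hom_closed: "f \<in> mod_hom R M N \<Longrightarrow> x \<in> carrier M \<Longrightarrow> f x \<in> carrier N"
  and mod_hom_add: "f \<in> mod_hom R M N \<Longrightarrow> x \<in> carrier M \<Longrightarrow> y \<in> carrier M
    \<Longrightarrow> f (x \<oplus>\<^bsub>M\<^esub> y) = f x \<oplus>\<^bsub>N\<^esub> f y"
  and mod_hom_smult: "f \<in> mod_hom R M N \<Longrightarrow> a \<in> carrier R \<Longrightarrow> x \<in> carrier M
    \<Longrightarrow> f (a \<odot>\<^bsub>M\<^esub> x) = a \<odot>\<^bsub>N\<^esub> f x"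
  by (auto simp: mod_hom_def)

context module begin

lemma M_minus_zero [simp]: "\<ominus>\<^bsub>M\<^esub> \<zero>\<^bsub>M\<^esub> = \<zero>\<^bsub>M\<^esub>"
  by (rule M.minus_equality) simp_all

lemma diff_zero_iff:
  assumes "x \<in> carrier M" "y \<in> carrier M"
  shows "x \<ominus>\<^bsub>M\<^esub> y = \<zero>\<^bsub>M\<^esub> \<longleftrightarrow> x = y"
proof
  assume "x \<ominus>\<^bsub>M\<^esub> y = \<zero>\<^bsub>M\<^esub>"
  then have "\<ominus>\<^bsub>M\<^esub> (\<ominus>\<^bsub>M\<^esub> y) = x"
    using assms by (intro M.minus_equality) (simp_all add: a_minus_def)
  then show "x = y" using assms by simp
qed (use assms in \<open>simp add: a_minus_def M.r_neg\<close>)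

lemma smult_l_diff: "a \<in> carrier R \<Longrightarrow> b \<in> carrier R \<Longrightarrow> x \<in> carrier M
    \<Longrightarrow> (a \<ominus> b) \<odot>\<^bsub>M\<^esub> x = a \<odot>\<^bsub>M\<^esub> x \<ominus>\<^bsub>M\<^esub> b \<odot>\<^bsub>M\<^esub> x"
  by (simp add: a_minus_def smult_l_distr smult_l_minus)

lemma smult_r_diff: "a \<in> carrier R \<Longrightarrow> x \<in> carrier M \<Longrightarrow> y \<in> carrier M
    \<Longrightarrow> a \<odot>\<^bsub>M\<^esub> (x \<ominus>\<^bsub>M\<^esub> y) = a \<odot>\<^bsub>M\<^esub> x \<ominus>\<^bsub>M\<^esub> a \<odot>\<^bsub>M\<^esub> y"
  by (simp add: a_minus_def smult_r_distr smult_r_minus)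

lemma smult_lcomm: "a \<in> carrier R \<Longrightarrow> b \<in> carrier R \<Longrightarrow> x \<in> carrier M
    \<Longrightarrow> a \<odot>\<^bsub>M\<^esub> (b \<odot>\<^bsub>M\<^esub> x) = b \<odot>\<^bsub>M\<^esub> (a \<odot>\<^bsub>M\<^esub> x)"
  by (simp add: smult_assoc1[symmetric] R.m_comm)

lemma submodule_zero: "submodule H R M \<Longrightarrow> \<zero>\<^bsub>M\<^esub> \<in> H"
  using subgroup.one_closed[OF submodule.axioms(1)] by fastforce

lemma submodule_diff: "submodule H R M \<Longrightarrow> x \<in> H \<Longrightarrow> y \<in> H \<Longrightarrow> x \<ominus>\<^bsub>M\<^esub> y \<in> H"
  by (simp add: a_minus_def submoduleE)

lemma submodule_finsum:
  assumes H: "submodule H R M" and "finite S" "\<And>i. i \<in> S \<Longrightarrow> f i \<in> H"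
  shows "(\<Oplus>\<^bsub>M\<^esub>i\<in>S. f i) \<in> H"
  using assms(2,3)
proof (induct S)
  case (insert x S)
  have "f \<in> S \<rightarrow> carrier M" "f x \<in> carrier M" using insert submoduleE(1)[OF H] by auto
  then show ?case using insert submoduleE(5)[OF H] by simp
qed (simp add: submodule_zero H)

end

locale linear_map = M?: module R M + N?: module R N
  for R (structure) and M (structure) and N (structure) +
  fixes h
  assumes hom: "h \<in> mod_hom R M N"
begin

lemmas closed = mod_hom_closed[OF hom]
  and add = mod_hom_add[OF hom]
  and smult = mod_hom_smult[OF hom]

lemma zero: "h \<zero>\<^bsub>M\<^esub> = \<zero>\<^bsub>N\<^esub>"
  using add[of "\<zero>\<^bsub>M\<^esub>" "\<zero>\<^bsub>M\<^esub>"] closed[of "\<zero>\<^bsub>M\<^esub>"] N.M.add.r_cancel_one' by simp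

lemma neg: "x \<in> carrier M \<Longrightarrow> h (\<ominus>\<^bsub>M\<^esub> x) = \<ominus>\<^bsub>N\<^esub> h x"
  by (rule N.M.minus_equality[symmetric]) (simp_all add: add[symmetric] M.M.l_neg zero closed)

lemma diff: "x \<in> carrier M \<Longrightarrow> y \<in> carrier M \<Longrightarrow> h (x \<ominus>\<^bsub>M\<^esub> y) = h x \<ominus>\<^bsub>N\<^esub> h y"
  by (simp add: a_minus_def add neg)

lemma map_finsum:
  assumes "finite S" "\<And>i. i \<in> S \<Longrightarrow> f i \<in> carrier M"
  shows "h (\<Oplus>\<^bsub>M\<^esub>i\<in>S. f i) = (\<Oplus>\<^bsub>N\<^esub>i\<in>S. h (f i))"
  using assms
proof (induct S)
  case empty
  show ?case by (simp add: zero)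
next
  case (insert x S)
  have "h (\<Oplus>\<^bsub>M\<^esub>i\<in>insert x S. f i) = h (f x \<oplus>\<^bsub>M\<^esub> (\<Oplus>\<^bsub>M\<^esub>i\<in>S. f i))"
    using insert by (subst M.M.finsum_insert) auto
  also have "\<dots> = h (f x) \<oplus>\<^bsub>N\<^esub> h (\<Oplus>\<^bsub>M\<^esub>i\<in>S. f i)"
    using insert by (intro add M.M.finsum_closed) auto
  also have "\<dots> = h (f x) \<oplus>\<^bsub>N\<^esub> (\<Oplus>\<^bsub>N\<^esub>i\<in>S. h (f i))"
    using insert by simp
  also have "\<dots> = (\<Oplus>\<^bsub>N\<^esub>i\<in>insert x S. h (f i))"
    using insert closed by (subst N.M.finsum_insert) auto
  finally show ?case .
qed

lemma inj_onI_kernel: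
  assumes "\<And>x. x \<in> carrier M \<Longrightarrow> h x = \<zero>\<^bsub>N\<^esub> \<Longrightarrow> x = \<zero>\<^bsub>M\<^esub>"
  shows "inj_on h (carrier M)"
proof (rule inj_onI)
  fix x y assume a: "x \<in> carrier M" "y \<in> carrier M" "h x = h y"
  then have "x \<ominus>\<^bsub>M\<^esub> y = \<zero>\<^bsub>M\<^esub>"
    using closed[OF a(2)] by (intro assms) (simp_all only: diff M.M.minus_closed, simp add: a_minus_def N.M.r_neg)
  then show "x = y" using a(1,2) M.diff_zero_iff by simp
qed

lemma kernel_submodule: "submodule {x \<in> carrier M. h x = \<zero>\<^bsub>N\<^esub>} R M"
  by (rule M.submoduleI) (auto simp: zero neg add smult)

lemma image_submodule: "submodule (h ` carrier M) R N"
proof (rule N.submoduleI)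
  show "h ` carrier M \<subseteq> carrier N" using closed by auto
  show "\<zero>\<^bsub>N\<^esub> \<in> h ` carrier M" by (rule image_eqI[of _ _ "\<zero>\<^bsub>M\<^esub>"]) (simp_all add: zero)
qed (auto simp: neg[symmetric] add[symmetric] smult[symmetric])

lemma preimage_submodule:
  assumes "submodule S R N" shows "submodule {x \<in> carrier M. h x \<in> S} R M"
  using N.submoduleE[OF assms] N.submodule_zero[OF assms]
  by (intro M.submoduleI) (auto simp: zero neg add smult closed)

end

lemmas linear_mapI = linear_map.intro[OF _ _ linear_map_axioms.intro]

lemma mod_hom_comp: "f \<in> mod_hom R M N \<Longrightarrow> g \<in> mod_hom R N Q \<Longrightarrow> g \<circ> f \<in> mod_hom R M Q"
  by (auto simp: mod_hom_def Pi_iff)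

lemma mod_hom_id: "id \<in> mod_hom R M M"
  by (auto simp: mod_hom_def)

text \<open>
  Module axioms pass to a homomorphic image, also along a surjection of the base rings. All the
  quotients below, by whatever set they are carried, are recognised as modules in this way.
\<close>

lemma module_image:
  assumes M: "module R M" and S: "cring S"
    and s: "\<sigma> \<in> ring_hom R S" "\<sigma> ` carrier R = carrier S"
    and surj: "\<pi> ` carrier M = carrier N"
    and zero: "\<pi> \<zero>\<^bsub>M\<^esub> = \<zero>\<^bsub>N\<^esub>"
    and add: "\<And>x y. x \<in> carrier M \<Longrightarrow> y \<in> carrier M \<Longrightarrow> \<pi> (x \<oplus>\<^bsub>M\<^esub> y) = \<pi> x \<oplus>\<^bsub>N\<^esub> \<pi> y"
    and smult: "\<And>a x. a \<in> carrier R \<Longrightarrow> x \<in> carrier M \<Longrightarrow> \<pi> (a \<odot>\<^bsub>M\<^esub> x) = \<sigma> a \<odot>\<^bsub>N\<^esub> \<pi> x"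
  shows "module S N"
proof -
  interpret M: module R M by fact
  have ex: "\<exists>x\<in>carrier M. y = \<pi> x" if "y \<in> carrier N" for y using that surj by auto
  have exr: "\<exists>x\<in>carrier R. y = \<sigma> x" if "y \<in> carrier S" for y using that s by auto
  have cl: "\<pi> x \<in> carrier N" if "x \<in> carrier M" for x using that surj by auto
  show ?thesis
  proof (rule moduleI)
    show "abelian_group N"
    proof (rule abelian_groupI)
      fix x y z assume "x \<in> carrier N" "y \<in> carrier N" "z \<in> carrier N"
      then obtain x' y' z' where *: "x' \<in> carrier M" "y' \<in> carrier M" "z' \<in> carrier M"
        and [simp]: "x = \<pi> x'" "y = \<pi> y'" "z = \<pi> z'" using ex by meson
      show "x \<oplus>\<^bsub>N\<^esub> y \<in> carrier N" using * by (simp add: add[symmetric] cl)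
      show "x \<oplus>\<^bsub>N\<^esub> y \<oplus>\<^bsub>N\<^esub> z = x \<oplus>\<^bsub>N\<^esub> (y \<oplus>\<^bsub>N\<^esub> z)" using * by (simp add: add[symmetric] M.M.a_assoc)
      show "x \<oplus>\<^bsub>N\<^esub> y = y \<oplus>\<^bsub>N\<^esub> x" using * by (simp add: add[symmetric] M.M.a_comm)
    next
      fix x assume "x \<in> carrier N"
      then obtain x' where *: "x' \<in> carrier M" "x = \<pi> x'" using ex by meson
      show "\<zero>\<^bsub>N\<^esub> \<oplus>\<^bsub>N\<^esub> x = x" using * by (simp add: add[symmetric] zero[symmetric])
      show "\<exists>y\<in>carrier N. y \<oplus>\<^bsub>N\<^esub> x = \<zero>\<^bsub>N\<^esub>"
        using * by (intro bexI[of _ "\<pi> (\<ominus>\<^bsub>M\<^esub> x')"]) (simp_all add: add[symmetric] zero[symmetric] M.M.l_neg cl)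
    qed (use zero cl in \<open>metis M.M.zero_closed\<close>)
  next
    fix a b x y assume "a \<in> carrier S" "b \<in> carrier S" "x \<in> carrier N" "y \<in> carrier N"
    then obtain x' y' a' b' where *: "x' \<in> carrier M" "y' \<in> carrier M" "a' \<in> carrier R" "b' \<in> carrier R"
        and [simp]: "x = \<pi> x'" "y = \<pi> y'" "a = \<sigma> a'" "b = \<sigma> b'" using ex exr by meson
    show "a \<odot>\<^bsub>N\<^esub> x \<in> carrier N" using * by (simp add: smult[symmetric] cl)
    show "(a \<oplus>\<^bsub>S\<^esub> b) \<odot>\<^bsub>N\<^esub> x = a \<odot>\<^bsub>N\<^esub> x \<oplus>\<^bsub>N\<^esub> b \<odot>\<^bsub>N\<^esub> x"
      using * by (simp add: smult[symmetric] add[symmetric] ring_hom_add[OF s(1), symmetric] M.smult_l_distr)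
    show "a \<odot>\<^bsub>N\<^esub> (x \<oplus>\<^bsub>N\<^esub> y) = a \<odot>\<^bsub>N\<^esub> x \<oplus>\<^bsub>N\<^esub> a \<odot>\<^bsub>N\<^esub> y"
      using * by (simp add: smult[symmetric] add[symmetric] M.smult_r_distr)
    show "(a \<otimes>\<^bsub>S\<^esub> b) \<odot>\<^bsub>N\<^esub> x = a \<odot>\<^bsub>N\<^esub> (b \<odot>\<^bsub>N\<^esub> x)"
      using * by (simp add: smult[symmetric] ring_hom_mult[OF s(1), symmetric] M.smult_assoc1)
  next
    fix x assume "x \<in> carrier N"
    then obtain x' where *: "x' \<in> carrier M" "x = \<pi> x'" using ex by meson
    show "\<one>\<^bsub>S\<^esub> \<odot>\<^bsub>N\<^esub> x = x" using * by (simp add: smult[symmetric] ring_hom_one[OF s(1), symmetric])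
  qed fact
qed

lemma (in module) module_image':
  assumes "\<pi> ` carrier M = carrier N" "\<pi> \<zero>\<^bsub>M\<^esub> = \<zero>\<^bsub>N\<^esub>"
    and "\<And>x y. x \<in> carrier M \<Longrightarrow> y \<in> carrier M \<Longrightarrow> \<pi> (x \<oplus>\<^bsub>M\<^esub> y) = \<pi> x \<oplus>\<^bsub>N\<^esub> \<pi> y"
    and "\<And>a x. a \<in> carrier R \<Longrightarrow> x \<in> carrier M \<Longrightarrow> \<pi> (a \<odot>\<^bsub>M\<^esub> x) = a \<odot>\<^bsub>N\<^esub> \<pi> x"
  shows "module R N"
  using assms by (intro module_image[of R M R id \<pi>]) (auto intro: module_axioms R.is_cring)

section \<open>Finitely supported functions\<close>

definition fin_supp :: "'x set \<Rightarrow> ('a, 'm, 's) module_scheme \<Rightarrow> ('x \<Rightarrow> 'm) set"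
  where "fin_supp X M =
    {f. (\<forall>x. f x \<in> carrier M) \<and> (\<forall>x. x \<notin> X \<longrightarrow> f x = \<zero>\<^bsub>M\<^esub>) \<and> finite {x. f x \<noteq> \<zero>\<^bsub>M\<^esub>}}"

definition fun_module :: "'x set \<Rightarrow> ('a, 'm, 's) module_scheme \<Rightarrow> ('a, 'x \<Rightarrow> 'm) module"
  where "fun_module X M =
    \<lparr>carrier = fin_supp X M, mult = undefined, one = undefined,
     zero = (\<lambda>_. \<zero>\<^bsub>M\<^esub>), add = (\<lambda>f g x. f x \<oplus>\<^bsub>M\<^esub> g x), smult = (\<lambda>a f x. a \<odot>\<^bsub>M\<^esub> f x)\<rparr>"

lemma fun_module_simps [simp]:
  "carrier (fun_module X M) = fin_supp X M"
  "\<zero>\<^bsub>fun_module X M\<^esub> = (\<lambda>_. \<zero>\<^bsub>M\<^esub>)"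
  "f \<oplus>\<^bsub>fun_module X M\<^esub> g = (\<lambda>x. f x \<oplus>\<^bsub>M\<^esub> g x)"
  "a \<odot>\<^bsub>fun_module X M\<^esub> f = (\<lambda>x. a \<odot>\<^bsub>M\<^esub> f x)"
  by (auto simp: fun_module_def)

lemma self_module_simps [simp]:
  "carrier (self_module R) = carrier R" "\<zero>\<^bsub>self_module R\<^esub> = \<zero>\<^bsub>R\<^esub>"
  "x \<oplus>\<^bsub>self_module R\<^esub> y = x \<oplus>\<^bsub>R\<^esub> y" "a \<odot>\<^bsub>self_module R\<^esub> x = a \<otimes>\<^bsub>R\<^esub> x"
  by (auto simp: self_module_def)

lemma self_module_inv [simp]: "\<ominus>\<^bsub>self_module R\<^esub> x = \<ominus>\<^bsub>R\<^esub> x"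
  by (simp add: a_inv_def m_inv_def)

lemma self_module_finsum [simp]: "(\<Oplus>\<^bsub>self_module R\<^esub>i\<in>S. f i) = (\<Oplus>\<^bsub>R\<^esub>i\<in>S. f i)"
  by (simp add: finsum_def self_module_def finprod_def)

lemma self_module: "cring R \<Longrightarrow> module R (self_module R)"
proof -
  assume "cring R"
  then interpret cring R .
  show ?thesis
  proof (rule moduleI)
    show "abelian_group (self_module R)"
      by (rule abelian_groupI) (auto simp: a_assoc add.l_inv_ex intro: a_comm)
  qed (auto simp: l_distr r_distr m_assoc \<open>cring R\<close>)
qed

lemma free_module_eq: "free_module R X = fun_module X (self_module R)"
  by (simp add: free_module_def fun_module_def fin_supp_def)

lemma fin_suppD:
  "f \<in> fin_supp X M \<Longrightarrow> f x \<in> carrier M" "f \<in> fin_supp X M \<Longrightarrow> x \<notin> X \<Longrightarrow> f x = \<zero>\<^bsub>M\<^esub>"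
  "f \<in> fin_supp X M \<Longrightarrow> finite {x. f x \<noteq> \<zero>\<^bsub>M\<^esub>}"
  by (auto simp: fin_supp_def)

lemma fin_suppI:
  "(\<And>x. f x \<in> carrier M) \<Longrightarrow> (\<And>x. x \<notin> X \<Longrightarrow> f x = \<zero>\<^bsub>M\<^esub>) \<Longrightarrow> finite {x. f x \<noteq> \<zero>\<^bsub>M\<^esub>}
    \<Longrightarrow> f \<in> fin_supp X M"
  by (auto simp: fin_supp_def)

lemma fin_suppI':
  assumes "finite T" "\<And>x. f x \<in> carrier M" "\<And>x. x \<notin> T \<Longrightarrow> f x = \<zero>\<^bsub>M\<^esub>"
  shows "f \<in> fin_supp T M"
  using assms(3) by (intro fin_suppI[OF assms(2,3)] finite_subset[OF _ assms(1)]) auto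

lemma fin_supp_mono: "X \<subseteq> Y \<Longrightarrow> fin_supp X M \<subseteq> fin_supp Y M"
  by (auto simp: fin_supp_def)

lemma (in module) fun_module: "module R (fun_module X M)"
proof -
  have fin: "finite {x. f x \<oplus>\<^bsub>M\<^esub> g x \<noteq> \<zero>\<^bsub>M\<^esub>}"
    if "finite {x. f x \<noteq> \<zero>\<^bsub>M\<^esub>}" "finite {x. g x \<noteq> \<zero>\<^bsub>M\<^esub>}" for f g :: "'x \<Rightarrow> _"
    by (rule finite_subset[OF _ finite_UnI[OF that]]) auto
  have fin': "finite {x. a \<odot>\<^bsub>M\<^esub> f x \<noteq> \<zero>\<^bsub>M\<^esub>}"
    if "finite {x. f x \<noteq> \<zero>\<^bsub>M\<^esub>}" "a \<in> carrier R" for f :: "'x \<Rightarrow> _" and a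
    by (rule finite_subset[OF _ that(1)]) (use that in auto)
  have group: "abelian_group (fun_module X M)"
  proof (rule abelian_groupI)
    fix f assume f: "f \<in> carrier (fun_module X M)"
    show "\<exists>y\<in>carrier (fun_module X M). y \<oplus>\<^bsub>fun_module X M\<^esub> f = \<zero>\<^bsub>fun_module X M\<^esub>"
    proof (rule bexI[of _ "\<lambda>x. \<ominus>\<^bsub>M\<^esub> f x"])
      have "{x. \<ominus>\<^bsub>M\<^esub> f x \<noteq> \<zero>\<^bsub>M\<^esub>} \<subseteq> {x. f x \<noteq> \<zero>\<^bsub>M\<^esub>}" using f by (auto simp: fin_supp_def)
      then show "(\<lambda>x. \<ominus>\<^bsub>M\<^esub> f x) \<in> carrier (fun_module X M)"
        using f finite_subset by (fastforce simp: fin_supp_def)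
    qed (use f in \<open>auto simp: fin_supp_def M.l_neg\<close>)
  qed (auto simp: fin_supp_def fin M.a_assoc intro: M.a_comm)
  show ?thesis
    by (rule moduleI)
      (auto simp: R.is_cring group fin_supp_def fin' smult_l_distr smult_r_distr smult_assoc1)
qed

lemma free_module: "cring R \<Longrightarrow> module R (free_module R X)"
  unfolding free_module_eq by (rule module.fun_module[OF self_module])

context module begin

lemma fun_module_inv:
  assumes "f \<in> fin_supp X M" shows "\<ominus>\<^bsub>fun_module X M\<^esub> f = (\<lambda>x. \<ominus>\<^bsub>M\<^esub> f x)"
proof -
  interpret F: module R "fun_module X M" by (rule fun_module)
  have "(\<lambda>x. \<ominus>\<^bsub>M\<^esub> f x) \<in> fin_supp X M"
  proof (rule fin_suppI)
    show "finite {x. \<ominus>\<^bsub>M\<^esub> f x \<noteq> \<zero>\<^bsub>M\<^esub>}"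
      by (rule finite_subset[OF _ fin_suppD(3)[OF assms]]) (use fin_suppD(1)[OF assms] in auto)
  qed (use fin_suppD[OF assms] in auto)
  then show ?thesis
    using F.M.minus_equality[of "\<lambda>x. \<ominus>\<^bsub>M\<^esub> f x" f] assms by (simp add: M.l_neg fin_suppD(1)[OF assms])
qed

lemma fin_supp_add: "f \<in> fin_supp X M \<Longrightarrow> g \<in> fin_supp X M \<Longrightarrow> (\<lambda>x. f x \<oplus>\<^bsub>M\<^esub> g x) \<in> fin_supp X M"
  and fin_supp_smult: "a \<in> carrier R \<Longrightarrow> f \<in> fin_supp X M \<Longrightarrow> (\<lambda>x. a \<odot>\<^bsub>M\<^esub> f x) \<in> fin_supp X M"
  and fin_supp_zero: "(\<lambda>_. \<zero>\<^bsub>M\<^esub>) \<in> fin_supp X M"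
  using fun_module[of X]
    abelian_group.axioms(1)[OF module.axioms(2)[OF fun_module[of X]]]
    module.smult_closed[OF fun_module[of X], of a f]
    abelian_monoid.a_closed[OF abelian_group.axioms(1)[OF module.axioms(2)[OF fun_module[of X]]], of f g]
    abelian_monoid.zero_closed[OF abelian_group.axioms(1)[OF module.axioms(2)[OF fun_module[of X]]]]
  by simp_all

lemma fin_supp_inv: "f \<in> fin_supp X M \<Longrightarrow> (\<lambda>x. \<ominus>\<^bsub>M\<^esub> f x) \<in> fin_supp X M"
  using abelian_group.a_inv_closed[OF module.axioms(2)[OF fun_module[of X]], of f] by (simp add: fun_module_inv)

lemma fun_module_diff:
  "f \<in> fin_supp X M \<Longrightarrow> g \<in> fin_supp X M \<Longrightarrow> f \<ominus>\<^bsub>fun_module X M\<^esub> g = (\<lambda>x. f x \<ominus>\<^bsub>M\<^esub> g x)"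
  by (simp add: a_minus_def fun_module_inv)

lemma fin_supp_diff:
  "f \<in> fin_supp X M \<Longrightarrow> g \<in> fin_supp X M \<Longrightarrow> (\<lambda>x. f x \<ominus>\<^bsub>M\<^esub> g x) \<in> fin_supp X M"
  by (simp add: a_minus_def fin_supp_inv fin_supp_add)

lemma fun_module_finsum:
  assumes "finite S" "\<And>i. i \<in> S \<Longrightarrow> f i \<in> fin_supp X M"
  shows "(\<Oplus>\<^bsub>fun_module X M\<^esub>i\<in>S. f i) = (\<lambda>x. \<Oplus>\<^bsub>M\<^esub>i\<in>S. f i x)"
proof -
  interpret F: module R "fun_module X M" by (rule fun_module)
  show ?thesis using assms
  proof (induct S)
    case (insert j S)
    have "(\<lambda>x. \<Oplus>\<^bsub>M\<^esub>i\<in>insert j S. f i x) = (\<lambda>x. f j x \<oplus>\<^bsub>M\<^esub> (\<Oplus>\<^bsub>M\<^esub>i\<in>S. f i x))"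
      using insert by (intro ext M.finsum_insert Pi_I) (blast intro: fin_suppD(1))+
    then show ?case using insert by (simp add: Pi_iff)
  qed simp
qed

lemma fin_supp_finsum:
  assumes "finite S" "\<And>i. i \<in> S \<Longrightarrow> f i \<in> fin_supp X M"
  shows "(\<lambda>x. \<Oplus>\<^bsub>M\<^esub>i\<in>S. f i x) \<in> fin_supp X M"
proof -
  interpret F: module R "fun_module X M" by (rule fun_module)
  show ?thesis
    using F.M.finsum_closed[of f S] assms fun_module_finsum[OF assms] by auto
qed

lemma fin_supp_lmult:
  assumes c: "c \<in> fin_supp X (self_module R)" and y: "y \<in> carrier M"
  shows "(\<lambda>x. c x \<odot>\<^bsub>M\<^esub> y) \<in> fin_supp X M"
proof (rule fin_suppI)
  show "finite {x. c x \<odot>\<^bsub>M\<^esub> y \<noteq> \<zero>\<^bsub>M\<^esub>}"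
    by (rule finite_subset[OF _ fin_suppD(3)[OF c]]) (use y in auto)
qed (use fin_suppD[OF c] y in auto)

lemma finsum_superset:
  assumes "finite T" "S \<subseteq> T" "\<And>i. i \<in> S \<Longrightarrow> f i \<in> carrier M" "\<And>i. i \<in> T - S \<Longrightarrow> f i = \<zero>\<^bsub>M\<^esub>"
  shows "(\<Oplus>\<^bsub>M\<^esub>i\<in>T. f i) = (\<Oplus>\<^bsub>M\<^esub>i\<in>S. f i)"
proof (rule M.add.finprod_mono_neutral_cong_right)
  show "f \<in> T \<rightarrow> carrier M" using assms(3,4) by (metis DiffI M.zero_closed Pi_I)
qed (use assms in auto)

lemma finsum_smult_rdistr:
  assumes "finite S" "f \<in> S \<rightarrow> carrier R" "x \<in> carrier M"
  shows "(\<Oplus>i\<in>S. f i) \<odot>\<^bsub>M\<^esub> x = (\<Oplus>\<^bsub>M\<^esub>i\<in>S. f i \<odot>\<^bsub>M\<^esub> x)"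
  using assms
proof (induct S)
  case (insert i S)
  then show ?case by (simp add: smult_l_distr Pi_iff R.finsum_closed)
qed simp

lemma finsum_neg:
  assumes "finite S" "f \<in> S \<rightarrow> carrier M"
  shows "(\<Oplus>\<^bsub>M\<^esub>i\<in>S. \<ominus>\<^bsub>M\<^esub> f i) = \<ominus>\<^bsub>M\<^esub> (\<Oplus>\<^bsub>M\<^esub>i\<in>S. f i)"
  using assms
proof (induct S)
  case (insert i S)
  then show ?case by (simp add: Pi_iff M.minus_add)
qed simp

lemma finsum_diff:
  assumes "finite S" "f \<in> S \<rightarrow> carrier M" "g \<in> S \<rightarrow> carrier M"
  shows "(\<Oplus>\<^bsub>M\<^esub>i\<in>S. f i \<ominus>\<^bsub>M\<^esub> g i) = (\<Oplus>\<^bsub>M\<^esub>i\<in>S. f i) \<ominus>\<^bsub>M\<^esub> (\<Oplus>\<^bsub>M\<^esub>i\<in>S. g i)"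
  using assms by (simp add: a_minus_def M.finsum_addf finsum_neg Pi_iff)

lemma finsum_swap:
  assumes "finite S" "finite T" "\<And>i j. i \<in> S \<Longrightarrow> j \<in> T \<Longrightarrow> f i j \<in> carrier M"
  shows "(\<Oplus>\<^bsub>M\<^esub>i\<in>S. \<Oplus>\<^bsub>M\<^esub>j\<in>T. f i j) = (\<Oplus>\<^bsub>M\<^esub>j\<in>T. \<Oplus>\<^bsub>M\<^esub>i\<in>S. f i j)"
  using assms(1,3)
proof (induct S)
  case empty
  then show ?case by simp
next
  case (insert x S)
  have "(\<Oplus>\<^bsub>M\<^esub>j\<in>T. \<Oplus>\<^bsub>M\<^esub>i\<in>insert x S. f i j) = (\<Oplus>\<^bsub>M\<^esub>j\<in>T. f x j \<oplus>\<^bsub>M\<^esub> (\<Oplus>\<^bsub>M\<^esub>i\<in>S. f i j))"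
    using insert by (intro M.finsum_cong') (auto simp: Pi_iff intro!: M.finsum_closed)
  then show ?case using insert assms(2)
    by (simp add: Pi_iff M.finsum_addf M.finsum_closed)
qed

lemma finsum_single:
  assumes "finite T" "t \<in> T" "y \<in> carrier M"
  shows "(\<Oplus>\<^bsub>M\<^esub>i\<in>T. if i = t then y else \<zero>\<^bsub>M\<^esub>) = y"
  using M.add.finprod_singleton[OF assms(2,1), of "\<lambda>_. y"] assms(3) by (simp add: eq_commute)

end

lemma (in cring) basis_vec_closed [simp]: "basis_vec R x y \<in> carrier R"
  by (simp add: basis_vec_def)

lemma (in cring) basis_vec_fin_supp: "x \<in> X \<Longrightarrow> basis_vec R x \<in> fin_supp X (self_module R)"
  by (rule fin_suppI) (auto simp: basis_vec_def)

context module begin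

lemma lin_ext_eq:
  assumes "f \<in> fin_supp X (self_module R)" "\<phi> \<in> X \<rightarrow> carrier M"
    and "finite S" "S \<subseteq> X" "{x. f x \<noteq> \<zero>} \<subseteq> S"
  shows "lin_ext R M \<phi> f = (\<Oplus>\<^bsub>M\<^esub>x\<in>S. f x \<odot>\<^bsub>M\<^esub> \<phi> x)"
proof -
  have "\<phi> x \<in> carrier M" if "x \<in> S" for x using assms(2,4) that by auto
  then show ?thesis
    unfolding lin_ext_def using assms(3,5) fin_suppD[OF assms(1)]
    by (intro finsum_superset[symmetric]) auto
qed

lemma lin_ext_hom:
  assumes \<phi>: "\<phi> \<in> X \<rightarrow> carrier M"
  shows "lin_ext R M \<phi> \<in> mod_hom R (free_module R X) M"
proof (rule mod_homI)
  have supp: "{x. f x \<noteq> \<zero>} \<subseteq> X" "finite {x. f x \<noteq> \<zero>}" if "f \<in> fin_supp X (self_module R)" for f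
    using fin_suppD[OF that] by auto
  fix f assume "f \<in> carrier (free_module R X)"
  then have f: "f \<in> fin_supp X (self_module R)" by (simp add: free_module_eq)
  have cl: "(\<lambda>x. f x \<odot>\<^bsub>M\<^esub> \<phi> x) \<in> S \<rightarrow> carrier M"
    if "f \<in> fin_supp X (self_module R)" "S \<subseteq> X" for S f
    using fin_suppD(1)[OF that(1)] that(2) \<phi> by (auto intro!: smult_closed)
  show "lin_ext R M \<phi> f \<in> carrier M"
    unfolding lin_ext_def using cl[OF f] supp[OF f] by (intro M.finsum_closed)
  { fix g assume "g \<in> carrier (free_module R X)"
    then have g: "g \<in> fin_supp X (self_module R)" by (simp add: free_module_eq)
    let ?S = "{x. f x \<noteq> \<zero>} \<union> {x. g x \<noteq> \<zero>}"
    have S: "finite ?S" "?S \<subseteq> X" using supp[OF f] supp[OF g] by auto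
    have \<phi>S: "\<phi> x \<in> carrier M" if "x \<in> ?S" for x using S(2) \<phi> that by blast
    have fg: "(\<lambda>x. f x \<oplus> g x) \<in> fin_supp X (self_module R)"
      using module.fin_supp_add[OF self_module[OF R.is_cring] f g] by simp
    have "lin_ext R M \<phi> (\<lambda>x. f x \<oplus> g x) = (\<Oplus>\<^bsub>M\<^esub>x\<in>?S. (f x \<oplus> g x) \<odot>\<^bsub>M\<^esub> \<phi> x)"
      by (rule lin_ext_eq[OF fg \<phi> S]) auto
    also have "\<dots> = (\<Oplus>\<^bsub>M\<^esub>x\<in>?S. f x \<odot>\<^bsub>M\<^esub> \<phi> x \<oplus>\<^bsub>M\<^esub> g x \<odot>\<^bsub>M\<^esub> \<phi> x)"
      using fin_suppD(1)[OF f] fin_suppD(1)[OF g] \<phi>S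
      by (intro M.finsum_cong') (auto intro!: smult_l_distr)
    also have "\<dots> = lin_ext R M \<phi> f \<oplus>\<^bsub>M\<^esub> lin_ext R M \<phi> g"
      by (subst M.finsum_addf) (use cl[OF f S(2)] cl[OF g S(2)] lin_ext_eq[OF f \<phi> S] lin_ext_eq[OF g \<phi> S] in auto)
    finally show "lin_ext R M \<phi> (f \<oplus>\<^bsub>free_module R X\<^esub> g) = lin_ext R M \<phi> f \<oplus>\<^bsub>M\<^esub> lin_ext R M \<phi> g"
      by (simp add: free_module_eq) }
  fix a assume a: "a \<in> carrier R"
  let ?S = "{x. f x \<noteq> \<zero>}"
  have \<phi>S: "\<phi> x \<in> carrier M" if "x \<in> ?S" for x using supp[OF f] \<phi> that by blast
  have af: "(\<lambda>x. a \<otimes> f x) \<in> fin_supp X (self_module R)"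
    using module.fin_supp_smult[OF self_module[OF R.is_cring] a f] by simp
  have "lin_ext R M \<phi> (\<lambda>x. a \<otimes> f x) = (\<Oplus>\<^bsub>M\<^esub>x\<in>?S. (a \<otimes> f x) \<odot>\<^bsub>M\<^esub> \<phi> x)"
    by (rule lin_ext_eq[OF af \<phi>]) (use supp[OF f] a in auto)
  also have "\<dots> = (\<Oplus>\<^bsub>M\<^esub>x\<in>?S. a \<odot>\<^bsub>M\<^esub> (f x \<odot>\<^bsub>M\<^esub> \<phi> x))"
    using fin_suppD(1)[OF f] \<phi>S a
    by (intro M.finsum_cong') (auto intro!: smult_assoc1)
  also have "\<dots> = a \<odot>\<^bsub>M\<^esub> lin_ext R M \<phi> f"
    using cl[OF f supp(1)[OF f]] a supp[OF f] by (simp add: lin_ext_def finsum_smult_ldistr)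
  finally show "lin_ext R M \<phi> (a \<odot>\<^bsub>free_module R X\<^esub> f) = a \<odot>\<^bsub>M\<^esub> lin_ext R M \<phi> f"
    by (simp add: free_module_eq)
qed

lemma lin_ext_basis_vec:
  assumes "\<phi> \<in> X \<rightarrow> carrier M" "x \<in> X"
  shows "lin_ext R M \<phi> (basis_vec R x) = \<phi> x"
proof -
  have "lin_ext R M \<phi> (basis_vec R x) = (\<Oplus>\<^bsub>M\<^esub>y\<in>{x}. basis_vec R x y \<odot>\<^bsub>M\<^esub> \<phi> y)"
    by (rule lin_ext_eq[OF R.basis_vec_fin_supp[OF assms(2)] assms(1)]) (use assms in \<open>auto simp: basis_vec_def\<close>)
  also have "\<dots> = \<phi> x" using assms by (auto simp: basis_vec_def Pi_iff)
  finally show ?thesis .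
qed

end

lemma (in cring) free_module_expand:
  assumes f: "f \<in> fin_supp X (self_module R)"
  shows "(\<Oplus>\<^bsub>free_module R X\<^esub>x\<in>{x. f x \<noteq> \<zero>}. f x \<odot>\<^bsub>free_module R X\<^esub> basis_vec R x) = f"
proof -
  interpret S: module R "self_module R" by (rule self_module[OF is_cring])
  let ?S = "{x. f x \<noteq> \<zero>}"
  have S: "finite ?S" "?S \<subseteq> X" using fin_suppD[OF f] by auto
  have "(\<Oplus>\<^bsub>fun_module X (self_module R)\<^esub>x\<in>?S. (\<lambda>y. f x \<otimes> basis_vec R x y))
      = (\<lambda>y. \<Oplus>\<^bsub>self_module R\<^esub>x\<in>?S. f x \<otimes> basis_vec R x y)"
  proof (rule S.fun_module_finsum[OF S(1)])
    fix i assume "i \<in> ?S"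
    then have "basis_vec R i \<in> fin_supp X (self_module R)" "f i \<in> carrier R"
      using S basis_vec_fin_supp[of i X] fin_suppD(1)[OF f] by auto
    then show "(\<lambda>y. f i \<otimes> basis_vec R i y) \<in> fin_supp X (self_module R)"
      using S.fin_supp_smult[of "f i" "basis_vec R i" X] by simp
  qed
  also have "\<dots> = f"
  proof
    fix y
    have "(\<Oplus>x\<in>?S. f x \<otimes> basis_vec R x y) = (\<Oplus>x\<in>?S. if x = y then f y else \<zero>)"
      using fin_suppD(1)[OF f] by (intro finsum_cong') (auto simp: basis_vec_def)
    also have "\<dots> = f y"
    proof (cases "f y = \<zero>")
      case True
      then have "(\<Oplus>x\<in>?S. if x = y then f y else \<zero>) = (\<Oplus>x\<in>?S. \<zero>)"
        by (intro finsum_cong') auto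
      then show ?thesis using True by (simp add: finsum_zero)
    next
      case False
      then show ?thesis using S.finsum_single[of ?S y "f y"] S fin_suppD(1)[OF f]
        unfolding self_module_simps self_module_finsum by auto
    qed
    finally show "(\<Oplus>\<^bsub>self_module R\<^esub>x\<in>?S. f x \<otimes> basis_vec R x y) = f y" by simp
  qed
  finally show ?thesis by (simp add: free_module_eq)
qed

section \<open>Quotient modules\<close>

locale quotient = M?: module R M for R (structure) and M (structure) +
  fixes H assumes H: "submodule H R M"
begin

lemma abelian_subgroup: "abelian_subgroup H M"
  by (intro abelian_subgroupI3 additive_subgroup.intro submodule.axioms(1)[OF H] M.M.abelian_group_axioms)

lemmas rcos_self = abelian_subgroup.a_rcos_self[OF abelian_subgroup]

lemma rcos_eq_iff:
  assumes "x \<in> carrier M" "y \<in> carrier M"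
  shows "H +>\<^bsub>M\<^esub> x = H +>\<^bsub>M\<^esub> y \<longleftrightarrow> x \<ominus>\<^bsub>M\<^esub> y \<in> H"
proof -
  have "x \<ominus>\<^bsub>M\<^esub> y \<in> H \<longleftrightarrow> x \<in> H +>\<^bsub>M\<^esub> y"
    using abelian_subgroup.a_rcos_module[OF abelian_subgroup, of y x] assms by (simp add: a_minus_def)
  then show ?thesis
    using abelian_subgroup.a_repr_independence'[OF abelian_subgroup, of x y] rcos_self[OF assms(1)] assms by auto
qed

lemma quot_carrier: "carrier (quot_module M H) = (\<lambda>x. H +>\<^bsub>M\<^esub> x) ` carrier M"
  by (auto simp: quot_module_def A_RCOSETS_def')

lemma quot_zero: "\<zero>\<^bsub>quot_module M H\<^esub> = H +>\<^bsub>M\<^esub> \<zero>\<^bsub>M\<^esub>"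
  by (simp add: quot_module_def M.M.a_coset_add_zero submoduleE(1)[OF H])

lemma quot_add: "x \<in> carrier M \<Longrightarrow> y \<in> carrier M \<Longrightarrow>
   (H +>\<^bsub>M\<^esub> x) \<oplus>\<^bsub>quot_module M H\<^esub> (H +>\<^bsub>M\<^esub> y) = H +>\<^bsub>M\<^esub> (x \<oplus>\<^bsub>M\<^esub> y)"
  by (simp add: quot_module_def abelian_subgroup.a_rcos_sum[OF abelian_subgroup])

lemma coset_UN:
  assumes x: "x \<in> carrier M" and g: "\<And>y. y \<in> H +>\<^bsub>M\<^esub> x \<Longrightarrow> g y = g x"
  shows "(\<Union>y\<in>H +>\<^bsub>M\<^esub> x. g y) = g x"
  using g rcos_self[OF x] by (metis (no_types, lifting) SUP_eq_const empty_iff)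

lemma rcosD: "x \<in> carrier M \<Longrightarrow> y \<in> H +>\<^bsub>M\<^esub> x \<Longrightarrow> y \<in> carrier M \<and> y \<ominus>\<^bsub>M\<^esub> x \<in> H"
  using abelian_subgroup.a_elemrcos_carrier[OF abelian_subgroup, of x y] abelian_subgroup.a_rcos_module[OF abelian_subgroup, of x y] by (simp add: a_minus_def)

lemma quot_smult:
  assumes a: "a \<in> carrier R" and x: "x \<in> carrier M"
  shows "a \<odot>\<^bsub>quot_module M H\<^esub> (H +>\<^bsub>M\<^esub> x) = H +>\<^bsub>M\<^esub> (a \<odot>\<^bsub>M\<^esub> x)"
proof -
  have "H +>\<^bsub>M\<^esub> (a \<odot>\<^bsub>M\<^esub> y) = H +>\<^bsub>M\<^esub> (a \<odot>\<^bsub>M\<^esub> x)" if "y \<in> H +>\<^bsub>M\<^esub> x" for y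
  proof -
    have y: "y \<in> carrier M" "y \<ominus>\<^bsub>M\<^esub> x \<in> H" using rcosD[OF x that] by auto
    have "a \<odot>\<^bsub>M\<^esub> y \<ominus>\<^bsub>M\<^esub> a \<odot>\<^bsub>M\<^esub> x = a \<odot>\<^bsub>M\<^esub> (y \<ominus>\<^bsub>M\<^esub> x)"
      using a x y by (simp add: a_minus_def smult_r_distr smult_r_minus)
    then show ?thesis using rcos_eq_iff y a x submodule.smult_closed[OF H] by simp
  qed
  then show ?thesis
    unfolding quot_module_def by (simp only: module.select_convs coset_UN[OF x, of "\<lambda>y. H +>\<^bsub>M\<^esub> (a \<odot>\<^bsub>M\<^esub> y)"])
qed

lemma quot_is_module: "module R (quot_module M H)"
  by (rule module_image'[of "\<lambda>x. H +>\<^bsub>M\<^esub> x"]) (auto simp: quot_carrier quot_zero quot_add quot_smult)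

lemma quot_hom: "(\<lambda>x. H +>\<^bsub>M\<^esub> x) \<in> mod_hom R M (quot_module M H)"
  by (rule mod_homI) (auto simp: quot_carrier quot_zero quot_add quot_smult)

lemma rcos_zero_iff: "x \<in> carrier M \<Longrightarrow> H +>\<^bsub>M\<^esub> x = \<zero>\<^bsub>quot_module M H\<^esub> \<longleftrightarrow> x \<in> H"
  by (simp add: quot_zero rcos_eq_iff a_minus_def)

end

section \<open>Tensor products\<close>

locale tensor_product = P?: module R P + N?: module R N
  for R (structure) and P (structure) and N (structure)
begin

abbreviation "F \<equiv> free_module R (carrier P \<times> carrier N)"
abbreviation "K \<equiv> tensor_ker R P N"
abbreviation "e m n \<equiv> basis_vec R (m, n)"
abbreviation "pt \<equiv> pure_tensor R P N"

lemma F_module: "module R F"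
  by (rule free_module[OF P.R.is_cring])

lemma e_closed: "m \<in> carrier P \<Longrightarrow> n \<in> carrier N \<Longrightarrow> e m n \<in> carrier F"
  by (simp add: free_module_eq P.R.basis_vec_fin_supp)

lemma tensor_rels_subset: "tensor_rels R P N \<subseteq> carrier F"
proof -
  interpret F: module R F by (rule F_module)
  show ?thesis
    unfolding tensor_rels_def Let_def
    by (auto intro!: e_closed F.M.minus_closed F.M.a_closed F.smult_closed P.smult_closed N.smult_closed
        P.M.a_closed N.M.a_closed)
qed

lemma tensor_ker_submodule: "submodule K R F"
proof -
  interpret F: module R F by (rule F_module)
  have K: "K = \<Inter>{t. submodule t R F \<and> tensor_rels R P N \<subseteq> t}"
    by (simp add: tensor_ker_def hull_def)
  have top: "K \<subseteq> carrier F"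
    unfolding K using tensor_rels_subset F.carrier_is_submodule by blast
  show ?thesis
  proof (rule F.submoduleI[OF top])
    show "\<zero>\<^bsub>F\<^esub> \<in> K" unfolding K by (auto simp: F.submodule_zero)
    show "\<And>a. a \<in> K \<Longrightarrow> \<ominus>\<^bsub>F\<^esub> a \<in> K" unfolding K by (auto dest: F.submoduleE(3))
    show "\<And>a b. a \<in> K \<Longrightarrow> b \<in> K \<Longrightarrow> a \<oplus>\<^bsub>F\<^esub> b \<in> K" unfolding K by (auto dest: F.submoduleE(5))
    show "\<And>a x. a \<in> carrier R \<Longrightarrow> x \<in> K \<Longrightarrow> a \<odot>\<^bsub>F\<^esub> x \<in> K"
      unfolding K by (auto dest: F.submoduleE(4))
  qed
qed

lemma tensor_quotient: "quotient R F K"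
  by (intro quotient.intro quotient_axioms.intro F_module tensor_ker_submodule)

sublocale Q: quotient R F K by (rule tensor_quotient)

lemma tensor_module: "module R (tensor R P N)"
  unfolding tensor_def by (rule Q.quot_is_module)

lemma pt_closed: "m \<in> carrier P \<Longrightarrow> n \<in> carrier N \<Longrightarrow> pt m n \<in> carrier (tensor R P N)"
  unfolding tensor_def pure_tensor_def by (simp add: Q.quot_carrier e_closed)

lemma tensor_rels_ker: "tensor_rels R P N \<subseteq> K"
  by (simp add: tensor_ker_def hull_subset)

lemma rel_add_l: "m \<in> carrier P \<Longrightarrow> m' \<in> carrier P \<Longrightarrow> n \<in> carrier N
    \<Longrightarrow> e (m \<oplus>\<^bsub>P\<^esub> m') n \<ominus>\<^bsub>F\<^esub> (e m n \<oplus>\<^bsub>F\<^esub> e m' n) \<in> K"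
  and rel_add_r: "m \<in> carrier P \<Longrightarrow> n \<in> carrier N \<Longrightarrow> n' \<in> carrier N
    \<Longrightarrow> e m (n \<oplus>\<^bsub>N\<^esub> n') \<ominus>\<^bsub>F\<^esub> (e m n \<oplus>\<^bsub>F\<^esub> e m n') \<in> K"
  and rel_smult_l: "a \<in> carrier R \<Longrightarrow> m \<in> carrier P \<Longrightarrow> n \<in> carrier N
    \<Longrightarrow> e (a \<odot>\<^bsub>P\<^esub> m) n \<ominus>\<^bsub>F\<^esub> (a \<odot>\<^bsub>F\<^esub> e m n) \<in> K"
  and rel_smult_r: "a \<in> carrier R \<Longrightarrow> m \<in> carrier P \<Longrightarrow> n \<in> carrier N
    \<Longrightarrow> e m (a \<odot>\<^bsub>N\<^esub> n) \<ominus>\<^bsub>F\<^esub> (a \<odot>\<^bsub>F\<^esub> e m n) \<in> K"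
  by (rule subsetD[OF tensor_rels_ker], unfold tensor_rels_def Let_def, blast)+

lemma pt_add_l: "m \<in> carrier P \<Longrightarrow> m' \<in> carrier P \<Longrightarrow> n \<in> carrier N
    \<Longrightarrow> pt (m \<oplus>\<^bsub>P\<^esub> m') n = pt m n \<oplus>\<^bsub>tensor R P N\<^esub> pt m' n"
  and pt_add_r: "m \<in> carrier P \<Longrightarrow> n \<in> carrier N \<Longrightarrow> n' \<in> carrier N
    \<Longrightarrow> pt m (n \<oplus>\<^bsub>N\<^esub> n') = pt m n \<oplus>\<^bsub>tensor R P N\<^esub> pt m n'"
  and pt_smult_l: "a \<in> carrier R \<Longrightarrow> m \<in> carrier P \<Longrightarrow> n \<in> carrier N
    \<Longrightarrow> pt (a \<odot>\<^bsub>P\<^esub> m) n = a \<odot>\<^bsub>tensor R P N\<^esub> pt m n"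
  and pt_smult_r: "a \<in> carrier R \<Longrightarrow> m \<in> carrier P \<Longrightarrow> n \<in> carrier N
    \<Longrightarrow> pt m (a \<odot>\<^bsub>N\<^esub> n) = a \<odot>\<^bsub>tensor R P N\<^esub> pt m n"
proof -
  note [simp] = e_closed Q.M.M.a_closed
  show "m \<in> carrier P \<Longrightarrow> m' \<in> carrier P \<Longrightarrow> n \<in> carrier N
    \<Longrightarrow> pt (m \<oplus>\<^bsub>P\<^esub> m') n = pt m n \<oplus>\<^bsub>tensor R P N\<^esub> pt m' n"
    using rel_add_l[of m m' n] by (simp add: tensor_def pure_tensor_def Q.quot_add Q.rcos_eq_iff)
  show "m \<in> carrier P \<Longrightarrow> n \<in> carrier N \<Longrightarrow> n' \<in> carrier N
    \<Longrightarrow> pt m (n \<oplus>\<^bsub>N\<^esub> n') = pt m n \<oplus>\<^bsub>tensor R P N\<^esub> pt m n'"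
    using rel_add_r[of m n n'] by (simp add: tensor_def pure_tensor_def Q.quot_add Q.rcos_eq_iff)
  show "a \<in> carrier R \<Longrightarrow> m \<in> carrier P \<Longrightarrow> n \<in> carrier N
    \<Longrightarrow> pt (a \<odot>\<^bsub>P\<^esub> m) n = a \<odot>\<^bsub>tensor R P N\<^esub> pt m n"
    using rel_smult_l[of a m n] by (simp add: tensor_def pure_tensor_def Q.quot_smult Q.rcos_eq_iff)
  show "a \<in> carrier R \<Longrightarrow> m \<in> carrier P \<Longrightarrow> n \<in> carrier N
    \<Longrightarrow> pt m (a \<odot>\<^bsub>N\<^esub> n) = a \<odot>\<^bsub>tensor R P N\<^esub> pt m n"
    using rel_smult_r[of a m n] by (simp add: tensor_def pure_tensor_def Q.quot_smult Q.rcos_eq_iff)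
qed

lemma pt_hom_r: "m \<in> carrier P \<Longrightarrow> pt m \<in> mod_hom R N (tensor R P N)"
  by (rule mod_homI) (auto simp: pt_closed pt_add_r pt_smult_r)

lemma pt_hom_l: "n \<in> carrier N \<Longrightarrow> (\<lambda>m. pt m n) \<in> mod_hom R P (tensor R P N)"
  by (rule mod_homI) (auto simp: pt_closed pt_add_l pt_smult_l)

lemma pt_map_r: "m \<in> carrier P \<Longrightarrow> linear_map R N (tensor R P N) (pt m)"
  by (intro linear_mapI pt_hom_r N.module_axioms tensor_module)

lemma pt_map_l: "n \<in> carrier N \<Longrightarrow> linear_map R P (tensor R P N) (\<lambda>m. pt m n)"
  by (intro linear_mapI pt_hom_l P.module_axioms tensor_module)

lemma pt_diff_r: "m \<in> carrier P \<Longrightarrow> n \<in> carrier N \<Longrightarrow> n' \<in> carrier N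
    \<Longrightarrow> pt m (n \<ominus>\<^bsub>N\<^esub> n') = pt m n \<ominus>\<^bsub>tensor R P N\<^esub> pt m n'"
  by (rule linear_map.diff[OF pt_map_r])

lemma pt_diff_l: "m \<in> carrier P \<Longrightarrow> m' \<in> carrier P \<Longrightarrow> n \<in> carrier N
    \<Longrightarrow> pt (m \<ominus>\<^bsub>P\<^esub> m') n = pt m n \<ominus>\<^bsub>tensor R P N\<^esub> pt m' n"
  by (rule linear_map.diff[OF pt_map_l])

lemma pt_zero_r: "m \<in> carrier P \<Longrightarrow> pt m \<zero>\<^bsub>N\<^esub> = \<zero>\<^bsub>tensor R P N\<^esub>"
  by (rule linear_map.zero[OF pt_map_r])

lemma pt_zero_l: "n \<in> carrier N \<Longrightarrow> pt \<zero>\<^bsub>P\<^esub> n = \<zero>\<^bsub>tensor R P N\<^esub>"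
  by (rule linear_map.zero[OF pt_map_l])

lemma tensor_sum_coset:
  assumes "finite T" "\<And>i. i \<in> T \<Longrightarrow> p i \<in> carrier P" "\<And>i. i \<in> T \<Longrightarrow> n i \<in> carrier N"
  shows "(\<Oplus>\<^bsub>tensor R P N\<^esub>i\<in>T. pt (p i) (n i)) = K +>\<^bsub>F\<^esub> (\<Oplus>\<^bsub>F\<^esub>i\<in>T. e (p i) (n i))"
proof -
  interpret L: linear_map R F "tensor R P N" "\<lambda>x. K +>\<^bsub>F\<^esub> x"
    unfolding tensor_def
    by (intro linear_mapI Q.quot_hom F_module Q.quot_is_module)
  show ?thesis
    using L.map_finsum[of T "\<lambda>i. e (p i) (n i)"] assms by (simp add: e_closed pure_tensor_def)
qed

lemma tensor_elem:
  assumes "x \<in> carrier (tensor R P N)"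
  obtains k :: nat and p n where "\<And>i. i < k \<Longrightarrow> p i \<in> carrier P" "\<And>i. i < k \<Longrightarrow> n i \<in> carrier N"
    "x = (\<Oplus>\<^bsub>tensor R P N\<^esub>i\<in>{..<k}. pt (p i) (n i))"
proof -
  interpret T: module R "tensor R P N" by (rule tensor_module)
  interpret L: linear_map R F "tensor R P N" "\<lambda>x. K +>\<^bsub>F\<^esub> x"
    unfolding tensor_def
    by (intro linear_mapI Q.quot_hom F_module Q.quot_is_module)
  obtain f where f: "f \<in> carrier F" "x = K +>\<^bsub>F\<^esub> f"
    using assms unfolding tensor_def by (auto simp: Q.quot_carrier)
  have f': "f \<in> fin_supp (carrier P \<times> carrier N) (self_module R)" using f by (simp add: free_module_eq)
  let ?S = "{z. f z \<noteq> \<zero>}"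
  have S: "finite ?S" "?S \<subseteq> carrier P \<times> carrier N" using fin_suppD[OF f'] by auto
  obtain h where h: "bij_betw h {..<card ?S} ?S"
    using ex_bij_betw_nat_finite[OF S(1)] by (auto simp: atLeast0LessThan)
  let ?p = "\<lambda>z. f z \<odot>\<^bsub>P\<^esub> fst z"
  have fz: "f z \<in> carrier R" for z using fin_suppD(1)[OF f', of z] by simp
  have "x = K +>\<^bsub>F\<^esub> (\<Oplus>\<^bsub>F\<^esub>z\<in>?S. f z \<odot>\<^bsub>F\<^esub> basis_vec R z)"
    using P.R.free_module_expand[OF f'] f by simp
  also have "\<dots> = (\<Oplus>\<^bsub>tensor R P N\<^esub>z\<in>?S. K +>\<^bsub>F\<^esub> (f z \<odot>\<^bsub>F\<^esub> basis_vec R z))"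
  proof (rule L.map_finsum[OF S(1)])
    fix i assume "i \<in> ?S"
    then have "basis_vec R i \<in> carrier F"
      unfolding free_module_eq fun_module_simps using S(2) by (intro P.R.basis_vec_fin_supp) blast
    then show "f i \<odot>\<^bsub>F\<^esub> basis_vec R i \<in> carrier F" using fz by (rule Q.M.smult_closed[rotated])
  qed
  also have "\<dots> = (\<Oplus>\<^bsub>tensor R P N\<^esub>z\<in>?S. pt (?p z) (snd z))"
  proof (rule T.M.finsum_cong')
    fix z assume "z \<in> ?S"
    then have z: "fst z \<in> carrier P" "snd z \<in> carrier N" using S by auto
    have "K +>\<^bsub>F\<^esub> (f z \<odot>\<^bsub>F\<^esub> e (fst z) (snd z)) = f z \<odot>\<^bsub>tensor R P N\<^esub> pt (fst z) (snd z)"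
      using fz[of z] z e_closed[OF z] L.smult[of "f z" "e (fst z) (snd z)"] by (simp only: pure_tensor_def)
    then show "K +>\<^bsub>F\<^esub> (f z \<odot>\<^bsub>F\<^esub> basis_vec R z) = pt (?p z) (snd z)"
      using z fz[of z] by (simp add: pt_smult_l)
  qed (use S fz in \<open>auto intro!: pt_closed\<close>)
  also have "\<dots> = (\<Oplus>\<^bsub>tensor R P N\<^esub>i\<in>{..<card ?S}. pt (?p (h i)) (snd (h i)))"
  proof -
    have "(\<Oplus>\<^bsub>tensor R P N\<^esub>z\<in>h ` {..<card ?S}. pt (?p z) (snd z))
        = (\<Oplus>\<^bsub>tensor R P N\<^esub>i\<in>{..<card ?S}. pt (?p (h i)) (snd (h i)))"
    proof (rule T.M.finsum_reindex)
      show "inj_on h {..<card ?S}" using h by (simp add: bij_betw_def)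
      have hS: "h ` {..<card ?S} = ?S" using h by (simp add: bij_betw_def)
      show "(\<lambda>z. pt (?p z) (snd z)) \<in> h ` {..<card ?S} \<rightarrow> carrier (tensor R P N)"
        unfolding hS using S fz by (auto intro!: pt_closed)
    qed
    then show ?thesis using h by (simp add: bij_betw_def)
  qed
  finally have "x = (\<Oplus>\<^bsub>tensor R P N\<^esub>i\<in>{..<card ?S}. pt (?p (h i)) (snd (h i)))" .
  moreover have "h i \<in> ?S" if "i < card ?S" for i using bij_betwE[OF h] that by auto
  then have "?p (h i) \<in> carrier P \<and> snd (h i) \<in> carrier N" if "i < card ?S" for i
    using subsetD[OF S(2), of "h i"] fz[of "h i"] that by (auto simp: mem_Times_iff)
  ultimately show ?thesis using that[of "card ?S" "\<lambda>i. ?p (h i)" "\<lambda>i. snd (h i)"] by auto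
qed

text \<open>
  The relations of the tensor product are the bilinearity relations and nothing more: a linear map
  on the free module that is bilinear on the basis modulo a submodule \<open>S\<close> sends all of them
  into \<open>S\<close>.
\<close>

lemma tensor_ker_image:
  assumes Q: "module R Q" and S: "submodule S R Q" and l: "l \<in> mod_hom R F Q"
    and "\<And>m m' n. m \<in> carrier P \<Longrightarrow> m' \<in> carrier P \<Longrightarrow> n \<in> carrier N
      \<Longrightarrow> l (e (m \<oplus>\<^bsub>P\<^esub> m') n) \<ominus>\<^bsub>Q\<^esub> (l (e m n) \<oplus>\<^bsub>Q\<^esub> l (e m' n)) \<in> S"
    and "\<And>m n n'. m \<in> carrier P \<Longrightarrow> n \<in> carrier N \<Longrightarrow> n' \<in> carrier N
      \<Longrightarrow> l (e m (n \<oplus>\<^bsub>N\<^esub> n')) \<ominus>\<^bsub>Q\<^esub> (l (e m n) \<oplus>\<^bsub>Q\<^esub> l (e m n')) \<in> S"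
    and "\<And>a m n. a \<in> carrier R \<Longrightarrow> m \<in> carrier P \<Longrightarrow> n \<in> carrier N
      \<Longrightarrow> l (e (a \<odot>\<^bsub>P\<^esub> m) n) \<ominus>\<^bsub>Q\<^esub> (a \<odot>\<^bsub>Q\<^esub> l (e m n)) \<in> S"
    and "\<And>a m n. a \<in> carrier R \<Longrightarrow> m \<in> carrier P \<Longrightarrow> n \<in> carrier N
      \<Longrightarrow> l (e m (a \<odot>\<^bsub>N\<^esub> n)) \<ominus>\<^bsub>Q\<^esub> (a \<odot>\<^bsub>Q\<^esub> l (e m n)) \<in> S"
    and x: "x \<in> K"
  shows "l x \<in> S"
proof -
  interpret L: linear_map R F Q l
    by (intro linear_mapI l F_module Q)
  have "tensor_rels R P N \<subseteq> {x \<in> carrier F. l x \<in> S}"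
  proof
    fix r assume r: "r \<in> tensor_rels R P N"
    note s = e_closed Q.M.M.a_closed Q.M.smult_closed L.diff L.add L.smult assms(4-7)
      P.smult_closed N.smult_closed P.M.a_closed N.M.a_closed
    have "l r \<in> S"
      using r unfolding tensor_rels_def Let_def by (auto simp: s)
    then show "r \<in> {x \<in> carrier F. l x \<in> S}" using r tensor_rels_subset by auto
  qed
  then have "K \<subseteq> {x \<in> carrier F. l x \<in> S}"
    unfolding tensor_ker_def by (rule hull_minimal[where S = "\<lambda>H. submodule H R F"]) (rule L.preimage_submodule[OF S])
  then show ?thesis using x by blast
qed

lemma tensor_universal:
  assumes Q: "module R Q" and S: "submodule S R Q"
    and \<beta>: "\<And>m n. m \<in> carrier P \<Longrightarrow> n \<in> carrier N \<Longrightarrow> \<beta> m n \<in> carrier Q"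
    and "\<And>m m' n. m \<in> carrier P \<Longrightarrow> m' \<in> carrier P \<Longrightarrow> n \<in> carrier N
      \<Longrightarrow> \<beta> (m \<oplus>\<^bsub>P\<^esub> m') n \<ominus>\<^bsub>Q\<^esub> (\<beta> m n \<oplus>\<^bsub>Q\<^esub> \<beta> m' n) \<in> S"
    and "\<And>m n n'. m \<in> carrier P \<Longrightarrow> n \<in> carrier N \<Longrightarrow> n' \<in> carrier N
      \<Longrightarrow> \<beta> m (n \<oplus>\<^bsub>N\<^esub> n') \<ominus>\<^bsub>Q\<^esub> (\<beta> m n \<oplus>\<^bsub>Q\<^esub> \<beta> m n') \<in> S"
    and "\<And>a m n. a \<in> carrier R \<Longrightarrow> m \<in> carrier P \<Longrightarrow> n \<in> carrier N
      \<Longrightarrow> \<beta> (a \<odot>\<^bsub>P\<^esub> m) n \<ominus>\<^bsub>Q\<^esub> (a \<odot>\<^bsub>Q\<^esub> \<beta> m n) \<in> S"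
    and "\<And>a m n. a \<in> carrier R \<Longrightarrow> m \<in> carrier P \<Longrightarrow> n \<in> carrier N
      \<Longrightarrow> \<beta> m (a \<odot>\<^bsub>N\<^esub> n) \<ominus>\<^bsub>Q\<^esub> (a \<odot>\<^bsub>Q\<^esub> \<beta> m n) \<in> S"
    and T: "finite T" "\<And>i. i \<in> T \<Longrightarrow> p i \<in> carrier P" "\<And>i. i \<in> T \<Longrightarrow> n i \<in> carrier N"
    and zero: "(\<Oplus>\<^bsub>tensor R P N\<^esub>i\<in>T. pt (p i) (n i)) = \<zero>\<^bsub>tensor R P N\<^esub>"
  shows "(\<Oplus>\<^bsub>Q\<^esub>i\<in>T. \<beta> (p i) (n i)) \<in> S"
proof -
  interpret Q': module R Q by fact
  let ?l = "lin_ext R Q (case_prod \<beta>)"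
  have \<beta>': "case_prod \<beta> \<in> carrier P \<times> carrier N \<rightarrow> carrier Q" using \<beta> by auto
  have l: "?l \<in> mod_hom R F Q" by (rule Q'.lin_ext_hom[OF \<beta>'])
  interpret L: linear_map R F Q ?l
    by (intro linear_mapI l F_module Q)
  have le: "?l (e m n) = \<beta> m n" if "m \<in> carrier P" "n \<in> carrier N" for m n
    using Q'.lin_ext_basis_vec[OF \<beta>', of "(m, n)"] that by simp
  have ec: "e (p i) (n i) \<in> carrier F" if "i \<in> T" for i using T that e_closed by auto
  have sc: "(\<Oplus>\<^bsub>F\<^esub>i\<in>T. e (p i) (n i)) \<in> carrier F" using ec by (intro Q.M.M.finsum_closed) auto
  have "(\<Oplus>\<^bsub>F\<^esub>i\<in>T. e (p i) (n i)) \<in> K"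
    using zero sc tensor_sum_coset[OF T] Q.rcos_zero_iff[OF sc] by (simp add: tensor_def)
  then have "?l (\<Oplus>\<^bsub>F\<^esub>i\<in>T. e (p i) (n i)) \<in> S"
    by (intro tensor_ker_image[OF Q S l])
      (simp_all add: le assms(4-7) P.smult_closed N.smult_closed P.M.a_closed N.M.a_closed)
  also have "?l (\<Oplus>\<^bsub>F\<^esub>i\<in>T. e (p i) (n i)) = (\<Oplus>\<^bsub>Q\<^esub>i\<in>T. ?l (e (p i) (n i)))"
    by (rule L.map_finsum[OF T(1) ec])
  also have "\<dots> = (\<Oplus>\<^bsub>Q\<^esub>i\<in>T. \<beta> (p i) (n i))"
    using T by (intro Q'.M.finsum_cong') (auto simp: le intro: \<beta>)
  finally show ?thesis .
qed

end

lemma tensor_map_hom: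
  fixes R (structure)
  assumes P: "module R P" "module R P'" and N: "module R N" "module R N'"
    and f: "f \<in> mod_hom R P P'" and g: "g \<in> mod_hom R N N'"
  shows "tensor_map R P' N' f g \<in> mod_hom R (tensor R P N) (tensor R P' N')"
    and "\<And>p n. p \<in> carrier P \<Longrightarrow> n \<in> carrier N \<Longrightarrow>
      tensor_map R P' N' f g (pure_tensor R P N p n) = pure_tensor R P' N' (f p) (g n)"
proof -
  interpret A: tensor_product R P N by (intro tensor_product.intro P N)
  interpret B: tensor_product R P' N' by (intro tensor_product.intro P N)
  let ?l = "lin_ext R B.F (\<lambda>(m, n). basis_vec R (f m, g n))"
  note fg = mod_hom_closed[OF f] mod_hom_closed[OF g]
  have \<phi>: "(\<lambda>(m, n). basis_vec R (f m, g n)) \<in> carrier P \<times> carrier N \<rightarrow> carrier B.F"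
    using fg B.e_closed by auto
  have l: "?l \<in> mod_hom R A.F B.F" by (rule module.lin_ext_hom[OF B.F_module \<phi>])
  interpret L: linear_map R A.F B.F ?l
    by (intro linear_mapI l A.F_module B.F_module)
  have le: "?l (A.e m n) = B.e (f m) (g n)" if "m \<in> carrier P" "n \<in> carrier N" for m n
    using module.lin_ext_basis_vec[OF B.F_module \<phi>, of "(m, n)"] that by simp
  have ker: "?l x \<in> B.K" if "x \<in> A.K" for x
    by (rule A.tensor_ker_image[OF B.F_module B.tensor_ker_submodule l _ _ _ _ that])
      (simp_all add: le A.P.smult_closed A.N.smult_closed A.P.M.a_closed A.N.M.a_closed fg
        mod_hom_add[OF f] mod_hom_add[OF g] mod_hom_smult[OF f] mod_hom_smult[OF g]
        B.rel_add_l B.rel_add_r B.rel_smult_l B.rel_smult_r)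
  have tm: "tensor_map R P' N' f g (A.K +>\<^bsub>A.F\<^esub> x) = B.K +>\<^bsub>B.F\<^esub> ?l x" if x: "x \<in> carrier A.F" for x
  proof -
    have "B.K +>\<^bsub>B.F\<^esub> ?l y = B.K +>\<^bsub>B.F\<^esub> ?l x" if "y \<in> A.K +>\<^bsub>A.F\<^esub> x" for y
    proof -
      have y: "y \<in> carrier A.F" "y \<ominus>\<^bsub>A.F\<^esub> x \<in> A.K" using A.Q.rcosD[OF x that] by auto
      show ?thesis using B.Q.rcos_eq_iff[of "?l y" "?l x"] L.closed x y ker[OF y(2)] L.diff[of y x] by simp
    qed
    then have "(\<Union>y\<in>A.K +>\<^bsub>A.F\<^esub> x. B.K +>\<^bsub>B.F\<^esub> ?l y) = B.K +>\<^bsub>B.F\<^esub> ?l x"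
      by (rule A.Q.coset_UN[OF x])
    then show ?thesis unfolding tensor_map_def Let_def quot_map_def .
  qed
  show "tensor_map R P' N' f g (pure_tensor R P N p n) = pure_tensor R P' N' (f p) (g n)"
    if "p \<in> carrier P" "n \<in> carrier N" for p n
    using tm[OF A.e_closed[OF that]] le[OF that] by (simp add: pure_tensor_def)
  have car: "\<exists>y\<in>carrier A.F. x = A.K +>\<^bsub>A.F\<^esub> y" if "x \<in> carrier (tensor R P N)" for x
    using that unfolding tensor_def by (auto simp: A.Q.quot_carrier)
  show "tensor_map R P' N' f g \<in> mod_hom R (tensor R P N) (tensor R P' N')"
  proof (rule mod_homI)
    fix x assume "x \<in> carrier (tensor R P N)"
    then obtain x' where x: "x' \<in> carrier A.F" "x = A.K +>\<^bsub>A.F\<^esub> x'" using car by blast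
    show "tensor_map R P' N' f g x \<in> carrier (tensor R P' N')"
      using x L.closed[OF x(1)] by (simp add: tm) (simp add: tensor_def B.Q.quot_carrier)
    { fix a assume "a \<in> carrier R"
      then show "tensor_map R P' N' f g (a \<odot>\<^bsub>tensor R P N\<^esub> x) = a \<odot>\<^bsub>tensor R P' N'\<^esub> tensor_map R P' N' f g x"
        using x L.closed[OF x(1)] L.smult[of a x'] by (simp add: tensor_def A.Q.quot_smult B.Q.quot_smult tm) }
    fix y assume "y \<in> carrier (tensor R P N)"
    then obtain y' where y: "y' \<in> carrier A.F" "y = A.K +>\<^bsub>A.F\<^esub> y'" using car by blast
    show "tensor_map R P' N' f g (x \<oplus>\<^bsub>tensor R P N\<^esub> y) =
       tensor_map R P' N' f g x \<oplus>\<^bsub>tensor R P' N'\<^esub> tensor_map R P' N' f g y"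
      using x y L.closed L.add[of x' y'] by (simp add: tensor_def A.Q.quot_add B.Q.quot_add tm A.Q.M.M.a_closed)
  qed
qed

lemma tensor_map_sum:
  fixes R (structure)
  assumes P: "module R P" "module R P'" and N: "module R N" "module R N'"
    and f: "f \<in> mod_hom R P P'" and g: "g \<in> mod_hom R N N'"
    and T: "finite T" "\<And>i. i \<in> T \<Longrightarrow> p i \<in> carrier P" "\<And>i. i \<in> T \<Longrightarrow> n i \<in> carrier N"
  shows "tensor_map R P' N' f g (\<Oplus>\<^bsub>tensor R P N\<^esub>i\<in>T. pure_tensor R P N (p i) (n i))
    = (\<Oplus>\<^bsub>tensor R P' N'\<^esub>i\<in>T. pure_tensor R P' N' (f (p i)) (g (n i)))"
proof -
  interpret A: tensor_product R P N by (intro tensor_product.intro P N)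
  interpret B: tensor_product R P' N' by (intro tensor_product.intro P N)
  interpret T': module R "tensor R P' N'" by (rule B.tensor_module)
  interpret L: linear_map R "tensor R P N" "tensor R P' N'" "tensor_map R P' N' f g"
    by (intro linear_mapI tensor_map_hom[OF P N f g] A.tensor_module B.tensor_module)
  have "tensor_map R P' N' f g (\<Oplus>\<^bsub>tensor R P N\<^esub>i\<in>T. A.pt (p i) (n i))
      = (\<Oplus>\<^bsub>tensor R P' N'\<^esub>i\<in>T. tensor_map R P' N' f g (A.pt (p i) (n i)))"
    by (rule L.map_finsum) (use T A.pt_closed in auto)
  also have "\<dots> = (\<Oplus>\<^bsub>tensor R P' N'\<^esub>i\<in>T. B.pt (f (p i)) (g (n i)))"
    using T mod_hom_closed[OF f] mod_hom_closed[OF g]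
    by (intro T'.M.finsum_cong') (auto intro!: tensor_map_hom(2)[OF P N f g] B.pt_closed)
  finally show ?thesis .
qed

lemma (in module) submodule_diff_cancel:
  assumes "submodule H R M" "x \<ominus>\<^bsub>M\<^esub> y \<in> H" "y \<in> H" "x \<in> carrier M"
  shows "x \<in> H"
proof -
  have "y \<in> carrier M" using submoduleE(1)[OF assms(1)] assms(3) by blast
  then have "(x \<ominus>\<^bsub>M\<^esub> y) \<oplus>\<^bsub>M\<^esub> y = x" using assms(4) by (simp add: a_minus_def M.a_assoc M.l_neg)
  then show ?thesis using submoduleE(5)[OF assms(1-3)] by simp
qed

lemma (in tensor_product) tensor_generated:
  assumes H: "submodule H R (tensor R P N)" and pt: "\<And>m n. m \<in> carrier P \<Longrightarrow> n \<in> carrier N \<Longrightarrow> pt m n \<in> H"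
    and x: "x \<in> carrier (tensor R P N)"
  shows "x \<in> H"
proof -
  interpret T: module R "tensor R P N" by (rule tensor_module)
  obtain k :: nat and p n where p: "\<And>i. i < k \<Longrightarrow> p i \<in> carrier P" "\<And>i. i < k \<Longrightarrow> n i \<in> carrier N"
    "x = (\<Oplus>\<^bsub>tensor R P N\<^esub>i\<in>{..<k}. pt (p i) (n i))" by (rule tensor_elem[OF x]) blast
  show ?thesis unfolding p(3) using p(1,2) pt by (intro T.submodule_finsum[OF H]) auto
qed

text \<open>
  Right exactness. The inverse to \<open>coker (P \<otimes> L \<rightarrow> P \<otimes> M) \<rightarrow> P \<otimes> N\<close> sends \<open>p \<otimes> n\<close> to
  \<open>p \<otimes> m\<close> for any preimage \<open>m\<close> of \<open>n\<close>.
\<close>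

lemma tensor_right_exact:
  fixes R (structure)
  assumes P: "module R P" and L: "module R L" and M: "module R M" and N: "module R N"
    and ex: "short_exact R L M N f g"
  shows "tensor_map R P M id f ` carrier (tensor R P L)
      = {x \<in> carrier (tensor R P M). tensor_map R P N id g x = \<zero>\<^bsub>tensor R P N\<^esub>}" (is ?exact)
    and "tensor_map R P N id g ` carrier (tensor R P M) = carrier (tensor R P N)" (is ?surj)
proof -
  have f: "f \<in> mod_hom R L M" and g: "g \<in> mod_hom R M N"
    and fg: "f ` carrier L = {x \<in> carrier M. g x = \<zero>\<^bsub>N\<^esub>}" and gs: "g ` carrier M = carrier N"
    using ex by (auto simp: short_exact_def)
  interpret TL: tensor_product R P L by (intro tensor_product.intro P L)
  interpret TM: tensor_product R P M by (intro tensor_product.intro P M)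
  interpret TN: tensor_product R P N by (intro tensor_product.intro P N)
  interpret tm: module R "tensor R P M" by (rule TM.tensor_module)
  interpret tn: module R "tensor R P N" by (rule TN.tensor_module)
  note fh = tensor_map_hom[OF P P L M mod_hom_id f] and gh = tensor_map_hom[OF P P M N mod_hom_id g]
  interpret LF: linear_map R "tensor R P L" "tensor R P M" "tensor_map R P M id f"
    by (intro linear_mapI fh TL.tensor_module TM.tensor_module)
  interpret LG: linear_map R "tensor R P M" "tensor R P N" "tensor_map R P N id g"
    by (intro linear_mapI gh TN.tensor_module TM.tensor_module)
  let ?T = "tensor R P M"
  let ?S = "tensor_map R P M id f ` carrier (tensor R P L)"
  have S: "submodule ?S R (tensor R P M)" by (rule LF.image_submodule)
  interpret g: linear_map R M N g by (intro linear_mapI M N g)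
  define \<sigma> where "\<sigma> n = (SOME m. m \<in> carrier M \<and> g m = n)" for n
  have \<sigma>: "\<sigma> n \<in> carrier M" "g (\<sigma> n) = n" if "n \<in> carrier N" for n
  proof -
    have "\<exists>m. m \<in> carrier M \<and> g m = n" using gs that by (metis image_iff)
    then show "\<sigma> n \<in> carrier M" "g (\<sigma> n) = n" unfolding \<sigma>_def by (metis (mono_tags, lifting) someI_ex)+
  qed
  have kerS: "TM.pt p m \<in> ?S" if "p \<in> carrier P" "m \<in> carrier M" "g m = \<zero>\<^bsub>N\<^esub>" for p m
  proof -
    have "m \<in> f ` carrier L" unfolding fg using that by simp
    then obtain l where "l \<in> carrier L" "m = f l" by blast
    then have "TM.pt p m = tensor_map R P M id f (TL.pt p l)" "TL.pt p l \<in> carrier (tensor R P L)"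
      using that fh(2)[of p l] TL.pt_closed[of p l] by simp_all
    then show ?thesis by (rule image_eqI)
  qed
  show ?surj
  proof (intro equalityI subsetI)
    fix x assume x: "x \<in> carrier (tensor R P N)"
    show "x \<in> tensor_map R P N id g ` carrier (tensor R P M)"
    proof (rule TN.tensor_generated[OF LG.image_submodule _ x])
      show "TN.pt p n \<in> tensor_map R P N id g ` carrier (tensor R P M)" if "p \<in> carrier P" "n \<in> carrier N" for p n
        using gh(2)[of p "\<sigma> n"] \<sigma> that by (intro image_eqI[of _ _ "TM.pt p (\<sigma> n)"] TM.pt_closed) simp_all
    qed
  qed (use LG.closed in auto)
  show ?exact
  proof (intro equalityI subsetI)
    fix x assume "x \<in> ?S"
    then obtain y where y: "y \<in> carrier (tensor R P L)" "x = tensor_map R P M id f y" by blast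
    have "y \<in> {y \<in> carrier (tensor R P L). tensor_map R P M id f y
      \<in> {x \<in> carrier (tensor R P M). tensor_map R P N id g x = \<zero>\<^bsub>tensor R P N\<^esub>}}"
    proof (rule TL.tensor_generated[OF LF.preimage_submodule[OF LG.kernel_submodule] _ y(1)])
      fix p l assume p: "p \<in> carrier P" and l: "l \<in> carrier L"
      have "f l \<in> carrier M" "g (f l) = \<zero>\<^bsub>N\<^esub>" using fg l by auto
      then show "TL.pt p l \<in> {y \<in> carrier (tensor R P L). tensor_map R P M id f y
          \<in> {x \<in> carrier (tensor R P M). tensor_map R P N id g x = \<zero>\<^bsub>tensor R P N\<^esub>}}"
        using fh(2)[OF p l] gh(2)[OF p] p l by (simp add: TL.pt_closed TM.pt_closed TN.pt_zero_r)
    qed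
    then show "x \<in> {x \<in> carrier (tensor R P M). tensor_map R P N id g x = \<zero>\<^bsub>tensor R P N\<^esub>}" using y(2) by simp
  next
    fix x assume "x \<in> {x \<in> carrier (tensor R P M). tensor_map R P N id g x = \<zero>\<^bsub>tensor R P N\<^esub>}"
    then have xc: "x \<in> carrier (tensor R P M)" and gx: "tensor_map R P N id g x = \<zero>\<^bsub>tensor R P N\<^esub>" by auto
    obtain k p n where x: "\<And>i. i < k \<Longrightarrow> p i \<in> carrier P" "\<And>i. i < k \<Longrightarrow> n i \<in> carrier M"
       "x = (\<Oplus>\<^bsub>?T\<^esub>i\<in>{..<k::nat}. TM.pt (p i) (n i))" using xc by (rule TM.tensor_elem) auto
    have gz: "(\<Oplus>\<^bsub>tensor R P N\<^esub>i\<in>{..<k}. TN.pt (id (p i)) (g (n i))) = \<zero>\<^bsub>tensor R P N\<^esub>"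
      using gx tensor_map_sum[OF P P M N mod_hom_id g, of "{..<k}" p n] x by auto
    have gn: "g (n i) \<in> carrier N" if "i < k" for i using x g.closed that by auto
    have r0: "y \<ominus>\<^bsub>?T\<^esub> y \<in> ?S" if "y \<in> carrier (tensor R P M)" for y
      using tm.submodule_zero[OF S] that by (simp only: a_minus_def tm.M.r_neg)
    have sum: "(\<Oplus>\<^bsub>?T\<^esub>i\<in>{..<k}. TM.pt (p i) (\<sigma> (g (n i)))) \<in> ?S"
    proof (rule TN.tensor_universal[OF TM.tensor_module S, where \<beta> = "\<lambda>p n. TM.pt p (\<sigma> n)" and p = p])
      fix m n n' assume a: "m \<in> carrier P" "n \<in> carrier N" "n' \<in> carrier N"
      have "TM.pt m (\<sigma> (n \<oplus>\<^bsub>N\<^esub> n')) \<ominus>\<^bsub>?T\<^esub> (TM.pt m (\<sigma> n) \<oplus>\<^bsub>?T\<^esub> TM.pt m (\<sigma> n'))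
        = TM.pt m (\<sigma> (n \<oplus>\<^bsub>N\<^esub> n') \<ominus>\<^bsub>M\<^esub> (\<sigma> n \<oplus>\<^bsub>M\<^esub> \<sigma> n'))"
        using a \<sigma> by (simp add: TM.pt_diff_r TM.pt_add_r)
      also have "\<dots> \<in> ?S"
        using a \<sigma> by (intro kerS) (simp_all add: g.diff g.add, simp add: TN.N.M.r_neg a_minus_def)
      finally show "TM.pt m (\<sigma> (n \<oplus>\<^bsub>N\<^esub> n')) \<ominus>\<^bsub>?T\<^esub> (TM.pt m (\<sigma> n) \<oplus>\<^bsub>?T\<^esub> TM.pt m (\<sigma> n')) \<in> ?S" .
    next
      fix a m n assume a: "a \<in> carrier R" "m \<in> carrier P" "n \<in> carrier N"
      have "TM.pt m (\<sigma> (a \<odot>\<^bsub>N\<^esub> n)) \<ominus>\<^bsub>?T\<^esub> (a \<odot>\<^bsub>?T\<^esub> TM.pt m (\<sigma> n))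
        = TM.pt m (\<sigma> (a \<odot>\<^bsub>N\<^esub> n) \<ominus>\<^bsub>M\<^esub> (a \<odot>\<^bsub>M\<^esub> \<sigma> n))"
        using a \<sigma> by (simp add: TM.pt_diff_r TM.pt_smult_r)
      also have "\<dots> \<in> ?S"
        using a \<sigma> by (intro kerS) (simp_all add: g.diff g.smult, simp add: TN.N.M.r_neg a_minus_def)
      finally show "TM.pt m (\<sigma> (a \<odot>\<^bsub>N\<^esub> n)) \<ominus>\<^bsub>?T\<^esub> (a \<odot>\<^bsub>?T\<^esub> TM.pt m (\<sigma> n)) \<in> ?S" .
    qed (use \<sigma> x gn gz in
        \<open>simp_all add: TM.pt_closed TM.pt_add_l TM.pt_smult_l r0 tm.M.a_closed tm.smult_closed\<close>)
    have "x \<ominus>\<^bsub>?T\<^esub> (\<Oplus>\<^bsub>?T\<^esub>i\<in>{..<k}. TM.pt (p i) (\<sigma> (g (n i))))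
        = (\<Oplus>\<^bsub>?T\<^esub>i\<in>{..<k}. TM.pt (p i) (n i) \<ominus>\<^bsub>?T\<^esub> TM.pt (p i) (\<sigma> (g (n i))))"
      unfolding x(3) using x \<sigma> gn by (intro tm.finsum_diff[symmetric]) (auto intro!: TM.pt_closed)
    also have "\<dots> \<in> ?S"
    proof (rule tm.submodule_finsum[OF S])
      fix i assume "i \<in> {..<k}"
      then have i: "p i \<in> carrier P" "n i \<in> carrier M" "\<sigma> (g (n i)) \<in> carrier M" "g (\<sigma> (g (n i))) = g (n i)"
        using x gn \<sigma> by auto
      have "TM.pt (p i) (n i \<ominus>\<^bsub>M\<^esub> \<sigma> (g (n i))) \<in> ?S"
        using i by (intro kerS) (simp_all add: g.diff, simp add: a_minus_def TN.N.M.r_neg g.closed)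
      then show "TM.pt (p i) (n i) \<ominus>\<^bsub>?T\<^esub> TM.pt (p i) (\<sigma> (g (n i))) \<in> ?S"
        using i by (simp add: TM.pt_diff_r)
    qed simp
    finally have d: "x \<ominus>\<^bsub>?T\<^esub> (\<Oplus>\<^bsub>?T\<^esub>i\<in>{..<k}. TM.pt (p i) (\<sigma> (g (n i)))) \<in> ?S" .
    show "x \<in> ?S" by (rule tm.submodule_diff_cancel[OF S d sum xc])
  qed
qed

section \<open>The equational criterion for flatness\<close>

text \<open>
  The submodule of the functions from \<open>X\<close> to \<open>M\<close> generated by the functions \<open>t \<mapsto> c t \<cdot> y\<close> with
  \<open>c \<in> S\<close>, that is, the image of \<open>S \<otimes> M\<close>, and the submodule \<open>J M\<close>. Closure under scalars is a
  consequence, because scalars can be moved into the factors from \<open>M\<close>.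
\<close>

inductive_set lspan :: "('a, 'm, 's) module_scheme \<Rightarrow> ('x \<Rightarrow> 'a) set \<Rightarrow> ('x \<Rightarrow> 'm) set"
  for M :: "('a, 'm, 's) module_scheme" and S :: "('x \<Rightarrow> 'a) set" where
  zero: "(\<lambda>_. \<zero>\<^bsub>M\<^esub>) \<in> lspan M S"
| step: "x \<in> lspan M S \<Longrightarrow> c \<in> S \<Longrightarrow> y \<in> carrier M \<Longrightarrow> (\<lambda>t. x t \<oplus>\<^bsub>M\<^esub> c t \<odot>\<^bsub>M\<^esub> y) \<in> lspan M S"

inductive_set ismult :: "('a, 'm, 's) module_scheme \<Rightarrow> 'a set \<Rightarrow> 'm set"
  for M :: "('a, 'm, 's) module_scheme" and J :: "'a set" where
  zero: "\<zero>\<^bsub>M\<^esub> \<in> ismult M J"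
| step: "x \<in> ismult M J \<Longrightarrow> r \<in> J \<Longrightarrow> y \<in> carrier M \<Longrightarrow> x \<oplus>\<^bsub>M\<^esub> r \<odot>\<^bsub>M\<^esub> y \<in> ismult M J"

lemma lspan_mono: "S \<subseteq> S' \<Longrightarrow> lspan M S \<subseteq> lspan M S'"
proof
  fix x assume S: "S \<subseteq> S'" and "x \<in> lspan M S"
  from this(2) show "x \<in> lspan M S'" by induct (use S in \<open>auto intro: lspan.intros\<close>)
qed

lemma ismult_mono: "J \<subseteq> J' \<Longrightarrow> ismult M J \<subseteq> ismult M J'"
proof
  fix x assume J: "J \<subseteq> J'" and "x \<in> ismult M J"
  from this(2) show "x \<in> ismult M J'" by induct (use J in \<open>auto intro: ismult.intros\<close>)
qed

context module begin

lemma lspan_fin_supp: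
  assumes "S \<subseteq> fin_supp X (self_module R)" "x \<in> lspan M S"
  shows "x \<in> fin_supp X M"
  using assms(2)
proof induct
  case (step x c y)
  then show ?case using assms(1) by (intro fin_supp_add fin_supp_lmult) auto
qed (rule fin_supp_zero)

lemma lspan_gen:
  assumes "S \<subseteq> fin_supp X (self_module R)" "c \<in> S" "y \<in> carrier M"
  shows "(\<lambda>t. c t \<odot>\<^bsub>M\<^esub> y) \<in> lspan M S"
proof -
  have "c t \<in> carrier R" for t using fin_suppD(1)[of c X "self_module R"] assms by auto
  then show ?thesis using lspan.step[OF lspan.zero assms(2,3)] assms(3) by simp
qed

lemma lspan_add:
  assumes S: "S \<subseteq> fin_supp X (self_module R)" and x: "x \<in> lspan M S" and y: "y \<in> lspan M S"
  shows "(\<lambda>t. x t \<oplus>\<^bsub>M\<^esub> y t) \<in> lspan M S"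
  using y
proof induct
  case zero
  then show ?case using x fin_suppD(1)[OF lspan_fin_supp[OF S x]] by simp
next
  case (step z c w)
  have "c t \<in> carrier R" for t using fin_suppD(1)[of c X "self_module R"] step S by auto
  then have "(\<lambda>t. x t \<oplus>\<^bsub>M\<^esub> (z t \<oplus>\<^bsub>M\<^esub> c t \<odot>\<^bsub>M\<^esub> w)) = (\<lambda>t. (x t \<oplus>\<^bsub>M\<^esub> z t) \<oplus>\<^bsub>M\<^esub> c t \<odot>\<^bsub>M\<^esub> w)"
    using fin_suppD(1)[OF lspan_fin_supp[OF S x]] fin_suppD(1)[OF lspan_fin_supp[OF S step(1)]] step(4)
    by (simp add: M.a_assoc)
  then show ?case using lspan.step[OF step(2,3,4)] by simp
qed

lemma lspan_smult:
  assumes S: "S \<subseteq> fin_supp X (self_module R)" and x: "x \<in> lspan M S" and a: "a \<in> carrier R"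
  shows "(\<lambda>t. a \<odot>\<^bsub>M\<^esub> x t) \<in> lspan M S"
  using x
proof induct
  case zero
  then show ?case using a lspan.zero[of M S] by simp
next
  case (step z c w)
  have c: "c t \<in> carrier R" for t using fin_suppD(1)[of c X "self_module R"] step S by auto
  have "a \<odot>\<^bsub>M\<^esub> (c t \<odot>\<^bsub>M\<^esub> w) = c t \<odot>\<^bsub>M\<^esub> (a \<odot>\<^bsub>M\<^esub> w)" for t
    using a c step(4) by (simp add: smult_assoc1[symmetric] R.m_comm)
  then have "(\<lambda>t. a \<odot>\<^bsub>M\<^esub> (z t \<oplus>\<^bsub>M\<^esub> c t \<odot>\<^bsub>M\<^esub> w)) = (\<lambda>t. a \<odot>\<^bsub>M\<^esub> z t \<oplus>\<^bsub>M\<^esub> c t \<odot>\<^bsub>M\<^esub> (a \<odot>\<^bsub>M\<^esub> w))"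
    using fin_suppD(1)[OF lspan_fin_supp[OF S step(1)]] step(4) c a by (simp add: smult_r_distr)
  then show ?case using lspan.step[OF step(2,3), of "a \<odot>\<^bsub>M\<^esub> w"] step(4) a by simp
qed

lemma lspan_submodule:
  assumes S: "S \<subseteq> fin_supp X (self_module R)"
  shows "submodule (lspan M S) R (fun_module X M)"
proof -
  interpret F: module R "fun_module X M" by (rule fun_module)
  show ?thesis
  proof (rule F.submoduleI)
    fix a assume a: "a \<in> lspan M S"
    have "(\<lambda>t. (\<ominus> \<one>) \<odot>\<^bsub>M\<^esub> a t) \<in> lspan M S" by (rule lspan_smult[OF S a]) simp
    moreover have "(\<ominus> \<one>) \<odot>\<^bsub>M\<^esub> a t = \<ominus>\<^bsub>M\<^esub> a t" for t
      using fin_suppD(1)[OF lspan_fin_supp[OF S a]] by (simp add: smult_l_minus)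
    ultimately show "\<ominus>\<^bsub>fun_module X M\<^esub> a \<in> lspan M S"
      using lspan_fin_supp[OF S a] by (simp add: fun_module_inv)
  qed (use lspan_fin_supp[OF S] in \<open>auto intro: lspan.zero lspan_add[OF S] lspan_smult[OF S]\<close>)
qed

lemma lspan_finite:
  assumes S: "S \<subseteq> fin_supp X (self_module R)" and x: "x \<in> lspan M S"
  obtains k :: nat and c v where "\<And>s. s < k \<Longrightarrow> c s \<in> S" "\<And>s. s < k \<Longrightarrow> v s \<in> carrier M"
    "x = (\<lambda>t. \<Oplus>\<^bsub>M\<^esub>s\<in>{..<k}. c s t \<odot>\<^bsub>M\<^esub> v s)"
proof -
  have "\<exists>(k::nat) c v. (\<forall>s<k. c s \<in> S) \<and> (\<forall>s<k. v s \<in> carrier M)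
    \<and> x = (\<lambda>t. \<Oplus>\<^bsub>M\<^esub>s\<in>{..<k}. c s t \<odot>\<^bsub>M\<^esub> v s)"
    using x
  proof induct
    case zero
    show ?case by (rule exI[of _ 0]) simp
  next
    case (step z d w)
    then obtain k :: nat and c v where *: "\<forall>s<k. c s \<in> S" "\<forall>s<k. v s \<in> carrier M"
      "z = (\<lambda>t. \<Oplus>\<^bsub>M\<^esub>s\<in>{..<k}. c s t \<odot>\<^bsub>M\<^esub> v s)" by blast
    have cR: "d t \<in> carrier R" if "d \<in> S" for d t using fin_suppD(1)[of d X "self_module R"] that S by auto
    have "(\<Oplus>\<^bsub>M\<^esub>s\<in>{..<Suc k}. (c(k := d)) s t \<odot>\<^bsub>M\<^esub> (v(k := w)) s)
        = (\<Oplus>\<^bsub>M\<^esub>s\<in>{..<k}. c s t \<odot>\<^bsub>M\<^esub> v s) \<oplus>\<^bsub>M\<^esub> d t \<odot>\<^bsub>M\<^esub> w" for t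
    proof -
      have "(\<Oplus>\<^bsub>M\<^esub>s\<in>{..<k}. (c(k := d)) s t \<odot>\<^bsub>M\<^esub> (v(k := w)) s) = (\<Oplus>\<^bsub>M\<^esub>s\<in>{..<k}. c s t \<odot>\<^bsub>M\<^esub> v s)"
        using * cR by (intro M.finsum_cong') auto
      moreover have "(\<Oplus>\<^bsub>M\<^esub>s\<in>{..<Suc k}. (c(k := d)) s t \<odot>\<^bsub>M\<^esub> (v(k := w)) s)
        = (c(k := d)) k t \<odot>\<^bsub>M\<^esub> (v(k := w)) k \<oplus>\<^bsub>M\<^esub> (\<Oplus>\<^bsub>M\<^esub>s\<in>{..<k}. (c(k := d)) s t \<odot>\<^bsub>M\<^esub> (v(k := w)) s)"
        unfolding lessThan_Suc using * cR step by (intro M.finsum_insert) auto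
      moreover have "(\<Oplus>\<^bsub>M\<^esub>s\<in>{..<k}. c s t \<odot>\<^bsub>M\<^esub> v s) \<in> carrier M"
        using * cR by (intro M.finsum_closed) auto
      ultimately show ?thesis using step cR by (simp add: M.a_comm)
    qed
    then show ?case using * step
      by (intro exI[of _ "Suc k"] exI[of _ "c(k := d)"] exI[of _ "v(k := w)"]) auto
  qed
  then show ?thesis using that by blast
qed

lemma lspan_image:
  assumes S: "S \<subseteq> fin_supp X (self_module R)" and Q: "module R Q"
    and h: "h \<in> mod_hom R (fun_module X M) Q" and H: "submodule H R Q"
    and gen: "\<And>c y. c \<in> S \<Longrightarrow> y \<in> carrier M \<Longrightarrow> h (\<lambda>t. c t \<odot>\<^bsub>M\<^esub> y) \<in> H"
    and x: "x \<in> lspan M S"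
  shows "h x \<in> H"
proof -
  interpret h: linear_map R "fun_module X M" Q h
    by (intro linear_mapI fun_module Q h)
  show ?thesis using x
  proof induct
    case zero
    show ?case using h.zero h.N.submodule_zero[OF H] by simp
  next
    case (step x c y)
    have "c \<in> fin_supp X (self_module R)" using step S by auto
    then have cy: "(\<lambda>t. c t \<odot>\<^bsub>M\<^esub> y) \<in> fin_supp X M" using step(4) by (rule fin_supp_lmult)
    have "h (\<lambda>t. x t \<oplus>\<^bsub>M\<^esub> c t \<odot>\<^bsub>M\<^esub> y) = h x \<oplus>\<^bsub>Q\<^esub> h (\<lambda>t. c t \<odot>\<^bsub>M\<^esub> y)"
      using h.add[of x "\<lambda>t. c t \<odot>\<^bsub>M\<^esub> y"] lspan_fin_supp[OF S step(1)] cy by simp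
    then show ?case using step gen h.N.submoduleE(5)[OF H] by simp
  qed
qed

lemma ismult_closed:
  assumes "ideal J R" "x \<in> ismult M J" shows "x \<in> carrier M"
  using assms(2) by induct (auto simp: ideal.Icarr[OF assms(1)])

lemma ismult_gen: "ideal J R \<Longrightarrow> r \<in> J \<Longrightarrow> y \<in> carrier M \<Longrightarrow> r \<odot>\<^bsub>M\<^esub> y \<in> ismult M J"
  using ismult.step[OF ismult.zero, of r J y M] by (simp add: ideal.Icarr)

lemma ismult_add:
  assumes J: "ideal J R" and x: "x \<in> ismult M J" and y: "y \<in> ismult M J"
  shows "x \<oplus>\<^bsub>M\<^esub> y \<in> ismult M J"
  using y
proof induct
  case zero
  then show ?case using x ismult_closed[OF J x] by simp
next
  case (step z r w)
  then have "x \<oplus>\<^bsub>M\<^esub> (z \<oplus>\<^bsub>M\<^esub> r \<odot>\<^bsub>M\<^esub> w) = (x \<oplus>\<^bsub>M\<^esub> z) \<oplus>\<^bsub>M\<^esub> r \<odot>\<^bsub>M\<^esub> w"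
    using ismult_closed[OF J] x ideal.Icarr[OF J] by (simp add: M.a_assoc)
  then show ?case using ismult.step[OF step(2,3,4)] by simp
qed

lemma ismult_smult:
  assumes J: "ideal J R" and x: "x \<in> ismult M J" and a: "a \<in> carrier R"
  shows "a \<odot>\<^bsub>M\<^esub> x \<in> ismult M J"
  using x
proof induct
  case zero
  then show ?case using a ismult.zero[of M J] by simp
next
  case (step z r w)
  then have "a \<odot>\<^bsub>M\<^esub> (z \<oplus>\<^bsub>M\<^esub> r \<odot>\<^bsub>M\<^esub> w) = a \<odot>\<^bsub>M\<^esub> z \<oplus>\<^bsub>M\<^esub> (a \<otimes> r) \<odot>\<^bsub>M\<^esub> w"
    using ismult_closed[OF J] a ideal.Icarr[OF J] by (simp add: smult_r_distr smult_assoc1)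
  then show ?case using ismult.step[OF step(2) ideal.I_l_closed[OF J step(3) a] step(4)] by simp
qed

lemma ismult_submodule:
  assumes J: "ideal J R" shows "submodule (ismult M J) R M"
proof (rule submoduleI)
  fix a assume a: "a \<in> ismult M J"
  have "(\<ominus> \<one>) \<odot>\<^bsub>M\<^esub> a \<in> ismult M J" by (rule ismult_smult[OF J a]) simp
  then show "\<ominus>\<^bsub>M\<^esub> a \<in> ismult M J" using ismult_closed[OF J a] by (simp add: smult_l_minus)
qed (use ismult_closed[OF J] in \<open>auto intro: ismult.zero ismult_add[OF J] ismult_smult[OF J]\<close>)

lemma ismult_image:
  assumes J: "ideal J R" and Q: "module R Q" and h: "h \<in> mod_hom R M Q" and H: "submodule H R Q"
    and gen: "\<And>r y. r \<in> J \<Longrightarrow> y \<in> carrier M \<Longrightarrow> h (r \<odot>\<^bsub>M\<^esub> y) \<in> H"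
    and x: "x \<in> ismult M J"
  shows "h x \<in> H"
proof -
  interpret h: linear_map R M Q h
    by (intro linear_mapI module_axioms Q h)
  show ?thesis using x
  proof induct
    case zero
    show ?case using h.zero h.N.submodule_zero[OF H] by simp
  next
    case (step x r y)
    then show ?case
      using gen h.N.submoduleE(5)[OF H] ismult_closed[OF J step(1)] ideal.Icarr[OF J] by (simp add: h.add)
  qed
qed

lemma matrix_assoc:
  assumes "finite S" "finite T" "\<And>t. t \<in> T \<Longrightarrow> g t \<in> carrier R"
    "\<And>s t. s \<in> S \<Longrightarrow> t \<in> T \<Longrightarrow> c s t \<in> carrier R" "\<And>s. s \<in> S \<Longrightarrow> v s \<in> carrier M"
  shows "(\<Oplus>\<^bsub>M\<^esub>t\<in>T. g t \<odot>\<^bsub>M\<^esub> (\<Oplus>\<^bsub>M\<^esub>s\<in>S. c s t \<odot>\<^bsub>M\<^esub> v s))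
    = (\<Oplus>\<^bsub>M\<^esub>s\<in>S. (\<Oplus>t\<in>T. g t \<otimes> c s t) \<odot>\<^bsub>M\<^esub> v s)"
proof -
  have "(\<Oplus>\<^bsub>M\<^esub>t\<in>T. g t \<odot>\<^bsub>M\<^esub> (\<Oplus>\<^bsub>M\<^esub>s\<in>S. c s t \<odot>\<^bsub>M\<^esub> v s))
      = (\<Oplus>\<^bsub>M\<^esub>t\<in>T. \<Oplus>\<^bsub>M\<^esub>s\<in>S. (g t \<otimes> c s t) \<odot>\<^bsub>M\<^esub> v s)"
  proof (rule M.finsum_cong')
    fix t assume t: "t \<in> T"
    have "g t \<odot>\<^bsub>M\<^esub> (\<Oplus>\<^bsub>M\<^esub>s\<in>S. c s t \<odot>\<^bsub>M\<^esub> v s) = (\<Oplus>\<^bsub>M\<^esub>s\<in>S. g t \<odot>\<^bsub>M\<^esub> (c s t \<odot>\<^bsub>M\<^esub> v s))"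
      using assms t by (intro finsum_smult_ldistr) auto
    also have "\<dots> = (\<Oplus>\<^bsub>M\<^esub>s\<in>S. (g t \<otimes> c s t) \<odot>\<^bsub>M\<^esub> v s)"
      using assms t by (intro M.finsum_cong') (auto simp: smult_assoc1)
    finally show "g t \<odot>\<^bsub>M\<^esub> (\<Oplus>\<^bsub>M\<^esub>s\<in>S. c s t \<odot>\<^bsub>M\<^esub> v s) = (\<Oplus>\<^bsub>M\<^esub>s\<in>S. (g t \<otimes> c s t) \<odot>\<^bsub>M\<^esub> v s)" .
  qed (use assms in \<open>auto intro!: M.finsum_closed\<close>)
  also have "\<dots> = (\<Oplus>\<^bsub>M\<^esub>s\<in>S. \<Oplus>\<^bsub>M\<^esub>t\<in>T. (g t \<otimes> c s t) \<odot>\<^bsub>M\<^esub> v s)"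
    using assms by (intro finsum_swap) auto
  also have "\<dots> = (\<Oplus>\<^bsub>M\<^esub>s\<in>S. (\<Oplus>t\<in>T. g t \<otimes> c s t) \<odot>\<^bsub>M\<^esub> v s)"
    using assms by (intro M.finsum_cong' finsum_smult_rdistr[symmetric])
      (auto intro!: M.finsum_closed R.finsum_closed)
  finally show ?thesis .
qed

lemma fun_module_expand:
  assumes T: "finite T" and q: "q \<in> fin_supp T M"
  shows "(\<Oplus>\<^bsub>fun_module T M\<^esub>t\<in>T. (\<lambda>x. basis_vec R t x \<odot>\<^bsub>M\<^esub> q t)) = q"
proof -
  have qt: "q t \<in> carrier M" for t by (rule fin_suppD(1)[OF q])
  have "(\<Oplus>\<^bsub>fun_module T M\<^esub>t\<in>T. (\<lambda>x. basis_vec R t x \<odot>\<^bsub>M\<^esub> q t))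
      = (\<lambda>x. \<Oplus>\<^bsub>M\<^esub>t\<in>T. basis_vec R t x \<odot>\<^bsub>M\<^esub> q t)"
    by (rule fun_module_finsum[OF T]) (auto intro!: fin_supp_lmult R.basis_vec_fin_supp qt)
  also have "\<dots> = q"
  proof
    fix x
    have "(\<Oplus>\<^bsub>M\<^esub>t\<in>T. basis_vec R t x \<odot>\<^bsub>M\<^esub> q t) = (\<Oplus>\<^bsub>M\<^esub>t\<in>T. if t = x then q x else \<zero>\<^bsub>M\<^esub>)"
      using qt by (intro M.finsum_cong') (auto simp: basis_vec_def)
    also have "\<dots> = q x"
    proof (cases "x \<in> T")
      case True
      then show ?thesis using finsum_single[OF T _ qt] by simp
    next
      case False
      then have "(\<Oplus>\<^bsub>M\<^esub>t\<in>T. if t = x then q x else \<zero>\<^bsub>M\<^esub>) = (\<Oplus>\<^bsub>M\<^esub>t\<in>T. \<zero>\<^bsub>M\<^esub>)"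
        by (intro M.finsum_cong') auto
      then show ?thesis using fin_suppD(2)[OF q False] by simp
    qed
    finally show "(\<Oplus>\<^bsub>M\<^esub>t\<in>T. basis_vec R t x \<odot>\<^bsub>M\<^esub> q t) = q x" .
  qed
  finally show ?thesis .
qed

lemma matrix_hom:
  assumes "finite S" "\<And>s. s \<in> S \<Longrightarrow> c s \<in> fin_supp X (self_module R)"
  shows "(\<lambda>v t. \<Oplus>\<^bsub>M\<^esub>s\<in>S. c s t \<odot>\<^bsub>M\<^esub> v s) \<in> mod_hom R (fun_module S M) (fun_module X M)"
proof (rule mod_homI)
  have cR: "c s t \<in> carrier R" if "s \<in> S" for s t using fin_suppD(1)[OF assms(2)[OF that], of t] by simp
  fix v assume "v \<in> carrier (fun_module S M)"
  then have v: "v \<in> fin_supp S M" by simp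
  show "(\<lambda>t. \<Oplus>\<^bsub>M\<^esub>s\<in>S. c s t \<odot>\<^bsub>M\<^esub> v s) \<in> carrier (fun_module X M)"
    using assms fin_suppD(1)[OF v] by (simp add: fin_supp_finsum fin_supp_lmult)
  { fix w assume "w \<in> carrier (fun_module S M)"
    then have w: "w \<in> fin_supp S M" by simp
    show "(\<lambda>t. \<Oplus>\<^bsub>M\<^esub>s\<in>S. c s t \<odot>\<^bsub>M\<^esub> (v \<oplus>\<^bsub>fun_module S M\<^esub> w) s) =
      (\<lambda>t. \<Oplus>\<^bsub>M\<^esub>s\<in>S. c s t \<odot>\<^bsub>M\<^esub> v s) \<oplus>\<^bsub>fun_module X M\<^esub> (\<lambda>t. \<Oplus>\<^bsub>M\<^esub>s\<in>S. c s t \<odot>\<^bsub>M\<^esub> w s)"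
      unfolding fun_module_simps
    proof
      fix t
      have "(\<Oplus>\<^bsub>M\<^esub>s\<in>S. c s t \<odot>\<^bsub>M\<^esub> (v s \<oplus>\<^bsub>M\<^esub> w s)) = (\<Oplus>\<^bsub>M\<^esub>s\<in>S. c s t \<odot>\<^bsub>M\<^esub> v s \<oplus>\<^bsub>M\<^esub> c s t \<odot>\<^bsub>M\<^esub> w s)"
        using cR fin_suppD(1)[OF v] fin_suppD(1)[OF w] by (intro M.finsum_cong') (auto simp: smult_r_distr)
      also have "\<dots> = (\<Oplus>\<^bsub>M\<^esub>s\<in>S. c s t \<odot>\<^bsub>M\<^esub> v s) \<oplus>\<^bsub>M\<^esub> (\<Oplus>\<^bsub>M\<^esub>s\<in>S. c s t \<odot>\<^bsub>M\<^esub> w s)"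
        using cR fin_suppD(1)[OF v] fin_suppD(1)[OF w] by (intro M.finsum_addf) auto
      finally show "(\<Oplus>\<^bsub>M\<^esub>s\<in>S. c s t \<odot>\<^bsub>M\<^esub> (v s \<oplus>\<^bsub>M\<^esub> w s))
        = (\<Oplus>\<^bsub>M\<^esub>s\<in>S. c s t \<odot>\<^bsub>M\<^esub> v s) \<oplus>\<^bsub>M\<^esub> (\<Oplus>\<^bsub>M\<^esub>s\<in>S. c s t \<odot>\<^bsub>M\<^esub> w s)" .
    qed }
  fix a assume a: "a \<in> carrier R"
  show "(\<lambda>t. \<Oplus>\<^bsub>M\<^esub>s\<in>S. c s t \<odot>\<^bsub>M\<^esub> (a \<odot>\<^bsub>fun_module S M\<^esub> v) s) =
      a \<odot>\<^bsub>fun_module X M\<^esub> (\<lambda>t. \<Oplus>\<^bsub>M\<^esub>s\<in>S. c s t \<odot>\<^bsub>M\<^esub> v s)"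
    unfolding fun_module_simps
  proof
    fix t
    have "(\<Oplus>\<^bsub>M\<^esub>s\<in>S. c s t \<odot>\<^bsub>M\<^esub> (a \<odot>\<^bsub>M\<^esub> v s)) = (\<Oplus>\<^bsub>M\<^esub>s\<in>S. a \<odot>\<^bsub>M\<^esub> (c s t \<odot>\<^bsub>M\<^esub> v s))"
      using cR fin_suppD(1)[OF v] a
      by (intro M.finsum_cong') (auto simp: smult_assoc1[symmetric] R.m_comm)
    also have "\<dots> = a \<odot>\<^bsub>M\<^esub> (\<Oplus>\<^bsub>M\<^esub>s\<in>S. c s t \<odot>\<^bsub>M\<^esub> v s)"
      using cR fin_suppD(1)[OF v] a assms(1) by (intro finsum_smult_ldistr[symmetric]) auto
    finally show "(\<Oplus>\<^bsub>M\<^esub>s\<in>S. c s t \<odot>\<^bsub>M\<^esub> (a \<odot>\<^bsub>M\<^esub> v s)) = a \<odot>\<^bsub>M\<^esub> (\<Oplus>\<^bsub>M\<^esub>s\<in>S. c s t \<odot>\<^bsub>M\<^esub> v s)" .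
  qed
qed

end

text \<open>
  The equational criterion for flatness of \<open>Q / c Q\<close> over \<open>R / c\<close>, without forming the
  quotients: a relation \<open>\<Sum> r\<^sub>i q\<^sub>i \<in> c Q\<close> holds only if \<open>q\<close> is a combination, with coefficients
  in \<open>Q\<close>, of vectors over \<open>R\<close> that satisfy the relation modulo \<open>c\<close>.
\<close>

definition flat_eq :: "('a, 'r) ring_scheme \<Rightarrow> ('a, 'm, 's) module_scheme \<Rightarrow> 'a set \<Rightarrow> bool"
  where "flat_eq R Q c \<longleftrightarrow> (\<forall>(k::nat) r q. (\<forall>i<k. r i \<in> carrier R) \<longrightarrow> q \<in> fin_supp {..<k} Q \<longrightarrow>
    (\<Oplus>\<^bsub>Q\<^esub>i\<in>{..<k}. r i \<odot>\<^bsub>Q\<^esub> q i) \<in> ismult Q c \<longrightarrow>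
    q \<in> lspan Q {b \<in> fin_supp {..<k} (self_module R). (\<Oplus>\<^bsub>R\<^esub>i\<in>{..<k}. r i \<otimes>\<^bsub>R\<^esub> b i) \<in> c})"

context module begin

text \<open>
  The equations can be solved one at a time: the coefficients of a combination that solves the
  earlier equations satisfy one relation, and the criterion for this relation yields a combination
  that also solves the next equation.
\<close>

lemma flat_eq_matrix:
  assumes flat: "flat_eq R M c" and c: "ideal c R" and T: "finite (T :: 'x set)"
    and g: "\<And>t. t \<in> T \<Longrightarrow> g t \<in> fin_supp Y (self_module R)"
    and q: "q \<in> fin_supp T M"
    and rel: "\<And>y. y \<in> Y \<Longrightarrow> (\<Oplus>\<^bsub>M\<^esub>t\<in>T. g t y \<odot>\<^bsub>M\<^esub> q t) \<in> ismult M c"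
  shows "q \<in> lspan M {b \<in> fin_supp T (self_module R). \<forall>y. (\<Oplus>t\<in>T. g t y \<otimes> b t) \<in> c}"
proof -
  interpret A: module R "self_module R" by (rule self_module[OF R.is_cring])
  interpret c: ideal c R by fact
  define W where "W Y0 = {b \<in> fin_supp T (self_module R). \<forall>y\<in>Y0. (\<Oplus>t\<in>T. g t y \<otimes> b t) \<in> c}" for Y0
  have W: "W Y0 \<subseteq> fin_supp T (self_module R)" for Y0 by (auto simp: W_def)
  have gR: "g t y \<in> carrier R" if "t \<in> T" for t y using fin_suppD(1)[OF g[OF that]] by simp
  have "q \<in> lspan M (W Y0)" if "finite Y0" "Y0 \<subseteq> Y" for Y0
    using that
  proof induct
    case empty
    have qt: "q t \<in> carrier M" for t by (rule fin_suppD(1)[OF q])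
    have "(\<Oplus>\<^bsub>fun_module T M\<^esub>t\<in>T. (\<lambda>x. basis_vec R t x \<odot>\<^bsub>M\<^esub> q t)) \<in> lspan M (W {})"
    proof (rule module.submodule_finsum[OF fun_module lspan_submodule[OF W] T])
      fix t assume "t \<in> T"
      then show "(\<lambda>x. basis_vec R t x \<odot>\<^bsub>M\<^esub> q t) \<in> lspan M (W {})"
        by (intro lspan_gen[OF W] qt) (auto simp: W_def R.basis_vec_fin_supp)
    qed
    also note fun_module_expand[OF T q]
    finally show ?case .
  next
    case (insert y Y0)
    then have "q \<in> lspan M (W Y0)" by auto
    then obtain k :: nat and d v where d: "\<And>s. s < k \<Longrightarrow> d s \<in> W Y0" and v: "\<And>s. s < k \<Longrightarrow> v s \<in> carrier M"
      and qd: "q = (\<lambda>t. \<Oplus>\<^bsub>M\<^esub>s\<in>{..<k}. d s t \<odot>\<^bsub>M\<^esub> v s)" by (rule lspan_finite[OF W]) blast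
    have dS: "d s \<in> fin_supp T (self_module R)" if "s < k" for s using d[OF that] W by auto
    have dR: "d s t \<in> carrier R" if "s < k" for s t using fin_suppD(1)[OF dS[OF that], of t] by simp
    define r where "r s = (\<Oplus>t\<in>T. g t y \<otimes> d s t)" for s
    have rR: "r s \<in> carrier R" if "s < k" for s
      unfolding r_def using gR dR that by (intro R.finsum_closed) auto
    define v' where "v' s = (if s < k then v s else \<zero>\<^bsub>M\<^esub>)" for s
    have v': "v' \<in> fin_supp {..<k} M" by (rule fin_suppI') (auto simp: v'_def v)
    have qd': "q = (\<lambda>t. \<Oplus>\<^bsub>M\<^esub>s\<in>{..<k}. d s t \<odot>\<^bsub>M\<^esub> v' s)"
      unfolding qd v'_def using dR v by (intro ext M.finsum_cong') auto
    have "(\<Oplus>\<^bsub>M\<^esub>s\<in>{..<k}. r s \<odot>\<^bsub>M\<^esub> v' s) = (\<Oplus>\<^bsub>M\<^esub>t\<in>T. g t y \<odot>\<^bsub>M\<^esub> q t)"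
      unfolding r_def qd'
      by (rule matrix_assoc[symmetric]) (use T gR dR fin_suppD(1)[OF v'] in auto)
    also have "\<dots> \<in> ismult M c" using rel insert by auto
    finally have "v' \<in> lspan M {b \<in> fin_supp {..<k} (self_module R). (\<Oplus>s\<in>{..<k}. r s \<otimes> b s) \<in> c}"
      using flat rR v' unfolding flat_eq_def by blast
    then have "(\<lambda>t. \<Oplus>\<^bsub>M\<^esub>s\<in>{..<k}. d s t \<odot>\<^bsub>M\<^esub> v' s) \<in> lspan M (W (insert y Y0))"
    proof (rule lspan_image[OF _ fun_module matrix_hom lspan_submodule[OF W], rotated -1])
      fix b w assume b: "b \<in> {b \<in> fin_supp {..<k} (self_module R). (\<Oplus>s\<in>{..<k}. r s \<otimes> b s) \<in> c}" and w: "w \<in> carrier M"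
      have bR: "b s \<in> carrier R" for s using fin_suppD(1)[of b "{..<k}" "self_module R" s] b by simp
      define d' where "d' t = (\<Oplus>s\<in>{..<k}. d s t \<otimes> b s)" for t
      have "d' \<in> fin_supp T (self_module R)"
        using mod_hom_closed[OF A.matrix_hom[of "{..<k}" d T], of b] dS b by (simp add: d'_def[abs_def])
      moreover have "(\<Oplus>t\<in>T. g t z \<otimes> d' t) \<in> c" if z: "z \<in> insert y Y0" for z
      proof -
        have eq: "(\<Oplus>t\<in>T. g t z \<otimes> d' t) = (\<Oplus>s\<in>{..<k}. (\<Oplus>t\<in>T. g t z \<otimes> d s t) \<otimes> b s)"
          using A.matrix_assoc[of "{..<k}" T "\<lambda>t. g t z" d b] T gR dR bR by (simp add: d'_def)
        show ?thesis
        proof (cases "z = y")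
          case True
          then show ?thesis using eq b by (simp add: r_def)
        next
          case False
          then have "z \<in> Y0" using z by auto
          then have "(\<Oplus>t\<in>T. g t z \<otimes> d s t) \<otimes> b s \<in> c" if "s < k" for s
            using d[OF that] bR by (auto simp: W_def c.I_r_closed)
          moreover have "submodule c R (self_module R)"
            by (rule A.submoduleI) (auto simp: c.Icarr c.I_l_closed)
          ultimately have "(\<Oplus>\<^bsub>self_module R\<^esub>s\<in>{..<k}. (\<Oplus>t\<in>T. g t z \<otimes> d s t) \<otimes> b s) \<in> c"
            by (intro A.submodule_finsum) auto
          then show ?thesis unfolding eq by simp
        qed
      qed
      ultimately have "d' \<in> W (insert y Y0)" by (simp add: W_def)
      then have "(\<lambda>t. d' t \<odot>\<^bsub>M\<^esub> w) \<in> lspan M (W (insert y Y0))" using w by (rule lspan_gen[OF W])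
      also have "(\<lambda>t. d' t \<odot>\<^bsub>M\<^esub> w) = (\<lambda>t. \<Oplus>\<^bsub>M\<^esub>s\<in>{..<k}. d s t \<odot>\<^bsub>M\<^esub> (b s \<odot>\<^bsub>M\<^esub> w))"
      proof
        fix t
        have "d' t \<odot>\<^bsub>M\<^esub> w = (\<Oplus>\<^bsub>M\<^esub>s\<in>{..<k}. (d s t \<otimes> b s) \<odot>\<^bsub>M\<^esub> w)"
          unfolding d'_def using dR bR w by (intro finsum_smult_rdistr) auto
        also have "\<dots> = (\<Oplus>\<^bsub>M\<^esub>s\<in>{..<k}. d s t \<odot>\<^bsub>M\<^esub> (b s \<odot>\<^bsub>M\<^esub> w))"
          using dR bR w by (intro M.finsum_cong') (auto simp: smult_assoc1)
        finally show "d' t \<odot>\<^bsub>M\<^esub> w = (\<Oplus>\<^bsub>M\<^esub>s\<in>{..<k}. d s t \<odot>\<^bsub>M\<^esub> (b s \<odot>\<^bsub>M\<^esub> w))" .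
      qed
      finally show "(\<lambda>t. \<Oplus>\<^bsub>M\<^esub>s\<in>{..<k}. d s t \<odot>\<^bsub>M\<^esub> (b s \<odot>\<^bsub>M\<^esub> w)) \<in> lspan M (W (insert y Y0))" .
    qed (use dS in auto)
    then show ?case using qd' by simp
  qed
  moreover define Y0 where "Y0 = (\<Union>t\<in>T. {y. g t y \<noteq> \<zero>})"
  moreover have "finite Y0" "Y0 \<subseteq> Y"
    unfolding Y0_def using T fin_suppD(3)[OF g] fin_suppD(2)[OF g] by auto
  ultimately have q0: "q \<in> lspan M (W Y0)" by blast
  have "W Y0 \<subseteq> {b \<in> fin_supp T (self_module R). \<forall>y. (\<Oplus>t\<in>T. g t y \<otimes> b t) \<in> c}"
  proof
    fix b assume b: "b \<in> W Y0"
    have bR: "b t \<in> carrier R" for t using fin_suppD(1)[of b T "self_module R" t] b by (simp add: W_def)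
    have "(\<Oplus>t\<in>T. g t y \<otimes> b t) \<in> c" for y
    proof (cases "y \<in> Y0")
      case False
      then have "(\<Oplus>t\<in>T. g t y \<otimes> b t) = (\<Oplus>t\<in>T. \<zero>)"
        using bR by (intro R.finsum_cong') (auto simp: Y0_def)
      then show ?thesis by simp
    qed (use b in \<open>simp add: W_def\<close>)
    then show "b \<in> {b \<in> fin_supp T (self_module R). \<forall>y. (\<Oplus>t\<in>T. g t y \<otimes> b t) \<in> c}"
      using b by (simp add: W_def)
  qed
  then show ?thesis using q0 lspan_mono by blast
qed

text \<open>
  Systems of equations without matrices: \<open>g\<close> is a linear operator over \<open>R\<close> and \<open>h\<close> its extension to
  coefficients in \<open>M\<close>. The operators of interest are Koszul differentials.
\<close>

lemma flat_eq_operator: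
  assumes flat: "flat_eq R M c" and c: "ideal c R" and T: "finite (T :: 'x set)"
    and g: "g \<in> mod_hom R (fun_module T (self_module R)) (fun_module Y (self_module R))"
    and h: "h \<in> mod_hom R (fun_module T M) (fun_module Y M)"
    and gh: "\<And>b y s. b \<in> fin_supp T (self_module R) \<Longrightarrow> y \<in> carrier M \<Longrightarrow> h (\<lambda>t. b t \<odot>\<^bsub>M\<^esub> y) s = g b s \<odot>\<^bsub>M\<^esub> y"
    and q: "q \<in> fin_supp T M" and rel: "\<And>s. h q s \<in> ismult M c"
  shows "q \<in> lspan M {b \<in> fin_supp T (self_module R). \<forall>s. g b s \<in> c}"
proof -
  interpret A: module R "self_module R" by (rule self_module[OF R.is_cring])
  interpret g: linear_map R "fun_module T (self_module R)" "fun_module Y (self_module R)" g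
    by (intro linear_mapI A.fun_module g)
  interpret h: linear_map R "fun_module T M" "fun_module Y M" h
    by (intro linear_mapI fun_module h)
  have e: "basis_vec R t \<in> fin_supp T (self_module R)" if "t \<in> T" for t using that by (rule R.basis_vec_fin_supp)
  have ge: "g (basis_vec R t) \<in> fin_supp Y (self_module R)" if "t \<in> T" for t
    using g.closed[of "basis_vec R t"] e[OF that] by simp
  have qM: "q t \<in> carrier M" for t by (rule fin_suppD(1)[OF q])
  have hq: "h q s = (\<Oplus>\<^bsub>M\<^esub>t\<in>T. g (basis_vec R t) s \<odot>\<^bsub>M\<^esub> q t)" for s
  proof -
    have el: "(\<lambda>x. basis_vec R t x \<odot>\<^bsub>M\<^esub> q t) \<in> fin_supp T M" if "t \<in> T" for t
      using e[OF that] qM by (rule fin_supp_lmult)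
    have "h q = h (\<Oplus>\<^bsub>fun_module T M\<^esub>t\<in>T. (\<lambda>x. basis_vec R t x \<odot>\<^bsub>M\<^esub> q t))"
      using fun_module_expand[OF T q] by simp
    also have "\<dots> = (\<Oplus>\<^bsub>fun_module Y M\<^esub>t\<in>T. h (\<lambda>x. basis_vec R t x \<odot>\<^bsub>M\<^esub> q t))"
      using el by (intro h.map_finsum T) simp
    also have "\<dots> = (\<lambda>s. \<Oplus>\<^bsub>M\<^esub>t\<in>T. h (\<lambda>x. basis_vec R t x \<odot>\<^bsub>M\<^esub> q t) s)"
      using h.closed el by (intro fun_module_finsum T) simp
    finally have "h q s = (\<Oplus>\<^bsub>M\<^esub>t\<in>T. h (\<lambda>x. basis_vec R t x \<odot>\<^bsub>M\<^esub> q t) s)" by simp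
    also have "\<dots> = (\<Oplus>\<^bsub>M\<^esub>t\<in>T. g (basis_vec R t) s \<odot>\<^bsub>M\<^esub> q t)"
      using gh[OF e qM] fin_suppD(1)[OF ge] qM by (intro M.finsum_cong') auto
    finally show ?thesis .
  qed
  have gb: "g b s = (\<Oplus>t\<in>T. g (basis_vec R t) s \<otimes> b t)" if b: "b \<in> fin_supp T (self_module R)" for b s
  proof -
    have bR: "b t \<in> carrier R" for t using fin_suppD(1)[OF b, of t] by simp
    have eq: "(\<lambda>x. basis_vec R t x \<otimes> b t) = b t \<odot>\<^bsub>fun_module T (self_module R)\<^esub> basis_vec R t" for t
      using bR by (simp add: R.m_comm)
    have "g b = g (\<Oplus>\<^bsub>fun_module T (self_module R)\<^esub>t\<in>T. b t \<odot>\<^bsub>fun_module T (self_module R)\<^esub> basis_vec R t)"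
      using A.fun_module_expand[OF T b] unfolding self_module_simps eq by simp
    also have "\<dots> = (\<Oplus>\<^bsub>fun_module Y (self_module R)\<^esub>t\<in>T. g (b t \<odot>\<^bsub>fun_module T (self_module R)\<^esub> basis_vec R t))"
      using e bR g.M.smult_closed[of "b _" "basis_vec R _"] by (intro g.map_finsum T) simp
    also have "\<dots> = (\<lambda>s. \<Oplus>\<^bsub>self_module R\<^esub>t\<in>T. g (b t \<odot>\<^bsub>fun_module T (self_module R)\<^esub> basis_vec R t) s)"
      using e bR g.M.smult_closed[of "b _" "basis_vec R _"] g.closed by (intro A.fun_module_finsum T) simp
    finally have "g b s = (\<Oplus>t\<in>T. g (b t \<odot>\<^bsub>fun_module T (self_module R)\<^esub> basis_vec R t) s)" by simp
    also have "\<dots> = (\<Oplus>t\<in>T. g (basis_vec R t) s \<otimes> b t)"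
      using g.smult[of "b _" "basis_vec R _"] bR e fin_suppD(1)[OF ge]
      by (intro R.finsum_cong') (auto simp: R.m_comm simp del: fun_module_simps(4), simp add: R.m_comm)
    finally show ?thesis .
  qed
  have "q \<in> lspan M {b \<in> fin_supp T (self_module R). \<forall>s. (\<Oplus>t\<in>T. g (basis_vec R t) s \<otimes> b t) \<in> c}"
    by (rule flat_eq_matrix[OF flat c T ge q]) (simp_all only: hq[symmetric] rel)
  also have "{b \<in> fin_supp T (self_module R). \<forall>s. (\<Oplus>t\<in>T. g (basis_vec R t) s \<otimes> b t) \<in> c}
      = {b \<in> fin_supp T (self_module R). \<forall>s. g b s \<in> c}" using gb by auto
  finally show ?thesis .
qed

lemma finsum_Plus:
  assumes "finite A" "finite B" "\<And>a. a \<in> A \<Longrightarrow> f (Inl a) \<in> carrier M" "\<And>b. b \<in> B \<Longrightarrow> f (Inr b) \<in> carrier M"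
  shows "(\<Oplus>\<^bsub>M\<^esub>x\<in>A <+> B. f x) = (\<Oplus>\<^bsub>M\<^esub>a\<in>A. f (Inl a)) \<oplus>\<^bsub>M\<^esub> (\<Oplus>\<^bsub>M\<^esub>b\<in>B. f (Inr b))"
proof -
  have "(\<Oplus>\<^bsub>M\<^esub>x\<in>A <+> B. f x) = (\<Oplus>\<^bsub>M\<^esub>x\<in>Inl ` A. f x) \<oplus>\<^bsub>M\<^esub> (\<Oplus>\<^bsub>M\<^esub>x\<in>Inr ` B. f x)"
    unfolding Plus_def using assms by (intro M.finsum_Un_disjoint) auto
  moreover have "(\<Oplus>\<^bsub>M\<^esub>x\<in>Inl ` A. f x) = (\<Oplus>\<^bsub>M\<^esub>a\<in>A. f (Inl a))"
    using assms by (intro M.finsum_reindex) auto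
  moreover have "(\<Oplus>\<^bsub>M\<^esub>x\<in>Inr ` B. f x) = (\<Oplus>\<^bsub>M\<^esub>a\<in>B. f (Inr a))"
    using assms by (intro M.finsum_reindex) auto
  ultimately show ?thesis by simp
qed

end

section \<open>Exactness of the tensor product and the equational criterion\<close>

text \<open>
  The class on which exactness is tested: the modules in which every element is annihilated by
  some ideal from \<open>\<Gamma>\<close>. For the powers of an ideal these are the torsion modules, for the zero
  ideal they are all modules.
\<close>

definition ann_by :: "('a, 'r) ring_scheme \<Rightarrow> 'a set set \<Rightarrow> ('a, 'u) module set"
  where "ann_by R \<Gamma> = {N. module R N
    \<and> (\<forall>x\<in>carrier N. \<exists>c\<in>\<Gamma>. \<forall>r\<in>c. r \<odot>\<^bsub>N\<^esub> x = \<zero>\<^bsub>N\<^esub>)}"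

locale ideal_filter = cring R for R (structure) +
  fixes \<Gamma> :: "'a set set"
  assumes ideals: "c \<in> \<Gamma> \<Longrightarrow> ideal c R"
    and nonempty: "\<Gamma> \<noteq> {}"
    and directed: "c \<in> \<Gamma> \<Longrightarrow> d \<in> \<Gamma> \<Longrightarrow> \<exists>e\<in>\<Gamma>. e \<subseteq> c \<and> e \<subseteq> d"
begin

lemma annihilate_finite:
  assumes "N \<in> ann_by R \<Gamma>" "finite X" "X \<subseteq> carrier N"
  shows "\<exists>c\<in>\<Gamma>. \<forall>x\<in>X. \<forall>r\<in>c. r \<odot>\<^bsub>N\<^esub> x = \<zero>\<^bsub>N\<^esub>"
  using assms(2,3)
proof induct
  case (insert x X)
  then obtain c where c: "c \<in> \<Gamma>" "\<forall>x\<in>X. \<forall>r\<in>c. r \<odot>\<^bsub>N\<^esub> x = \<zero>\<^bsub>N\<^esub>" by auto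
  obtain d where d: "d \<in> \<Gamma>" "\<forall>r\<in>d. r \<odot>\<^bsub>N\<^esub> x = \<zero>\<^bsub>N\<^esub>" using assms(1) insert by (auto simp: ann_by_def)
  obtain e where "e \<in> \<Gamma>" "e \<subseteq> c" "e \<subseteq> d" using directed[OF c(1) d(1)] by auto
  then show ?case using c d by (intro bexI[of _ e]) auto
qed (use nonempty in auto)

end

lemma basis_vec_smult_fin_supp:
  assumes "module R Q" "x \<in> X" "p \<in> carrier Q"
  shows "(\<lambda>y. basis_vec R x y \<odot>\<^bsub>Q\<^esub> p) \<in> fin_supp X Q"
  by (rule module.fin_supp_lmult[OF assms(1) cring.basis_vec_fin_supp[OF module.axioms(1)[OF assms(1)] assms(2)] assms(3)])

section \<open>Relations between generators\<close>

lemma (in module) eval_map: "linear_map R (fun_module X M) M (\<lambda>f. f x)"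
  by (intro linear_mapI mod_homI fun_module module_axioms) (auto intro: fin_suppD(1))

lemma (in module) combination_map:
  assumes T: "finite T" and n: "\<And>i. i \<in> T \<Longrightarrow> n i \<in> carrier M"
  shows "linear_map R (fun_module T (self_module R)) M (\<lambda>b. \<Oplus>\<^bsub>M\<^esub>i\<in>T. b i \<odot>\<^bsub>M\<^esub> n i)"
proof (intro linear_mapI module_axioms mod_homI)
  show "module R (fun_module T (self_module R))" by (rule module.fun_module[OF self_module[OF R.is_cring]])
  have bR: "b i \<in> carrier R" if "b \<in> carrier (fun_module T (self_module R))" for b i
    using fin_suppD(1)[of b T "self_module R" i] that by simp
  let ?h = "\<lambda>b. \<Oplus>\<^bsub>M\<^esub>i\<in>T. b i \<odot>\<^bsub>M\<^esub> n i"
  fix b assume b: "b \<in> carrier (fun_module T (self_module R))"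
  show "?h b \<in> carrier M" using bR[OF b] n by (intro M.finsum_closed) auto
  show "?h (a \<odot>\<^bsub>fun_module T (self_module R)\<^esub> b) = a \<odot>\<^bsub>M\<^esub> ?h b" if a: "a \<in> carrier R" for a
  proof -
    have "?h (a \<odot>\<^bsub>fun_module T (self_module R)\<^esub> b) = (\<Oplus>\<^bsub>M\<^esub>i\<in>T. a \<odot>\<^bsub>M\<^esub> (b i \<odot>\<^bsub>M\<^esub> n i))"
      using bR[OF b] n a by (intro M.finsum_cong') (auto simp: smult_assoc1)
    then show ?thesis using bR[OF b] n a T by (subst finsum_smult_ldistr) auto
  qed
  fix c assume c: "c \<in> carrier (fun_module T (self_module R))"
  have "?h (b \<oplus>\<^bsub>fun_module T (self_module R)\<^esub> c) = (\<Oplus>\<^bsub>M\<^esub>i\<in>T. b i \<odot>\<^bsub>M\<^esub> n i \<oplus>\<^bsub>M\<^esub> c i \<odot>\<^bsub>M\<^esub> n i)"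
    using bR[OF b] bR[OF c] n by (intro M.finsum_cong') (auto simp: smult_l_distr)
  also have "\<dots> = ?h b \<oplus>\<^bsub>M\<^esub> ?h c"
    using bR[OF b] bR[OF c] n by (intro M.finsum_addf) auto
  finally show "?h (b \<oplus>\<^bsub>fun_module T (self_module R)\<^esub> c) = ?h b \<oplus>\<^bsub>M\<^esub> ?h c" .
qed

lemma (in module) combination_basis:
  assumes T: "finite T" and t: "t \<in> T" and n: "\<And>i. i \<in> T \<Longrightarrow> n i \<in> carrier M"
  shows "(\<Oplus>\<^bsub>M\<^esub>i\<in>T. basis_vec R t i \<odot>\<^bsub>M\<^esub> n i) = n t"
proof -
  have "(\<Oplus>\<^bsub>M\<^esub>i\<in>T. basis_vec R t i \<odot>\<^bsub>M\<^esub> n i) = (\<Oplus>\<^bsub>M\<^esub>i\<in>T. if i = t then n t else \<zero>\<^bsub>M\<^esub>)"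
    using n by (intro M.finsum_cong') (auto simp: basis_vec_def)
  then show ?thesis using finsum_single[OF T t n[OF t]] by simp
qed

context tensor_product begin

text \<open>
  For a presentation \<open>h\<close> of \<open>N\<close> by a free module, lifting elements along \<open>h\<close> is linear up to relations.
  So \<open>p \<otimes> h b \<mapsto> (b\<^sub>y p)\<^sub>y\<close> is well defined modulo the combinations of relations.
\<close>

lemma tensor_presentation_zero:
  assumes h: "linear_map R (fun_module Y (self_module R)) N h"
    and surj: "\<And>x. x \<in> carrier N \<Longrightarrow> \<exists>b\<in>fin_supp Y (self_module R). h b = x"
    and T: "finite T" and p: "\<And>i. i \<in> T \<Longrightarrow> p i \<in> carrier P"
    and w: "\<And>i. i \<in> T \<Longrightarrow> w i \<in> fin_supp Y (self_module R)" "\<And>i. i \<in> T \<Longrightarrow> h (w i) = n i"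
    and zero: "(\<Oplus>\<^bsub>tensor R P N\<^esub>i\<in>T. pt (p i) (n i)) = \<zero>\<^bsub>tensor R P N\<^esub>"
  shows "(\<Oplus>\<^bsub>fun_module Y P\<^esub>i\<in>T. (\<lambda>y. w i y \<odot>\<^bsub>P\<^esub> p i)) \<in> lspan P {b \<in> fin_supp Y (self_module R). h b = \<zero>\<^bsub>N\<^esub>}"
proof -
  let ?AY = "fun_module Y (self_module R)" and ?PY = "fun_module Y P"
  interpret A: module R "self_module R" by (rule self_module[OF P.R.is_cring])
  interpret PY: module R ?PY by (rule P.fun_module)
  interpret h: linear_map R ?AY N h by (rule h)
  let ?S = "{b \<in> fin_supp Y (self_module R). h b = \<zero>\<^bsub>N\<^esub>}"
  have SA: "?S \<subseteq> fin_supp Y (self_module R)" by auto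
  have S: "submodule (lspan P ?S) R ?PY" by (rule P.lspan_submodule[OF SA])
  define \<rho> where "\<rho> x = (SOME b. b \<in> carrier ?AY \<and> h b = x)" for x
  have "\<rho> x \<in> carrier ?AY \<and> h (\<rho> x) = x" if "x \<in> carrier N" for x
  proof -
    have "\<exists>b. b \<in> carrier ?AY \<and> h b = x" using surj[OF that] by auto
    then show ?thesis unfolding \<rho>_def by (rule someI_ex)
  qed
  then have \<rho>: "\<rho> x \<in> carrier ?AY" "h (\<rho> x) = x" if "x \<in> carrier N" for x using that by simp_all
  have coefR: "b i \<in> carrier R" if "b \<in> carrier ?AY" for b i using fin_suppD(1)[of b Y "self_module R" i] that by simp
  have lm: "(\<lambda>i. b i \<odot>\<^bsub>P\<^esub> y) \<in> carrier ?PY" if "b \<in> carrier ?AY" "y \<in> carrier P" for b y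
    using P.fin_supp_lmult[of b Y y] that by simp
  have key: "(\<lambda>i. b i \<odot>\<^bsub>P\<^esub> y) \<ominus>\<^bsub>?PY\<^esub> (\<lambda>i. c i \<odot>\<^bsub>P\<^esub> y) \<in> lspan P ?S"
    if b: "b \<in> carrier ?AY" and c: "c \<in> carrier ?AY" and bc: "h b = h c" and y: "y \<in> carrier P" for b c y
  proof -
    have "h (b \<ominus>\<^bsub>?AY\<^esub> c) = \<zero>\<^bsub>N\<^esub>"
      unfolding h.diff[OF b c] bc using N.diff_zero_iff[OF h.closed[OF c] h.closed[OF c]] by simp
    then have "b \<ominus>\<^bsub>?AY\<^esub> c \<in> ?S" using h.M.M.minus_closed[OF b c] by simp
    from P.lspan_gen[OF SA this y] have "(\<lambda>i. (b \<ominus>\<^bsub>?AY\<^esub> c) i \<odot>\<^bsub>P\<^esub> y) \<in> lspan P ?S" .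
    moreover have "(b \<ominus>\<^bsub>?AY\<^esub> c) i \<odot>\<^bsub>P\<^esub> y = b i \<odot>\<^bsub>P\<^esub> y \<ominus>\<^bsub>P\<^esub> c i \<odot>\<^bsub>P\<^esub> y" for i
      using A.fun_module_diff[of b Y c] b c P.smult_l_diff[OF coefR[OF b] coefR[OF c] y] by (simp add: a_minus_def)
    ultimately show ?thesis using P.fun_module_diff[of _ Y] lm[OF b y] lm[OF c y] by simp
  qed
  have refl: "x \<ominus>\<^bsub>?PY\<^esub> x \<in> lspan P ?S" if "x \<in> carrier ?PY" for x
    using PY.diff_zero_iff[OF that that] PY.submodule_zero[OF S] by simp
  have n: "n i \<in> carrier N" if "i \<in> T" for i using h.closed[of "w i"] w[OF that] by simp
  have 1: "(\<Oplus>\<^bsub>?PY\<^esub>t\<in>T. (\<lambda>i. \<rho> (n t) i \<odot>\<^bsub>P\<^esub> p t)) \<in> lspan P ?S"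
  proof (rule tensor_universal[OF PY.module_axioms S, where \<beta> = "\<lambda>y x i. \<rho> x i \<odot>\<^bsub>P\<^esub> y"])
    show "(\<lambda>i. \<rho> x i \<odot>\<^bsub>P\<^esub> y) \<in> carrier ?PY" if "y \<in> carrier P" "x \<in> carrier N" for y x by (rule lm[OF \<rho>(1)[OF that(2)] that(1)])
    fix y x assume y: "y \<in> carrier P" and x: "x \<in> carrier N"
    note \<rho>R = coefR[OF \<rho>(1)]
    show "(\<lambda>i. \<rho> x i \<odot>\<^bsub>P\<^esub> (y \<oplus>\<^bsub>P\<^esub> y')) \<ominus>\<^bsub>?PY\<^esub> ((\<lambda>i. \<rho> x i \<odot>\<^bsub>P\<^esub> y) \<oplus>\<^bsub>?PY\<^esub> (\<lambda>i. \<rho> x i \<odot>\<^bsub>P\<^esub> y')) \<in> lspan P ?S"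
      if "y' \<in> carrier P" for y'
      using refl[OF PY.M.a_closed[OF lm[OF \<rho>(1)[OF x] y] lm[OF \<rho>(1)[OF x] that]]] that x y \<rho>R by (simp add: P.smult_r_distr)
    show "(\<lambda>i. \<rho> (x \<oplus>\<^bsub>N\<^esub> x') i \<odot>\<^bsub>P\<^esub> y) \<ominus>\<^bsub>?PY\<^esub> ((\<lambda>i. \<rho> x i \<odot>\<^bsub>P\<^esub> y) \<oplus>\<^bsub>?PY\<^esub> (\<lambda>i. \<rho> x' i \<odot>\<^bsub>P\<^esub> y)) \<in> lspan P ?S"
      if x': "x' \<in> carrier N" for x'
      using key[OF \<rho>(1)[OF N.M.a_closed[OF x x']] h.M.M.a_closed[OF \<rho>(1)[OF x] \<rho>(1)[OF x']] _ y]
        h.add[OF \<rho>(1)[OF x] \<rho>(1)[OF x']] \<rho>(2) x x' y \<rho>R by (simp add: P.smult_l_distr)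
    fix a assume a: "a \<in> carrier R"
    show "(\<lambda>i. \<rho> x i \<odot>\<^bsub>P\<^esub> (a \<odot>\<^bsub>P\<^esub> y)) \<ominus>\<^bsub>?PY\<^esub> (a \<odot>\<^bsub>?PY\<^esub> (\<lambda>i. \<rho> x i \<odot>\<^bsub>P\<^esub> y)) \<in> lspan P ?S"
      using refl[OF PY.smult_closed[OF a lm[OF \<rho>(1)[OF x] y]]] P.smult_lcomm[OF \<rho>R[OF x] a y] by simp
    show "(\<lambda>i. \<rho> (a \<odot>\<^bsub>N\<^esub> x) i \<odot>\<^bsub>P\<^esub> y) \<ominus>\<^bsub>?PY\<^esub> (a \<odot>\<^bsub>?PY\<^esub> (\<lambda>i. \<rho> x i \<odot>\<^bsub>P\<^esub> y)) \<in> lspan P ?S"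
      using key[OF \<rho>(1)[OF N.smult_closed[OF a x]] h.M.smult_closed[OF a \<rho>(1)[OF x]] _ y]
        h.smult[OF a \<rho>(1)[OF x]] \<rho>(2) a x y \<rho>R by (simp add: P.smult_assoc1)
  qed (use T p n zero in auto)
  have e: "(\<lambda>i. w t i \<odot>\<^bsub>P\<^esub> p t) \<in> carrier ?PY" "(\<lambda>i. \<rho> (n t) i \<odot>\<^bsub>P\<^esub> p t) \<in> carrier ?PY" if "t \<in> T" for t
    using lm[OF _ p[OF that]] \<rho>(1)[OF n[OF that]] w(1)[OF that] by simp_all
  have "(\<Oplus>\<^bsub>?PY\<^esub>t\<in>T. (\<lambda>i. w t i \<odot>\<^bsub>P\<^esub> p t) \<ominus>\<^bsub>?PY\<^esub> (\<lambda>i. \<rho> (n t) i \<odot>\<^bsub>P\<^esub> p t)) \<in> lspan P ?S"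
    by (intro PY.submodule_finsum[OF S T] key) (use \<rho> n w p in auto)
  also have "(\<Oplus>\<^bsub>?PY\<^esub>t\<in>T. (\<lambda>i. w t i \<odot>\<^bsub>P\<^esub> p t) \<ominus>\<^bsub>?PY\<^esub> (\<lambda>i. \<rho> (n t) i \<odot>\<^bsub>P\<^esub> p t))
      = (\<Oplus>\<^bsub>?PY\<^esub>t\<in>T. (\<lambda>i. w t i \<odot>\<^bsub>P\<^esub> p t)) \<ominus>\<^bsub>?PY\<^esub> (\<Oplus>\<^bsub>?PY\<^esub>t\<in>T. (\<lambda>i. \<rho> (n t) i \<odot>\<^bsub>P\<^esub> p t))"
    using e by (intro PY.finsum_diff[OF T]) blast+
  finally show ?thesis using 1 by (rule PY.submodule_diff_cancel[OF S]) (use e in \<open>blast intro: PY.M.finsum_closed\<close>)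
qed

text \<open>The presentation by the free module on all elements of the second factor.\<close>

lemma tensor_zero_relations:
  assumes T: "finite T" "\<And>i. i \<in> T \<Longrightarrow> p i \<in> carrier P" "\<And>i. i \<in> T \<Longrightarrow> n i \<in> carrier N"
    and zero: "(\<Oplus>\<^bsub>tensor R P N\<^esub>i\<in>T. pt (p i) (n i)) = \<zero>\<^bsub>tensor R P N\<^esub>"
  shows "(\<lambda>x. \<Oplus>\<^bsub>P\<^esub>i\<in>T. basis_vec R (n i) x \<odot>\<^bsub>P\<^esub> p i)
    \<in> lspan P {c \<in> carrier (free_module R (carrier N)). lin_ext R N id c = \<zero>\<^bsub>N\<^esub>}"
proof -
  have id: "id \<in> carrier N \<rightarrow> carrier N" by auto
  have h: "linear_map R (fun_module (carrier N) (self_module R)) N (lin_ext R N id)"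
    using N.lin_ext_hom[OF id] free_module[OF P.R.is_cring, of "carrier N"]
    by (intro linear_mapI N.module_axioms) (simp_all add: free_module_eq)
  have b: "basis_vec R x \<in> fin_supp (carrier N) (self_module R)" "lin_ext R N id (basis_vec R x) = x" if "x \<in> carrier N" for x
    using P.R.basis_vec_fin_supp[OF that] N.lin_ext_basis_vec[OF id that] by simp_all
  have surj: "\<exists>c\<in>fin_supp (carrier N) (self_module R). lin_ext R N id c = x" if "x \<in> carrier N" for x using b[OF that] by blast
  have "(\<Oplus>\<^bsub>fun_module (carrier N) P\<^esub>i\<in>T. (\<lambda>x. basis_vec R (n i) x \<odot>\<^bsub>P\<^esub> p i))
      \<in> lspan P {c \<in> fin_supp (carrier N) (self_module R). lin_ext R N id c = \<zero>\<^bsub>N\<^esub>}"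
    by (rule tensor_presentation_zero[OF h surj T(1,2) b(1)[OF T(3)] b(2)[OF T(3)] zero])
  moreover have "(\<Oplus>\<^bsub>fun_module (carrier N) P\<^esub>i\<in>T. (\<lambda>x. basis_vec R (n i) x \<odot>\<^bsub>P\<^esub> p i))
      = (\<lambda>x. \<Oplus>\<^bsub>P\<^esub>i\<in>T. basis_vec R (n i) x \<odot>\<^bsub>P\<^esub> p i)"
    by (rule P.fun_module_finsum[OF T(1)]) (rule basis_vec_smult_fin_supp[OF P.module_axioms T(3,2)])
  ultimately show ?thesis by (simp add: free_module_eq)
qed

text \<open>
  The presentation by a finite family of generators. For a single generator it computes
  \<open>P \<otimes> R/J = P/J P\<close>, see \<open>tensor_cyclic_zero_iff\<close> below.
\<close>

lemma tensor_generators_zero: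
  assumes T: "finite T" and n: "\<And>i. i \<in> T \<Longrightarrow> n i \<in> carrier N"
    and gen: "\<And>x. x \<in> carrier N \<Longrightarrow> \<exists>b\<in>fin_supp T (self_module R). (\<Oplus>\<^bsub>N\<^esub>i\<in>T. b i \<odot>\<^bsub>N\<^esub> n i) = x"
    and q: "q \<in> fin_supp T P" and zero: "(\<Oplus>\<^bsub>tensor R P N\<^esub>i\<in>T. pt (q i) (n i)) = \<zero>\<^bsub>tensor R P N\<^esub>"
  shows "q \<in> lspan P {b \<in> fin_supp T (self_module R). (\<Oplus>\<^bsub>N\<^esub>i\<in>T. b i \<odot>\<^bsub>N\<^esub> n i) = \<zero>\<^bsub>N\<^esub>}"
proof -
  have qP: "q i \<in> carrier P" for i by (rule fin_suppD(1)[OF q])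
  have "(\<Oplus>\<^bsub>fun_module T P\<^esub>t\<in>T. (\<lambda>i. basis_vec R t i \<odot>\<^bsub>P\<^esub> q t))
      \<in> lspan P {b \<in> fin_supp T (self_module R). (\<Oplus>\<^bsub>N\<^esub>i\<in>T. b i \<odot>\<^bsub>N\<^esub> n i) = \<zero>\<^bsub>N\<^esub>}"
    by (rule tensor_presentation_zero[OF N.combination_map[OF T n] gen T qP P.R.basis_vec_fin_supp
          N.combination_basis[OF T _ n] zero])
  then show ?thesis unfolding P.fun_module_expand[OF T q] .
qed

end

lemma (in tensor_product) sum_pt_hom:
  assumes "finite T" "\<And>i. i \<in> T \<Longrightarrow> n i \<in> carrier N"
  shows "(\<lambda>v. \<Oplus>\<^bsub>tensor R P N\<^esub>i\<in>T. pt (v i) (n i)) \<in> mod_hom R (fun_module T P) (tensor R P N)"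
proof -
  interpret t: module R "tensor R P N" by (rule tensor_module)
  note c = fin_suppD(1)
  show ?thesis
  proof (rule mod_homI)
    fix v assume "v \<in> carrier (fun_module T P)"
    then have v: "v i \<in> carrier P" for i using c[of v T P] by simp
    show "(\<Oplus>\<^bsub>tensor R P N\<^esub>i\<in>T. pt (v i) (n i)) \<in> carrier (tensor R P N)"
      using v assms pt_closed by (intro t.M.finsum_closed) auto
    { fix w assume "w \<in> carrier (fun_module T P)"
      then have w: "w i \<in> carrier P" for i using c[of w T P] by simp
      have "(\<Oplus>\<^bsub>tensor R P N\<^esub>i\<in>T. pt (v i \<oplus>\<^bsub>P\<^esub> w i) (n i))
          = (\<Oplus>\<^bsub>tensor R P N\<^esub>i\<in>T. pt (v i) (n i) \<oplus>\<^bsub>tensor R P N\<^esub> pt (w i) (n i))"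
        using v w assms pt_closed by (intro t.M.finsum_cong') (auto simp: pt_add_l)
      also have "\<dots> = (\<Oplus>\<^bsub>tensor R P N\<^esub>i\<in>T. pt (v i) (n i)) \<oplus>\<^bsub>tensor R P N\<^esub> (\<Oplus>\<^bsub>tensor R P N\<^esub>i\<in>T. pt (w i) (n i))"
        using v w assms pt_closed by (intro t.M.finsum_addf) auto
      finally show "(\<Oplus>\<^bsub>tensor R P N\<^esub>i\<in>T. pt ((v \<oplus>\<^bsub>fun_module T P\<^esub> w) i) (n i))
        = (\<Oplus>\<^bsub>tensor R P N\<^esub>i\<in>T. pt (v i) (n i)) \<oplus>\<^bsub>tensor R P N\<^esub> (\<Oplus>\<^bsub>tensor R P N\<^esub>i\<in>T. pt (w i) (n i))" by simp }
    fix a assume a: "a \<in> carrier R"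
    have "(\<Oplus>\<^bsub>tensor R P N\<^esub>i\<in>T. pt (a \<odot>\<^bsub>P\<^esub> v i) (n i))
        = (\<Oplus>\<^bsub>tensor R P N\<^esub>i\<in>T. a \<odot>\<^bsub>tensor R P N\<^esub> pt (v i) (n i))"
      using v a assms pt_closed by (intro t.M.finsum_cong') (auto simp: pt_smult_l)
    also have "\<dots> = a \<odot>\<^bsub>tensor R P N\<^esub> (\<Oplus>\<^bsub>tensor R P N\<^esub>i\<in>T. pt (v i) (n i))"
      using v a assms pt_closed by (intro t.finsum_smult_ldistr[symmetric]) auto
    finally show "(\<Oplus>\<^bsub>tensor R P N\<^esub>i\<in>T. pt ((a \<odot>\<^bsub>fun_module T P\<^esub> v) i) (n i))
        = a \<odot>\<^bsub>tensor R P N\<^esub> (\<Oplus>\<^bsub>tensor R P N\<^esub>i\<in>T. pt (v i) (n i))" by simp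
  qed
qed

text \<open>A relation \<open>\<Sum> c\<^sub>i n\<^sub>i = 0\<close> contributes \<open>\<Sum> c\<^sub>i y \<otimes> n\<^sub>i = y \<otimes> \<Sum> c\<^sub>i n\<^sub>i = 0\<close>.\<close>

lemma (in tensor_product) sum_pt_relations:
  assumes T: "finite T" "\<And>i. i \<in> T \<Longrightarrow> n i \<in> carrier N"
    and S: "\<And>c. c \<in> S \<Longrightarrow> c \<in> fin_supp T (self_module R) \<and> (\<Oplus>\<^bsub>N\<^esub>i\<in>T. c i \<odot>\<^bsub>N\<^esub> n i) = \<zero>\<^bsub>N\<^esub>"
    and p: "p \<in> lspan P S"
  shows "(\<Oplus>\<^bsub>tensor R P N\<^esub>i\<in>T. pt (p i) (n i)) = \<zero>\<^bsub>tensor R P N\<^esub>"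
proof -
  interpret t: module R "tensor R P N" by (rule tensor_module)
  have H: "submodule {\<zero>\<^bsub>tensor R P N\<^esub>} R (tensor R P N)" by (rule t.submoduleI) auto
  have "(\<Oplus>\<^bsub>tensor R P N\<^esub>i\<in>T. pt (p i) (n i)) \<in> {\<zero>\<^bsub>tensor R P N\<^esub>}"
  proof (rule P.lspan_image[OF _ tensor_module sum_pt_hom[OF T] H _ p])
    fix c y assume c: "c \<in> S" and y: "y \<in> carrier P"
    have cR: "c i \<in> carrier R" for i using S[OF c] fin_suppD(1)[of c T "self_module R" i] by simp
    interpret l: linear_map R N "tensor R P N" "pt y" by (rule pt_map_r[OF y])
    have "(\<Oplus>\<^bsub>tensor R P N\<^esub>i\<in>T. pt (c i \<odot>\<^bsub>P\<^esub> y) (n i)) = (\<Oplus>\<^bsub>tensor R P N\<^esub>i\<in>T. pt y (c i \<odot>\<^bsub>N\<^esub> n i))"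
      using cR y T pt_closed by (intro t.M.finsum_cong') (auto simp: pt_smult_l pt_smult_r)
    also have "\<dots> = pt y (\<Oplus>\<^bsub>N\<^esub>i\<in>T. c i \<odot>\<^bsub>N\<^esub> n i)"
      using cR T by (intro l.map_finsum[symmetric]) auto
    also have "\<dots> = \<zero>\<^bsub>tensor R P N\<^esub>" using S[OF c] pt_zero_r[OF y] by simp
    finally show "(\<Oplus>\<^bsub>tensor R P N\<^esub>i\<in>T. pt (c i \<odot>\<^bsub>P\<^esub> y) (n i)) \<in> {\<zero>\<^bsub>tensor R P N\<^esub>}" by simp
  qed (use S in auto)
  then show ?thesis by simp
qed

section \<open>The equational criterion implies exactness\<close>

context ideal_filter begin

text \<open>
  An element \<open>\<Sum> p\<^sub>i \<otimes> l\<^sub>i\<close> that vanishes in \<open>Q \<otimes> M\<close> does so because of finitely many relations in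
  \<open>M\<close>, and this is a system of linear equations for the \<open>p\<^sub>i\<close>. Let \<open>c\<close> annihilate the elements of \<open>M\<close>
  that occur. The criterion makes the \<open>p\<^sub>i\<close> a combination of solutions over \<open>R\<close> modulo \<open>c\<close>, and these
  are honest relations between the \<open>f l\<^sub>i\<close>, hence between the \<open>l\<^sub>i\<close>. So the element vanishes in \<open>Q \<otimes> L\<close>.
\<close>

lemma flat_eq_imp_exact:
  assumes Q: "module R Q" and flat: "\<And>c. c \<in> \<Gamma> \<Longrightarrow> flat_eq R Q c"
  shows "tensor_exact_on R Q (ann_by R \<Gamma>)"
  unfolding tensor_exact_on_def
proof (intro ballI allI impI)
  fix L M N :: "('a, 'u) module" and f g
  assume L: "L \<in> ann_by R \<Gamma>" and M: "M \<in> ann_by R \<Gamma>" and N: "N \<in> ann_by R \<Gamma>"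
    and ex: "short_exact R L M N f g"
  have Lm: "module R L" and Mm: "module R M" and Nm: "module R N" using L M N by (auto simp: ann_by_def)
  have f: "f \<in> mod_hom R L M" and g: "g \<in> mod_hom R M N" and inj: "inj_on f (carrier L)"
    using ex by (auto simp: short_exact_def)
  interpret TL: tensor_product R Q L by (intro tensor_product.intro Q Lm)
  interpret TM: tensor_product R Q M by (intro tensor_product.intro Q Mm)
  interpret tl: module R "tensor R Q L" by (rule TL.tensor_module)
  interpret tm: module R "tensor R Q M" by (rule TM.tensor_module)
  interpret f: linear_map R L M f by (intro linear_mapI Lm Mm f)
  note fh = tensor_map_hom[OF Q Q Lm Mm mod_hom_id f] and gh = tensor_map_hom[OF Q Q Mm Nm mod_hom_id g]
  interpret LF: linear_map R "tensor R Q L" "tensor R Q M" "tensor_map R Q M id f"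
    by (intro linear_mapI fh TL.tensor_module TM.tensor_module)
  interpret A: module R "self_module R" by (rule self_module[OF is_cring])
  let ?FM = "free_module R (carrier M)"
  interpret FM: module R ?FM by (rule free_module[OF is_cring])
  have id: "id \<in> carrier M \<rightarrow> carrier M" by auto
  interpret I: linear_map R ?FM M "lin_ext R M id"
    by (intro linear_mapI TM.N.lin_ext_hom[OF id] FM.module_axioms Mm)
  let ?K = "{c \<in> carrier ?FM. lin_ext R M id c = \<zero>\<^bsub>M\<^esub>}"
  let ?QL = "tensor R Q L" and ?QM = "tensor R Q M"
  have kernel: "x = \<zero>\<^bsub>?QL\<^esub>"
    if xc: "x \<in> carrier (?QL)" and fx: "tensor_map R Q M id f x = \<zero>\<^bsub>?QM\<^esub>" for x
  proof -
    obtain k :: nat and p n where p: "\<And>i. i < k \<Longrightarrow> p i \<in> carrier Q" and n: "\<And>i. i < k \<Longrightarrow> n i \<in> carrier L"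
      and x: "x = (\<Oplus>\<^bsub>?QL\<^esub>i\<in>{..<k}. TL.pt (p i) (n i))" by (rule TL.tensor_elem[OF xc]) blast
    have fn: "f (n i) \<in> carrier M" if "i < k" for i using n[OF that] by (rule f.closed)
    have "tensor_map R Q M id f x = (\<Oplus>\<^bsub>?QM\<^esub>i\<in>{..<k}. TM.pt (id (p i)) (f (n i)))"
      unfolding x by (rule tensor_map_sum[OF Q Q Lm Mm mod_hom_id f]) (use p n in auto)
    then have "(\<Oplus>\<^bsub>?QM\<^esub>i\<in>{..<k}. TM.pt (p i) (f (n i))) = \<zero>\<^bsub>?QM\<^esub>" using fx by simp
    from TM.tensor_zero_relations[OF _ _ _ this] have rel:
      "(\<lambda>y. \<Oplus>\<^bsub>Q\<^esub>i\<in>{..<k}. basis_vec R (f (n i)) y \<odot>\<^bsub>Q\<^esub> p i) \<in> lspan Q ?K"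
      using p fn by simp
    have K: "?K \<subseteq> fin_supp (carrier M) (self_module R)" by (auto simp: free_module_eq)
    obtain k' :: nat and \<kappa> v where \<kappa>: "\<And>s. s < k' \<Longrightarrow> \<kappa> s \<in> ?K" and v: "\<And>s. s < k' \<Longrightarrow> v s \<in> carrier Q"
      and eq: "(\<lambda>y. \<Oplus>\<^bsub>Q\<^esub>i\<in>{..<k}. basis_vec R (f (n i)) y \<odot>\<^bsub>Q\<^esub> p i) = (\<lambda>y. \<Oplus>\<^bsub>Q\<^esub>s\<in>{..<k'}. \<kappa> s y \<odot>\<^bsub>Q\<^esub> v s)"
      by (rule TL.P.lspan_finite[OF K rel]) blast
    \<comment> \<open>The vectors \<open>w t\<close> lift the elements \<open>f (l t)\<close>, and \<open>\<Sum> w t \<cdot> q t = 0\<close> in the free module.\<close>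
    define T where "T = {..<k} <+> {..<k'}"
    define w where "w = case_sum (\<lambda>i. basis_vec R (f (n i))) \<kappa>"
    define q where "q t = (if t \<in> T then case_sum p (\<lambda>s. \<ominus>\<^bsub>Q\<^esub> v s) t else \<zero>\<^bsub>Q\<^esub>)" for t
    define l :: "nat + nat \<Rightarrow> 'u" where "l = case_sum n (\<lambda>_. \<zero>\<^bsub>L\<^esub>)"
    have T: "finite T" by (simp add: T_def)
    have w: "w t \<in> fin_supp (carrier M) (self_module R)" "lin_ext R M id (w t) = f (l t)" if "t \<in> T" for t
      using that \<kappa> fn TM.N.lin_ext_basis_vec[OF id] f.zero basis_vec_fin_supp[OF fn]
      by (auto simp: T_def w_def l_def free_module_eq)
    have wR: "w t y \<in> carrier R" if "t \<in> T" for t y using fin_suppD(1)[OF w(1)[OF that], of y] by simp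
    have q: "q \<in> fin_supp T Q" by (rule fin_suppI'[OF T]) (auto simp: q_def T_def p v)
    have qQ: "q t \<in> carrier Q" for t by (rule fin_suppD(1)[OF q])
    have l: "l t \<in> carrier L" if "t \<in> T" for t using that n by (auto simp: T_def l_def)
    have rel0: "(\<Oplus>\<^bsub>Q\<^esub>t\<in>T. w t y \<odot>\<^bsub>Q\<^esub> q t) = \<zero>\<^bsub>Q\<^esub>" for y
    proof -
      have \<kappa>R: "\<kappa> s y \<in> carrier R" if "s < k'" for s using wR[of "Inr s"] that by (auto simp: T_def w_def)
      have "(\<Oplus>\<^bsub>Q\<^esub>t\<in>T. w t y \<odot>\<^bsub>Q\<^esub> q t) = (\<Oplus>\<^bsub>Q\<^esub>i\<in>{..<k}. w (Inl i) y \<odot>\<^bsub>Q\<^esub> q (Inl i)) \<oplus>\<^bsub>Q\<^esub> (\<Oplus>\<^bsub>Q\<^esub>s\<in>{..<k'}. w (Inr s) y \<odot>\<^bsub>Q\<^esub> q (Inr s))"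
        using wR qQ unfolding T_def by (intro TL.P.finsum_Plus) auto
      also have "(\<Oplus>\<^bsub>Q\<^esub>i\<in>{..<k}. w (Inl i) y \<odot>\<^bsub>Q\<^esub> q (Inl i)) = (\<Oplus>\<^bsub>Q\<^esub>i\<in>{..<k}. basis_vec R (f (n i)) y \<odot>\<^bsub>Q\<^esub> p i)"
        using p by (intro TL.P.M.finsum_cong') (auto simp: w_def q_def T_def)
      also have "\<dots> = (\<Oplus>\<^bsub>Q\<^esub>s\<in>{..<k'}. \<kappa> s y \<odot>\<^bsub>Q\<^esub> v s)" by (rule fun_cong[OF eq])
      also have "(\<Oplus>\<^bsub>Q\<^esub>s\<in>{..<k'}. w (Inr s) y \<odot>\<^bsub>Q\<^esub> q (Inr s)) = (\<Oplus>\<^bsub>Q\<^esub>s\<in>{..<k'}. \<ominus>\<^bsub>Q\<^esub> (\<kappa> s y \<odot>\<^bsub>Q\<^esub> v s))"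
        using v \<kappa>R by (intro TL.P.M.finsum_cong') (auto simp: w_def q_def T_def TL.P.smult_r_minus)
      also have "\<dots> = \<ominus>\<^bsub>Q\<^esub> (\<Oplus>\<^bsub>Q\<^esub>s\<in>{..<k'}. \<kappa> s y \<odot>\<^bsub>Q\<^esub> v s)" using \<kappa>R v by (intro TL.P.finsum_neg) auto
      finally show ?thesis using \<kappa>R v by (simp add: TL.P.M.r_neg TL.P.M.finsum_closed Pi_iff)
    qed
    define Z where "Z = (\<Union>t\<in>T. {y. w t y \<noteq> \<zero>})"
    have Z: "finite Z" "Z \<subseteq> carrier M" using T fin_suppD(2,3)[OF w(1)] by (auto simp: Z_def)
    obtain c where c: "c \<in> \<Gamma>" "\<And>z r. z \<in> Z \<Longrightarrow> r \<in> c \<Longrightarrow> r \<odot>\<^bsub>M\<^esub> z = \<zero>\<^bsub>M\<^esub>" using annihilate_finite[OF M Z] by blast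
    have "q \<in> lspan Q {b \<in> fin_supp T (self_module R). \<forall>y. (\<Oplus>t\<in>T. w t y \<otimes> b t) \<in> c}"
      by (rule TL.P.flat_eq_matrix[OF flat[OF c(1)] ideals[OF c(1)] T w(1) q]) (simp_all add: rel0 ismult.zero)
    then have "(\<Oplus>\<^bsub>?QL\<^esub>t\<in>T. TL.pt (q t) (l t)) = \<zero>\<^bsub>?QL\<^esub>"
    proof (rule TL.sum_pt_relations[OF T l, rotated -1])
      fix b assume "b \<in> {b \<in> fin_supp T (self_module R). \<forall>y. (\<Oplus>t\<in>T. w t y \<otimes> b t) \<in> c}"
      then have b: "b \<in> fin_supp T (self_module R)" and bc: "\<And>y. (\<Oplus>t\<in>T. w t y \<otimes> b t) \<in> c" by auto
      have bR: "b t \<in> carrier R" for t using fin_suppD(1)[OF b, of t] by simp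
      have bw: "b t \<odot>\<^bsub>?FM\<^esub> w t \<in> carrier ?FM" if "t \<in> T" for t
        using w(1)[OF that] bR by (intro FM.smult_closed) (simp_all add: free_module_eq)
      define d where "d = (\<Oplus>\<^bsub>?FM\<^esub>t\<in>T. b t \<odot>\<^bsub>?FM\<^esub> w t)"
      have dF: "d \<in> fin_supp (carrier M) (self_module R)"
        using FM.M.finsum_closed[of "\<lambda>t. b t \<odot>\<^bsub>?FM\<^esub> w t" T] bw by (simp add: d_def free_module_eq Pi_I)
      have d: "d y = (\<Oplus>t\<in>T. w t y \<otimes> b t)" for y
      proof -
        have "d = (\<lambda>y. \<Oplus>\<^bsub>self_module R\<^esub>t\<in>T. (b t \<odot>\<^bsub>?FM\<^esub> w t) y)"
          unfolding d_def free_module_eq by (rule A.fun_module_finsum[OF T]) (use bw in \<open>simp add: free_module_eq\<close>)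
        then have "d y = (\<Oplus>\<^bsub>self_module R\<^esub>t\<in>T. (b t \<odot>\<^bsub>?FM\<^esub> w t) y)" by (rule fun_cong)
        also have "\<dots> = (\<Oplus>t\<in>T. w t y \<otimes> b t)"
          unfolding self_module_finsum using bR wR by (intro finsum_cong') (auto simp: free_module_eq m_comm)
        finally show ?thesis .
      qed
      have "f (\<Oplus>\<^bsub>L\<^esub>t\<in>T. b t \<odot>\<^bsub>L\<^esub> l t) = (\<Oplus>\<^bsub>M\<^esub>t\<in>T. f (b t \<odot>\<^bsub>L\<^esub> l t))" using bR l by (intro f.map_finsum T) auto
      also have "\<dots> = (\<Oplus>\<^bsub>M\<^esub>t\<in>T. lin_ext R M id (b t \<odot>\<^bsub>?FM\<^esub> w t))"
      proof (rule TM.N.M.finsum_cong'[OF refl])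
        show "(\<lambda>t. lin_ext R M id (b t \<odot>\<^bsub>?FM\<^esub> w t)) \<in> T \<rightarrow> carrier M" using I.closed[OF bw] by blast
        show "f (b t \<odot>\<^bsub>L\<^esub> l t) = lin_ext R M id (b t \<odot>\<^bsub>?FM\<^esub> w t)" if "t \<in> T" for t
          using I.smult[OF bR, of "w t" t] w[OF that] f.smult[OF bR l[OF that]] by (simp add: free_module_eq)
      qed
      also have "\<dots> = lin_ext R M id d" unfolding d_def by (rule I.map_finsum[OF T bw, symmetric])
      also have "\<dots> = (\<Oplus>\<^bsub>M\<^esub>y\<in>Z. d y \<odot>\<^bsub>M\<^esub> id y)"
      proof (intro TM.N.lin_ext_eq[OF dF id Z] subsetI)
        fix y assume "y \<in> {y. d y \<noteq> \<zero>}"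
        moreover have "d y = \<zero>" if "y \<notin> Z"
        proof -
          have "d y = (\<Oplus>t\<in>T. \<zero>)" unfolding d using bR that by (intro finsum_cong') (auto simp: Z_def)
          then show ?thesis by simp
        qed
        ultimately show "y \<in> Z" by blast
      qed
      also have "\<dots> = (\<Oplus>\<^bsub>M\<^esub>y\<in>Z. \<zero>\<^bsub>M\<^esub>)" using c(2) bc by (intro TM.N.M.finsum_cong') (auto simp: d)
      finally have "f (\<Oplus>\<^bsub>L\<^esub>t\<in>T. b t \<odot>\<^bsub>L\<^esub> l t) = f \<zero>\<^bsub>L\<^esub>" by (simp add: f.zero)
      moreover have "(\<Oplus>\<^bsub>L\<^esub>t\<in>T. b t \<odot>\<^bsub>L\<^esub> l t) \<in> carrier L" using bR l by (intro TL.N.M.finsum_closed) auto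
      ultimately show "b \<in> fin_supp T (self_module R) \<and> (\<Oplus>\<^bsub>L\<^esub>t\<in>T. b t \<odot>\<^bsub>L\<^esub> l t) = \<zero>\<^bsub>L\<^esub>"
        using b inj by (simp add: inj_on_eq_iff)
    qed
    moreover have "(\<Oplus>\<^bsub>?QL\<^esub>t\<in>T. TL.pt (q t) (l t)) = x"
    proof -
      have "(\<Oplus>\<^bsub>?QL\<^esub>t\<in>T. TL.pt (q t) (l t)) = (\<Oplus>\<^bsub>?QL\<^esub>i\<in>{..<k}. TL.pt (q (Inl i)) (l (Inl i)))
          \<oplus>\<^bsub>?QL\<^esub> (\<Oplus>\<^bsub>?QL\<^esub>s\<in>{..<k'}. TL.pt (q (Inr s)) (l (Inr s)))"
        using qQ l unfolding T_def by (intro tl.finsum_Plus) (auto intro!: TL.pt_closed)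
      also have "(\<Oplus>\<^bsub>?QL\<^esub>i\<in>{..<k}. TL.pt (q (Inl i)) (l (Inl i))) = x"
        unfolding x using p n by (intro tl.M.finsum_cong') (auto simp: q_def l_def T_def TL.pt_closed)
      also have "(\<Oplus>\<^bsub>?QL\<^esub>s\<in>{..<k'}. TL.pt (q (Inr s)) (l (Inr s))) = (\<Oplus>\<^bsub>?QL\<^esub>s\<in>{..<k'}. \<zero>\<^bsub>?QL\<^esub>)"
        using qQ by (intro tl.M.finsum_cong') (auto simp: l_def TL.pt_zero_r)
      finally show ?thesis using xc by simp
    qed
    ultimately show ?thesis by simp
  qed
  have "inj_on (tensor_map R Q M id f) (carrier (?QL))"
    by (rule LF.inj_onI_kernel) (rule kernel)
  then show "short_exact R (tensor R Q L) (tensor R Q M) (tensor R Q N)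
      (tensor_map R Q M id f) (tensor_map R Q N id g)"
    unfolding short_exact_def using fh(1) gh(1) tensor_right_exact[OF Q Lm Mm Nm ex] by simp
qed

end

section \<open>Tensor products with cyclic modules\<close>

context tensor_product begin

lemma cyclic_multiple:
  assumes \<pi>: "\<pi> \<in> mod_hom R (self_module R) N" "\<pi> ` carrier R = carrier N" and n: "n \<in> carrier N"
  shows "\<exists>a\<in>carrier R. n = a \<odot>\<^bsub>N\<^esub> \<pi> \<one>"
proof -
  have "n \<in> \<pi> ` carrier R" unfolding \<pi>(2) by (rule n)
  then obtain a where "a \<in> carrier R" "n = \<pi> a" by auto
  then show ?thesis using mod_hom_smult[OF \<pi>(1), of a \<one>] by auto
qed

lemma tensor_cyclic_elem:
  assumes \<pi>: "\<pi> \<in> mod_hom R (self_module R) N" "\<pi> ` carrier R = carrier N"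
    and x: "x \<in> carrier (tensor R P N)"
  shows "\<exists>y\<in>carrier P. x = pt y (\<pi> \<one>)"
proof -
  have 1: "\<pi> \<one> \<in> carrier N" using mod_hom_closed[OF \<pi>(1)] by simp
  have "x \<in> (\<lambda>y. pt y (\<pi> \<one>)) ` carrier P"
  proof (rule tensor_generated[OF linear_map.image_submodule[OF pt_map_l[OF 1]] _ x])
    fix m n assume m: "m \<in> carrier P" and "n \<in> carrier N"
    then obtain a where a: "a \<in> carrier R" "n = a \<odot>\<^bsub>N\<^esub> \<pi> \<one>" using cyclic_multiple[OF \<pi>] by blast
    show "pt m n \<in> (\<lambda>y. pt y (\<pi> \<one>)) ` carrier P"
      using a m 1 by (intro image_eqI[of _ _ "a \<odot>\<^bsub>P\<^esub> m"]) (simp_all add: pt_smult_l pt_smult_r)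
  qed
  then show ?thesis by (elim imageE) (rule bexI)
qed

lemma tensor_cyclic_zero_iff:
  assumes \<pi>: "\<pi> \<in> mod_hom R (self_module R) N" "\<pi> ` carrier R = carrier N"
    and J: "ideal J R" and ker: "\<And>x. x \<in> carrier R \<Longrightarrow> \<pi> x = \<zero>\<^bsub>N\<^esub> \<longleftrightarrow> x \<in> J"
    and y: "y \<in> carrier P"
  shows "pt y (\<pi> \<one>) = \<zero>\<^bsub>tensor R P N\<^esub> \<longleftrightarrow> y \<in> ismult P J"
proof
  have 1: "\<pi> \<one> \<in> carrier N" using mod_hom_closed[OF \<pi>(1)] by simp
  have \<pi>1: "r \<odot>\<^bsub>N\<^esub> \<pi> \<one> = \<pi> r" if "r \<in> carrier R" for r using mod_hom_smult[OF \<pi>(1), of r \<one>] that by simp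
  interpret T: module R "tensor R P N" by (rule tensor_module)
  { assume "y \<in> ismult P J"
    then have "pt y (\<pi> \<one>) \<in> {\<zero>\<^bsub>tensor R P N\<^esub>}"
    proof (rule P.ismult_image[OF J tensor_module pt_hom_l[OF 1], rotated -1])
      show "submodule {\<zero>\<^bsub>tensor R P N\<^esub>} R (tensor R P N)" by (rule T.submoduleI) auto
      fix r y assume r: "r \<in> J" and y: "y \<in> carrier P"
      have rR: "r \<in> carrier R" by (rule ideal.Icarr[OF J r])
      then have "r \<odot>\<^bsub>N\<^esub> \<pi> \<one> = \<zero>\<^bsub>N\<^esub>" using \<pi>1 ker r by simp
      then show "pt (r \<odot>\<^bsub>P\<^esub> y) (\<pi> \<one>) \<in> {\<zero>\<^bsub>tensor R P N\<^esub>}"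
        using pt_zero_r[OF y] pt_smult_l[OF rR y 1] pt_smult_r[OF rR y 1] by simp
    qed
    then show "pt y (\<pi> \<one>) = \<zero>\<^bsub>tensor R P N\<^esub>" by simp }
  assume zero: "pt y (\<pi> \<one>) = \<zero>\<^bsub>tensor R P N\<^esub>"
  let ?S = "{b \<in> fin_supp {()} (self_module R). (\<Oplus>\<^bsub>N\<^esub>i\<in>{()}. b i \<odot>\<^bsub>N\<^esub> \<pi> \<one>) = \<zero>\<^bsub>N\<^esub>}"
  have unit_sum: "(\<Oplus>\<^bsub>N\<^esub>i\<in>{()}. b i \<odot>\<^bsub>N\<^esub> \<pi> \<one>) = b () \<odot>\<^bsub>N\<^esub> \<pi> \<one>" if "b () \<in> carrier R" for b
    using N.M.finsum_insert[of "{}" "()"] that 1 by simp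
  have yS: "(\<lambda>_. y) \<in> lspan P ?S"
  proof (rule tensor_generators_zero)
    show "\<exists>b\<in>fin_supp {()} (self_module R). (\<Oplus>\<^bsub>N\<^esub>i\<in>{()}. b i \<odot>\<^bsub>N\<^esub> \<pi> \<one>) = x" if x: "x \<in> carrier N" for x
    proof -
      obtain a where "a \<in> carrier R" "x = a \<odot>\<^bsub>N\<^esub> \<pi> \<one>" using cyclic_multiple[OF \<pi> x] by blast
      then show ?thesis by (intro bexI[of _ "\<lambda>_. a"] fin_suppI') (auto simp: unit_sum)
    qed
    show "(\<Oplus>\<^bsub>tensor R P N\<^esub>i\<in>{()}. pt y (\<pi> \<one>)) = \<zero>\<^bsub>tensor R P N\<^esub>"
      using zero T.M.finsum_insert[of "{}" "()"] by simp
  qed (use y 1 in \<open>auto intro: fin_suppI'\<close>)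
  have "(\<lambda>_. y) () \<in> ismult P J"
  proof (rule P.lspan_image[OF _ P.module_axioms linear_map.hom[OF P.eval_map] P.ismult_submodule[OF J] _ yS])
    fix b z assume b: "b \<in> ?S" and z: "z \<in> carrier P"
    have bR: "b () \<in> carrier R" using b fin_suppD(1)[of b "{()}" "self_module R" "()"] by simp
    then have "b () \<in> J" using b unit_sum[of b, OF bR] \<pi>1[OF bR] ker[OF bR] by simp
    then show "b () \<odot>\<^bsub>P\<^esub> z \<in> ismult P J" by (rule P.ismult_gen[OF J _ z])
  qed auto
  then show "y \<in> ismult P J" by simp
qed

end

section \<open>Exactness implies the equational criterion\<close>

text \<open>Quotients exist in every type into which the module embeds: use coset representatives.\<close>

lemma (in module) quotient_module_in_type:
  fixes \<iota> :: "'c \<Rightarrow> 'u"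
  assumes H: "submodule H R M" and \<iota>: "inj_on \<iota> (carrier M)"
  obtains N :: "('a, 'u) module" and \<pi> where "module R N" "\<pi> \<in> mod_hom R M N"
    "\<pi> ` carrier M = carrier N" "\<And>x. x \<in> carrier M \<Longrightarrow> \<pi> x = \<zero>\<^bsub>N\<^esub> \<longleftrightarrow> x \<in> H"
proof -
  interpret q: quotient R M H by (intro quotient.intro quotient_axioms.intro H module_axioms)
  let ?cos = "\<lambda>x. H +>\<^bsub>M\<^esub> x"
  define rep where "rep X = (SOME y. y \<in> X)" for X :: "'c set"
  have rep: "rep (?cos x) \<in> ?cos x" if "x \<in> carrier M" for x
    unfolding rep_def using q.rcos_self[OF that] by (rule someI)
  have repM: "rep (?cos x) \<in> carrier M" and cos_rep: "?cos (rep (?cos x)) = ?cos x" if x: "x \<in> carrier M" for x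
  proof -
    show "rep (?cos x) \<in> carrier M" using q.rcosD[OF x rep[OF x]] by simp
    then show "?cos (rep (?cos x)) = ?cos x" using q.rcos_eq_iff[OF _ x] q.rcosD[OF x rep[OF x]] by simp
  qed
  define \<pi> where "\<pi> x = \<iota> (rep (?cos x))" for x
  have \<pi>: "\<pi> x = \<pi> y \<longleftrightarrow> x \<ominus>\<^bsub>M\<^esub> y \<in> H" if x: "x \<in> carrier M" and y: "y \<in> carrier M" for x y
  proof -
    have "\<pi> x = \<pi> y \<longleftrightarrow> rep (?cos x) = rep (?cos y)"
      unfolding \<pi>_def by (rule inj_on_eq_iff[OF \<iota> repM[OF x] repM[OF y]])
    also have "\<dots> \<longleftrightarrow> ?cos x = ?cos y" using cos_rep[OF x] cos_rep[OF y] by metis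
    also have "\<dots> \<longleftrightarrow> x \<ominus>\<^bsub>M\<^esub> y \<in> H" by (rule q.rcos_eq_iff[OF x y])
    finally show ?thesis .
  qed
  define \<sigma> where "\<sigma> = inv_into (carrier M) \<pi>"
  have \<sigma>: "\<sigma> (\<pi> x) \<in> carrier M" "\<pi> (\<sigma> (\<pi> x)) = \<pi> x" if "x \<in> carrier M" for x
    unfolding \<sigma>_def using that by (auto intro: inv_into_into f_inv_into_f)
  have \<sigma>H: "\<sigma> (\<pi> x) \<ominus>\<^bsub>M\<^esub> x \<in> H" if "x \<in> carrier M" for x using \<pi>[OF \<sigma>(1)[OF that] that] \<sigma>(2)[OF that] by simp
  define N :: "('a, 'u) module" where "N = \<lparr>carrier = \<pi> ` carrier M, mult = undefined, one = undefined,
    zero = \<pi> \<zero>\<^bsub>M\<^esub>, add = (\<lambda>u v. \<pi> (\<sigma> u \<oplus>\<^bsub>M\<^esub> \<sigma> v)), smult = (\<lambda>a u. \<pi> (a \<odot>\<^bsub>M\<^esub> \<sigma> u))\<rparr>"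
  have add: "\<pi> (x \<oplus>\<^bsub>M\<^esub> y) = \<pi> x \<oplus>\<^bsub>N\<^esub> \<pi> y" if x: "x \<in> carrier M" and y: "y \<in> carrier M" for x y
  proof -
    have "(\<sigma> (\<pi> x) \<oplus>\<^bsub>M\<^esub> \<sigma> (\<pi> y)) \<ominus>\<^bsub>M\<^esub> (x \<oplus>\<^bsub>M\<^esub> y) = (\<sigma> (\<pi> x) \<ominus>\<^bsub>M\<^esub> x) \<oplus>\<^bsub>M\<^esub> (\<sigma> (\<pi> y) \<ominus>\<^bsub>M\<^esub> y)"
      using x y \<sigma>(1) by (simp add: a_minus_def M.minus_add M.a_ac)
    also have "\<dots> \<in> H" by (rule submoduleE(5)[OF H \<sigma>H[OF x] \<sigma>H[OF y]])
    finally show ?thesis using \<pi>[of "\<sigma> (\<pi> x) \<oplus>\<^bsub>M\<^esub> \<sigma> (\<pi> y)" "x \<oplus>\<^bsub>M\<^esub> y"] \<sigma>(1) x y by (simp add: N_def)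
  qed
  have smult: "\<pi> (a \<odot>\<^bsub>M\<^esub> x) = a \<odot>\<^bsub>N\<^esub> \<pi> x" if a: "a \<in> carrier R" and x: "x \<in> carrier M" for a x
  proof -
    have "a \<odot>\<^bsub>M\<^esub> \<sigma> (\<pi> x) \<ominus>\<^bsub>M\<^esub> a \<odot>\<^bsub>M\<^esub> x \<in> H"
      using submoduleE(4)[OF H a \<sigma>H[OF x]] smult_r_diff[OF a \<sigma>(1)[OF x] x] by simp
    then show ?thesis using \<pi>[of "a \<odot>\<^bsub>M\<^esub> \<sigma> (\<pi> x)" "a \<odot>\<^bsub>M\<^esub> x"] \<sigma>(1) a x by (simp add: N_def)
  qed
  have "module R N"
    by (rule module_image'[of \<pi>]) (use add smult in \<open>auto simp: N_def\<close>)
  moreover have "\<pi> \<in> mod_hom R M N"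
    by (rule mod_homI) (use add smult in \<open>auto simp: N_def\<close>)
  moreover have "\<pi> x = \<zero>\<^bsub>N\<^esub> \<longleftrightarrow> x \<in> H" if "x \<in> carrier M" for x
    using \<pi>[OF that M.zero_closed] that by (simp add: N_def a_minus_def)
  ultimately show ?thesis by (intro that[of N \<pi>]) (simp_all add: N_def)
qed

lemma (in cring) ideal_submodule:
  assumes "ideal c R" shows "submodule c R (self_module R)"
proof -
  interpret A: module R "self_module R" by (rule self_module[OF is_cring])
  interpret c: ideal c R by (rule assms)
  show ?thesis by (rule A.submoduleI) (auto simp: c.Icarr c.I_l_closed)
qed

lemma (in cring) cyclic_module_in_type:
  fixes \<iota> :: "'a \<Rightarrow> 'u"
  assumes J: "ideal J R" and \<iota>: "inj_on \<iota> (carrier R)"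
  obtains N :: "('a, 'u) module" and \<pi> where "module R N" "\<pi> \<in> mod_hom R (self_module R) N"
    "\<pi> ` carrier R = carrier N" "\<And>x. x \<in> carrier R \<Longrightarrow> \<pi> x = \<zero>\<^bsub>N\<^esub> \<longleftrightarrow> x \<in> J"
proof -
  interpret A: module R "self_module R" by (rule self_module[OF is_cring])
  show ?thesis
  proof (rule A.quotient_module_in_type[OF ideal_submodule[OF J], of \<iota>])
    show "inj_on \<iota> (carrier (self_module R))" using \<iota> by simp
    fix N :: "('a, 'u) module" and \<pi>
    assume "module R N" "\<pi> \<in> mod_hom R (self_module R) N" "\<pi> ` carrier (self_module R) = carrier N"
      "\<And>x. x \<in> carrier (self_module R) \<Longrightarrow> \<pi> x = \<zero>\<^bsub>N\<^esub> \<longleftrightarrow> x \<in> J"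
    then show ?thesis by (intro that[of N \<pi>]) simp_all
  qed
qed

context ideal_filter begin

text \<open>
  The exact sequence \<open>L \<rightarrow> R/c \<rightarrow> (R/c)/L\<close>, in which \<open>L\<close> is generated by the residue classes of the \<open>r\<^sub>i\<close>.
  The element \<open>\<Sum> q\<^sub>i \<otimes> r\<^sub>i\<close> vanishes in \<open>Q \<otimes> R/c\<close>, hence in \<open>Q \<otimes> L\<close>, and the relations between the
  generators of \<open>L\<close> are those required.
\<close>

lemma exact_imp_flat_eq:
  fixes \<iota> :: "'a \<Rightarrow> 'u"
  assumes Q: "module R Q" and \<iota>: "inj_on \<iota> (carrier R)"
    and ex: "tensor_exact_on R Q (ann_by R \<Gamma> :: ('a, 'u) module set)" and c\<Gamma>: "c \<in> \<Gamma>"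
  shows "flat_eq R Q c"
  unfolding flat_eq_def
proof (intro allI impI)
  fix k :: nat and r q
  assume r: "\<forall>i<k. r i \<in> carrier R" and q: "q \<in> fin_supp {..<k} Q"
    and rel: "(\<Oplus>\<^bsub>Q\<^esub>i\<in>{..<k}. r i \<odot>\<^bsub>Q\<^esub> q i) \<in> ismult Q c"
  interpret Q: module R Q by (rule Q)
  interpret A: module R "self_module R" by (rule self_module[OF is_cring])
  have c: "ideal c R" by (rule ideals[OF c\<Gamma>])
  have qQ: "q i \<in> carrier Q" for i by (rule fin_suppD(1)[OF q])
  obtain M :: "('a, 'u) module" and \<pi> where M: "module R M" and \<pi>: "\<pi> \<in> mod_hom R (self_module R) M"
    "\<pi> ` carrier R = carrier M" and ker: "\<And>x. x \<in> carrier R \<Longrightarrow> \<pi> x = \<zero>\<^bsub>M\<^esub> \<longleftrightarrow> x \<in> c"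
    by (rule cyclic_module_in_type[OF c \<iota>]) blast
  interpret M: module R M by (rule M)
  interpret \<pi>: linear_map R "self_module R" M \<pi>
    by (intro linear_mapI A.module_axioms M \<pi>(1))
  define n where "n i = \<pi> (r i)" for i
  have n: "n i \<in> carrier M" if "i \<in> {..<k}" for i using \<pi>.closed[of "r i"] r that by (simp add: n_def)
  define h where "h b = (\<Oplus>\<^bsub>M\<^esub>i\<in>{..<k}. b i \<odot>\<^bsub>M\<^esub> n i)" for b
  let ?Ak = "fun_module {..<k} (self_module R)"
  interpret h: linear_map R ?Ak M h unfolding h_def by (rule M.combination_map[OF finite_lessThan n])
  have h_eq: "h b = \<zero>\<^bsub>M\<^esub> \<longleftrightarrow> (\<Oplus>i\<in>{..<k}. r i \<otimes> b i) \<in> c" if b: "b \<in> fin_supp {..<k} (self_module R)" for b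
  proof -
    have bR: "b i \<in> carrier R" for i using fin_suppD(1)[OF b, of i] by simp
    have "h b = (\<Oplus>\<^bsub>M\<^esub>i\<in>{..<k}. \<pi> (r i \<otimes> b i))"
      unfolding h_def
    proof (rule M.M.finsum_cong')
      show "(\<lambda>i. \<pi> (r i \<otimes> b i)) \<in> {..<k} \<rightarrow> carrier M" using bR r \<pi>.closed by simp
      show "b i \<odot>\<^bsub>M\<^esub> n i = \<pi> (r i \<otimes> b i)" if "i \<in> {..<k}" for i
        using \<pi>.smult[OF bR[of i], of "r i"] bR r that by (simp add: n_def m_comm)
    qed rule
    also have "\<dots> = \<pi> (\<Oplus>\<^bsub>self_module R\<^esub>i\<in>{..<k}. r i \<otimes> b i)"
      using bR r by (intro \<pi>.map_finsum[symmetric]) auto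
    finally have "h b = \<pi> (\<Oplus>i\<in>{..<k}. r i \<otimes> b i)" by (simp only: self_module_finsum)
    moreover have "(\<Oplus>i\<in>{..<k}. r i \<otimes> b i) \<in> carrier R" using bR r by (intro finsum_closed) auto
    ultimately show ?thesis using ker by simp
  qed
  let ?H = "h ` carrier ?Ak"
  define L where "L = M\<lparr>carrier := ?H\<rparr>"
  have H: "submodule ?H R M" by (rule h.image_submodule)
  have L: "module R L" unfolding L_def by (rule submodule.submodule_is_module[OF H M])
  have LM: "carrier L \<subseteq> carrier M" using M.submoduleE(1)[OF H] by (simp add: L_def)
  obtain N :: "('a, 'u) module" and g where N: "module R N" and g: "g \<in> mod_hom R M N"
    "g ` carrier M = carrier N" and gker: "\<And>x. x \<in> carrier M \<Longrightarrow> g x = \<zero>\<^bsub>N\<^esub> \<longleftrightarrow> x \<in> ?H"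
    by (rule M.quotient_module_in_type[OF H inj_on_id]) blast
  interpret g: linear_map R M N g by (intro linear_mapI M N g(1))
  have inc: "linear_map R L M id"
    by (intro linear_mapI L M mod_homI) (use LM in \<open>auto simp: L_def\<close>)
  let ?QL = "tensor R Q L" and ?QM = "tensor R Q M"
  have "short_exact R L M N id g"
    unfolding short_exact_def using linear_map.hom[OF inc] g gker LM by (auto simp: L_def)
  moreover have killM: "s \<odot>\<^bsub>M\<^esub> x = \<zero>\<^bsub>M\<^esub>" if "x \<in> carrier M" and s: "s \<in> c" for x s
  proof -
    have "x \<in> \<pi> ` carrier R" unfolding \<pi>(2) by (rule that(1))
    then obtain a where a: "a \<in> carrier R" "x = \<pi> a" by auto
    have "\<pi> (s \<otimes> a) = \<zero>\<^bsub>M\<^esub>" using ker ideal.I_r_closed[OF c s a(1)] ideal.Icarr[OF c] by simp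
    then show ?thesis using \<pi>.smult[of s a] ideal.Icarr[OF c s] a by simp
  qed
  have "M \<in> ann_by R \<Gamma>" using M killM c\<Gamma> by (auto simp: ann_by_def)
  moreover have "L \<in> ann_by R \<Gamma>"
  proof -
    have "s \<odot>\<^bsub>L\<^esub> x = \<zero>\<^bsub>L\<^esub>" if "x \<in> carrier L" "s \<in> c" for x s
      using killM[OF subsetD[OF LM that(1)] that(2)] by (simp add: L_def)
    then show ?thesis using L c\<Gamma> by (auto simp: ann_by_def)
  qed
  moreover have "N \<in> ann_by R \<Gamma>"
  proof -
    have "s \<odot>\<^bsub>N\<^esub> y = \<zero>\<^bsub>N\<^esub>" if "y \<in> carrier N" and s: "s \<in> c" for y s
    proof -
      have "y \<in> g ` carrier M" unfolding g(2) by (rule that(1))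
      then obtain x where x: "x \<in> carrier M" "y = g x" by auto
      then show ?thesis using g.smult[OF ideal.Icarr[OF c s] x(1)] killM[OF x(1) s] g.zero by simp
    qed
    then show ?thesis using N c\<Gamma> by (auto simp: ann_by_def)
  qed
  ultimately have inj: "inj_on (tensor_map R Q M id id) (carrier (?QL))"
    using ex unfolding tensor_exact_on_def short_exact_def by blast
  interpret TL: tensor_product R Q L by (intro tensor_product.intro Q L)
  interpret TM: tensor_product R Q M by (intro tensor_product.intro Q M)
  interpret tl: module R "?QL" by (rule TL.tensor_module)
  interpret tm: module R "?QM" by (rule TM.tensor_module)
  interpret t: linear_map R "?QL" "?QM" "tensor_map R Q M id id"
    by (intro linear_mapI TL.tensor_module TM.tensor_module
        tensor_map_hom[OF Q Q L M mod_hom_id linear_map.hom[OF inc]])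
  have nL: "n i \<in> carrier L" if i: "i \<in> {..<k}" for i
    using basis_vec_fin_supp[OF i] M.combination_basis[OF finite_lessThan i n]
    by (auto simp: L_def h_def intro!: image_eqI[of _ _ "basis_vec R i"])
  have \<pi>1: "\<pi> \<one> \<in> carrier M" using \<pi>.closed[of \<one>] by simp
  let ?x = "\<Oplus>\<^bsub>?QL\<^esub>i\<in>{..<k}. TL.pt (q i) (n i)"
  have "tensor_map R Q M id id ?x = (\<Oplus>\<^bsub>?QM\<^esub>i\<in>{..<k}. TM.pt (id (q i)) (id (n i)))"
    by (rule tensor_map_sum[OF Q Q L M mod_hom_id linear_map.hom[OF inc]]) (use qQ nL in auto)
  also have "\<dots> = (\<Oplus>\<^bsub>?QM\<^esub>i\<in>{..<k}. TM.pt (r i \<odot>\<^bsub>Q\<^esub> q i) (\<pi> \<one>))"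
  proof (rule tm.M.finsum_cong')
    show "(\<lambda>i. TM.pt (r i \<odot>\<^bsub>Q\<^esub> q i) (\<pi> \<one>)) \<in> {..<k} \<rightarrow> carrier (?QM)"
      using r qQ \<pi>1 by (intro Pi_I TM.pt_closed) auto
    show "TM.pt (id (q i)) (id (n i)) = TM.pt (r i \<odot>\<^bsub>Q\<^esub> q i) (\<pi> \<one>)" if "i \<in> {..<k}" for i
      using \<pi>.smult[of "r i" \<one>] r that qQ \<pi>1 by (simp add: n_def TM.pt_smult_l TM.pt_smult_r)
  qed rule
  also have "\<dots> = TM.pt (\<Oplus>\<^bsub>Q\<^esub>i\<in>{..<k}. r i \<odot>\<^bsub>Q\<^esub> q i) (\<pi> \<one>)"
    using r qQ by (intro linear_map.map_finsum[OF TM.pt_map_l[OF \<pi>1], symmetric]) auto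
  also have "\<dots> = \<zero>\<^bsub>?QM\<^esub>"
    by (rule TM.tensor_cyclic_zero_iff[THEN iffD2, OF \<pi> c ker Q.ismult_closed[OF c rel] rel])
  finally have "tensor_map R Q M id id ?x = tensor_map R Q M id id \<zero>\<^bsub>?QL\<^esub>" using t.zero by simp
  moreover have "?x \<in> carrier (?QL)" using qQ nL by (intro tl.M.finsum_closed) (auto intro!: TL.pt_closed)
  ultimately have x0: "?x = \<zero>\<^bsub>?QL\<^esub>" using inj by (auto dest: inj_onD)
  have hL: "(\<Oplus>\<^bsub>L\<^esub>i\<in>{..<k}. b i \<odot>\<^bsub>L\<^esub> n i) = h b" if b: "b \<in> fin_supp {..<k} (self_module R)" for b
  proof -
    have "b i \<odot>\<^bsub>L\<^esub> n i \<in> carrier L" if "i \<in> {..<k}" for i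
      using nL[OF that] fin_suppD(1)[OF b, of i] by (intro TL.N.smult_closed) auto
    then show ?thesis
      using linear_map.map_finsum[OF inc, of "{..<k}" "\<lambda>i. b i \<odot>\<^bsub>L\<^esub> n i"] by (simp add: h_def L_def)
  qed
  have "q \<in> lspan Q {b \<in> fin_supp {..<k} (self_module R). (\<Oplus>\<^bsub>L\<^esub>i\<in>{..<k}. b i \<odot>\<^bsub>L\<^esub> n i) = \<zero>\<^bsub>L\<^esub>}"
  proof (rule TL.tensor_generators_zero[OF finite_lessThan nL _ q x0])
    fix x assume "x \<in> carrier L"
    then obtain b where "b \<in> fin_supp {..<k} (self_module R)" "x = h b" by (auto simp: L_def)
    then show "\<exists>b\<in>fin_supp {..<k} (self_module R). (\<Oplus>\<^bsub>L\<^esub>i\<in>{..<k}. b i \<odot>\<^bsub>L\<^esub> n i) = x" using hL by auto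
  qed
  moreover have "\<zero>\<^bsub>L\<^esub> = \<zero>\<^bsub>M\<^esub>" by (simp add: L_def)
  ultimately show "q \<in> lspan Q {b \<in> fin_supp {..<k} (self_module R). (\<Oplus>i\<in>{..<k}. r i \<otimes> b i) \<in> c}"
    using hL h_eq by (simp cong: conj_cong)
qed

theorem exact_iff_flat_eq:
  fixes \<iota> :: "'a \<Rightarrow> 'u"
  assumes "module R Q" and "inj_on \<iota> (carrier R)"
  shows "tensor_exact_on R Q (ann_by R \<Gamma> :: ('a, 'u) module set) \<longleftrightarrow> (\<forall>c\<in>\<Gamma>. flat_eq R Q c)"
  using exact_imp_flat_eq[OF assms] flat_eq_imp_exact[OF assms(1)] by blast

end

section \<open>Koszul complexes with coefficients\<close>

definition words :: "nat \<Rightarrow> bool list set"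
  where "words p = {s. length s = p}"

definition words_deg :: "nat \<Rightarrow> nat \<Rightarrow> bool list set"
  where "words_deg p q = {s. length s = p \<and> count_list s True = q}"

abbreviation zero_word :: "nat \<Rightarrow> bool list"
  where "zero_word p \<equiv> replicate p False"

lemma finite_words: "finite (words p)"
  using finite_lists_length_eq[of "UNIV :: bool set" p] by (simp add: words_def)

lemma words_deg_subset: "words_deg p q \<subseteq> words p"
  by (auto simp: words_def words_deg_def)

lemma finite_words_deg: "finite (words_deg p q)"
  using finite_subset[OF words_deg_subset finite_words] .

lemma count_zero_word: "count_list s True = 0 \<Longrightarrow> s = zero_word (length s)"
proof (induct s)
  case (Cons b s)
  then show ?case by (cases b) auto
qed simp

lemma words_deg_empty: "p < q \<Longrightarrow> words_deg p q = {}"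
proof -
  have "count_list s True \<le> length s" for s :: "bool list" by (rule count_le_length)
  then show "p < q \<Longrightarrow> words_deg p q = {}" unfolding words_deg_def using leD by auto
qed

text \<open>The differential of \<open>K(R; as) \<otimes> M\<close>, on functions from words to \<open>M\<close>.\<close>

fun kd :: "('a, 'm, 's) module_scheme \<Rightarrow> 'a list \<Rightarrow> (bool list \<Rightarrow> 'm) \<Rightarrow> bool list \<Rightarrow> 'm" where
  "kd M [] f s = \<zero>\<^bsub>M\<^esub>"
| "kd M (a # as) f [] = \<zero>\<^bsub>M\<^esub>"
| "kd M (a # as) f (False # s) = kd M as (\<lambda>t. f (False # t)) s \<oplus>\<^bsub>M\<^esub> a \<odot>\<^bsub>M\<^esub> f (True # s)"
| "kd M (a # as) f (True # s) = \<ominus>\<^bsub>M\<^esub> kd M as (\<lambda>t. f (True # t)) s"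

lemma koszul_d_eq: "koszul_d R as f s = kd (self_module R) as f s"
  by (induct R as f s rule: koszul_d.induct) simp_all

lemma (in cring) koszul_weight_closed [simp]:
  "set as \<subseteq> carrier R \<Longrightarrow> koszul_weight R e as s \<in> carrier R"
proof (induct as arbitrary: s)
  case (Cons a as)
  then show ?case by (cases s) auto
qed simp

lemma (in cring) koszul_weight_zero_word:
  "set as \<subseteq> carrier R \<Longrightarrow> koszul_weight R e as (zero_word p) = \<one>"
proof (induct as arbitrary: p)
  case (Cons a as)
  then show ?case by (cases p) auto
qed simp

lemma (in cring) koszul_weight_add:
  "set as \<subseteq> carrier R \<Longrightarrow>
    koszul_weight R (e + e') as s = koszul_weight R e as s \<otimes> koszul_weight R e' as s"
proof (induct as arbitrary: s)
  case (Cons a as)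
  show ?case
  proof (cases s)
    case [simp]: (Cons b t)
    have "koszul_weight R e as t \<in> carrier R" "koszul_weight R e' as t \<in> carrier R" "a \<in> carrier R"
      "a [^] e \<in> carrier R" "a [^] e' \<in> carrier R"
      using Cons.prems by auto
    then show ?thesis using Cons.hyps[of t] Cons.prems
      by (simp add: nat_pow_mult[symmetric] m_assoc) (simp add: m_lcomm)
  qed simp
qed simp

lemma seq_pow_closed: "cring R \<Longrightarrow> set as \<subseteq> carrier R \<Longrightarrow> set (seq_pow R as n) \<subseteq> carrier R"
  by (auto simp: seq_pow_def intro!: monoid.nat_pow_closed cring.axioms ring.is_monoid dest: cring.axioms(1))

lemma length_seq_pow [simp]: "length (seq_pow R as n) = length as"
  by (simp add: seq_pow_def)

context module begin

lemma kd_closed: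
  "set as \<subseteq> carrier R \<Longrightarrow> (\<And>s. f s \<in> carrier M) \<Longrightarrow> kd M as f s \<in> carrier M"
proof (induct as arbitrary: f s)
  case (Cons a as)
  then show ?case by (cases s; cases "hd s") auto
qed simp

lemma kd_zero [simp]: "set as \<subseteq> carrier R \<Longrightarrow> kd M as (\<lambda>_. \<zero>\<^bsub>M\<^esub>) s = \<zero>\<^bsub>M\<^esub>"
proof (induct as arbitrary: s)
  case (Cons a as)
  show ?case
  proof (cases s)
    case [simp]: (Cons b t)
    show ?thesis using Cons.hyps[of t] Cons.prems by (cases b) auto
  qed simp
qed simp

text \<open>The value at \<open>s\<close> involves only the words that have one more \<open>True\<close> than \<open>s\<close>.\<close>

lemma kd_cong:
  "length s = length as \<Longrightarrow>
   (\<And>t. length t = length as \<Longrightarrow> count_list t True = Suc (count_list s True) \<Longrightarrow> f t = g t) \<Longrightarrow>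
   kd M as f s = kd M as g s"
proof (induct as arbitrary: s f g)
  case (Cons a as)
  obtain b t where s: "s = b # t" using Cons.prems by (cases s) auto
  show ?case
  proof (cases b)
    case True
    have "kd M as (\<lambda>t. f (True # t)) t = kd M as (\<lambda>t. g (True # t)) t"
      using Cons.prems s True by (intro Cons.hyps) auto
    then show ?thesis using s True by simp
  next
    case False
    have "kd M as (\<lambda>t. f (False # t)) t = kd M as (\<lambda>t. g (False # t)) t"
      using Cons.prems s False by (intro Cons.hyps) auto
    moreover have "f (True # t) = g (True # t)" using Cons.prems s False by auto
    ultimately show ?thesis using s False by simp
  qed
qed simp

lemma kd_length:
  "set as \<subseteq> carrier R \<Longrightarrow> (\<And>t. length t \<noteq> length as \<Longrightarrow> f t = \<zero>\<^bsub>M\<^esub>) \<Longrightarrow> length s \<noteq> length as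
    \<Longrightarrow> kd M as f s = \<zero>\<^bsub>M\<^esub>"
proof (induct as arbitrary: s f)
  case (Cons a as)
  show ?case
  proof (cases s)
    case [simp]: (Cons b t)
    have "kd M as (\<lambda>t. f (b # t)) t = \<zero>\<^bsub>M\<^esub>"
      using Cons.prems by (intro Cons.hyps) auto
    moreover have "f (True # t) = \<zero>\<^bsub>M\<^esub>" using Cons.prems by auto
    ultimately show ?thesis using Cons.prems by (cases b) auto
  qed simp
qed simp

lemma kd_deg:
  assumes as: "set as \<subseteq> carrier R" and f: "\<And>t. t \<notin> words_deg (length as) q \<Longrightarrow> f t = \<zero>\<^bsub>M\<^esub>"
    and s: "\<not> (length s = length as \<and> Suc (count_list s True) = q)"
  shows "kd M as f s = \<zero>\<^bsub>M\<^esub>"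
proof (cases "length s = length as")
  case True
  then have "kd M as f s = kd M as (\<lambda>_. \<zero>\<^bsub>M\<^esub>) s"
    using s by (intro kd_cong) (auto intro!: f simp: words_deg_def)
  then show ?thesis using as by simp
next
  case False
  then show ?thesis using as by (intro kd_length) (auto intro!: f simp: words_deg_def)
qed

end

lemma (in linear_map) kd_map:
  "set as \<subseteq> carrier R \<Longrightarrow> (\<And>s. f s \<in> carrier M) \<Longrightarrow> h (kd M as f s) = kd N as (\<lambda>t. h (f t)) s"
proof (induct as arbitrary: f s)
  case Nil
  then show ?case by (simp add: zero)
next
  case (Cons a as)
  show ?case
  proof (cases s)
    case Nil
    then show ?thesis by (simp add: zero)
  next
    case [simp]: (Cons b t)
    have 1: "h (kd M as (\<lambda>t. f (b # t)) t) = kd N as (\<lambda>t. h (f (b # t))) t"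
      using Cons.prems by (intro Cons.hyps) auto
    have 2: "kd M as (\<lambda>t. f (b # t)) t \<in> carrier M"
      using Cons.prems by (intro M.kd_closed) auto
    show ?thesis using 1 2 Cons.prems by (cases b) (simp_all add: neg add smult)
  qed
qed

lemma cring_self_map: "module R M \<Longrightarrow> y \<in> carrier M \<Longrightarrow> linear_map R (self_module R) M (\<lambda>r. r \<odot>\<^bsub>M\<^esub> y)"
proof -
  assume "module R M" and y: "y \<in> carrier M"
  then interpret module R M by simp
  show ?thesis
    by (intro linear_mapI mod_homI self_module[OF R.is_cring] module_axioms)
      (use y in \<open>auto simp: smult_l_distr smult_assoc1\<close>)
qed

context module begin

lemma kd_lmult:
  assumes "set as \<subseteq> carrier R" "\<And>s. c s \<in> carrier R" "y \<in> carrier M"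
  shows "kd M as (\<lambda>s. c s \<odot>\<^bsub>M\<^esub> y) s = kd (self_module R) as c s \<odot>\<^bsub>M\<^esub> y"
  using linear_map.kd_map[OF cring_self_map[OF module_axioms assms(3)] assms(1), of c s] assms(2) by simp

lemma kd_fun_module:
  assumes "set as \<subseteq> carrier R" "\<And>s. f s \<in> fin_supp X M"
  shows "kd (fun_module X M) as f s x = kd M as (\<lambda>t. f t x) s"
  using linear_map.kd_map[OF eval_map[of X x] assms(1), of f s] assms(2) by simp

lemma kd_add:
  assumes "set as \<subseteq> carrier R" "\<And>s. f s \<in> carrier M" "\<And>s. g s \<in> carrier M"
  shows "kd M as (\<lambda>s. f s \<oplus>\<^bsub>M\<^esub> g s) s = kd M as f s \<oplus>\<^bsub>M\<^esub> kd M as g s"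
  using assms
proof (induct as arbitrary: f g s)
  case (Cons a as)
  show ?case
  proof (cases s)
    case [simp]: (Cons b t)
    have 1: "kd M as (\<lambda>t. f (b # t) \<oplus>\<^bsub>M\<^esub> g (b # t)) t = kd M as (\<lambda>t. f (b # t)) t \<oplus>\<^bsub>M\<^esub> kd M as (\<lambda>t. g (b # t)) t"
      using Cons.prems by (intro Cons.hyps) auto
    have 2: "kd M as (\<lambda>t. f (b # t)) t \<in> carrier M" "kd M as (\<lambda>t. g (b # t)) t \<in> carrier M"
      using Cons.prems by (auto intro!: kd_closed)
    have 3: "a \<odot>\<^bsub>M\<^esub> f (True # t) \<in> carrier M" "a \<odot>\<^bsub>M\<^esub> g (True # t) \<in> carrier M" using Cons.prems by auto
    show ?thesis using 1 2 3 Cons.prems by (cases b) (simp_all add: M.minus_add smult_r_distr M.a_ac)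
  qed simp
qed simp

lemma kd_smult:
  assumes "set as \<subseteq> carrier R" "\<And>s. f s \<in> carrier M" "a \<in> carrier R"
  shows "kd M as (\<lambda>s. a \<odot>\<^bsub>M\<^esub> f s) s = a \<odot>\<^bsub>M\<^esub> kd M as f s"
proof -
  have "linear_map R M M (\<lambda>x. a \<odot>\<^bsub>M\<^esub> x)"
    by (intro linear_mapI mod_homI module_axioms)
      (use assms(3) in \<open>auto simp: smult_r_distr smult_lcomm\<close>)
  from linear_map.kd_map[OF this assms(1), of f s] show ?thesis using assms(2) by simp
qed

lemma kd_hom:
  assumes as: "set as \<subseteq> carrier R"
  shows "kd M as \<in> mod_hom R (fun_module (words (length as)) M) (fun_module (words (length as)) M)"
proof (rule mod_homI)
  fix f assume "f \<in> carrier (fun_module (words (length as)) M)"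
  then have f: "f \<in> fin_supp (words (length as)) M" by simp
  show "kd M as f \<in> carrier (fun_module (words (length as)) M)"
    unfolding fun_module_simps
    using fin_suppD[OF f] as by (intro fin_suppI'[OF finite_words] kd_closed kd_length) (auto simp: words_def)
  show "kd M as (a \<odot>\<^bsub>fun_module (words (length as)) M\<^esub> f) = a \<odot>\<^bsub>fun_module (words (length as)) M\<^esub> kd M as f"
    if "a \<in> carrier R" for a
    using kd_smult[OF as fin_suppD(1)[OF f] that] by (simp add: fun_eq_iff)
  fix g assume "g \<in> carrier (fun_module (words (length as)) M)"
  then have g: "g \<in> fin_supp (words (length as)) M" by simp
  show "kd M as (f \<oplus>\<^bsub>fun_module (words (length as)) M\<^esub> g) =
    kd M as f \<oplus>\<^bsub>fun_module (words (length as)) M\<^esub> kd M as g"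
    using kd_add[OF as fin_suppD(1)[OF f] fin_suppD(1)[OF g]] by (simp add: fun_eq_iff)
qed

lemma kd_map_words:
  assumes as: "set as \<subseteq> carrier R" and p: "p = length as"
  shows "linear_map R (fun_module (words p) M) (fun_module (words p) M) (kd M as)"
  unfolding p by (intro linear_mapI fun_module kd_hom as)

lemma kd_neg:
  assumes "set as \<subseteq> carrier R" "\<And>s. f s \<in> carrier M"
  shows "kd M as (\<lambda>s. \<ominus>\<^bsub>M\<^esub> f s) s = \<ominus>\<^bsub>M\<^esub> kd M as f s"
  using kd_smult[of as f "\<ominus> \<one>" s] assms kd_closed[of as f s] by (simp add: smult_l_minus)

lemma kd_diff:
  assumes "set as \<subseteq> carrier R" "\<And>s. f s \<in> carrier M" "\<And>s. g s \<in> carrier M"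
  shows "kd M as (\<lambda>s. f s \<ominus>\<^bsub>M\<^esub> g s) s = kd M as f s \<ominus>\<^bsub>M\<^esub> kd M as g s"
  using kd_add[of as f "\<lambda>s. \<ominus>\<^bsub>M\<^esub> g s" s] kd_neg[of as g s] assms by (simp add: a_minus_def)

lemma kd_kd:
  assumes "set as \<subseteq> carrier R" "\<And>s. f s \<in> carrier M"
  shows "kd M as (kd M as f) s = \<zero>\<^bsub>M\<^esub>"
  using assms
proof (induct as arbitrary: f s)
  case (Cons a as)
  have as: "set as \<subseteq> carrier R" "a \<in> carrier R" using Cons.prems by auto
  show ?case
  proof (cases s)
    case [simp]: (Cons b t)
    let ?F = "\<lambda>t. f (False # t)" and ?T = "\<lambda>t. f (True # t)"
    have IH: "kd M as (kd M as ?F) t = \<zero>\<^bsub>M\<^esub>" "kd M as (kd M as ?T) t = \<zero>\<^bsub>M\<^esub>"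
      using Cons.prems by (auto intro!: Cons.hyps)
    have cl: "kd M as ?F u \<in> carrier M" "kd M as ?T u \<in> carrier M" for u
      using Cons.prems by (auto intro!: kd_closed)
    have T: "(\<lambda>t. kd M (a # as) f (True # t)) = (\<lambda>t. \<ominus>\<^bsub>M\<^esub> kd M as ?T t)" by simp
    have F: "(\<lambda>t. kd M (a # as) f (False # t)) = (\<lambda>t. kd M as ?F t \<oplus>\<^bsub>M\<^esub> a \<odot>\<^bsub>M\<^esub> f (True # t))" by simp
    show ?thesis
    proof (cases b)
      case True
      then show ?thesis unfolding Cons kd.simps T
        using kd_neg[OF as(1), of "kd M as ?T" t] cl IH by simp
    next
      case False
      have "kd M as (\<lambda>t. kd M as ?F t \<oplus>\<^bsub>M\<^esub> a \<odot>\<^bsub>M\<^esub> f (True # t)) t = a \<odot>\<^bsub>M\<^esub> kd M as ?T t"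
        using kd_add[OF as(1), of "kd M as ?F" "\<lambda>t. a \<odot>\<^bsub>M\<^esub> f (True # t)" t] kd_smult[OF as(1), of ?T a t]
          IH cl as Cons.prems by simp
      then show ?thesis using False F cl as by (simp add: smult_r_minus M.r_neg)
    qed
  qed simp
qed simp

lemma kd_trans:
  assumes "set as \<subseteq> carrier R" "\<And>s. f s \<in> carrier M"
  shows "kd M (seq_pow R as n) (\<lambda>s. koszul_weight R e as s \<odot>\<^bsub>M\<^esub> f s) s
    = koszul_weight R e as s \<odot>\<^bsub>M\<^esub> kd M (seq_pow R as (n + e)) f s"
  using assms
proof (induct as arbitrary: f s)
  case Nil
  then show ?case by (simp add: seq_pow_def)
next
  case (Cons a as)
  have as: "set as \<subseteq> carrier R" "a \<in> carrier R" and f: "\<And>s. f s \<in> carrier M" using Cons.prems by auto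
  have sp: "seq_pow R (a # as) m = a [^] m # seq_pow R as m" for m by (simp add: seq_pow_def)
  have spc: "set (seq_pow R as m) \<subseteq> carrier R" for m by (rule seq_pow_closed[OF R.is_cring as(1)])
  have w: "koszul_weight R e as t \<in> carrier R" for t by (rule R.koszul_weight_closed[OF as(1)])
  show ?case
  proof (cases s)
    case Nil
    then show ?thesis by (simp add: sp)
  next
    case [simp]: (Cons b t)
    have IH: "kd M (seq_pow R as n) (\<lambda>t. koszul_weight R e as t \<odot>\<^bsub>M\<^esub> f (b # t)) t
      = koszul_weight R e as t \<odot>\<^bsub>M\<^esub> kd M (seq_pow R as (n + e)) (\<lambda>t. f (b # t)) t"
      using Cons.prems by (intro Cons.hyps) auto
    have cl: "kd M (seq_pow R as (n + e)) (\<lambda>t. f (b # t)) t \<in> carrier M" using f by (intro kd_closed spc)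
    show ?thesis
    proof (cases b)
      case True
      have "kd M (seq_pow R as n) (\<lambda>t. koszul_weight R e (a # as) (True # t) \<odot>\<^bsub>M\<^esub> f (True # t)) t
          = kd M (seq_pow R as n) (\<lambda>t. a [^] e \<odot>\<^bsub>M\<^esub> (koszul_weight R e as t \<odot>\<^bsub>M\<^esub> f (True # t))) t"
        using w as f by (simp add: smult_assoc1)
      also have "\<dots> = a [^] e \<odot>\<^bsub>M\<^esub> kd M (seq_pow R as n) (\<lambda>t. koszul_weight R e as t \<odot>\<^bsub>M\<^esub> f (True # t)) t"
        using w as f by (intro kd_smult spc) auto
      finally show ?thesis using IH True w as cl by (simp add: sp smult_assoc1 smult_r_minus)
    next
      case False
      have "a [^] n \<odot>\<^bsub>M\<^esub> ((a [^] e \<otimes> koszul_weight R e as t) \<odot>\<^bsub>M\<^esub> f (True # t))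
        = koszul_weight R e as t \<odot>\<^bsub>M\<^esub> (a [^] (n + e) \<odot>\<^bsub>M\<^esub> f (True # t))"
        using w as f by (simp add: smult_assoc1[symmetric] R.nat_pow_mult[symmetric] R.m_ac)
      then show ?thesis using IH False w as f cl
        by (simp add: sp smult_r_distr)
    qed
  qed
qed

end

text \<open>
  Exterior multiplication by the \<open>l\<close>-th basis vector. It is a homotopy between zero and
  multiplication by the \<open>l\<close>-th entry of the sequence.
\<close>

fun hk :: "('a, 'm, 's) module_scheme \<Rightarrow> nat \<Rightarrow> (bool list \<Rightarrow> 'm) \<Rightarrow> bool list \<Rightarrow> 'm" where
  "hk M l f [] = \<zero>\<^bsub>M\<^esub>"
| "hk M 0 f (False # s) = \<zero>\<^bsub>M\<^esub>"
| "hk M 0 f (True # s) = f (False # s)"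
| "hk M (Suc l) f (False # s) = hk M l (\<lambda>t. f (False # t)) s"
| "hk M (Suc l) f (True # s) = \<ominus>\<^bsub>M\<^esub> hk M l (\<lambda>t. f (True # t)) s"

context module begin

lemma hk_closed: "(\<And>s. f s \<in> carrier M) \<Longrightarrow> hk M l f s \<in> carrier M"
proof (induct s arbitrary: l f)
  case (Cons b s)
  then show ?case by (cases l; cases b) auto
qed simp

lemma hk_add:
  "(\<And>s. f s \<in> carrier M) \<Longrightarrow> (\<And>s. g s \<in> carrier M) \<Longrightarrow>
    hk M l (\<lambda>s. f s \<oplus>\<^bsub>M\<^esub> g s) s = hk M l f s \<oplus>\<^bsub>M\<^esub> hk M l g s"
proof (induct s arbitrary: l f g)
  case (Cons b s)
  have "hk M k (\<lambda>t. f (b # t) \<oplus>\<^bsub>M\<^esub> g (b # t)) s = hk M k (\<lambda>t. f (b # t)) s \<oplus>\<^bsub>M\<^esub> hk M k (\<lambda>t. g (b # t)) s" for k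
    using Cons.prems by (intro Cons.hyps) auto
  then show ?case using Cons.prems by (cases l; cases b) (auto simp: M.minus_add hk_closed)
qed simp

lemma hk_smult:
  "(\<And>s. f s \<in> carrier M) \<Longrightarrow> a \<in> carrier R \<Longrightarrow> hk M l (\<lambda>s. a \<odot>\<^bsub>M\<^esub> f s) s = a \<odot>\<^bsub>M\<^esub> hk M l f s"
proof (induct s arbitrary: l f)
  case (Cons b s)
  have "hk M k (\<lambda>t. a \<odot>\<^bsub>M\<^esub> f (b # t)) s = a \<odot>\<^bsub>M\<^esub> hk M k (\<lambda>t. f (b # t)) s" for k
    using Cons.prems by (intro Cons.hyps) auto
  then show ?case using Cons.prems by (cases l; cases b) (auto simp: smult_r_minus hk_closed)
qed simp

lemma hk_length:
  "(\<And>t. length t \<noteq> p \<Longrightarrow> f t = \<zero>\<^bsub>M\<^esub>) \<Longrightarrow> length s \<noteq> p \<Longrightarrow> hk M l f s = \<zero>\<^bsub>M\<^esub>"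
proof (induct s arbitrary: l f p)
  case (Cons b s)
  have "hk M k (\<lambda>t. f (b # t)) s = \<zero>\<^bsub>M\<^esub>" for k
  proof (cases p)
    case 0
    then have "f (b # t) = \<zero>\<^bsub>M\<^esub>" for t using Cons.prems by auto
    then show ?thesis by (intro Cons.hyps[of "Suc (length s)"]) auto
  next
    case (Suc p')
    then show ?thesis using Cons.prems by (intro Cons.hyps[of p']) auto
  qed
  then show ?case using Cons.prems by (cases l; cases b) auto
qed simp

lemma hk_hom: "hk M l \<in> mod_hom R (fun_module (words p) M) (fun_module (words p) M)"
proof (rule mod_homI)
  fix f assume "f \<in> carrier (fun_module (words p) M)"
  then have f: "f \<in> fin_supp (words p) M" by simp
  show "hk M l f \<in> carrier (fun_module (words p) M)"
    unfolding fun_module_simps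
    using fin_suppD[OF f] by (intro fin_suppI'[OF finite_words] hk_closed hk_length[of p]) (auto simp: words_def)
  show "hk M l (a \<odot>\<^bsub>fun_module (words p) M\<^esub> f) = a \<odot>\<^bsub>fun_module (words p) M\<^esub> hk M l f"
    if "a \<in> carrier R" for a
    using hk_smult[OF fin_suppD(1)[OF f] that] by (simp add: fun_eq_iff)
  fix g assume "g \<in> carrier (fun_module (words p) M)"
  then have g: "g \<in> fin_supp (words p) M" by simp
  show "hk M l (f \<oplus>\<^bsub>fun_module (words p) M\<^esub> g) =
    hk M l f \<oplus>\<^bsub>fun_module (words p) M\<^esub> hk M l g"
    using hk_add[OF fin_suppD(1)[OF f] fin_suppD(1)[OF g]] by (simp add: fun_eq_iff)
qed

lemma hk_homotopy:
  assumes "set as \<subseteq> carrier R" "\<And>s. f s \<in> carrier M" "l < length as" "length s = length as"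
  shows "kd M as (hk M l f) s \<oplus>\<^bsub>M\<^esub> hk M l (kd M as f) s = as ! l \<odot>\<^bsub>M\<^esub> f s"
  using assms
proof (induct as arbitrary: l f s)
  case (Cons a as)
  have as: "set as \<subseteq> carrier R" "a \<in> carrier R" and f: "\<And>s. f s \<in> carrier M" using Cons.prems by auto
  obtain b t where s: "s = b # t" and t: "length t = length as" using Cons.prems by (cases s) auto
  let ?F = "\<lambda>t. f (False # t)" and ?T = "\<lambda>t. f (True # t)"
  have cl: "kd M as (\<lambda>t. f (b # t)) u \<in> carrier M" for u b
    using f by (intro kd_closed as) auto
  show ?case
  proof (cases l)
    case 0
    have e: "(\<lambda>t. hk M 0 f (False # t)) = (\<lambda>_. \<zero>\<^bsub>M\<^esub>)" "(\<lambda>t. hk M 0 f (True # t)) = ?F" by auto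
    show ?thesis
    proof (cases b)
      case True
      then show ?thesis using 0 s e cl[of False t] as f
        by (simp add: M.a_assoc[symmetric] M.l_neg)
    next
      case False
      then show ?thesis using 0 s e as f by simp
    qed
  next
    case (Suc k)
    have e: "(\<lambda>t. hk M (Suc k) f (False # t)) = hk M k ?F" "(\<lambda>t. hk M (Suc k) f (True # t)) = (\<lambda>t. \<ominus>\<^bsub>M\<^esub> hk M k ?T t)" by auto
    have hcl: "hk M k (\<lambda>t. f (b # t)) u \<in> carrier M" for u b using f by (intro hk_closed) auto
    have IH: "kd M as (hk M k (\<lambda>t. f (b # t))) t \<oplus>\<^bsub>M\<^esub> hk M k (kd M as (\<lambda>t. f (b # t))) t = as ! k \<odot>\<^bsub>M\<^esub> f (b # t)"
      using Suc Cons.prems t by (intro Cons.hyps) auto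
    show ?thesis
    proof (cases b)
      case True
      have e2: "(\<lambda>t. kd M (a # as) f (True # t)) = (\<lambda>t. (\<ominus> \<one>) \<odot>\<^bsub>M\<^esub> kd M as ?T t)"
        using cl[of True] by (simp add: smult_l_minus)
      have 1: "kd M as (\<lambda>t. \<ominus>\<^bsub>M\<^esub> hk M k ?T t) t = \<ominus>\<^bsub>M\<^esub> kd M as (hk M k ?T) t"
        using hcl[of True] by (intro kd_neg as) auto
      have 2: "hk M k (\<lambda>t. (\<ominus> \<one>) \<odot>\<^bsub>M\<^esub> kd M as ?T t) t = \<ominus>\<^bsub>M\<^esub> hk M k (kd M as ?T) t"
        using hk_smult[of "kd M as ?T" "\<ominus> \<one>" k t] cl[of True] hk_closed[of "kd M as ?T"] by (simp add: smult_l_minus)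
      have c1: "kd M as (hk M k ?T) t \<in> carrier M" using hcl[of True] by (intro kd_closed as) auto
      have c2: "hk M k (kd M as ?T) t \<in> carrier M" using cl[of True] by (intro hk_closed) auto
      have "kd M (a # as) (hk M l f) s \<oplus>\<^bsub>M\<^esub> hk M l (kd M (a # as) f) s
        = \<ominus>\<^bsub>M\<^esub> (\<ominus>\<^bsub>M\<^esub> kd M as (hk M k ?T) t) \<oplus>\<^bsub>M\<^esub> \<ominus>\<^bsub>M\<^esub> (\<ominus>\<^bsub>M\<^esub> hk M k (kd M as ?T) t)"
        unfolding s Suc using True 1 2 e e2 by (simp only: kd.simps hk.simps)
      then show ?thesis using IH True c1 c2 s Suc by simp
    next
      case False
      have e2: "(\<lambda>t. kd M (a # as) f (False # t)) = (\<lambda>t. kd M as ?F t \<oplus>\<^bsub>M\<^esub> a \<odot>\<^bsub>M\<^esub> f (True # t))" by simp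
      have 2: "hk M k (\<lambda>t. kd M as ?F t \<oplus>\<^bsub>M\<^esub> a \<odot>\<^bsub>M\<^esub> f (True # t)) t
          = hk M k (kd M as ?F) t \<oplus>\<^bsub>M\<^esub> a \<odot>\<^bsub>M\<^esub> hk M k ?T t"
        using cl[of False] f as by (simp add: hk_add hk_smult)
      have c1: "kd M as (hk M k ?F) t \<in> carrier M" using hcl[of False] by (intro kd_closed as) auto
      have c2: "hk M k (kd M as ?F) t \<in> carrier M" using cl[of False] by (intro hk_closed) auto
      have c3: "a \<odot>\<^bsub>M\<^esub> hk M k ?T t \<in> carrier M" using hcl[of True t] as by simp
      have "kd M (a # as) (hk M l f) s \<oplus>\<^bsub>M\<^esub> hk M l (kd M (a # as) f) s
        = (kd M as (hk M k ?F) t \<oplus>\<^bsub>M\<^esub> \<ominus>\<^bsub>M\<^esub> (a \<odot>\<^bsub>M\<^esub> hk M k ?T t)) \<oplus>\<^bsub>M\<^esub> (hk M k (kd M as ?F) t \<oplus>\<^bsub>M\<^esub> a \<odot>\<^bsub>M\<^esub> hk M k ?T t)"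
        using s Suc False e 2 e2 hcl[of True t] as by (simp add: smult_r_minus)
      also have "\<dots> = kd M as (hk M k ?F) t \<oplus>\<^bsub>M\<^esub> hk M k (kd M as ?F) t"
        using c1 c2 c3 M.a_comm[OF c2 c3] by (simp add: M.a_assoc M.r_neg1)
      finally show ?thesis using IH False s Suc by simp
    qed
  qed
qed simp

end

text \<open>
  The product of the Koszul complex on a sequence \<open>bs\<close>, with coefficients in a complex \<open>X\<close>, into
  \<open>X\<close>: the word \<open>s\<close> acts by the composite of the operators \<open>h\<^sub>l\<close> with \<open>s\<^sub>l = True\<close>. It is a chain
  map if each \<open>h\<^sub>l\<close> is a homotopy from zero to multiplication by \<open>b\<^sub>l\<close>.
\<close>

fun kmult :: "('a, 'x, 's) module_scheme \<Rightarrow> ('x \<Rightarrow> 'x) list \<Rightarrow> (bool list \<Rightarrow> 'x) \<Rightarrow> 'x" where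
  "kmult X [] W = W []"
| "kmult X (h # hs) W = kmult X hs (\<lambda>s. W (False # s)) \<oplus>\<^bsub>X\<^esub> h (kmult X hs (\<lambda>s. W (True # s)))"

context module begin

definition sign :: "nat \<Rightarrow> 'a" where "sign k = (if even k then \<one> else \<ominus> \<one>)"

lemma sign_closed [simp]: "sign k \<in> carrier R"
  by (simp add: sign_def)

lemma sign_Suc: "x \<in> carrier M \<Longrightarrow> sign (Suc k) \<odot>\<^bsub>M\<^esub> x = \<ominus>\<^bsub>M\<^esub> (sign k \<odot>\<^bsub>M\<^esub> x)"
  by (simp add: sign_def smult_l_minus)

lemma kmult_closed:
  "set hs \<subseteq> mod_hom R M M \<Longrightarrow> (\<And>s. W s \<in> carrier M) \<Longrightarrow> kmult M hs W \<in> carrier M"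
proof (induct hs arbitrary: W)
  case (Cons h hs)
  then have "h (kmult M hs (\<lambda>s. W (True # s))) \<in> carrier M" by (intro mod_hom_closed[of h]) auto
  then show ?case using Cons by simp
qed simp

lemma kmult_add:
  "set hs \<subseteq> mod_hom R M M \<Longrightarrow> (\<And>s. W s \<in> carrier M) \<Longrightarrow> (\<And>s. V s \<in> carrier M) \<Longrightarrow>
    kmult M hs (\<lambda>s. W s \<oplus>\<^bsub>M\<^esub> V s) = kmult M hs W \<oplus>\<^bsub>M\<^esub> kmult M hs V"
proof (induct hs arbitrary: W V)
  case (Cons h hs)
  then have h: "h \<in> mod_hom R M M" by simp
  have cl: "kmult M hs (\<lambda>s. W (b # s)) \<in> carrier M" "kmult M hs (\<lambda>s. V (b # s)) \<in> carrier M" for b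
    using Cons.prems by (auto intro!: kmult_closed)
  have "kmult M hs (\<lambda>s. W (b # s) \<oplus>\<^bsub>M\<^esub> V (b # s)) = kmult M hs (\<lambda>s. W (b # s)) \<oplus>\<^bsub>M\<^esub> kmult M hs (\<lambda>s. V (b # s))" for b
    using Cons.prems by (intro Cons.hyps) auto
  then show ?case using cl mod_hom_closed[OF h] by (simp add: mod_hom_add[OF h] M.a_ac)
qed simp

lemma kmult_smult:
  "set hs \<subseteq> mod_hom R M M \<Longrightarrow> (\<And>s. W s \<in> carrier M) \<Longrightarrow> a \<in> carrier R \<Longrightarrow>
    kmult M hs (\<lambda>s. a \<odot>\<^bsub>M\<^esub> W s) = a \<odot>\<^bsub>M\<^esub> kmult M hs W"
proof (induct hs arbitrary: W)
  case (Cons h hs)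
  then have h: "h \<in> mod_hom R M M" by simp
  have cl: "kmult M hs (\<lambda>s. W (b # s)) \<in> carrier M" for b
    using Cons.prems by (auto intro!: kmult_closed)
  have "kmult M hs (\<lambda>s. a \<odot>\<^bsub>M\<^esub> W (b # s)) = a \<odot>\<^bsub>M\<^esub> kmult M hs (\<lambda>s. W (b # s))" for b
    using Cons.prems by (intro Cons.hyps) auto
  then show ?case using cl mod_hom_closed[OF h] Cons.prems by (simp add: mod_hom_smult[OF h] smult_r_distr)
qed simp

lemma kmult_neg:
  assumes "set hs \<subseteq> mod_hom R M M" "\<And>s. W s \<in> carrier M"
  shows "kmult M hs (\<lambda>s. \<ominus>\<^bsub>M\<^esub> W s) = \<ominus>\<^bsub>M\<^esub> kmult M hs W"
  using kmult_smult[OF assms, of "\<ominus> \<one>"] assms kmult_closed[OF assms] by (simp add: smult_l_minus)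

lemma kmult_chain:
  assumes D: "D \<in> mod_hom R M M" and bs: "set bs \<subseteq> carrier R" and hs: "set hs \<subseteq> mod_hom R M M"
    and "length hs = length bs"
    and "\<And>l x. l < length bs \<Longrightarrow> x \<in> carrier M \<Longrightarrow> D ((hs ! l) x) \<oplus>\<^bsub>M\<^esub> (hs ! l) (D x) = bs ! l \<odot>\<^bsub>M\<^esub> x"
    and W: "\<And>s. W s \<in> carrier M"
  shows "D (kmult M hs W) = kmult M hs (kd M bs W)
    \<oplus>\<^bsub>M\<^esub> kmult M hs (\<lambda>s. sign (count_list s True) \<odot>\<^bsub>M\<^esub> D (W s))"
  using bs hs assms(4-6)
proof (induct bs arbitrary: hs W)
  case Nil
  then show ?case using mod_hom_closed[OF D, of "W []"] by (simp add: sign_def)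
next
  case (Cons b bs)
  obtain h hs' where hs: "hs = h # hs'" using Cons.prems by (cases hs) auto
  have h: "h \<in> mod_hom R M M" and hs': "set hs' \<subseteq> mod_hom R M M" and b: "b \<in> carrier R" "set bs \<subseteq> carrier R"
    using Cons.prems hs by auto
  interpret D: linear_map R M M D by (intro linear_mapI module_axioms D)
  interpret h: linear_map R M M h by (intro linear_mapI module_axioms h)
  let ?F = "\<lambda>s. W (False # s)" and ?T = "\<lambda>s. W (True # s)"
  have F: "\<And>s. ?F s \<in> carrier M" and T: "\<And>s. ?T s \<in> carrier M" using Cons.prems by auto
  let ?S = "\<lambda>V s. sign (count_list s True) \<odot>\<^bsub>M\<^esub> D (V s)"
  have IH: "D (kmult M hs' V) = kmult M hs' (kd M bs V) \<oplus>\<^bsub>M\<^esub> kmult M hs' (?S V)"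
    if "\<And>s. V s \<in> carrier M" for V
  proof (rule Cons.hyps)
    fix l x assume "l < length bs" "x \<in> carrier M"
    then show "D ((hs' ! l) x) \<oplus>\<^bsub>M\<^esub> (hs' ! l) (D x) = bs ! l \<odot>\<^bsub>M\<^esub> x"
      using Cons.prems(4)[of "Suc l" x] hs by simp
  qed (use b hs' Cons.prems hs that in auto)
  have hom: "D (h x) = b \<odot>\<^bsub>M\<^esub> x \<ominus>\<^bsub>M\<^esub> h (D x)" if "x \<in> carrier M" for x
  proof -
    have "b \<odot>\<^bsub>M\<^esub> x = D (h x) \<oplus>\<^bsub>M\<^esub> h (D x)" using Cons.prems(4)[of 0 x] hs that by simp
    then show ?thesis using that D.closed h.closed by (simp add: a_minus_def M.a_assoc M.r_neg)
  qed
  have cF: "kmult M hs' ?F \<in> carrier M" and cT: "kmult M hs' ?T \<in> carrier M"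
    using F T by (auto intro!: kmult_closed hs')
  have kF: "kd M bs ?F s \<in> carrier M" and kT: "kd M bs ?T s \<in> carrier M" for s
    using F T by (auto intro!: kd_closed b)
  have SF: "?S ?F s \<in> carrier M" and ST: "?S ?T s \<in> carrier M" for s
    using F T D.closed by auto
  note cl = kmult_closed[OF hs' kF] kmult_closed[OF hs' kT] kmult_closed[OF hs' SF] kmult_closed[OF hs' ST]
  have "D (kmult M hs W) = D (kmult M hs' ?F) \<oplus>\<^bsub>M\<^esub> D (h (kmult M hs' ?T))"
    using hs cF cT h.closed by (simp add: D.add)
  also have "\<dots> = (kmult M hs' (kd M bs ?F) \<oplus>\<^bsub>M\<^esub> kmult M hs' (?S ?F))
      \<oplus>\<^bsub>M\<^esub> (b \<odot>\<^bsub>M\<^esub> kmult M hs' ?T \<ominus>\<^bsub>M\<^esub> (h (kmult M hs' (kd M bs ?T)) \<oplus>\<^bsub>M\<^esub> h (kmult M hs' (?S ?T))))"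
    using cT cl IH[OF F] IH[OF T] hom[OF cT] by (simp add: h.add)
  also have "\<dots> = ((kmult M hs' (kd M bs ?F) \<oplus>\<^bsub>M\<^esub> b \<odot>\<^bsub>M\<^esub> kmult M hs' ?T) \<oplus>\<^bsub>M\<^esub> \<ominus>\<^bsub>M\<^esub> h (kmult M hs' (kd M bs ?T)))
      \<oplus>\<^bsub>M\<^esub> (kmult M hs' (?S ?F) \<oplus>\<^bsub>M\<^esub> \<ominus>\<^bsub>M\<^esub> h (kmult M hs' (?S ?T)))"
    using cT cl h.closed b by (simp add: a_minus_def M.minus_add M.a_ac)
  also have "(kmult M hs' (kd M bs ?F) \<oplus>\<^bsub>M\<^esub> b \<odot>\<^bsub>M\<^esub> kmult M hs' ?T) \<oplus>\<^bsub>M\<^esub> \<ominus>\<^bsub>M\<^esub> h (kmult M hs' (kd M bs ?T))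
      = kmult M hs (kd M (b # bs) W)"
    using hs kmult_add[OF hs' kF, of "\<lambda>s. b \<odot>\<^bsub>M\<^esub> ?T s"] kmult_smult[OF hs' T b(1)] kmult_neg[OF hs' kT] T b cl
    by (simp add: h.neg)
  also have "kmult M hs' (?S ?F) \<oplus>\<^bsub>M\<^esub> \<ominus>\<^bsub>M\<^esub> h (kmult M hs' (?S ?T)) = kmult M hs (?S W)"
    using hs kmult_neg[OF hs' ST] T D.closed cl by (simp add: sign_Suc h.neg)
  finally show ?case .
qed

lemma kmult_submodule:
  assumes S: "submodule S R M"
  shows "set hs \<subseteq> mod_hom R M M \<Longrightarrow> (\<And>h x. h \<in> set hs \<Longrightarrow> x \<in> carrier M \<Longrightarrow> h x \<in> S) \<Longrightarrow>
    (\<And>s. W s \<in> carrier M) \<Longrightarrow> W (zero_word (length hs)) = \<zero>\<^bsub>M\<^esub> \<Longrightarrow> kmult M hs W \<in> S"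
proof (induct hs arbitrary: W)
  case Nil
  then show ?case by (simp add: submodule_zero[OF S])
next
  case (Cons h hs)
  have "kmult M hs (\<lambda>s. W (False # s)) \<in> S" using Cons.prems by (intro Cons.hyps) auto
  moreover have "h (kmult M hs (\<lambda>s. W (True # s))) \<in> S"
    using Cons.prems by (intro Cons.prems(2) kmult_closed) auto
  ultimately show ?case by (simp add: submoduleE(5)[OF S])
qed

lemma kmult_single:
  "set hs \<subseteq> mod_hom R M M \<Longrightarrow> (\<And>s. W s \<in> carrier M) \<Longrightarrow> (\<And>s. s \<noteq> zero_word (length hs) \<Longrightarrow> W s = \<zero>\<^bsub>M\<^esub>)
    \<Longrightarrow> kmult M hs W = W (zero_word (length hs))"
proof (induct hs arbitrary: W)
  case (Cons h hs)
  have h: "h \<in> mod_hom R M M" and hs: "set hs \<subseteq> mod_hom R M M" using Cons.prems by auto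
  interpret h: linear_map R M M h by (intro linear_mapI module_axioms h)
  have "kmult M hs (\<lambda>s. W (False # s)) = W (False # zero_word (length hs))"
    using Cons.prems by (intro Cons.hyps) auto
  moreover have "(\<lambda>s. W (True # s)) = (\<lambda>s. \<zero> \<odot>\<^bsub>M\<^esub> \<zero>\<^bsub>M\<^esub>)" using Cons.prems by auto
  then have "kmult M hs (\<lambda>s. W (True # s)) = \<zero>\<^bsub>M\<^esub>"
    using kmult_smult[OF hs, of "\<lambda>_. \<zero>\<^bsub>M\<^esub>" \<zero>] kmult_closed[OF hs, of "\<lambda>_. \<zero>\<^bsub>M\<^esub>"] by simp
  ultimately show ?case using Cons.prems by (simp add: h.zero)
qed simp

lemma kmult_weight:
  "set hs \<subseteq> mod_hom R M M \<Longrightarrow> set as \<subseteq> carrier R \<Longrightarrow> length hs = length as \<Longrightarrow> (\<And>s. W s \<in> carrier M) \<Longrightarrow>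
    kmult M (map2 (\<lambda>a h x. a [^] e \<odot>\<^bsub>M\<^esub> h x) as hs) W = kmult M hs (\<lambda>s. koszul_weight R e as s \<odot>\<^bsub>M\<^esub> W s)"
proof (induct as arbitrary: hs W)
  case Nil
  then show ?case by simp
next
  case (Cons a as)
  obtain h hs' where hs: "hs = h # hs'" using Cons.prems by (cases hs) auto
  have h: "h \<in> mod_hom R M M" and hs': "set hs' \<subseteq> mod_hom R M M" and a: "a \<in> carrier R" "set as \<subseteq> carrier R"
    using Cons.prems hs by auto
  have w: "koszul_weight R e as t \<in> carrier R" for t by (rule R.koszul_weight_closed[OF a(2)])
  have IH: "kmult M (map2 (\<lambda>a h x. a [^] e \<odot>\<^bsub>M\<^esub> h x) as hs') (\<lambda>s. W (b # s))
      = kmult M hs' (\<lambda>s. koszul_weight R e as s \<odot>\<^bsub>M\<^esub> W (b # s))" for b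
    using Cons.prems hs by (intro Cons.hyps) auto
  have c: "kmult M hs' (\<lambda>s. koszul_weight R e as s \<odot>\<^bsub>M\<^esub> W (b # s)) \<in> carrier M" for b
    using Cons.prems w by (intro kmult_closed hs') auto
  have "kmult M hs' (\<lambda>s. (a [^] e \<otimes> koszul_weight R e as s) \<odot>\<^bsub>M\<^esub> W (True # s))
      = a [^] e \<odot>\<^bsub>M\<^esub> kmult M hs' (\<lambda>s. koszul_weight R e as s \<odot>\<^bsub>M\<^esub> W (True # s))"
    using kmult_smult[OF hs', of "\<lambda>s. koszul_weight R e as s \<odot>\<^bsub>M\<^esub> W (True # s)" "a [^] e"] w a Cons.prems
    by (simp add: smult_assoc1)
  then show ?case using hs IH w a c by (simp add: mod_hom_smult[OF h])
qed

end

section \<open>Powers of a finitely generated ideal\<close>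

locale fg_ideal = cring R for R (structure) +
  fixes as :: "'a list" and I :: "'a set"
  assumes as_closed: "set as \<subseteq> carrier R" and as_nonempty: "as \<noteq> []" and I_eq: "I = Idl (set as)"
begin

abbreviation "p \<equiv> length as"
abbreviation "Ip n \<equiv> ideal_pow R I n"
abbreviation "A \<equiv> self_module R"

sublocale A: module R A by (rule self_module[OF is_cring])

lemma as_nth [simp]: "l < p \<Longrightarrow> as ! l \<in> carrier R"
  using as_closed by (meson nth_mem subsetD)

lemma ideal_I: "ideal I R"
  unfolding I_eq by (rule genideal_ideal[OF as_closed])

lemma Ip_0: "Ip 0 = carrier R"
  by (simp add: nat_pow_def ideals_set_def)

lemma Ip_Suc: "Ip (Suc n) = ideal_prod R (Ip n) I"
  by (simp add: nat_pow_def ideals_set_def)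

lemma ideal_Ip: "ideal (Ip n) R"
proof (induct n)
  case 0
  show ?case unfolding Ip_0 by (rule oneideal)
next
  case (Suc n)
  then show ?case unfolding Ip_Suc by (rule ideal_prod_is_ideal[OF _ ideal_I])
qed

lemma Ip_antimono: "m \<le> n \<Longrightarrow> Ip n \<subseteq> Ip m"
proof (induct n rule: dec_induct)
  case (step n)
  have "Ip (Suc n) \<subseteq> Ip n" using ideal_prod_inter[OF ideal_Ip ideal_I] unfolding Ip_Suc by blast
  then show ?case using step by blast
qed simp

lemma Ip_carrier: "x \<in> Ip n \<Longrightarrow> x \<in> carrier R"
  using ideal.Icarr[OF ideal_Ip] .

lemma gen_pow_Ip: "a \<in> set as \<Longrightarrow> a [^] n \<in> Ip n"
proof (induct n)
  case (Suc n)
  then have "a \<in> I" unfolding I_eq using genideal_self[OF as_closed] by blast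
  then have "a [^] n \<otimes> a \<in> ideal_prod R (Ip n) I" using Suc by (intro ideal_prod.prod) auto
  then show ?case unfolding Ip_Suc by simp
next
  case 0
  show ?case unfolding Ip_0 by simp
qed

lemma ismult_Ip_A: "x \<in> Ip n \<Longrightarrow> x \<in> ismult A (Ip n)"
  using A.ismult_gen[OF ideal_Ip, of x n \<one>] Ip_carrier by simp

definition monomials :: "nat \<Rightarrow> 'a set"
  where "monomials k = {foldr (\<otimes>) xs \<one> | xs. length xs = k \<and> set xs \<subseteq> set as}"

lemma foldr_mult_closed: "set xs \<subseteq> carrier R \<Longrightarrow> foldr (\<otimes>) xs \<one> \<in> carrier R"
  by (induct xs) auto

lemma Ip_least:
  assumes "ideal b R" "monomials k \<subseteq> b" shows "Ip k \<subseteq> b"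
  using assms
proof (induct k arbitrary: b)
  case 0
  then have "\<one> \<in> b" by (auto simp: monomials_def)
  then show ?case using ideal.one_imp_carrier[OF 0(1)] unfolding Ip_0 by simp
next
  case (Suc k)
  interpret b: ideal b R by fact
  have colon: "ideal {x \<in> carrier R. y \<otimes> x \<in> b} R" if y: "y \<in> carrier R" for y
  proof (rule idealI[OF ring_axioms])
    show "subgroup {x \<in> carrier R. y \<otimes> x \<in> b} (add_monoid R)"
      using y by (intro add.subgroupI) (auto simp: r_minus r_distr intro: exI[of _ \<zero>])
    fix a x assume a: "a \<in> {x \<in> carrier R. y \<otimes> x \<in> b}" and x: "x \<in> carrier R"
    then show "x \<otimes> a \<in> {x \<in> carrier R. y \<otimes> x \<in> b}" using y b.I_l_closed by (simp add: m_lcomm)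
    then show "a \<otimes> x \<in> {x \<in> carrier R. y \<otimes> x \<in> b}" using a x by (simp add: m_comm)
  qed
  have a: "Ip k \<subseteq> {x \<in> carrier R. a \<otimes> x \<in> b}" if a: "a \<in> set as" for a
  proof (rule Suc.hyps[OF colon])
    show "monomials k \<subseteq> {x \<in> carrier R. a \<otimes> x \<in> b}"
    proof
      fix m assume "m \<in> monomials k"
      then obtain xs where xs: "length xs = k" "set xs \<subseteq> set as" "m = foldr (\<otimes>) xs \<one>"
        by (auto simp: monomials_def)
      have "foldr (\<otimes>) (a # xs) \<one> \<in> monomials (Suc k)"
        unfolding monomials_def using xs a by (intro CollectI exI[of _ "a # xs"]) auto
      then show "m \<in> {x \<in> carrier R. a \<otimes> x \<in> b}"
        using xs as_closed foldr_mult_closed[of xs] Suc.prems(2) by auto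
    qed
  qed (use a as_closed in auto)
  have ij: "i \<otimes> j \<in> b" if i: "i \<in> Ip k" and j: "j \<in> I" for i j
  proof -
    have iR: "i \<in> carrier R" using Ip_carrier i .
    have "set as \<subseteq> {x \<in> carrier R. i \<otimes> x \<in> b}" using a i as_closed iR by (auto simp: m_comm subset_iff)
    then have "I \<subseteq> {x \<in> carrier R. i \<otimes> x \<in> b}"
      unfolding I_eq by (rule genideal_minimal[OF colon[OF iR]])
    then show ?thesis using j by blast
  qed
  have "x \<in> b" if "x \<in> ideal_prod R (Ip k) I" for x
    using that by (induct rule: ideal_prod.induct) (use ij in auto)
  then show ?case unfolding Ip_Suc by blast
qed

lemma foldr_mult_pow:
  assumes "a \<in> carrier R" "set xs \<subseteq> carrier R"
  shows "\<exists>r\<in>carrier R. foldr (\<otimes>) xs \<one> = a [^] count_list xs a \<otimes> r"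
  using assms(2)
proof (induct xs)
  case Nil
  show ?case by (rule bexI[of _ \<one>]) auto
next
  case (Cons x xs)
  then obtain r where r: "r \<in> carrier R" "foldr (\<otimes>) xs \<one> = a [^] count_list xs a \<otimes> r" by auto
  show ?case
  proof (cases "x = a")
    case True
    have "a \<otimes> (a [^] count_list xs a \<otimes> r) = a [^] Suc (count_list xs a) \<otimes> r"
      using r assms(1) by (simp add: m_assoc m_lcomm)
    then show ?thesis using True r by (intro bexI[of _ r]) auto
  next
    case False
    then show ?thesis using Cons.prems r assms(1) by (intro bexI[of _ "x \<otimes> r"]) (auto simp: m_lcomm)
  qed
qed

text \<open>Among \<open>p J\<close> factors from a set of at most \<open>p\<close> generators, some generator occurs \<open>J\<close> times.\<close>

lemma Ip_subset_pow:
  assumes b: "ideal b R" and J: "\<And>a. a \<in> set as \<Longrightarrow> a [^] J \<in> b" and "J \<ge> 1"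
  shows "Ip (p * J) \<subseteq> b"
proof (rule Ip_least[OF b], rule subsetI)
  fix m assume "m \<in> monomials (p * J)"
  then obtain xs where xs: "length xs = p * J" "set xs \<subseteq> set as" "m = foldr (\<otimes>) xs \<one>"
    by (auto simp: monomials_def)
  have "\<exists>a\<in>set as. J \<le> count_list xs a"
  proof (rule ccontr)
    assume neg: "\<not> (\<exists>a\<in>set as. J \<le> count_list xs a)"
    have "count_list xs a \<le> J - 1" if "a \<in> set as" for a
    proof -
      have "\<not> J \<le> count_list xs a" using neg that by blast
      then show ?thesis by linarith
    qed
    then have "sum (count_list xs) (set as) \<le> card (set as) * (J - 1)"
      using sum_bounded_above[of "set as" "count_list xs" "J - 1"] by simp
    also have "\<dots> \<le> p * (J - 1)" using card_length by (rule mult_le_mono1)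
    also have "\<dots> < p * J" using as_nonempty assms(3) by simp
    finally show False using sum_count_set[OF xs(2)] xs(1) by simp
  qed
  then obtain a where a: "a \<in> set as" "J \<le> count_list xs a" by blast
  have aR: "a \<in> carrier R" using a as_closed by auto
  obtain r where r: "r \<in> carrier R" "m = a [^] count_list xs a \<otimes> r"
    using foldr_mult_pow[OF aR, of xs] xs as_closed by auto
  have "a [^] count_list xs a = a [^] J \<otimes> a [^] (count_list xs a - J)"
    using a aR by (simp add: nat_pow_mult)
  then have "m = a [^] J \<otimes> (a [^] (count_list xs a - J) \<otimes> r)" using r aR by (simp add: m_assoc)
  then show "m \<in> b" using J[OF a(1)] r aR by (simp add: ideal.I_r_closed[OF b])
qed

end

lemma (in module) kd_unit_word:
  assumes "set bs \<subseteq> carrier R" "b \<in> set bs" "y \<in> carrier M"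
  shows "\<exists>f\<in>fin_supp (words_deg (length bs) 1) M. kd M bs f (zero_word (length bs)) = b \<odot>\<^bsub>M\<^esub> y"
  using assms(1,2)
proof (induct bs)
  case (Cons c bs)
  show ?case
  proof (cases "b = c")
    case True
    let ?f = "\<lambda>s. if s = True # zero_word (length bs) then y else \<zero>\<^bsub>M\<^esub>"
    have "?f \<in> fin_supp (words_deg (length (c # bs)) 1) M"
      using assms(3) by (intro fin_suppI'[OF finite_words_deg]) (auto simp: words_deg_def)
    moreover have "kd M (c # bs) ?f (zero_word (length (c # bs))) = b \<odot>\<^bsub>M\<^esub> y"
      using True Cons.prems assms(3) by simp
    ultimately show ?thesis by blast
  next
    case False
    then obtain f where f: "f \<in> fin_supp (words_deg (length bs) 1) M"
      "kd M bs f (zero_word (length bs)) = b \<odot>\<^bsub>M\<^esub> y" using Cons by auto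
    let ?f = "\<lambda>s. case s of False # t \<Rightarrow> f t | _ \<Rightarrow> \<zero>\<^bsub>M\<^esub>"
    have "?f \<in> fin_supp (words_deg (length (c # bs)) 1) M"
      using fin_suppD[OF f(1)] by (intro fin_suppI'[OF finite_words_deg])
        (auto simp: words_deg_def split: list.splits bool.splits)
    moreover have "kd M (c # bs) ?f (zero_word (length (c # bs))) = b \<odot>\<^bsub>M\<^esub> y"
      using f Cons.prems assms(3) by auto
    ultimately show ?thesis by blast
  qed
qed simp

context fg_ideal begin

lemma spc: "set (seq_pow R as n) \<subseteq> carrier R"
  by (rule seq_pow_closed[OF is_cring as_closed])

text \<open>The ideals generated by the powers \<open>a\<^sub>i ^ J\<close> are cofinal with the powers of \<open>I\<close>.\<close>

lemma ismult_kd: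
  assumes M: "module R M" and J: "J \<ge> 1" and x: "x \<in> ismult M (Ip (p * J))"
  shows "\<exists>f\<in>fin_supp (words_deg p 1) M. x = kd M (seq_pow R as J) f (zero_word p)"
proof -
  interpret M: module R M by fact
  let ?h = "\<lambda>f. kd M (seq_pow R as J) f (zero_word p)"
  interpret h: linear_map R "fun_module (words_deg p 1) M" M ?h
  proof (intro linear_mapI mod_homI M M.fun_module)
    fix f assume f: "f \<in> carrier (fun_module (words_deg p 1) M)"
    then have f': "f s \<in> carrier M" for s using fin_suppD(1)[of f] by simp
    show "?h f \<in> carrier M" using f' by (intro M.kd_closed spc)
    show "?h (a \<odot>\<^bsub>fun_module (words_deg p 1) M\<^esub> f) = a \<odot>\<^bsub>M\<^esub> ?h f" if "a \<in> carrier R" for a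
      using M.kd_smult[OF spc, of f a] f' that by simp
    fix g assume "g \<in> carrier (fun_module (words_deg p 1) M)"
    then have "g s \<in> carrier M" for s using fin_suppD(1)[of g] by simp
    then show "?h (f \<oplus>\<^bsub>fun_module (words_deg p 1) M\<^esub> g) = ?h f \<oplus>\<^bsub>M\<^esub> ?h g"
      using M.kd_add[OF spc, of f g] f' by simp
  qed
  define B where "B = ?h ` carrier (fun_module (words_deg p 1) M)"
  have B: "submodule B R M" unfolding B_def by (rule h.image_submodule)
  note Bs = M.submoduleE[OF B] M.submodule_zero[OF B]
  define C where "C = {r \<in> carrier R. \<forall>y\<in>carrier M. r \<odot>\<^bsub>M\<^esub> y \<in> B}"
  have id: "ideal C R"
  proof (rule idealI[OF ring_axioms])
    show "subgroup C (add_monoid R)"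
    proof (rule add.subgroupI)
      have "\<zero> \<in> C" using Bs by (simp add: C_def)
      then show "C \<noteq> {}" by blast
      show "\<ominus> r \<in> C" if "r \<in> C" for r using that Bs(3) by (simp add: C_def M.smult_l_minus)
      show "r \<oplus> s \<in> C" if "r \<in> C" "s \<in> C" for r s using that Bs(5) by (simp add: C_def M.smult_l_distr)
    qed (auto simp: C_def)
    fix r x assume r: "r \<in> C" and x: "x \<in> carrier R"
    then show "x \<otimes> r \<in> C" using Bs(4) by (simp add: C_def M.smult_assoc1)
    then show "r \<otimes> x \<in> C" using r x by (simp add: C_def m_comm)
  qed
  have "Ip (p * J) \<subseteq> C"
  proof (rule Ip_subset_pow[OF id _ J])
    fix a assume a: "a \<in> set as"
    have "a [^] J \<odot>\<^bsub>M\<^esub> y \<in> B" if "y \<in> carrier M" for y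
    proof -
      have "a [^] J \<in> set (seq_pow R as J)" using a by (simp add: seq_pow_def)
      from M.kd_unit_word[OF spc this that] obtain f where
        "f \<in> fin_supp (words_deg p 1) M" "kd M (seq_pow R as J) f (zero_word p) = a [^] J \<odot>\<^bsub>M\<^esub> y" by auto
      then show ?thesis unfolding B_def by (intro image_eqI[of _ _ f]) auto
    qed
    then show "a [^] J \<in> C" using a as_closed by (auto simp: C_def)
  qed
  then have "id x \<in> B"
    by (intro M.ismult_image[OF ideal_Ip M mod_hom_id B _ x]) (auto simp: C_def)
  then show ?thesis unfolding B_def by auto
qed

end

section \<open>Weak proregularity and an Artin--Rees property\<close>

text \<open>
  The pro-zero condition on Koszul homology with coefficients in \<open>M\<close>, in terms of cycles and
  boundaries. For \<open>M = R\<close> this is weak proregularity.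
\<close>

definition koszul_pro_zero :: "('a, 'r) ring_scheme \<Rightarrow> 'a list \<Rightarrow> ('a, 'm, 's) module_scheme \<Rightarrow> bool"
  where "koszul_pro_zero R as M \<longleftrightarrow> (\<forall>q\<ge>1. \<forall>m\<ge>1. \<exists>k\<ge>m. \<forall>z\<in>fin_supp (words_deg (length as) q) M.
    (\<forall>s. kd M (seq_pow R as k) z s = \<zero>\<^bsub>M\<^esub>) \<longrightarrow>
    (\<exists>y\<in>fin_supp (words_deg (length as) (Suc q)) M.
      \<forall>s. koszul_weight R (k - m) as s \<odot>\<^bsub>M\<^esub> z s = kd M (seq_pow R as m) y s))"

context fg_ideal begin

abbreviation "X \<equiv> fun_module (words p) A"
abbreviation "D n \<equiv> kd A (seq_pow R as n)"

definition small :: "nat \<Rightarrow> (bool list \<Rightarrow> 'a) set"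
  where "small j = {x \<in> carrier X. \<forall>s. x s \<in> Ip j}"

lemma X_module: "module R X"
  by (rule A.fun_module)

lemma D_map: "linear_map R X X (D n)"
  by (rule A.kd_map_words[OF spc]) simp

lemma small_submodule: "submodule (small j) R X"
proof -
  interpret X: module R X by (rule X_module)
  interpret j: ideal "Ip j" R by (rule ideal_Ip)
  show ?thesis
  proof (rule X.submoduleI)
    fix a b assume a: "a \<in> small j"
    then have a': "a \<in> fin_supp (words p) A" by (simp add: small_def)
    show "\<ominus>\<^bsub>X\<^esub> a \<in> small j"
      using a A.fun_module_inv[OF a'] X.M.a_inv_closed[of a] j.a_inv_closed by (auto simp: small_def)
    { assume "b \<in> small j"
      then show "a \<oplus>\<^bsub>X\<^esub> b \<in> small j" using a X.M.a_closed[of a b] by (auto simp: small_def) }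
    { fix r assume "r \<in> carrier R"
      then show "r \<odot>\<^bsub>X\<^esub> a \<in> small j" using a X.smult_closed[of r a] j.I_l_closed by (auto simp: small_def) }
  qed (auto simp: small_def A.fin_supp_zero[simplified])
qed

lemma hk_map: "linear_map R X X (hk A l)"
  by (intro linear_mapI X_module A.hk_hom)

text \<open>The operators of exterior multiplication, scaled from level \<open>J\<close> to level \<open>n\<close>.\<close>

definition "hops e = map2 (\<lambda>a h x. a [^] (e::nat) \<odot>\<^bsub>X\<^esub> h x) as (map (hk A) [0..<p])"

lemma hops_nth: "l < p \<Longrightarrow> hops e ! l = (\<lambda>x. (as ! l) [^] e \<odot>\<^bsub>X\<^esub> hk A l x)"
  by (simp add: hops_def)

lemma length_hops [simp]: "length (hops e) = p"
  by (simp add: hops_def)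

lemma hops_hom: "set (hops e) \<subseteq> mod_hom R X X"
proof
  interpret X: module R X by (rule X_module)
  fix h assume "h \<in> set (hops e)"
  then obtain l where l: "l < p" "h = (\<lambda>x. (as ! l) [^] e \<odot>\<^bsub>X\<^esub> hk A l x)"
    by (metis hops_nth in_set_conv_nth length_hops)
  interpret k: linear_map R X X "hk A l" by (rule hk_map)
  have a: "(as ! l) [^] e \<in> carrier R" using l by simp
  show "h \<in> mod_hom R X X"
    unfolding l(2) by (rule mod_homI) (use a k.closed in \<open>auto simp only: k.add k.smult X.smult_r_distr X.smult_lcomm X.smult_closed\<close>)
qed

lemma hops_small:
  assumes "h \<in> set (hops e)" "x \<in> carrier X" shows "h x \<in> small e"
proof -
  interpret X: module R X by (rule X_module)
  obtain l where l: "l < p" "h = (\<lambda>x. (as ! l) [^] e \<odot>\<^bsub>X\<^esub> hk A l x)"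
    using assms(1) by (metis hops_nth in_set_conv_nth length_hops)
  interpret k: linear_map R X X "hk A l" by (rule hk_map)
  have a: "(as ! l) [^] e \<in> Ip e" using gen_pow_Ip l by simp
  have "hk A l x s \<in> carrier R" for s using fin_suppD(1)[of "hk A l x" "words p" A s] k.closed[OF assms(2)] by simp
  then show ?thesis
    using a X.smult_closed[OF Ip_carrier[OF a] k.closed[OF assms(2)]]
    by (auto simp: small_def l(2) ideal.I_r_closed[OF ideal_Ip])
qed

lemma hops_homotopy:
  assumes l: "l < p" and x: "x \<in> carrier X"
  shows "D n ((hops e ! l) x) \<oplus>\<^bsub>X\<^esub> (hops e ! l) (D n x) = seq_pow R as (n + e) ! l \<odot>\<^bsub>X\<^esub> x"
proof
  fix s
  interpret X: module R X by (rule X_module)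
  interpret k: linear_map R X X "hk A l" by (rule hk_map)
  interpret D: linear_map R X X "D n" by (rule D_map)
  have a: "as ! l \<in> carrier R" using l by simp
  have kx: "hk A l x \<in> carrier X" and Dx: "D n x \<in> carrier X" using k.closed D.closed x by auto
  have kD: "hk A l (D n x) \<in> carrier X" and Dk: "D n (hk A l x) \<in> carrier X" using k.closed D.closed kx Dx by auto
  note R = fin_suppD(1)[of _ "words p" A, simplified]
  have xR: "x t \<in> carrier R" for t using R x by simp
  have "(D n ((hops e ! l) x) \<oplus>\<^bsub>X\<^esub> (hops e ! l) (D n x)) s
      = (as ! l) [^] e \<otimes> (D n (hk A l x) s \<oplus> hk A l (D n x) s)"
    using a D.smult[of "(as ! l) [^] e" "hk A l x"] kx R[of "D n (hk A l x)"] R[of "hk A l (D n x)"] Dk kD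
    by (simp add: hops_nth[OF l] r_distr)
  also have "\<dots> = (as ! l) [^] e \<otimes> ((as ! l) [^] n \<otimes> x s)"
  proof (cases "length s = p")
    case True
    have "D n (hk A l x) s \<oplus>\<^bsub>A\<^esub> hk A l (D n x) s = seq_pow R as n ! l \<odot>\<^bsub>A\<^esub> x s"
      using xR by (intro A.hk_homotopy spc) (auto simp: l True)
    then show ?thesis using l by (simp add: seq_pow_def)
  next
    case False
    then have "s \<notin> words p" by (simp add: words_def)
    then have "f s = \<zero>" if "f \<in> carrier X" for f using fin_suppD(2)[of f "words p" A s] that by simp
    from this[OF x] this[OF Dk] this[OF kD] show ?thesis using a by simp
  qed
  also have "\<dots> = (seq_pow R as (n + e) ! l \<odot>\<^bsub>X\<^esub> x) s"
    using l a xR by (simp add: seq_pow_def nat_pow_mult[symmetric] m_ac)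
  finally show "(D n ((hops e ! l) x) \<oplus>\<^bsub>X\<^esub> (hops e ! l) (D n x)) s = (seq_pow R as (n + e) ! l \<odot>\<^bsub>X\<^esub> x) s" .
qed

text \<open>
  Cycles in both directions of the double complex \<open>K(R; as^J) \<otimes> K(R; as^n)\<close>, in column \<open>q\<close>.
\<close>

definition bicycle :: "nat \<Rightarrow> nat \<Rightarrow> nat \<Rightarrow> (bool list \<Rightarrow> bool list \<Rightarrow> 'a) \<Rightarrow> bool"
  where "bicycle n J q U \<longleftrightarrow> (\<forall>s. U s \<in> carrier X) \<and> (\<forall>s. s \<notin> words_deg p q \<longrightarrow> U s = \<zero>\<^bsub>X\<^esub>) \<and>
    (\<forall>s. kd X (seq_pow R as J) U s = \<zero>\<^bsub>X\<^esub>) \<and> (\<forall>s. D n (U s) = \<zero>\<^bsub>X\<^esub>)"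

lemma signed_D_map: "linear_map R X X (\<lambda>x. A.sign q \<odot>\<^bsub>X\<^esub> D n x)"
proof -
  interpret X: module R X by (rule X_module)
  interpret D: linear_map R X X "D n" by (rule D_map)
  show ?thesis
    by (intro linear_mapI mod_homI X_module)
      (auto simp only: D.add D.smult D.closed X.smult_r_distr X.smult_lcomm X.smult_closed A.sign_closed)
qed

lemma bicycle_D:
  assumes V: "\<And>s. V s \<in> carrier X" and Vq: "\<And>s. s \<notin> words_deg p q \<Longrightarrow> V s = \<zero>\<^bsub>X\<^esub>"
    and dV: "\<And>s. D n (kd X (seq_pow R as J) V s) = \<zero>\<^bsub>X\<^esub>"
  shows "bicycle n J q (\<lambda>s. A.sign q \<odot>\<^bsub>X\<^esub> D n (V s))"
  unfolding bicycle_def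
proof (intro conjI allI impI)
  interpret X: module R X by (rule X_module)
  interpret D: linear_map R X X "D n" by (rule D_map)
  fix s
  have VX: "V s \<in> fin_supp (words p) A" using V[of s] by simp
  show "A.sign q \<odot>\<^bsub>X\<^esub> D n (V s) \<in> carrier X" by (intro linear_map.closed[OF signed_D_map] V)
  show "A.sign q \<odot>\<^bsub>X\<^esub> D n (V s) = \<zero>\<^bsub>X\<^esub>" if "s \<notin> words_deg p q"
    unfolding Vq[OF that] by (simp only: D.zero A.sign_closed X.smult_r_null)
  have "kd X (seq_pow R as J) (\<lambda>s. A.sign q \<odot>\<^bsub>X\<^esub> D n (V s)) s
      = A.sign q \<odot>\<^bsub>X\<^esub> D n (kd X (seq_pow R as J) V s)"
    by (rule linear_map.kd_map[OF signed_D_map spc V, symmetric])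
  then show "kd X (seq_pow R as J) (\<lambda>s. A.sign q \<odot>\<^bsub>X\<^esub> D n (V s)) s = \<zero>\<^bsub>X\<^esub>"
    by (simp only: dV A.sign_closed X.smult_r_null)
  have "D n (D n (V s)) = \<zero>\<^bsub>X\<^esub>"
    using A.kd_kd[OF spc, of "V s"] fin_suppD(1)[OF VX] by (simp add: fun_eq_iff)
  then show "D n (A.sign q \<odot>\<^bsub>X\<^esub> D n (V s)) = \<zero>\<^bsub>X\<^esub>"
    by (simp only: D.smult D.closed V A.sign_closed X.smult_r_null)
qed

text \<open>
  In positive columns all products into \<open>K(R; as^n)\<close> carry factors \<open>a\<^sub>l ^ e\<close>, so the boundary that
  the chain rule produces is that of a small element.
\<close>

lemma kmult_boundary:
  assumes V: "\<And>s. V s \<in> carrier X" and Vq: "\<And>s. s \<notin> words_deg p q \<Longrightarrow> V s = \<zero>\<^bsub>X\<^esub>" and q: "q \<ge> 1"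
    and e: "j \<le> e" and u: "u \<in> small j" "kmult X (hops e) (\<lambda>s. A.sign q \<odot>\<^bsub>X\<^esub> D n (V s)) = D n u"
  shows "\<exists>u\<in>small j. kmult X (hops e) (kd X (seq_pow R as (n + e)) V) = D n u"
proof -
  interpret X: module R X by (rule X_module)
  interpret D: linear_map R X X "D n" by (rule D_map)
  let ?kV = "kmult X (hops e) (kd X (seq_pow R as (n + e)) V)"
  have "D n (kmult X (hops e) V) = ?kV
      \<oplus>\<^bsub>X\<^esub> kmult X (hops e) (\<lambda>s. X.sign (count_list s True) \<odot>\<^bsub>X\<^esub> D n (V s))"
  proof (rule X.kmult_chain[OF D.hom spc hops_hom])
    fix l x assume "l < length (seq_pow R as (n + e))" "x \<in> carrier X"
    then show "D n ((hops e ! l) x) \<oplus>\<^bsub>X\<^esub> (hops e ! l) (D n x) = seq_pow R as (n + e) ! l \<odot>\<^bsub>X\<^esub> x"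
      using hops_homotopy[of l x n e] by (simp only: length_seq_pow)
  qed (use V in simp_all)
  also have "(\<lambda>s. X.sign (count_list s True) \<odot>\<^bsub>X\<^esub> D n (V s)) = (\<lambda>s. A.sign q \<odot>\<^bsub>X\<^esub> D n (V s))"
  proof
    fix s
    show "X.sign (count_list s True) \<odot>\<^bsub>X\<^esub> D n (V s) = A.sign q \<odot>\<^bsub>X\<^esub> D n (V s)"
    proof (cases "s \<in> words_deg p q")
      case True
      then show ?thesis by (simp only: words_deg_def mem_Collect_eq X.sign_def A.sign_def)
    next
      case False
      show ?thesis unfolding Vq[OF False]
        by (simp only: D.zero A.sign_closed X.sign_closed X.smult_r_null)
    qed
  qed
  finally have eq: "D n (kmult X (hops e) V) = ?kV \<oplus>\<^bsub>X\<^esub> D n u" using u by simp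
  have VS: "kmult X (hops e) V \<in> small j"
  proof (rule X.kmult_submodule[OF small_submodule hops_hom])
    fix h x assume "h \<in> set (hops e)" "x \<in> carrier X"
    then have "h x \<in> small e" by (rule hops_small)
    then show "h x \<in> small j" using Ip_antimono[OF e] by (auto simp: small_def)
  next
    show "V (zero_word (length (hops e))) = \<zero>\<^bsub>X\<^esub>" by (rule Vq) (use q in \<open>simp add: words_deg_def\<close>)
  qed (rule V)
  have c: "kmult X (hops e) V \<in> carrier X" "u \<in> carrier X" using VS u(1) by (auto simp: small_def)
  have kc: "?kV \<in> carrier X" by (intro X.kmult_closed hops_hom X.kd_closed spc V)
  have "D n (kmult X (hops e) V \<ominus>\<^bsub>X\<^esub> u) = ?kV"
    unfolding D.diff[OF c] eq unfolding a_minus_def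
    using kc D.closed[OF c(2)] by (simp only: X.M.a_assoc X.M.r_neg X.M.a_inv_closed X.M.r_zero)
  then show ?thesis using X.submodule_diff[OF small_submodule VS u(1)] by metis
qed

text \<open>
  Climbing the columns: a cycle in both directions becomes, after a transition that lowers \<open>J\<close>, a
  boundary in the first direction of some \<open>V\<close>, and the differential of \<open>V\<close> in the second
  direction is again a cycle in both directions, one column higher. There are only \<open>p\<close> columns.
\<close>

lemma koszul_zigzag:
  assumes wpr: "koszul_pro_zero R as A" and n: "n \<ge> 1" and q: "q \<ge> 1"
  shows "\<exists>J\<ge>n + j. \<forall>U. bicycle n J q U \<longrightarrow> (\<exists>u\<in>small j. kmult X (hops (J - n)) U = D n u)"
  using q
proof (induct "Suc p - q" arbitrary: q)
  case 0
  interpret X: module R X by (rule X_module)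
  interpret D: linear_map R X X "D n" by (rule D_map)
  have "\<exists>u\<in>small j. kmult X (hops j) U = D n u" if "bicycle n (n + j) q U" for U
  proof -
    have "U s = \<zero>\<^bsub>X\<^esub>" for s using that words_deg_empty[of p q] 0 by (simp add: bicycle_def)
    then have "kmult X (hops j) U = \<zero>\<^bsub>X\<^esub>"
      using X.kmult_single[OF hops_hom[of j], of U] X.M.zero_closed by metis
    then show ?thesis using D.zero X.submodule_zero[OF small_submodule] by metis
  qed
  then show ?case by (intro exI[of _ "n + j"]) simp
next
  case (Suc x)
  interpret X: module R X by (rule X_module)
  interpret D: linear_map R X X "D n" by (rule D_map)
  have "\<exists>J\<ge>n + j. \<forall>U. bicycle n J (Suc q) U \<longrightarrow> (\<exists>u\<in>small j. kmult X (hops (J - n)) U = D n u)"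
    by (rule Suc.hyps(1)) (use Suc.hyps(2) in simp_all)
  then obtain J1 where J1: "J1 \<ge> n + j" and IH:
    "\<And>U. bicycle n J1 (Suc q) U \<Longrightarrow> \<exists>u\<in>small j. kmult X (hops (J1 - n)) U = D n u" by blast
  have J11: "J1 \<ge> 1" using J1 n by simp
  obtain J where J: "J \<ge> J1" and pz: "\<And>z. z \<in> fin_supp (words_deg p q) A \<Longrightarrow>
      (\<forall>s. kd A (seq_pow R as J) z s = \<zero>) \<Longrightarrow> \<exists>y\<in>fin_supp (words_deg p (Suc q)) A.
      \<forall>s. koszul_weight R (J - J1) as s \<otimes> z s = kd A (seq_pow R as J1) y s"
    using wpr J11 Suc.prems unfolding koszul_pro_zero_def self_module_simps by meson
  let ?e = "J1 - n"
  have n_e: "n + ?e = J1" and je: "j \<le> ?e" using J1 by simp_all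
  have "\<exists>u\<in>small j. kmult X (hops (J - n)) U = D n u" if bU: "bicycle n J q U" for U
  proof -
    have U: "U s \<in> carrier X" and Uq: "s \<notin> words_deg p q \<Longrightarrow> U s = \<zero>\<^bsub>X\<^esub>"
      and dU: "kd X (seq_pow R as J) U s = \<zero>\<^bsub>X\<^esub>" and DU: "D n (U s) = \<zero>\<^bsub>X\<^esub>" for s
      using bU unfolding bicycle_def by blast+
    have UX: "U s \<in> fin_supp (words p) A" for s using U[of s] by simp
    have UR: "U s t \<in> carrier R" for s t using fin_suppD(1)[OF UX, of s t] by simp
    have "\<exists>y\<in>fin_supp (words_deg p (Suc q)) A.
      \<forall>s. koszul_weight R (J - J1) as s \<otimes> U s t = kd A (seq_pow R as J1) y s" for t
    proof (rule pz)
      show "(\<lambda>s. U s t) \<in> fin_supp (words_deg p q) A"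
        using Uq UR by (intro fin_suppI'[OF finite_words_deg]) auto
      have "kd A (seq_pow R as J) (\<lambda>s. U s t) s = kd X (seq_pow R as J) U s t" for s
        by (rule A.kd_fun_module[OF spc UX, symmetric])
      then show "\<forall>s. kd A (seq_pow R as J) (\<lambda>s. U s t) s = \<zero>" using dU by simp
    qed
    then obtain y where y: "\<And>t. y t \<in> fin_supp (words_deg p (Suc q)) A"
      "\<And>t s. koszul_weight R (J - J1) as s \<otimes> U s t = kd A (seq_pow R as J1) (y t) s" by metis
    define V where "V s t = (if t \<in> words p then y t s else \<zero>)" for s t
    have yR: "y t s \<in> carrier R" for t s using fin_suppD(1)[OF y(1), of t s] by simp
    have VX: "V s \<in> fin_supp (words p) A" for s
      by (rule fin_suppI'[OF finite_words]) (auto simp: V_def yR)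
    then have V: "V s \<in> carrier X" for s by simp
    have Vq: "V s = \<zero>\<^bsub>X\<^esub>" if "s \<notin> words_deg p (Suc q)" for s
      using fin_suppD(2)[OF y(1) that] by (auto simp: V_def)
    note w = koszul_weight_closed[OF as_closed]
    have dV: "kd X (seq_pow R as J1) V s = koszul_weight R (J - J1) as s \<odot>\<^bsub>X\<^esub> U s" for s
    proof
      fix t
      have "kd X (seq_pow R as J1) V s t = kd A (seq_pow R as J1) (\<lambda>s. V s t) s"
        by (rule A.kd_fun_module[OF spc VX])
      also have "\<dots> = koszul_weight R (J - J1) as s \<otimes> U s t"
      proof (cases "t \<in> words p")
        case True
        then show ?thesis using y(2)[of s t] by (simp add: V_def)
      next
        case False
        then have "(\<lambda>s. V s t) = (\<lambda>_. \<zero>\<^bsub>A\<^esub>)" "U s t = \<zero>"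
          using fin_suppD(2)[OF UX False, of s] by (auto simp: V_def)
        then show ?thesis using A.kd_zero[OF spc] w by simp
      qed
      finally show "kd X (seq_pow R as J1) V s t = (koszul_weight R (J - J1) as s \<odot>\<^bsub>X\<^esub> U s) t" by simp
    qed
    have "D n (kd X (seq_pow R as J1) V s) = \<zero>\<^bsub>X\<^esub>" for s
      unfolding dV by (simp only: D.smult[OF w U] DU X.smult_r_null w)
    from IH[OF bicycle_D[OF V Vq this]] obtain u where
      u: "u \<in> small j" "kmult X (hops ?e) (\<lambda>s. A.sign (Suc q) \<odot>\<^bsub>X\<^esub> D n (V s)) = D n u" by blast
    have "kmult X (hops ?e) (kd X (seq_pow R as J1) V) = kmult X (hops (J - n)) U"
    proof -
      have hk: "set (map (hk A) [0..<p]) \<subseteq> mod_hom R X X" using A.hk_hom by auto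
      have wU: "koszul_weight R e as s \<odot>\<^bsub>X\<^esub> U s \<in> carrier X" for e s using w U by (intro X.smult_closed)
      have "koszul_weight R ?e as s \<odot>\<^bsub>X\<^esub> (koszul_weight R (J - J1) as s \<odot>\<^bsub>X\<^esub> U s)
          = koszul_weight R (J - n) as s \<odot>\<^bsub>X\<^esub> U s" for s
      proof -
        have "J - n = ?e + (J - J1)" using J J1 by simp
        then show ?thesis
          by (simp only: koszul_weight_add[OF as_closed, of ?e "J - J1" s] X.smult_assoc1[OF w w U])
      qed
      then show ?thesis
        unfolding dV[abs_def] hops_def
        by (simp only: X.kmult_weight[OF hk as_closed _ wU] X.kmult_weight[OF hk as_closed _ U] length_map length_upt diff_zero)
    qed
    moreover have "\<exists>u\<in>small j. kmult X (hops ?e) (kd X (seq_pow R as (n + ?e)) V) = D n u"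
      by (rule kmult_boundary[OF V _ _ je u]) (erule Vq, simp)
    ultimately show ?thesis by (simp only: n_e)
  qed
  then show ?case using J J1 by (intro exI[of _ J]) auto
qed

text \<open>
  Small cycles are boundaries of small elements. A cycle \<open>z\<close> in \<open>I^(p J)\<close> is a boundary in the
  first direction of some \<open>W\<close> in column one; continue by climbing.
\<close>

lemma koszul_artin_rees:
  assumes wpr: "koszul_pro_zero R as A" and n: "n \<ge> 1"
  shows "\<exists>N. \<forall>z\<in>small N. D n z = \<zero>\<^bsub>X\<^esub> \<longrightarrow> (\<exists>u\<in>small j. z = D n u)"
proof -
  interpret X: module R X by (rule X_module)
  interpret D: linear_map R X X "D n" by (rule D_map)
  obtain J where J: "J \<ge> n + j" and zz:
    "\<And>U. bicycle n J 1 U \<Longrightarrow> \<exists>u\<in>small j. kmult X (hops (J - n)) U = D n u"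
    using koszul_zigzag[OF wpr n order_refl, of j] by blast
  let ?e = "J - n"
  have n_e: "n + ?e = J" and je: "j \<le> ?e" and J1: "J \<ge> 1" using J n by auto
  have "\<exists>u\<in>small j. z = D n u" if z: "z \<in> small (p * J)" and Dz: "D n z = \<zero>\<^bsub>X\<^esub>" for z
  proof -
    have zX: "z \<in> fin_supp (words p) A" and zc: "z \<in> carrier X" using z by (auto simp: small_def)
    have "\<exists>f\<in>fin_supp (words_deg p 1) A. z t = kd A (seq_pow R as J) f (zero_word p)" for t
      using z by (intro ismult_kd[OF A.module_axioms J1] ismult_Ip_A) (simp add: small_def)
    then obtain f where f: "\<And>t. f t \<in> fin_supp (words_deg p 1) A"
      "\<And>t. z t = kd A (seq_pow R as J) (f t) (zero_word p)" by metis
    have fR: "f t s \<in> carrier R" for t s using fin_suppD(1)[OF f(1), of t s] by simp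
    define W where "W s t = (if t \<in> words p then f t s else \<zero>)" for s t
    have WX: "W s \<in> fin_supp (words p) A" for s
      by (rule fin_suppI'[OF finite_words]) (auto simp: W_def fR)
    then have W: "W s \<in> carrier X" for s by simp
    have Wq: "W s = \<zero>\<^bsub>X\<^esub>" if "s \<notin> words_deg p 1" for s
      using fin_suppD(2)[OF f(1) that] by (auto simp: W_def)
    have dW0: "kd X (seq_pow R as J) W (zero_word p) = z"
    proof
      fix t
      have "kd X (seq_pow R as J) W (zero_word p) t = kd A (seq_pow R as J) (\<lambda>s. W s t) (zero_word p)"
        by (rule A.kd_fun_module[OF spc WX])
      also have "\<dots> = z t"
      proof (cases "t \<in> words p")
        case True
        then show ?thesis using f(2)[of t] by (simp add: W_def)
      next
        case False
        then have "(\<lambda>s. W s t) = (\<lambda>_. \<zero>\<^bsub>A\<^esub>)" "z t = \<zero>"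
          using fin_suppD(2)[OF zX False] by (auto simp: W_def)
        then show ?thesis using A.kd_zero[OF spc] by simp
      qed
      finally show "kd X (seq_pow R as J) W (zero_word p) t = z t" .
    qed
    have dW: "kd X (seq_pow R as J) W s = \<zero>\<^bsub>X\<^esub>" if "s \<noteq> zero_word p" for s
    proof (rule X.kd_deg[OF spc, of _ 1])
      show "\<not> (length s = length (seq_pow R as J) \<and> Suc (count_list s True) = 1)"
        using that count_zero_word[of s] by (cases "count_list s True") auto
    qed (use Wq in \<open>simp only: length_seq_pow\<close>)
    have "D n (kd X (seq_pow R as J) W s) = \<zero>\<^bsub>X\<^esub>" for s
    proof (cases "s = zero_word p")
      case True
      then show ?thesis by (simp only: dW0 Dz)
    next
      case False
      show ?thesis by (simp only: dW[OF False] D.zero)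
    qed
    from zz[OF bicycle_D[OF W Wq this]] obtain u where
      u: "u \<in> small j" "kmult X (hops ?e) (\<lambda>s. A.sign 1 \<odot>\<^bsub>X\<^esub> D n (W s)) = D n u" by blast
    have "kmult X (hops ?e) (kd X (seq_pow R as J) W) = z"
    proof -
      have "kmult X (hops ?e) (kd X (seq_pow R as J) W) = kd X (seq_pow R as J) W (zero_word (length (hops ?e)))"
        by (rule X.kmult_single[OF hops_hom X.kd_closed[OF spc W]]) (unfold length_hops, rule dW)
      then show ?thesis by (simp only: dW0 length_hops)
    qed
    moreover have "\<exists>u\<in>small j. kmult X (hops ?e) (kd X (seq_pow R as (n + ?e)) W) = D n u"
      by (rule kmult_boundary[OF W _ _ je u]) (erule Wq, simp)
    ultimately show ?thesis by (simp only: n_e)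
  qed
  then show ?thesis by (intro exI[of _ "p * J"]) auto
qed

end

lemma (in linear_map) sum_submodule:
  assumes S: "submodule S R M" and T: "submodule T R N"
  shows "submodule {z \<in> carrier N. \<exists>u\<in>S. z \<ominus>\<^bsub>N\<^esub> h u \<in> T} R N"
proof (rule N.submoduleI)
  have SM: "u \<in> carrier M" if "u \<in> S" for u using M.submoduleE(1)[OF S] that by auto
  note hS = closed[OF SM]
  show "\<zero>\<^bsub>N\<^esub> \<in> {z \<in> carrier N. \<exists>u\<in>S. z \<ominus>\<^bsub>N\<^esub> h u \<in> T}"
    using M.submodule_zero[OF S] N.submodule_zero[OF T] zero by (auto simp: a_minus_def intro!: bexI[of _ "\<zero>\<^bsub>M\<^esub>"])
  fix a b assume "a \<in> {z \<in> carrier N. \<exists>u\<in>S. z \<ominus>\<^bsub>N\<^esub> h u \<in> T}"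
  then obtain u where a: "a \<in> carrier N" "u \<in> S" "a \<ominus>\<^bsub>N\<^esub> h u \<in> T" by auto
  have "\<ominus>\<^bsub>N\<^esub> a \<ominus>\<^bsub>N\<^esub> h (\<ominus>\<^bsub>M\<^esub> u) = \<ominus>\<^bsub>N\<^esub> (a \<ominus>\<^bsub>N\<^esub> h u)"
    using a hS SM by (simp add: neg a_minus_def N.M.minus_add)
  then show "\<ominus>\<^bsub>N\<^esub> a \<in> {z \<in> carrier N. \<exists>u\<in>S. z \<ominus>\<^bsub>N\<^esub> h u \<in> T}"
    using a N.submoduleE(3)[OF T a(3)] M.submoduleE(3)[OF S a(2)] by (auto intro!: bexI[of _ "\<ominus>\<^bsub>M\<^esub> u"])
  { assume "b \<in> {z \<in> carrier N. \<exists>u\<in>S. z \<ominus>\<^bsub>N\<^esub> h u \<in> T}"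
    then obtain v where b: "b \<in> carrier N" "v \<in> S" "b \<ominus>\<^bsub>N\<^esub> h v \<in> T" by auto
    have "(a \<oplus>\<^bsub>N\<^esub> b) \<ominus>\<^bsub>N\<^esub> h (u \<oplus>\<^bsub>M\<^esub> v) = (a \<ominus>\<^bsub>N\<^esub> h u) \<oplus>\<^bsub>N\<^esub> (b \<ominus>\<^bsub>N\<^esub> h v)"
      using a b hS SM by (simp add: add a_minus_def N.M.minus_add N.M.a_ac)
    then show "a \<oplus>\<^bsub>N\<^esub> b \<in> {z \<in> carrier N. \<exists>u\<in>S. z \<ominus>\<^bsub>N\<^esub> h u \<in> T}"
      using a b N.submoduleE(5)[OF T a(3) b(3)] M.submoduleE(5)[OF S a(2) b(2)]
      by (auto intro!: bexI[of _ "u \<oplus>\<^bsub>M\<^esub> v"]) }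
  fix r assume r: "r \<in> carrier R"
  have "r \<odot>\<^bsub>N\<^esub> a \<ominus>\<^bsub>N\<^esub> h (r \<odot>\<^bsub>M\<^esub> u) = r \<odot>\<^bsub>N\<^esub> (a \<ominus>\<^bsub>N\<^esub> h u)"
    using a r hS SM by (simp add: smult N.smult_r_diff)
  then show "r \<odot>\<^bsub>N\<^esub> a \<in> {z \<in> carrier N. \<exists>u\<in>S. z \<ominus>\<^bsub>N\<^esub> h u \<in> T}"
    using a r N.submoduleE(4)[OF T r a(3)] M.submoduleE(4)[OF S r a(2)] by (auto intro!: bexI[of _ "r \<odot>\<^bsub>M\<^esub> u"])
qed auto

context module begin

lemma coordinate_submodule:
  assumes H: "submodule H R M"
  shows "submodule {x \<in> fin_supp X M. \<forall>s. x s \<in> H} R (fun_module X M)"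
proof -
  interpret F: module R "fun_module X M" by (rule fun_module)
  show ?thesis
    by (rule F.submoduleI)
      (use submoduleE[OF H] submodule_zero[OF H] fin_supp_zero[of X] fin_supp_add[of _ X] fin_supp_smult[of _ _ X]
        fin_supp_inv[of _ X] in \<open>auto simp: fun_module_inv\<close>)
qed

lemma kd_submodule:
  assumes H: "submodule H R M"
  shows "set bs \<subseteq> carrier R \<Longrightarrow> (\<And>b s. b \<in> set bs \<Longrightarrow> b \<odot>\<^bsub>M\<^esub> f s \<in> H) \<Longrightarrow> kd M bs f s \<in> H"
proof (induct bs arbitrary: f s)
  case Nil
  then show ?case by (simp add: submodule_zero[OF H])
next
  case (Cons b bs)
  show ?case
  proof (cases s)
    case [simp]: (Cons c t)
    have "kd M bs (\<lambda>t. f (c # t)) t \<in> H" using Cons.prems by (intro Cons.hyps) auto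
    then show ?thesis using Cons.prems(2)[of b] submoduleE[OF H] by (cases c) auto
  qed (simp add: submodule_zero[OF H])
qed

lemma kd_slice_hom:
  assumes bs: "set bs \<subseteq> carrier R"
  shows "(\<lambda>w s. kd M bs (\<lambda>q. w (q, s)) z) \<in> mod_hom R (fun_module (T \<times> words p) M) (fun_module (words p) M)"
proof (rule mod_homI)
  have wM: "w x \<in> carrier M" if "w \<in> carrier (fun_module (T \<times> words p) M)" for w x
    using fin_suppD(1)[of w "T \<times> words p" M x] that by simp
  let ?h = "\<lambda>w s. kd M bs (\<lambda>q. w (q, s)) z"
  fix w assume w: "w \<in> carrier (fun_module (T \<times> words p) M)"
  have "?h w s = \<zero>\<^bsub>M\<^esub>" if "s \<notin> words p" for s
  proof -
    have "(\<lambda>q. w (q, s)) = (\<lambda>_. \<zero>\<^bsub>M\<^esub>)" using w fin_suppD(2)[of w "T \<times> words p" M] that by auto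
    then show ?thesis by (simp only: kd_zero[OF bs])
  qed
  then show "?h w \<in> carrier (fun_module (words p) M)"
    unfolding fun_module_simps using wM[OF w] by (intro fin_suppI'[OF finite_words]) (auto intro!: kd_closed[OF bs])
  show "?h (a \<odot>\<^bsub>fun_module (T \<times> words p) M\<^esub> w) = a \<odot>\<^bsub>fun_module (words p) M\<^esub> ?h w" if "a \<in> carrier R" for a
    using kd_smult[OF bs, of "\<lambda>q. w (q, _)" a] wM[OF w] that by (simp add: fun_eq_iff)
  fix v assume v: "v \<in> carrier (fun_module (T \<times> words p) M)"
  show "?h (w \<oplus>\<^bsub>fun_module (T \<times> words p) M\<^esub> v) = ?h w \<oplus>\<^bsub>fun_module (words p) M\<^esub> ?h v"
    using kd_add[OF bs, of "\<lambda>q. w (q, _)" "\<lambda>q. v (q, _)"] wM[OF w] wM[OF v] by (simp add: fun_eq_iff)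
qed

text \<open>
  The differential is homogeneous, so the other components of a chain with homogeneous boundary can
  be dropped.
\<close>

lemma kd_project:
  assumes bs: "set bs \<subseteq> carrier R" and y: "\<And>s. f s \<in> carrier M"
    and sup: "\<And>s. s \<notin> words_deg (length bs) q \<Longrightarrow> kd M bs f s = \<zero>\<^bsub>M\<^esub>"
  shows "kd M bs (\<lambda>s. if s \<in> words_deg (length bs) (Suc q) then f s else \<zero>\<^bsub>M\<^esub>) = kd M bs f"
proof
  fix s
  let ?g = "\<lambda>s. if s \<in> words_deg (length bs) (Suc q) then f s else \<zero>\<^bsub>M\<^esub>"
  show "kd M bs ?g s = kd M bs f s"
  proof (cases "s \<in> words_deg (length bs) q")
    case True
    then show ?thesis by (intro kd_cong) (auto simp: words_deg_def)
  next
    case False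
    then have "kd M bs ?g s = \<zero>\<^bsub>M\<^esub>" by (intro kd_deg[OF bs, of "Suc q"]) (auto simp: words_deg_def)
    then show ?thesis using sup[OF False] by simp
  qed
qed

end

section \<open>Koszul complexes with coefficients in a complete module\<close>

context fg_ideal begin

definition smallM :: "('a, 'm, 's) module_scheme \<Rightarrow> nat \<Rightarrow> (bool list \<Rightarrow> 'm) set"
  where "smallM M j = {x \<in> fin_supp (words p) M. \<forall>s. x s \<in> ismult M (Ip j)}"

lemma Ip_submodule: "submodule (Ip j) R A"
  by (rule ideal_submodule[OF ideal_Ip])

lemma gen_pow_mem: "b \<in> set (seq_pow R as J) \<Longrightarrow> b \<in> Ip J"
  using gen_pow_Ip by (auto simp: seq_pow_def)

end

text \<open>
  The module \<open>M\<close> is separated and complete for the \<open>I\<close>-adic topology. Completeness is stated for series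
  whose \<open>k\<close>-th term lies in \<open>I\<^sup>k M\<close>, the form in which successive approximation produces them.
\<close>

locale complete_flat = fg_ideal + M: module R M for M (structure) +
  assumes wpr: "koszul_pro_zero R as A"
    and flat: "\<And>k. flat_eq R M (Ip k)"
    and sep: "\<And>x. x \<in> carrier M \<Longrightarrow> (\<And>k. x \<in> ismult M (Ip k)) \<Longrightarrow> x = \<zero>\<^bsub>M\<^esub>"
    and conv: "\<And>u. (\<And>k. u k \<in> ismult M (Ip k)) \<Longrightarrow>
      \<exists>x\<in>carrier M. \<forall>m. x \<ominus>\<^bsub>M\<^esub> (\<Oplus>\<^bsub>M\<^esub>k\<in>{..<m}. u k) \<in> ismult M (Ip m)"
begin

abbreviation "FM \<equiv> fun_module (words p) M"
abbreviation "d n \<equiv> kd M (seq_pow R as n)"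

lemma FM_module: "module R FM"
  by (rule M.fun_module)

lemma d_map: "linear_map R FM FM (d n)"
  by (rule M.kd_map_words[OF spc]) simp

lemma smallM_submodule: "submodule (smallM M j) R FM"
  unfolding smallM_def by (rule M.coordinate_submodule[OF M.ismult_submodule[OF ideal_Ip]])

lemma smallM_mono: "i \<le> j \<Longrightarrow> smallM M j \<subseteq> smallM M i"
  using ismult_mono[OF Ip_antimono, of i j M] by (auto simp: smallM_def)

lemma smallM_carrier: "x \<in> smallM M j \<Longrightarrow> x \<in> carrier FM"
  by (simp add: smallM_def)

lemma d_lmult:
  assumes "\<And>s. c s \<in> carrier R" "y \<in> carrier M"
  shows "d n (\<lambda>s. c s \<odot>\<^bsub>M\<^esub> y) = (\<lambda>s. D n c s \<odot>\<^bsub>M\<^esub> y)"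
  by (rule ext, rule M.kd_lmult[OF spc assms])

lemma small_lmult: "c \<in> small j \<Longrightarrow> y \<in> carrier M \<Longrightarrow> (\<lambda>s. c s \<odot>\<^bsub>M\<^esub> y) \<in> smallM M j"
  by (auto simp: small_def smallM_def intro!: M.fin_supp_lmult M.ismult_gen ideal_Ip)

lemma d_smallM: "x \<in> smallM M j \<Longrightarrow> d n x \<in> smallM M j"
  using linear_map.closed[OF d_map, of x n] subsetD[OF spc] M.submoduleE(4)[OF M.ismult_submodule[OF ideal_Ip]]
  by (auto simp: smallM_def intro!: M.kd_submodule[OF M.ismult_submodule[OF ideal_Ip] spc])

text \<open>
  Modulo any power of \<open>I\<close>, a sufficiently small cycle is the boundary of a small element: by
  flatness it is a combination of elements over \<open>R\<close> that are nearly cycles, and the Artin--Rees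
  property corrects these to cycles, which are boundaries.
\<close>

lemma small_cycle_approx:
  assumes n: "n \<ge> 1"
  shows "\<exists>N. \<forall>z\<in>smallM M N. d n z = \<zero>\<^bsub>FM\<^esub> \<longrightarrow> (\<forall>i. \<exists>u\<in>smallM M j. z \<ominus>\<^bsub>FM\<^esub> d n u \<in> smallM M i)"
proof -
  interpret X: module R X by (rule X_module)
  interpret D: linear_map R X X "D n" by (rule D_map)
  interpret FM: module R FM by (rule FM_module)
  interpret d: linear_map R FM FM "d n" by (rule d_map)
  obtain N1 where N1: "\<And>z. z \<in> small N1 \<Longrightarrow> D n z = \<zero>\<^bsub>X\<^esub> \<Longrightarrow> \<exists>u\<in>small j. z = D n u"
    using koszul_artin_rees[OF wpr n, of j] by blast
  define J where "J = max 1 N1"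
  have J: "J \<ge> 1" "J \<ge> N1" by (auto simp: J_def)
  have "\<exists>u\<in>smallM M j. z \<ominus>\<^bsub>FM\<^esub> d n u \<in> smallM M i"
    if z: "z \<in> smallM M (p * J)" and dz: "d n z = \<zero>\<^bsub>FM\<^esub>" for z i
  proof -
    define j3 where "j3 = max i N1"
    obtain N3 where N3: "\<And>z. z \<in> small N3 \<Longrightarrow> D n z = \<zero>\<^bsub>X\<^esub> \<Longrightarrow> \<exists>u\<in>small j3. z = D n u"
      using koszul_artin_rees[OF wpr n, of j3] by blast
    have "\<exists>f\<in>fin_supp (words_deg p 1) M. z s = kd M (seq_pow R as J) f (zero_word p)" for s
      using z by (intro ismult_kd[OF M.module_axioms J(1)]) (simp add: smallM_def)
    then obtain f where f: "\<And>s. f s \<in> fin_supp (words_deg p 1) M"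
      "\<And>s. z s = kd M (seq_pow R as J) (f s) (zero_word p)" by metis
    let ?T = "words_deg p 1 \<times> words p"
    have T: "finite ?T" using finite_words finite_words_deg by blast
    \<comment> \<open>The coordinate at \<open>s\<close> of \<open>hA w\<close>, and of \<open>hM w\<close>, is \<open>\<Sum> a\<^sub>l^J w(l, s)\<close>.\<close>
    define hA where "hA w s = kd A (seq_pow R as J) (\<lambda>q. w (q, s)) (zero_word p)" for w :: "bool list \<times> bool list \<Rightarrow> 'a" and s
    define hM where "hM w s = kd M (seq_pow R as J) (\<lambda>q. w (q, s)) (zero_word p)" for w :: "bool list \<times> bool list \<Rightarrow> 'c" and s
    have hA: "hA \<in> mod_hom R (fun_module ?T A) X"
      unfolding hA_def[abs_def] by (rule A.kd_slice_hom[OF spc])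
    have hM: "hM \<in> mod_hom R (fun_module ?T M) FM"
      unfolding hM_def[abs_def] by (rule M.kd_slice_hom[OF spc])
    have hAM: "hM (\<lambda>t. b t \<odot>\<^bsub>M\<^esub> y) = (\<lambda>s. hA b s \<odot>\<^bsub>M\<^esub> y)"
      if "b \<in> fin_supp ?T A" "y \<in> carrier M" for b y
      using M.kd_lmult[OF spc _ that(2), of "\<lambda>q. b (q, _)"] fin_suppD(1)[OF that(1)] by (simp add: hM_def hA_def fun_eq_iff)
    have hAR: "hA b s \<in> carrier R" if "b \<in> fin_supp ?T A" for b s
      using mod_hom_closed[OF hA, of b] that fin_suppD(1)[of "hA b" "words p" A s] by simp
    define w where "w x = (if x \<in> ?T then f (snd x) (fst x) else \<zero>\<^bsub>M\<^esub>)" for x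
    have w: "w \<in> fin_supp ?T M"
      by (rule fin_suppI'[OF T]) (auto simp: w_def fin_suppD(1)[OF f(1)])
    have hw: "hM w = z"
    proof
      fix s
      show "hM w s = z s"
      proof (cases "s \<in> words p")
        case True
        then have "(\<lambda>q. w (q, s)) = f s" using fin_suppD(2)[OF f(1)] by (auto simp: w_def)
        then show ?thesis using f(2) by (simp add: hM_def)
      next
        case False
        then have "(\<lambda>q. w (q, s)) = (\<lambda>_. \<zero>\<^bsub>M\<^esub>)" "z s = \<zero>\<^bsub>M\<^esub>"
          using z fin_suppD(2)[of z "words p" M s] by (auto simp: w_def smallM_def)
        then show ?thesis unfolding hM_def by (simp only: M.kd_zero[OF spc])
      qed
    qed
    have "w \<in> lspan M {b \<in> fin_supp ?T A. \<forall>s. (D n \<circ> hA) b s \<in> Ip N3}"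
    proof (rule M.flat_eq_operator[OF flat ideal_Ip T mod_hom_comp[OF hA D.hom] mod_hom_comp[OF hM d.hom] _ w])
      show "(d n \<circ> hM) (\<lambda>t. b t \<odot>\<^bsub>M\<^esub> y) s = (D n \<circ> hA) b s \<odot>\<^bsub>M\<^esub> y"
        if "b \<in> fin_supp ?T A" "y \<in> carrier M" for b y s
        unfolding o_def hAM[OF that] d_lmult[OF hAR[OF that(1)] that(2)] ..
      show "(d n \<circ> hM) w s \<in> ismult M (Ip N3)" for s
        unfolding o_def hw dz by (simp add: ismult.zero)
    qed
    then have "hM w \<in> {z \<in> carrier FM. \<exists>u\<in>smallM M j. z \<ominus>\<^bsub>FM\<^esub> d n u \<in> smallM M i}"
    proof (rule M.lspan_image[OF _ FM_module hM d.sum_submodule[OF smallM_submodule smallM_submodule], rotated -1])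
      fix b y assume "b \<in> {b \<in> fin_supp ?T A. \<forall>s. (D n \<circ> hA) b s \<in> Ip N3}" and y: "y \<in> carrier M"
      then have b: "b \<in> fin_supp ?T A" and Db: "\<And>s. D n (hA b) s \<in> Ip N3" by auto
      have hb: "hA b \<in> carrier X" using mod_hom_closed[OF hA] b by simp
      have "hA b s \<in> Ip J" for s
        unfolding hA_def
        using gen_pow_mem fin_suppD(1)[OF b] by (intro A.kd_submodule[OF Ip_submodule spc]) (auto simp: ideal.I_r_closed[OF ideal_Ip])
      then have hs: "hA b \<in> small N1" using hb Ip_antimono[OF J(2)] by (auto simp: small_def)
      have "D n (hA b) \<in> small N3" using D.closed[OF hb] Db by (simp add: small_def)
      moreover have "D n (D n (hA b)) = \<zero>\<^bsub>X\<^esub>" using A.kd_kd[OF spc, of "hA b"] hAR[OF b] by (simp add: fun_eq_iff)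
      ultimately obtain e where e: "e \<in> small j3" "D n (hA b) = D n e" using N3 by blast
      have ec: "e \<in> carrier X" using e by (simp add: small_def)
      have eN1: "e \<in> small N1" "e \<in> small i"
        using e Ip_antimono[of N1 j3] Ip_antimono[of i j3] by (auto simp: small_def j3_def)
      have "hA b \<ominus>\<^bsub>X\<^esub> e \<in> small N1" by (rule X.submodule_diff[OF small_submodule hs eN1(1)])
      moreover have "D n (hA b \<ominus>\<^bsub>X\<^esub> e) = \<zero>\<^bsub>X\<^esub>"
        unfolding D.diff[OF hb ec] e(2) using X.diff_zero_iff[OF D.closed[OF ec] D.closed[OF ec]] by simp
      ultimately obtain v where v: "v \<in> small j" "hA b \<ominus>\<^bsub>X\<^esub> e = D n v" using N1 by blast
      have vR: "v s \<in> carrier R" and eR: "e s \<in> carrier R" for s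
        using v(1) e(1) Ip_carrier by (auto simp: small_def)
      have Dv: "D n v = (\<lambda>s. hA b s \<ominus> e s)"
        using v(2) A.fun_module_diff[of "hA b" "words p" e] hb ec by (simp add: a_minus_def)
      have uy: "(\<lambda>s. v s \<odot>\<^bsub>M\<^esub> y) \<in> smallM M j" using small_lmult[OF v(1) y] .
      have "(\<lambda>s. hA b s \<odot>\<^bsub>M\<^esub> y) \<ominus>\<^bsub>FM\<^esub> d n (\<lambda>s. v s \<odot>\<^bsub>M\<^esub> y) = (\<lambda>s. e s \<odot>\<^bsub>M\<^esub> y)"
      proof -
        have 1: "d n (\<lambda>s. v s \<odot>\<^bsub>M\<^esub> y) = (\<lambda>s. (hA b s \<ominus> e s) \<odot>\<^bsub>M\<^esub> y)"
          unfolding d_lmult[OF vR y] Dv ..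
        have 2: "(\<lambda>s. hA b s \<odot>\<^bsub>M\<^esub> y) \<in> fin_supp (words p) M"
          using hb y by (intro M.fin_supp_lmult) auto
        have 3: "d n (\<lambda>s. v s \<odot>\<^bsub>M\<^esub> y) \<in> fin_supp (words p) M"
          using d.closed[OF smallM_carrier[OF uy]] by simp
        have "h \<odot>\<^bsub>M\<^esub> y \<ominus>\<^bsub>M\<^esub> (h \<ominus> g) \<odot>\<^bsub>M\<^esub> y = g \<odot>\<^bsub>M\<^esub> y" if "h \<in> carrier R" "g \<in> carrier R" for h g
        proof -
          have "h \<ominus> (h \<ominus> g) = g" using that by algebra
          then show ?thesis using that y M.smult_l_diff[of h "h \<ominus> g" y] by simp
        qed
        then show ?thesis unfolding M.fun_module_diff[OF 2 3] unfolding 1 using hAR[OF b] eR by simp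
      qed
      also have "\<dots> \<in> smallM M i" by (rule small_lmult[OF eN1(2) y])
      finally show "hM (\<lambda>t. b t \<odot>\<^bsub>M\<^esub> y) \<in> {z \<in> carrier FM. \<exists>u\<in>smallM M j. z \<ominus>\<^bsub>FM\<^esub> d n u \<in> smallM M i}"
        unfolding hAM[OF b y] using uy hb y by (auto intro!: M.fin_supp_lmult)
    qed auto
    then show ?thesis unfolding hw by simp
  qed
  then show ?thesis by blast
qed

text \<open>
  Successive approximation: the corrections come from ever higher powers of \<open>I\<close>, so that their sum
  converges, and the remaining error lies in all powers of \<open>I\<close>.
\<close>

lemma small_cycle_boundary:
  assumes n: "n \<ge> 1"
  shows "\<exists>N. \<forall>z\<in>smallM M N. d n z = \<zero>\<^bsub>FM\<^esub> \<longrightarrow> (\<exists>u\<in>carrier FM. z = d n u)"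
proof -
  interpret FM: module R FM by (rule FM_module)
  interpret d: linear_map R FM FM "d n" by (rule d_map)
  obtain N0 where N0: "\<And>j z i. z \<in> smallM M (N0 j) \<Longrightarrow> d n z = \<zero>\<^bsub>FM\<^esub> \<Longrightarrow> \<exists>u\<in>smallM M j. z \<ominus>\<^bsub>FM\<^esub> d n u \<in> smallM M i"
    using small_cycle_approx[OF n] by metis
  \<comment> \<open>The bound \<open>j\<close> makes the \<open>j\<close>-th remainder lie in \<open>I\<^sup>j M\<close>.\<close>
  define N where "N j = max (N0 j) j" for j
  have "\<exists>u\<in>carrier FM. z = d n u" if z: "z \<in> smallM M (N 0)" and dz: "d n z = \<zero>\<^bsub>FM\<^esub>" for z
  proof -
    define P where "P j z \<longleftrightarrow> z \<in> smallM M (N j) \<and> d n z = \<zero>\<^bsub>FM\<^esub>" for j z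
    have "\<exists>u. u \<in> smallM M j \<and> P (Suc j) (z \<ominus>\<^bsub>FM\<^esub> d n u)" if "P j z" for j z
    proof -
      have z: "z \<in> smallM M (N0 j)" "d n z = \<zero>\<^bsub>FM\<^esub>" "z \<in> carrier FM"
        using that smallM_mono[of "N0 j" "N j"] by (auto simp: P_def N_def smallM_def)
      obtain u where u: "u \<in> smallM M j" "z \<ominus>\<^bsub>FM\<^esub> d n u \<in> smallM M (N (Suc j))" using N0[OF z(1,2)] by blast
      have uc: "u \<in> carrier FM" "u s \<in> carrier M" for s using u smallM_carrier fin_suppD(1)[of u "words p" M s] by (auto simp: smallM_def)
      have "d n (d n u) = \<zero>\<^bsub>FM\<^esub>" using M.kd_kd[OF spc uc(2)] by (simp add: fun_eq_iff)
      then have "d n (z \<ominus>\<^bsub>FM\<^esub> d n u) = \<zero>\<^bsub>FM\<^esub>"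
        using z uc by (simp only: d.diff d.closed) (simp only: FM.diff_zero_iff FM.M.zero_closed)
      then show ?thesis using u by (auto simp: P_def)
    qed
    then obtain U where U: "\<And>j z. P j z \<Longrightarrow> U j z \<in> smallM M j \<and> P (Suc j) (z \<ominus>\<^bsub>FM\<^esub> d n (U j z))" by metis
    define zz where "zz = rec_nat z (\<lambda>j z. z \<ominus>\<^bsub>FM\<^esub> d n (U j z))"
    have zz: "zz 0 = z" "\<And>j. zz (Suc j) = zz j \<ominus>\<^bsub>FM\<^esub> d n (U j (zz j))" by (simp_all add: zz_def)
    define u where "u j = U j (zz j)" for j
    have Pz: "P j (zz j)" for j
    proof (induct j)
      case 0
      show ?case using z dz by (simp add: P_def zz)
    next
      case (Suc j)
      then show ?case using U[of j "zz j"] by (simp add: zz)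
    qed
    have u: "u j \<in> smallM M j" for j using U[OF Pz] by (simp add: u_def)
    have uc: "u j \<in> carrier FM" for j using smallM_carrier[OF u] .
    have zc: "zz j \<in> carrier FM" for j using Pz smallM_carrier by (auto simp: P_def)
    have zsum: "z \<ominus>\<^bsub>FM\<^esub> d n (\<Oplus>\<^bsub>FM\<^esub>k\<in>{..<m}. u k) = zz m" for m
    proof (induct m)
      case 0
      have "z \<ominus>\<^bsub>FM\<^esub> d n \<zero>\<^bsub>FM\<^esub> = z" unfolding d.zero a_minus_def FM.M_minus_zero
        using zc[of 0] by (simp only: zz FM.M.r_zero)
      then show ?case by (simp only: lessThan_0 FM.M.finsum_empty zz)
    next
      case (Suc m)
      let ?s = "\<Oplus>\<^bsub>FM\<^esub>k\<in>{..<m}. u k"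
      have sc: "?s \<in> carrier FM" using uc by (intro FM.M.finsum_closed) auto
      have "(\<Oplus>\<^bsub>FM\<^esub>k\<in>{..<Suc m}. u k) = u m \<oplus>\<^bsub>FM\<^esub> ?s"
        unfolding lessThan_Suc using uc by (intro FM.M.finsum_insert) auto
      then have "z \<ominus>\<^bsub>FM\<^esub> d n (\<Oplus>\<^bsub>FM\<^esub>k\<in>{..<Suc m}. u k) = (z \<ominus>\<^bsub>FM\<^esub> d n ?s) \<ominus>\<^bsub>FM\<^esub> d n (u m)"
        using zc[of 0] sc uc[of m] d.closed[OF sc] d.closed[OF uc[of m]] unfolding a_minus_def
        by (simp only: d.add FM.M.minus_add FM.M.a_ac FM.M.a_inv_closed FM.M.a_closed zz)
      then show ?case unfolding Suc by (simp only: zz(2) u_def[of m])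
    qed
    have "\<exists>x\<in>carrier M. \<forall>m. x \<ominus>\<^bsub>M\<^esub> (\<Oplus>\<^bsub>M\<^esub>k\<in>{..<m}. u k s) \<in> ismult M (Ip m)" for s
      using u by (intro conv) (simp add: smallM_def)
    then obtain x where x: "\<And>s. x s \<in> carrier M" "\<And>s m. x s \<ominus>\<^bsub>M\<^esub> (\<Oplus>\<^bsub>M\<^esub>k\<in>{..<m}. u k s) \<in> ismult M (Ip m)" by metis
    define y where "y s = (if s \<in> words p then x s else \<zero>\<^bsub>M\<^esub>)" for s
    have y: "y \<in> fin_supp (words p) M" by (rule fin_suppI'[OF finite_words]) (auto simp: y_def x)
    then have yc: "y \<in> carrier FM" by simp
    have ysmall: "y \<ominus>\<^bsub>FM\<^esub> (\<Oplus>\<^bsub>FM\<^esub>k\<in>{..<m}. u k) \<in> smallM M m" for m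
    proof -
      have sc: "(\<Oplus>\<^bsub>FM\<^esub>k\<in>{..<m}. u k) \<in> carrier FM" using uc by (intro FM.M.finsum_closed) auto
      have s: "(\<Oplus>\<^bsub>FM\<^esub>k\<in>{..<m}. u k) = (\<lambda>s. \<Oplus>\<^bsub>M\<^esub>k\<in>{..<m}. u k s)"
        using uc by (intro M.fun_module_finsum) auto
      have "(y \<ominus>\<^bsub>FM\<^esub> (\<Oplus>\<^bsub>FM\<^esub>k\<in>{..<m}. u k)) s \<in> ismult M (Ip m)" for s
      proof (cases "s \<in> words p")
        case True
        then show ?thesis using M.fun_module_diff[OF y, of "\<Oplus>\<^bsub>FM\<^esub>k\<in>{..<m}. u k"] sc x(2)[of s m] s by (simp add: y_def)
      next
        case False
        have "y \<ominus>\<^bsub>FM\<^esub> (\<Oplus>\<^bsub>FM\<^esub>k\<in>{..<m}. u k) \<in> carrier FM" by (intro FM.M.minus_closed yc sc)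
        then show ?thesis using fin_suppD(2)[OF _ False, of "y \<ominus>\<^bsub>FM\<^esub> (\<Oplus>\<^bsub>FM\<^esub>k\<in>{..<m}. u k)" M] by (simp add: ismult.zero)
      qed
      then show ?thesis using FM.M.minus_closed[OF yc sc] by (simp add: smallM_def)
    qed
    have diff: "z \<ominus>\<^bsub>FM\<^esub> d n y \<in> smallM M m" for m
    proof -
      let ?s = "\<Oplus>\<^bsub>FM\<^esub>k\<in>{..<m}. u k"
      have sc: "?s \<in> carrier FM" using uc by (intro FM.M.finsum_closed) auto
      have 1: "zz m \<in> smallM M m" using Pz[of m] smallM_mono[of m "N m"] by (auto simp: P_def N_def)
      have 2: "d n (y \<ominus>\<^bsub>FM\<^esub> ?s) \<in> smallM M m" by (intro d_smallM ysmall)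
      have c: "z \<in> carrier FM" "d n y \<in> carrier FM" "d n ?s \<in> carrier FM"
        using zc[of 0] d.closed yc sc by (simp_all only: zz)
      have "zz m \<ominus>\<^bsub>FM\<^esub> d n (y \<ominus>\<^bsub>FM\<^esub> ?s) = (z \<oplus>\<^bsub>FM\<^esub> \<ominus>\<^bsub>FM\<^esub> d n ?s) \<oplus>\<^bsub>FM\<^esub> (d n ?s \<oplus>\<^bsub>FM\<^esub> \<ominus>\<^bsub>FM\<^esub> d n y)"
        unfolding zsum[symmetric] d.diff[OF yc sc] unfolding a_minus_def
        using c by (simp only: FM.M.minus_add FM.M.minus_minus FM.M.a_inv_closed FM.M.a_comm)
      also have "\<dots> = z \<ominus>\<^bsub>FM\<^esub> d n y"
        unfolding a_minus_def using c
        by (simp only: FM.M.a_assoc FM.M.r_neg1 FM.M.a_inv_closed FM.M.a_closed)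
      finally show ?thesis using FM.submodule_diff[OF smallM_submodule 1 2] by simp
    qed
    have "z = d n y"
    proof
      fix s
      have c: "z \<in> fin_supp (words p) M" "d n y \<in> fin_supp (words p) M"
        using zc[of 0] d.closed[OF yc] by (simp_all add: zz)
      have e: "(z \<ominus>\<^bsub>FM\<^esub> d n y) s = z s \<ominus>\<^bsub>M\<^esub> d n y s" using M.fun_module_diff[OF c] by simp
      have "z s \<ominus>\<^bsub>M\<^esub> d n y s = \<zero>\<^bsub>M\<^esub>"
        using diff fin_suppD(1)[OF c(1)] fin_suppD(1)[OF c(2)]
        by (intro sep M.M.minus_closed) (auto simp: smallM_def e[symmetric] simp del: fun_module_simps)
      then show "z s = d n y s" using M.diff_zero_iff fin_suppD(1)[OF c(1)] fin_suppD(1)[OF c(2)] by simp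
    qed
    then show ?thesis using yc by blast
  qed
  then show ?thesis by blast
qed

text \<open>
  Flatness makes a cycle a combination of vectors over \<open>R\<close> that are cycles modulo a high power of \<open>I\<close>.
  Their boundaries are small, hence by the Artin--Rees property boundaries of small elements, and
  subtracting these gives cycles.
\<close>

lemma cycle_decompose:
  assumes n: "n \<ge> 1" and q: "q \<ge> 1" and z: "z \<in> fin_supp (words_deg p q) M" and dz: "d n z = \<zero>\<^bsub>FM\<^esub>"
  shows "\<exists>z0\<in>lspan M {c \<in> fin_supp (words_deg p q) A. D n c = \<zero>\<^bsub>X\<^esub>}. z \<ominus>\<^bsub>FM\<^esub> z0 \<in> smallM M N"
proof -
  interpret X: module R X by (rule X_module)
  interpret D: linear_map R X X "D n" by (rule D_map)
  interpret d: linear_map R FM FM "d n" by (rule d_map)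
  interpret FM: module R FM by (rule FM_module)
  let ?T = "words_deg p q"
  let ?C = "{c \<in> fin_supp ?T A. D n c = \<zero>\<^bsub>X\<^esub>}"
  have sub: "fin_supp ?T N' \<subseteq> fin_supp (words p) N'" for N' :: "('a, 'x, 'y) module_scheme"
    by (rule fin_supp_mono[OF words_deg_subset])
  have sub': "fin_supp ?T A \<subseteq> carrier X" "fin_supp ?T M \<subseteq> carrier FM"
    using fin_supp_mono[OF words_deg_subset[of p q]] by auto
  obtain N3 where N3: "\<And>z. z \<in> small N3 \<Longrightarrow> D n z = \<zero>\<^bsub>X\<^esub> \<Longrightarrow> \<exists>u\<in>small N. z = D n u"
    using koszul_artin_rees[OF wpr n, of N] by blast
  have r: "D n \<in> mod_hom R (fun_module ?T A) X" "d n \<in> mod_hom R (fun_module ?T M) FM" "id \<in> mod_hom R (fun_module ?T M) FM"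
    by (rule mod_homI; use D.closed D.add D.smult d.closed d.add d.smult sub' in \<open>auto simp: subset_iff\<close>)+
  have C: "?C \<subseteq> fin_supp ?T A" by auto
  have CX: "?C \<subseteq> fin_supp (words p) A" using sub' by auto
  have "z \<in> lspan M {b \<in> fin_supp ?T A. \<forall>s. D n b s \<in> Ip N3}"
  proof (rule M.flat_eq_operator[OF flat ideal_Ip finite_words_deg r(1,2) _ z])
    show "d n (\<lambda>t. b t \<odot>\<^bsub>M\<^esub> y) s = D n b s \<odot>\<^bsub>M\<^esub> y" if "b \<in> fin_supp ?T A" "y \<in> carrier M" for b y s
      using fin_suppD(1)[OF that(1)] by (subst d_lmult[OF _ that(2)]) auto
    show "d n z s \<in> ismult M (Ip N3)" for s using dz by (simp add: ismult.zero)
  qed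
  then have "id z \<in> {z \<in> carrier FM. \<exists>z0\<in>lspan M ?C. z \<ominus>\<^bsub>FM\<^esub> id z0 \<in> smallM M N}"
  proof (rule M.lspan_image[OF _ FM_module r(3) linear_map.sum_submodule[OF _ M.lspan_submodule[OF CX] smallM_submodule], rotated -1])
    show "linear_map R FM FM id"
      by (intro linear_mapI FM_module mod_hom_id)
    fix b y assume "b \<in> {b \<in> fin_supp ?T A. \<forall>s. D n b s \<in> Ip N3}" and y: "y \<in> carrier M"
    then have b: "b \<in> fin_supp ?T A" and Db: "\<And>s. D n b s \<in> Ip N3" by auto
    have bX: "b \<in> carrier X" using b sub' by auto
    have bR: "b s \<in> carrier R" for s using fin_suppD(1)[OF b, of s] by simp
    have "D n b \<in> small N3" using D.closed[OF bX] Db by (simp add: small_def)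
    moreover have "D n (D n b) = \<zero>\<^bsub>X\<^esub>" using A.kd_kd[OF spc, of b] bR by (simp add: fun_eq_iff)
    ultimately obtain e where e: "e \<in> small N" "D n b = D n e" using N3 by blast
    have eR: "e s \<in> carrier R" for s using e(1) Ip_carrier by (auto simp: small_def)
    obtain q' where q': "q = Suc q'" using q by (cases q) auto
    define e' where "e' s = (if s \<in> ?T then e s else \<zero>)" for s
    have e'T: "e' \<in> fin_supp ?T A" by (rule fin_suppI'[OF finite_words_deg]) (auto simp: e'_def eR)
    have e's: "e' \<in> small N"
      using e(1) e'T sub' additive_subgroup.zero_closed[OF ideal.axioms(1)[OF ideal_Ip]] by (auto simp: small_def e'_def)
    have "D n e' = D n e"
    proof -
      have "D n e s = \<zero>\<^bsub>A\<^esub>" if "s \<notin> words_deg (length (seq_pow R as n)) q'" for s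
        unfolding e(2)[symmetric]
        by (rule A.kd_deg[OF spc, of _ q]) (use fin_suppD(2)[OF b] that q' in \<open>auto simp: words_deg_def\<close>)
      from A.kd_project[OF spc, of e n q', OF _ this] show ?thesis
        using eR unfolding e'_def[abs_def] q' self_module_simps by simp
    qed
    then have De: "D n b = D n e'" using e by simp
    have e'X: "e' \<in> carrier X" using e'T sub' by auto
    let ?c = "b \<ominus>\<^bsub>X\<^esub> e'"
    have cf: "?c = (\<lambda>s. b s \<ominus> e' s)"
      using A.fun_module_diff[of b "words p" e'] bX e'X by (simp add: a_minus_def)
    have "?c \<in> fin_supp ?T A" unfolding cf using A.fin_supp_diff[OF b e'T] by (simp add: a_minus_def)
    moreover have "D n ?c = \<zero>\<^bsub>X\<^esub>"
      unfolding D.diff[OF bX e'X] De using X.diff_zero_iff[OF D.closed[OF e'X] D.closed[OF e'X]] by simp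
    ultimately have c: "?c \<in> ?C" by simp
    have 1: "(\<lambda>s. ?c s \<odot>\<^bsub>M\<^esub> y) \<in> lspan M ?C" by (rule M.lspan_gen[OF C c y])
    have by': "(\<lambda>s. b s \<odot>\<^bsub>M\<^esub> y) \<in> fin_supp (words p) M" using bX y by (intro M.fin_supp_lmult) auto
    have cy': "(\<lambda>s. ?c s \<odot>\<^bsub>M\<^esub> y) \<in> fin_supp (words p) M" using X.M.minus_closed[OF bX e'X] y by (intro M.fin_supp_lmult) auto
    have "(\<lambda>s. b s \<odot>\<^bsub>M\<^esub> y) \<ominus>\<^bsub>FM\<^esub> (\<lambda>s. ?c s \<odot>\<^bsub>M\<^esub> y) = (\<lambda>s. e' s \<odot>\<^bsub>M\<^esub> y)"
    proof -
      have "h \<odot>\<^bsub>M\<^esub> y \<ominus>\<^bsub>M\<^esub> (h \<ominus> g) \<odot>\<^bsub>M\<^esub> y = g \<odot>\<^bsub>M\<^esub> y" if "h \<in> carrier R" "g \<in> carrier R" for h g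
      proof -
        have "h \<ominus> (h \<ominus> g) = g" using that by algebra
        then show ?thesis using that y M.smult_l_diff[of h "h \<ominus> g" y] by simp
      qed
      moreover have "e' s \<in> carrier R" for s using fin_suppD(1)[OF e'T, of s] by simp
      ultimately show ?thesis using M.fun_module_diff[OF by' cy'] bR unfolding cf by (simp add: fun_eq_iff)
    qed
    also have "\<dots> \<in> smallM M N" by (rule small_lmult[OF e's y])
    finally show "id (\<lambda>t. b t \<odot>\<^bsub>M\<^esub> y) \<in> {z \<in> carrier FM. \<exists>z0\<in>lspan M ?C. z \<ominus>\<^bsub>FM\<^esub> id z0 \<in> smallM M N}"
      using 1 by' by auto
  qed auto
  then show ?thesis by simp
qed

text \<open>
  Up to a small cycle, which is a boundary, a cycle is a combination of cycles over \<open>R\<close>, and these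
  become boundaries at a lower level by weak proregularity.
\<close>

lemma complete_pro_zero: "koszul_pro_zero R as M"
  unfolding koszul_pro_zero_def
proof (intro allI impI)
  fix q m :: nat assume q: "1 \<le> q" and m: "1 \<le> m"
  obtain k where k: "k \<ge> m" and pz: "\<And>z. z \<in> fin_supp (words_deg p q) A \<Longrightarrow>
      (\<forall>s. kd A (seq_pow R as k) z s = \<zero>) \<Longrightarrow> \<exists>y\<in>fin_supp (words_deg p (Suc q)) A.
      \<forall>s. koszul_weight R (k - m) as s \<otimes> z s = kd A (seq_pow R as m) y s"
    using wpr q m unfolding koszul_pro_zero_def self_module_simps by meson
  have k1: "k \<ge> 1" and mk: "m + (k - m) = k" using k m by auto
  interpret FM: module R FM by (rule FM_module)
  interpret dk: linear_map R FM FM "d k" by (rule d_map)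
  interpret dm: linear_map R FM FM "d m" by (rule d_map)
  note w = koszul_weight_closed[OF as_closed]
  let ?kt = "\<lambda>z s. koszul_weight R (k - m) as s \<odot>\<^bsub>M\<^esub> z s"
  have kt: "?kt \<in> mod_hom R FM FM"
  proof (rule mod_homI)
    fix z assume "z \<in> carrier FM"
    then have z: "z \<in> fin_supp (words p) M" by simp
    show "?kt z \<in> carrier FM"
      unfolding fun_module_simps by (intro fin_suppI'[OF finite_words]) (use fin_suppD[OF z] w in auto)
    show "?kt (a \<odot>\<^bsub>FM\<^esub> z) = a \<odot>\<^bsub>FM\<^esub> ?kt z" if "a \<in> carrier R" for a
      using that w fin_suppD(1)[OF z] by (simp add: M.smult_lcomm)
    fix y assume "y \<in> carrier FM"
    then show "?kt (z \<oplus>\<^bsub>FM\<^esub> y) = ?kt z \<oplus>\<^bsub>FM\<^esub> ?kt y"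
      using w fin_suppD(1)[OF z] fin_suppD(1)[of y "words p" M] by (simp add: M.smult_r_distr)
  qed
  interpret kt: linear_map R FM FM ?kt by (intro linear_mapI FM_module kt)
  obtain N where N: "\<And>z. z \<in> smallM M N \<Longrightarrow> d k z = \<zero>\<^bsub>FM\<^esub> \<Longrightarrow> \<exists>u\<in>carrier FM. z = d k u"
    using small_cycle_boundary[OF k1] by blast
  have "\<exists>y\<in>fin_supp (words_deg p (Suc q)) M. \<forall>s. koszul_weight R (k - m) as s \<odot>\<^bsub>M\<^esub> z s = d m y s"
    if z: "z \<in> fin_supp (words_deg p q) M" and dz: "\<forall>s. d k z s = \<zero>\<^bsub>M\<^esub>" for z
  proof -
    have zc: "z \<in> carrier FM" using z fin_supp_mono[OF words_deg_subset[of p q]] by auto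
    have dz': "d k z = \<zero>\<^bsub>FM\<^esub>" using dz by auto
    let ?C = "{c \<in> fin_supp (words_deg p q) A. D k c = \<zero>\<^bsub>X\<^esub>}"
    obtain z0 where z0: "z0 \<in> lspan M ?C" and small: "z \<ominus>\<^bsub>FM\<^esub> z0 \<in> smallM M N"
      using cycle_decompose[OF k1 q z dz'] by blast
    have C: "?C \<subseteq> fin_supp (words p) A" using fin_supp_mono[OF words_deg_subset[of p q]] by auto
    have z0c: "z0 \<in> carrier FM" using M.lspan_fin_supp[OF C z0] by simp
    have "d k z0 \<in> {\<zero>\<^bsub>FM\<^esub>}"
    proof (rule M.lspan_image[OF C FM_module dk.hom _ _ z0])
      show "submodule {\<zero>\<^bsub>FM\<^esub>} R FM" using FM.M_minus_zero by (intro FM.submoduleI) (auto simp: M.fin_supp_zero)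
      fix c y assume c: "c \<in> ?C" and y: "y \<in> carrier M"
      have "c s \<in> carrier R" for s using c fin_suppD(1)[of c "words_deg p q" A s] by simp
      then show "d k (\<lambda>t. c t \<odot>\<^bsub>M\<^esub> y) \<in> {\<zero>\<^bsub>FM\<^esub>}" using c y by (simp add: d_lmult)
    qed
    then have "d k (z \<ominus>\<^bsub>FM\<^esub> z0) = \<zero>\<^bsub>FM\<^esub>"
      using dz' zc z0c by (simp only: dk.diff singleton_iff FM.diff_zero_iff FM.M.zero_closed)
    then obtain u where u: "u \<in> carrier FM" "z \<ominus>\<^bsub>FM\<^esub> z0 = d k u" using N[OF small] by blast
    have "?kt z0 \<in> d m ` carrier FM"
    proof (rule M.lspan_image[OF C FM_module kt dm.image_submodule _ z0])
      fix c y assume c: "c \<in> ?C" and y: "y \<in> carrier M"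
      then obtain v where v: "v \<in> fin_supp (words_deg p (Suc q)) A"
        "\<And>s. koszul_weight R (k - m) as s \<otimes> c s = D m v s" using pz[of c] by (auto simp: fun_eq_iff)
      have cR: "c s \<in> carrier R" and vR: "v s \<in> carrier R" for s
        using c fin_suppD(1)[of c "words_deg p q" A s] fin_suppD(1)[OF v(1), of s] by simp_all
      have "?kt (\<lambda>t. c t \<odot>\<^bsub>M\<^esub> y) = d m (\<lambda>s. v s \<odot>\<^bsub>M\<^esub> y)"
        unfolding d_lmult[OF vR y] using v(2) cR w y by (simp add: M.smult_assoc1[symmetric])
      moreover have "(\<lambda>s. v s \<odot>\<^bsub>M\<^esub> y) \<in> carrier FM"
        using M.fin_supp_lmult[OF v(1) y] fin_supp_mono[OF words_deg_subset[of p "Suc q"]] by auto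
      ultimately show "?kt (\<lambda>t. c t \<odot>\<^bsub>M\<^esub> y) \<in> d m ` carrier FM" by (rule image_eqI)
    qed
    then obtain v where v: "?kt z0 = d m v" "v \<in> carrier FM" by (rule imageE)
    have uM: "u s \<in> carrier M" for s using u(1) fin_suppD(1)[of u "words p" M s] by simp
    have ku: "?kt (d k u) = d m (?kt u)"
      using M.kd_trans[OF as_closed uM, of m "k - m"] by (simp add: mk fun_eq_iff)
    have "z = (z \<ominus>\<^bsub>FM\<^esub> z0) \<oplus>\<^bsub>FM\<^esub> z0"
      unfolding a_minus_def using zc z0c by (simp only: FM.M.a_assoc FM.M.l_neg FM.M.a_inv_closed FM.M.r_zero)
    then have "?kt z = ?kt (d k u \<oplus>\<^bsub>FM\<^esub> z0)" using u(2) by simp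
    also have "\<dots> = d m (?kt u) \<oplus>\<^bsub>FM\<^esub> d m v"
      using kt.add[OF dk.closed[OF u(1)] z0c] ku v(1) by simp
    also have "\<dots> = d m (?kt u \<oplus>\<^bsub>FM\<^esub> v)"
      by (rule dm.add[OF kt.closed[OF u(1)] v(2), symmetric])
    finally obtain y where y: "y \<in> carrier FM" "?kt z = d m y" using FM.M.a_closed[OF kt.closed[OF u(1)] v(2)] by blast
    have yM: "y s \<in> carrier M" for s using y(1) fin_suppD(1)[of y "words p" M s] by simp
    let ?y = "\<lambda>s. if s \<in> words_deg p (Suc q) then y s else \<zero>\<^bsub>M\<^esub>"
    have "d m y s = \<zero>\<^bsub>M\<^esub>" if "s \<notin> words_deg p q" for s
      using fun_cong[OF y(2), of s] fin_suppD(2)[OF z that] w by simp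
    then have "d m ?y = d m y" using M.kd_project[OF spc, of y m q] yM by simp
    moreover have "?y \<in> fin_supp (words_deg p (Suc q)) M"
      by (rule fin_suppI'[OF finite_words_deg]) (auto simp: yM)
    ultimately show ?thesis using y(2) by (metis (no_types, lifting))
  qed
  then show "\<exists>k\<ge>m. \<forall>z\<in>fin_supp (words_deg p q) M. (\<forall>s. d k z s = \<zero>\<^bsub>M\<^esub>) \<longrightarrow>
      (\<exists>y\<in>fin_supp (words_deg p (Suc q)) M. \<forall>s. koszul_weight R (k - m) as s \<odot>\<^bsub>M\<^esub> z s = d m y s)"
    using k by blast
qed

end

section \<open>Syzygies\<close>

context module begin

lemma kd_fin_supp:
  assumes bs: "set bs \<subseteq> carrier R" and f: "f \<in> fin_supp (words_deg (length bs) (Suc q)) M"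
  shows "kd M bs f \<in> fin_supp (words_deg (length bs) q) M"
proof (rule fin_suppI'[OF finite_words_deg])
  show "kd M bs f s \<in> carrier M" for s by (rule kd_closed[OF bs fin_suppD(1)[OF f]])
  show "kd M bs f s = \<zero>\<^bsub>M\<^esub>" if "s \<notin> words_deg (length bs) q" for s
    by (rule kd_deg[OF bs fin_suppD(2)[OF f]]) (use that in \<open>auto simp: words_deg_def\<close>)
qed

lemma row_map:
  assumes S: "finite S" and r: "\<And>s. s \<in> S \<Longrightarrow> r s \<in> carrier R"
  shows "linear_map R (fun_module S M) M (\<lambda>v. \<Oplus>\<^bsub>M\<^esub>s\<in>S. r s \<odot>\<^bsub>M\<^esub> v s)"
proof (intro linear_mapI fun_module module_axioms mod_homI)
  have vM: "v s \<in> carrier M" if "v \<in> carrier (fun_module S M)" for v s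
    using fin_suppD(1)[of v S M s] that by simp
  let ?h = "\<lambda>v. \<Oplus>\<^bsub>M\<^esub>s\<in>S. r s \<odot>\<^bsub>M\<^esub> v s"
  fix v assume v: "v \<in> carrier (fun_module S M)"
  show "?h v \<in> carrier M" using r vM[OF v] by (intro M.finsum_closed) auto
  show "?h (a \<odot>\<^bsub>fun_module S M\<^esub> v) = a \<odot>\<^bsub>M\<^esub> ?h v" if a: "a \<in> carrier R" for a
  proof -
    have "?h (a \<odot>\<^bsub>fun_module S M\<^esub> v) = (\<Oplus>\<^bsub>M\<^esub>s\<in>S. a \<odot>\<^bsub>M\<^esub> (r s \<odot>\<^bsub>M\<^esub> v s))"
      using r vM[OF v] a by (intro M.finsum_cong') (auto simp: smult_lcomm)
    then show ?thesis using r vM[OF v] a S by (subst finsum_smult_ldistr) auto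
  qed
  fix w assume w: "w \<in> carrier (fun_module S M)"
  have "?h (v \<oplus>\<^bsub>fun_module S M\<^esub> w) = (\<Oplus>\<^bsub>M\<^esub>s\<in>S. r s \<odot>\<^bsub>M\<^esub> v s \<oplus>\<^bsub>M\<^esub> r s \<odot>\<^bsub>M\<^esub> w s)"
    using r vM[OF v] vM[OF w] by (intro M.finsum_cong') (auto simp: smult_r_distr)
  also have "\<dots> = ?h v \<oplus>\<^bsub>M\<^esub> ?h w"
    using r vM[OF v] vM[OF w] by (intro M.finsum_addf) auto
  finally show "?h (v \<oplus>\<^bsub>fun_module S M\<^esub> w) = ?h v \<oplus>\<^bsub>M\<^esub> ?h w" .
qed

lemma ismult_finsum:
  assumes J: "ideal J R" and "finite S" "\<And>s. s \<in> S \<Longrightarrow> r s \<in> J" "\<And>s. s \<in> S \<Longrightarrow> y s \<in> carrier M"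
  shows "(\<Oplus>\<^bsub>M\<^esub>s\<in>S. r s \<odot>\<^bsub>M\<^esub> y s) \<in> ismult M J"
  using assms by (intro submodule_finsum[OF ismult_submodule[OF J]] ismult_gen) auto

end

lemma (in module) lspan_lift:
  assumes L: "linear_map R L M \<phi>" and surj: "\<And>y. y \<in> carrier M \<Longrightarrow> \<exists>w\<in>carrier L. \<phi> w = y"
    and S: "S \<subseteq> fin_supp X (self_module R)" and q: "q \<in> lspan M S"
  shows "\<exists>g\<in>lspan L S. \<forall>t. \<phi> (g t) = q t"
  using q
proof (induct q rule: lspan.induct)
  case zero
  show ?case using linear_map.zero[OF L] by (intro bexI[OF _ lspan.zero]) simp
next
  case (step x c y)
  interpret \<phi>: linear_map R L M \<phi> by (rule L)
  obtain g where g: "g \<in> lspan L S" "\<And>t. \<phi> (g t) = x t" using step(2) by blast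
  obtain w where w: "w \<in> carrier L" "\<phi> w = y" using surj[OF step(4)] by blast
  have gc: "g t \<in> carrier L" for t using fin_suppD(1)[OF module.lspan_fin_supp[OF linear_map.axioms(1)[OF L] S g(1)]] .
  have cR: "c t \<in> carrier R" for t using fin_suppD(1)[OF subsetD[OF S step(3)], of t] by simp
  show ?case
    using lspan.step[OF g(1) step(3) w(1)] gc cR w by (intro bexI) (auto simp: \<phi>.add \<phi>.smult g(2))
qed

text \<open>
  Two properties of a module that together pass to the kernel of every surjection from a free module,
  hence to all syzygies: flatness modulo all powers of \<open>I\<close>, and pro-zero Koszul homology.
\<close>

locale koszul_flat = fg_ideal + M: module R M for M (structure) +
  assumes wpr: "koszul_pro_zero R as A"
    and flat: "\<And>k. flat_eq R M (Ip k)"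
    and pro: "koszul_pro_zero R as M"

locale syzygy = koszul_flat +
  fixes B :: "'x set" and \<phi>
  assumes phi: "\<phi> \<in> mod_hom R (fun_module B A) M"
    and surj: "\<phi> ` fin_supp B A = carrier M"
begin

abbreviation "F \<equiv> fun_module B A"

definition K :: "('a, 'x \<Rightarrow> 'a) module"
  where "K = F\<lparr>carrier := {f \<in> fin_supp B A. \<phi> f = \<zero>\<^bsub>M\<^esub>}\<rparr>"

lemma K_simps [simp]:
  "carrier K = {f \<in> fin_supp B A. \<phi> f = \<zero>\<^bsub>M\<^esub>}" "\<zero>\<^bsub>K\<^esub> = \<zero>\<^bsub>F\<^esub>" "x \<oplus>\<^bsub>K\<^esub> y = x \<oplus>\<^bsub>F\<^esub> y" "a \<odot>\<^bsub>K\<^esub> x = a \<odot>\<^bsub>F\<^esub> x"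
  by (simp_all add: K_def)

sublocale F: module R F by (rule A.fun_module)

sublocale phi: linear_map R F M \<phi>
  by (intro linear_mapI F.module_axioms M.module_axioms phi)

sublocale K: module R K
  using submodule.submodule_is_module[OF phi.kernel_submodule F.module_axioms] by (simp add: K_def)

sublocale inc: linear_map R K F id
  by (intro linear_mapI F.module_axioms K.module_axioms mod_homI) auto

lemma phi_lift: assumes "v \<in> carrier M" shows "\<exists>w\<in>carrier F. \<phi> w = v"
proof -
  have "v \<in> \<phi> ` fin_supp B A" unfolding surj by (rule assms)
  then show ?thesis by auto
qed

lemma kd_K: "set bs \<subseteq> carrier R \<Longrightarrow> (\<And>s. f s \<in> carrier K) \<Longrightarrow> kd K bs f s = kd F bs f s"
  using inc.kd_map[of bs f s] by simp

text \<open>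
  If an \<open>F\<close>-valued chain has boundary in \<open>K\<close>, its image in the complex of \<open>M\<close> is a cycle, which
  becomes a boundary at a lower level. Subtracting a lift of the bounding chain gives a \<open>K\<close>-valued
  chain whose boundary is the image of the given boundary at that level. This is the part of the long exact homology sequence of
  \<open>0 \<rightarrow> K \<rightarrow> F \<rightarrow> M \<rightarrow> 0\<close> that is used.
\<close>

lemma kernel_chain_lift:
  assumes q: "q \<ge> 1" and m: "m \<ge> 1"
  shows "\<exists>l\<ge>m. \<forall>y\<in>fin_supp (words_deg p q) F. (\<forall>s. \<phi> (kd F (seq_pow R as l) y s) = \<zero>\<^bsub>M\<^esub>) \<longrightarrow>
    (\<exists>y'\<in>fin_supp (words_deg p q) K. \<forall>s. kd K (seq_pow R as m) y' s
      = koszul_weight R (l - m) as s \<odot>\<^bsub>F\<^esub> kd F (seq_pow R as l) y s)"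
proof -
  obtain l where l: "l \<ge> m" and pz: "\<And>z. z \<in> fin_supp (words_deg p q) M \<Longrightarrow>
      (\<And>s. kd M (seq_pow R as l) z s = \<zero>\<^bsub>M\<^esub>) \<Longrightarrow> \<exists>y\<in>fin_supp (words_deg p (Suc q)) M.
      \<forall>s. koszul_weight R (l - m) as s \<odot>\<^bsub>M\<^esub> z s = kd M (seq_pow R as m) y s"
    using pro q m unfolding koszul_pro_zero_def by meson
  note w = koszul_weight_closed[OF as_closed]
  have "\<exists>y'\<in>fin_supp (words_deg p q) K. \<forall>s. kd K (seq_pow R as m) y' s
      = koszul_weight R (l - m) as s \<odot>\<^bsub>F\<^esub> kd F (seq_pow R as l) y s"
    if y: "y \<in> fin_supp (words_deg p q) F" and dy: "\<forall>s. \<phi> (kd F (seq_pow R as l) y s) = \<zero>\<^bsub>M\<^esub>" for y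
  proof -
    have yF: "y s \<in> carrier F" for s using fin_suppD(1)[OF y] .
    have "(\<lambda>s. \<phi> (y s)) \<in> fin_supp (words_deg p q) M"
      using phi.closed[OF yF] fin_suppD(2)[OF y] phi.zero by (intro fin_suppI'[OF finite_words_deg]) auto
    from pz[OF this] obtain \<theta> where \<theta>: "\<theta> \<in> fin_supp (words_deg p (Suc q)) M"
      "\<And>s. koszul_weight R (l - m) as s \<odot>\<^bsub>M\<^esub> \<phi> (y s) = kd M (seq_pow R as m) \<theta> s"
      using dy phi.kd_map[OF spc yF] by auto
    have "\<exists>x\<in>carrier F. \<phi> x = \<theta> s \<and> (s \<notin> words_deg p (Suc q) \<longrightarrow> x = \<zero>\<^bsub>F\<^esub>)" for s
    proof (cases "s \<in> words_deg p (Suc q)")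
      case True
      then show ?thesis using phi_lift[OF fin_suppD(1)[OF \<theta>(1), of s]] by blast
    next
      case False
      then show ?thesis using fin_suppD(2)[OF \<theta>(1) False] phi.zero F.M.zero_closed by metis
    qed
    then obtain \<Theta> where \<Theta>: "\<And>s. \<Theta> s \<in> carrier F" "\<And>s. \<phi> (\<Theta> s) = \<theta> s"
      "\<And>s. s \<notin> words_deg p (Suc q) \<Longrightarrow> \<Theta> s = \<zero>\<^bsub>F\<^esub>" by metis
    have d\<Theta>: "kd F (seq_pow R as m) \<Theta> \<in> fin_supp (words_deg p q) F"
      using F.kd_fin_supp[OF spc, of \<Theta> m q] fin_suppI'[OF finite_words_deg \<Theta>(1,3)] by simp
    note dc = F.kd_closed[OF spc \<Theta>(1)]
    have wy: "koszul_weight R (l - m) as s \<odot>\<^bsub>F\<^esub> y s \<in> carrier F" for s by (intro F.smult_closed w yF)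
    define y' where "y' s = koszul_weight R (l - m) as s \<odot>\<^bsub>F\<^esub> y s \<ominus>\<^bsub>F\<^esub> kd F (seq_pow R as m) \<Theta> s" for s
    have y'F: "y' s \<in> carrier F" for s unfolding y'_def by (intro F.M.minus_closed wy dc)
    have "\<phi> (y' s) = \<zero>\<^bsub>M\<^esub>" for s
    proof -
      have "\<phi> (y' s) = kd M (seq_pow R as m) \<theta> s \<ominus>\<^bsub>M\<^esub> kd M (seq_pow R as m) \<theta> s"
        unfolding y'_def phi.diff[OF wy dc] phi.smult[OF w yF] \<theta>(2) phi.kd_map[OF spc \<Theta>(1)] \<Theta>(2) ..
      then show ?thesis
        using M.diff_zero_iff M.kd_closed[OF spc fin_suppD(1)[OF \<theta>(1)]] by simp
    qed
    then have y'K: "y' s \<in> carrier K" for s using y'F[of s] by simp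
    have y'0: "y' s = \<zero>\<^bsub>K\<^esub>" if "s \<notin> words_deg p q" for s
    proof -
      have "y' s = \<zero>\<^bsub>F\<^esub> \<ominus>\<^bsub>F\<^esub> \<zero>\<^bsub>F\<^esub>"
        unfolding y'_def fin_suppD(2)[OF y that] fin_suppD(2)[OF d\<Theta> that] F.smult_r_null[OF w] ..
      then show ?thesis using F.diff_zero_iff F.M.zero_closed by simp
    qed
    have "kd K (seq_pow R as m) y' s = koszul_weight R (l - m) as s \<odot>\<^bsub>F\<^esub> kd F (seq_pow R as l) y s" for s
    proof -
      have "kd F (seq_pow R as m) y' s
          = koszul_weight R (l - m) as s \<odot>\<^bsub>F\<^esub> kd F (seq_pow R as (m + (l - m))) y s \<ominus>\<^bsub>F\<^esub> \<zero>\<^bsub>F\<^esub>"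
        unfolding y'_def F.kd_diff[OF spc wy dc] F.kd_trans[OF as_closed yF] F.kd_kd[OF spc \<Theta>(1)] ..
      also have "\<dots> = koszul_weight R (l - m) as s \<odot>\<^bsub>F\<^esub> kd F (seq_pow R as l) y s"
        using l F.smult_closed[OF w F.kd_closed[OF spc yF]] unfolding a_minus_def F.M_minus_zero
        by (simp only: F.M.r_zero le_add_diff_inverse)
      finally show ?thesis unfolding kd_K[OF spc y'K] .
    qed
    then show ?thesis by (intro bexI[OF _ fin_suppI'[OF finite_words_deg y'K y'0]] allI)
  qed
  then show ?thesis using l by blast
qed

text \<open>
  An element of \<open>K\<close> in a high multiple of \<open>F\<close> is a boundary of an \<open>F\<close>-valued chain of degree one,
  hence of a \<open>K\<close>-valued one.
\<close>

lemma syzygy_artin_rees: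
  "\<exists>N. carrier K \<inter> ismult F (Ip N) \<subseteq> ismult K (Ip m)"
proof -
  define J where "J = max m 1"
  obtain l where l: "l \<ge> J" and lift: "\<And>y. y \<in> fin_supp (words_deg p 1) F \<Longrightarrow>
      (\<And>s. \<phi> (kd F (seq_pow R as l) y s) = \<zero>\<^bsub>M\<^esub>) \<Longrightarrow> \<exists>y'\<in>fin_supp (words_deg p 1) K.
      \<forall>s. kd K (seq_pow R as J) y' s = koszul_weight R (l - J) as s \<odot>\<^bsub>F\<^esub> kd F (seq_pow R as l) y s"
    using kernel_chain_lift[of 1 J] unfolding J_def by auto
  have l1: "l \<ge> 1" using l by (simp add: J_def)
  have "x \<in> ismult K (Ip m)" if x: "x \<in> carrier K" and xN: "x \<in> ismult F (Ip (p * l))" for x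
  proof -
    obtain f where f: "f \<in> fin_supp (words_deg p 1) F" "x = kd F (seq_pow R as l) f (zero_word p)"
      using ismult_kd[OF F.module_axioms l1 xN] by blast
    have "\<phi> (kd F (seq_pow R as l) f s) = \<zero>\<^bsub>M\<^esub>" for s
    proof (cases "s = zero_word p")
      case True
      then show ?thesis using x f(2) by simp
    next
      case False
      then have "\<not> (length s = p \<and> Suc (count_list s True) = 1)" using count_zero_word[of s] by (metis One_nat_def nat.inject)
      then have "kd F (seq_pow R as l) f s = \<zero>\<^bsub>F\<^esub>"
        using F.kd_deg[OF spc, of _ 1 f s] fin_suppD(2)[OF f(1)] by simp
      then show ?thesis using phi.zero by simp
    qed
    from lift[OF f(1) this] obtain g where g: "g \<in> fin_supp (words_deg p 1) K"
      "\<And>s. kd K (seq_pow R as J) g s = koszul_weight R (l - J) as s \<odot>\<^bsub>F\<^esub> kd F (seq_pow R as l) f s" by blast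
    have xF: "x \<in> carrier F" using x by simp
    have "kd K (seq_pow R as J) g (zero_word p) = x"
      unfolding g(2) koszul_weight_zero_word[OF as_closed] f(2)[symmetric] by (rule F.smult_one[OF xF])
    moreover have "kd K (seq_pow R as J) g (zero_word p) \<in> ismult K (Ip J)"
      using gen_pow_mem fin_suppD(1)[OF g(1)]
      by (intro K.kd_submodule[OF K.ismult_submodule[OF ideal_Ip] spc] K.ismult_gen[OF ideal_Ip])
    ultimately show ?thesis using ismult_mono[OF Ip_antimono, of m J K] by (auto simp: J_def)
  qed
  then show ?thesis by blast
qed

text \<open>
  A weak form of the vanishing of \<open>Tor\<^sub>1(M, -)\<close>: relations that hold coordinatewise in \<open>F\<close> hold in
  \<open>K\<close>. The relation \<open>\<Sum> k t b \<cdot> \<phi> e\<^sub>b = 0\<close> in \<open>M\<close> has coefficients in \<open>R\<close> up to a high power of \<open>I\<close>;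
  this yields elements \<open>e\<^sub>b - G b\<close> of \<open>K\<close> with \<open>k t = \<Sum> k t b (e\<^sub>b - G b)\<close> up to a small error.
\<close>

lemma syzygy_pure:
  assumes T: "finite (T :: 'y set)" and k: "k \<in> fin_supp T K"
    and S: "submodule S R (fun_module T A)" and big: "\<And>c. c \<in> fin_supp T A \<Longrightarrow> (\<And>t. c t \<in> Ip m) \<Longrightarrow> c \<in> S"
    and coord: "\<And>x. (\<lambda>t. k t x) \<in> S"
  shows "k \<in> lspan K S"
proof -
  interpret TA: module R "fun_module T A" by (rule A.fun_module)
  interpret TK: module R "fun_module T K" by (rule K.fun_module)
  have SA: "S \<subseteq> fin_supp T A" using TA.submoduleE(1)[OF S] by simp
  obtain N where N: "carrier K \<inter> ismult F (Ip N) \<subseteq> ismult K (Ip m)" using syzygy_artin_rees by blast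
  have kK: "k t \<in> carrier K" for t by (rule fin_suppD(1)[OF k])
  then have kF: "k t \<in> fin_supp B A" and k\<phi>: "\<phi> (k t) = \<zero>\<^bsub>M\<^esub>" for t by simp_all
  have kR: "k t b \<in> carrier R" for t b using fin_suppD(1)[OF kF, of t b] by simp
  define B0 where "B0 = (\<Union>t\<in>T. {x. k t x \<noteq> \<zero>\<^bsub>A\<^esub>})"
  have B0: "finite B0" "B0 \<subseteq> B"
    using T fin_suppD(3)[OF kF] fin_suppD(2)[OF kF] by (auto simp: B0_def)
  have kB0: "k t b = \<zero>" if "b \<notin> B0" for t b
    using that fin_suppD(2)[OF k, of t] by (cases "t \<in> T") (auto simp: B0_def)
  let ?e = "basis_vec R"
  have e: "?e b \<in> carrier F" if "b \<in> B0" for b using basis_vec_fin_supp[of b B] B0(2) that by auto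
  have k_sum: "k t = (\<Oplus>\<^bsub>F\<^esub>b\<in>B0. k t b \<odot>\<^bsub>F\<^esub> ?e b)" for t
  proof -
    have "(\<Oplus>\<^bsub>F\<^esub>b\<in>B0. k t b \<odot>\<^bsub>F\<^esub> ?e b) = (\<Oplus>\<^bsub>F\<^esub>b\<in>{b. k t b \<noteq> \<zero>}. k t b \<odot>\<^bsub>F\<^esub> ?e b)"
    proof (rule F.finsum_superset[OF B0(1)])
      show "{b. k t b \<noteq> \<zero>} \<subseteq> B0" using kB0 by auto
      then show "k t b \<odot>\<^bsub>F\<^esub> ?e b \<in> carrier F" if "b \<in> {b. k t b \<noteq> \<zero>}" for b
        using that by (intro F.smult_closed kR e) auto
      show "k t b \<odot>\<^bsub>F\<^esub> ?e b = \<zero>\<^bsub>F\<^esub>" if "b \<in> B0 - {b. k t b \<noteq> \<zero>}" for b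
        using that e[of b] F.smult_l_null by simp
    qed
    then show ?thesis using free_module_expand[OF kF, of t] by (simp add: free_module_eq)
  qed
  define q where "q b = (if b \<in> B0 then \<phi> (?e b) else \<zero>\<^bsub>M\<^esub>)" for b
  have q: "q \<in> fin_supp B0 M" using phi.closed[OF e] by (intro fin_suppI'[OF B0(1)]) (auto simp: q_def)
  have rel: "(\<Oplus>\<^bsub>M\<^esub>b\<in>B0. k t b \<odot>\<^bsub>M\<^esub> q b) \<in> ismult M (Ip N)" for t
  proof -
    have "(\<Oplus>\<^bsub>M\<^esub>b\<in>B0. k t b \<odot>\<^bsub>M\<^esub> q b) = (\<Oplus>\<^bsub>M\<^esub>b\<in>B0. \<phi> (k t b \<odot>\<^bsub>F\<^esub> ?e b))"
      using phi.smult[OF kR e] M.smult_closed[OF kR phi.closed[OF e]]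
      by (intro M.M.finsum_cong') (auto simp: q_def)
    also have "\<dots> = \<phi> (\<Oplus>\<^bsub>F\<^esub>b\<in>B0. k t b \<odot>\<^bsub>F\<^esub> ?e b)"
      by (rule phi.map_finsum[OF B0(1), symmetric]) (intro F.smult_closed kR e)
    also have "\<dots> = \<phi> (k t)" by (simp only: k_sum[symmetric])
    finally show ?thesis by (simp add: k\<phi> ismult.zero)
  qed
  have gY: "(\<lambda>t. k t b) \<in> fin_supp T A" for b
    using fin_suppD(2)[OF k] kR by (intro fin_suppI'[OF T]) auto
  let ?C = "{c \<in> fin_supp B0 A. \<forall>t. (\<Oplus>b\<in>B0. k t b \<otimes> c b) \<in> Ip N}"
  have "q \<in> lspan M ?C"
    using M.flat_eq_matrix[OF flat ideal_Ip B0(1) gY q rel] by simp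
  moreover have C: "?C \<subseteq> fin_supp B0 A" by auto
  ultimately obtain G where G_span: "G \<in> lspan F ?C" and \<phi>G: "\<And>b. \<phi> (G b) = q b"
    using M.lspan_lift[OF phi.linear_map_axioms phi_lift C] by blast
  have G: "G b \<in> carrier F" for b by (rule fin_suppD(1)[OF F.lspan_fin_supp[OF C G_span]])
  define u where "u b = ?e b \<ominus>\<^bsub>F\<^esub> G b" for b
  have uF: "u b \<in> carrier F" if "b \<in> B0" for b unfolding u_def by (intro F.M.minus_closed e that G)
  have u: "u b \<in> carrier K" if b: "b \<in> B0" for b
  proof -
    have "\<phi> (u b) = q b \<ominus>\<^bsub>M\<^esub> q b" unfolding u_def phi.diff[OF e[OF b] G] \<phi>G using b by (simp add: q_def)
    then show ?thesis using uF[OF b] M.diff_zero_iff fin_suppD(1)[OF q] by simp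
  qed
  define k1 where "k1 t = (\<Oplus>\<^bsub>K\<^esub>b\<in>B0. k t b \<odot>\<^bsub>K\<^esub> u b)" for t
  have gu: "(\<lambda>t. k t b \<odot>\<^bsub>K\<^esub> u b) \<in> lspan K S" if "b \<in> B0" for b
    by (rule K.lspan_gen[OF SA coord u[OF that]])
  have sub: "submodule (lspan K S) R (fun_module T K)" by (rule K.lspan_submodule[OF SA])
  have k1: "k1 \<in> lspan K S"
  proof -
    have "(\<Oplus>\<^bsub>fun_module T K\<^esub>b\<in>B0. (\<lambda>t. k t b \<odot>\<^bsub>K\<^esub> u b)) \<in> lspan K S"
      by (rule TK.submodule_finsum[OF sub B0(1) gu])
    then show ?thesis
      using K.fun_module_finsum[OF B0(1) K.lspan_fin_supp[OF SA gu]] by (simp only: k1_def[abs_def])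
  qed
  have k1K: "k1 t \<in> carrier K" for t using fin_suppD(1)[OF K.lspan_fin_supp[OF SA k1]] .
  have small: "k t \<ominus>\<^bsub>K\<^esub> k1 t \<in> ismult K (Ip m)" for t
  proof -
    have ke: "k t b \<odot>\<^bsub>F\<^esub> ?e b \<in> carrier F" and kG: "k t b \<odot>\<^bsub>F\<^esub> G b \<in> carrier F" and ku: "k t b \<odot>\<^bsub>F\<^esub> u b \<in> carrier F"
      if "b \<in> B0" for b using that by (intro F.smult_closed kR e G uF, assumption?)+
    have "k1 t = (\<Oplus>\<^bsub>F\<^esub>b\<in>B0. k t b \<odot>\<^bsub>F\<^esub> u b)"
      unfolding k1_def using inc.map_finsum[OF B0(1), of "\<lambda>b. k t b \<odot>\<^bsub>K\<^esub> u b"] K.smult_closed[OF kR u] by (simp del: K_simps(1) fun_module_simps)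
    then have k1t: "k t \<ominus>\<^bsub>F\<^esub> k1 t = (\<Oplus>\<^bsub>F\<^esub>b\<in>B0. k t b \<odot>\<^bsub>F\<^esub> ?e b \<ominus>\<^bsub>F\<^esub> k t b \<odot>\<^bsub>F\<^esub> u b)"
      using ke ku by (subst F.finsum_diff[OF B0(1)]) (simp_all only: k_sum[symmetric] Pi_I)
    also have "\<dots> = (\<Oplus>\<^bsub>F\<^esub>b\<in>B0. k t b \<odot>\<^bsub>F\<^esub> G b)"
    proof (rule F.M.finsum_cong')
      show "(\<lambda>b. k t b \<odot>\<^bsub>F\<^esub> G b) \<in> B0 \<rightarrow> carrier F" using kG by blast
      fix b assume b: "b \<in> B0"
      have "?e b \<ominus>\<^bsub>F\<^esub> u b = G b"
        unfolding u_def a_minus_def using e[OF b] G[of b]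
        by (simp only: F.M.minus_add F.M.minus_minus F.M.a_inv_closed F.M.r_neg2)
      then show "k t b \<odot>\<^bsub>F\<^esub> ?e b \<ominus>\<^bsub>F\<^esub> k t b \<odot>\<^bsub>F\<^esub> u b = k t b \<odot>\<^bsub>F\<^esub> G b"
        using F.smult_r_diff[OF kR e[OF b] uF[OF b]] by simp
    qed rule
    also have "\<dots> \<in> ismult F (Ip N)"
    proof (rule F.lspan_image[OF C F.module_axioms linear_map.hom[OF F.row_map[OF B0(1) kR]] F.ismult_submodule[OF ideal_Ip] _ G_span])
      fix c y assume c: "c \<in> ?C" and y: "y \<in> carrier F"
      have cR: "c b \<in> carrier R" for b using c fin_suppD(1)[of c B0 A b] by simp
      have "(\<Oplus>\<^bsub>F\<^esub>b\<in>B0. k t b \<odot>\<^bsub>F\<^esub> (c b \<odot>\<^bsub>F\<^esub> y)) = (\<Oplus>\<^bsub>F\<^esub>b\<in>B0. (k t b \<otimes> c b) \<odot>\<^bsub>F\<^esub> y)"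
        using kR cR y by (intro F.M.finsum_cong') (auto simp: F.smult_assoc1 simp del: fun_module_simps)
      also have "\<dots> = (\<Oplus>b\<in>B0. k t b \<otimes> c b) \<odot>\<^bsub>F\<^esub> y"
        using kR cR y B0(1) by (intro F.finsum_smult_rdistr[symmetric]) auto
      also have "\<dots> \<in> ismult F (Ip N)" using c y by (intro F.ismult_gen[OF ideal_Ip]) auto
      finally show "(\<Oplus>\<^bsub>F\<^esub>b\<in>B0. k t b \<odot>\<^bsub>F\<^esub> (c b \<odot>\<^bsub>F\<^esub> y)) \<in> ismult F (Ip N)" .
    qed
    finally have "k t \<ominus>\<^bsub>F\<^esub> k1 t \<in> ismult F (Ip N)" .
    moreover have "k t \<ominus>\<^bsub>K\<^esub> k1 t = k t \<ominus>\<^bsub>F\<^esub> k1 t" using inc.diff[OF kK k1K] by simp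
    ultimately have "k t \<ominus>\<^bsub>K\<^esub> k1 t \<in> carrier K \<inter> ismult F (Ip N)"
      using K.M.minus_closed[OF kK[of t] k1K[of t]] by (simp del: K_simps)
    then show ?thesis using N by blast
  qed
  have k2: "(\<lambda>t. k t \<ominus>\<^bsub>K\<^esub> k1 t) \<in> lspan K S"
  proof -
    let ?k2 = "\<lambda>t. k t \<ominus>\<^bsub>K\<^esub> k1 t"
    have k2: "?k2 \<in> fin_supp T K" by (rule K.fin_supp_diff[OF k K.lspan_fin_supp[OF SA k1]])
    have "(\<lambda>x. ?e t x \<odot>\<^bsub>K\<^esub> ?k2 t) \<in> lspan K S" if t: "t \<in> T" for t
    proof (rule K.ismult_image[OF ideal_Ip TK.module_axioms _ sub _ small])
      show "(\<lambda>y x. ?e t x \<odot>\<^bsub>K\<^esub> y) \<in> mod_hom R K (fun_module T K)"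
      proof (rule mod_homI)
        show "(\<lambda>x. ?e t x \<odot>\<^bsub>K\<^esub> y) \<in> carrier (fun_module T K)" if "y \<in> carrier K" for y
          using basis_vec_smult_fin_supp[OF K.module_axioms t that] by simp
        show "(\<lambda>x. ?e t x \<odot>\<^bsub>K\<^esub> (y \<oplus>\<^bsub>K\<^esub> z)) = (\<lambda>x. ?e t x \<odot>\<^bsub>K\<^esub> y) \<oplus>\<^bsub>fun_module T K\<^esub> (\<lambda>x. ?e t x \<odot>\<^bsub>K\<^esub> z)"
          if "y \<in> carrier K" "z \<in> carrier K" for y z
          using K.smult_r_distr[OF basis_vec_closed that] unfolding fun_module_simps by (rule ext)
        show "(\<lambda>x. ?e t x \<odot>\<^bsub>K\<^esub> (a \<odot>\<^bsub>K\<^esub> y)) = a \<odot>\<^bsub>fun_module T K\<^esub> (\<lambda>x. ?e t x \<odot>\<^bsub>K\<^esub> y)"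
          if "a \<in> carrier R" "y \<in> carrier K" for a y
          using K.smult_lcomm[OF basis_vec_closed that] unfolding fun_module_simps by (rule ext)
      qed
      fix r y assume r: "r \<in> Ip m" and y: "y \<in> carrier K"
      have rR: "r \<in> carrier R" by (rule Ip_carrier[OF r])
      have "(\<lambda>x. r \<otimes> ?e t x) \<in> S"
      proof (rule big)
        show "(\<lambda>x. r \<otimes> ?e t x) \<in> fin_supp T A" using A.fin_supp_smult[OF rR basis_vec_fin_supp[OF t]] by simp
        show "r \<otimes> ?e t x \<in> Ip m" for x by (rule ideal.I_r_closed[OF ideal_Ip r basis_vec_closed])
      qed
      have "(\<lambda>x. ?e t x \<odot>\<^bsub>K\<^esub> (r \<odot>\<^bsub>K\<^esub> y)) = (\<lambda>x. (r \<otimes> ?e t x) \<odot>\<^bsub>K\<^esub> y)"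
        unfolding K.smult_assoc1[OF rR basis_vec_closed y] K.smult_lcomm[OF rR basis_vec_closed y] ..
      with K.lspan_gen[OF SA \<open>(\<lambda>x. r \<otimes> ?e t x) \<in> S\<close> y]
      show "(\<lambda>x. ?e t x \<odot>\<^bsub>K\<^esub> (r \<odot>\<^bsub>K\<^esub> y)) \<in> lspan K S" by (simp only:)
    qed
    then have "(\<Oplus>\<^bsub>fun_module T K\<^esub>t\<in>T. (\<lambda>x. ?e t x \<odot>\<^bsub>K\<^esub> ?k2 t)) \<in> lspan K S"
      by (rule TK.submodule_finsum[OF sub T])
    then show ?thesis unfolding K.fun_module_expand[OF T k2] .
  qed
  have "(\<lambda>t. k1 t \<oplus>\<^bsub>K\<^esub> (k t \<ominus>\<^bsub>K\<^esub> k1 t)) \<in> lspan K S" by (rule K.lspan_add[OF SA k1 k2])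
  moreover have "k1 t \<oplus>\<^bsub>K\<^esub> (k t \<ominus>\<^bsub>K\<^esub> k1 t) = k t" for t
    unfolding a_minus_def using kK[of t] k1K[of t]
    by (simp only: K.M.a_comm[of "k t"] K.M.r_neg2 K.M.a_inv_closed)
  ultimately show ?thesis by simp
qed

text \<open>
  The relation holds for the coordinates of the \<open>q\<^sub>i\<close> in \<open>F\<close>, modulo \<open>I\<^sup>j\<close>, and the vectors over \<open>R\<close> that
  satisfy it include all those with entries in \<open>I\<^sup>j\<close>, so purity applies.
\<close>

lemma syzygy_flat_eq: "flat_eq R K (Ip j)"
  unfolding flat_eq_def
proof (intro allI impI)
  fix n :: nat and r q
  assume r: "\<forall>i<n. r i \<in> carrier R" and q: "q \<in> fin_supp {..<n} K"
    and rel: "(\<Oplus>\<^bsub>K\<^esub>i\<in>{..<n}. r i \<odot>\<^bsub>K\<^esub> q i) \<in> ismult K (Ip j)"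
  let ?h = "\<lambda>b. \<Oplus>i\<in>{..<n}. r i \<otimes> b i"
  have h: "linear_map R (fun_module {..<n} A) A ?h"
    using A.row_map[of "{..<n}" r] r by simp
  let ?S = "{b \<in> carrier (fun_module {..<n} A). ?h b \<in> Ip j}"
  have "q \<in> lspan K ?S"
  proof (rule syzygy_pure[OF finite_lessThan q linear_map.preimage_submodule[OF h Ip_submodule]])
    show "c \<in> ?S" if c: "c \<in> fin_supp {..<n} A" and cj: "\<And>t. c t \<in> Ip j" for c
    proof -
      have "?h c \<in> Ip j"
        using A.submodule_finsum[OF Ip_submodule, of "{..<n}" "\<lambda>i. r i \<otimes> c i"]
          ideal.I_l_closed[OF ideal_Ip cj] r by simp
      then show ?thesis using c by simp
    qed
    fix x
    have qK: "q t \<in> carrier K" for t by (rule fin_suppD(1)[OF q])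
    have qx: "q t x \<in> carrier R" for t using qK[of t] fin_suppD(1)[of "q t" B A x] by simp
    interpret ev: linear_map R K A "\<lambda>f. f x"
      using mod_hom_comp[OF inc.hom linear_map.hom[OF A.eval_map[where X = B and x = x]]]
      by (intro linear_mapI K.module_axioms A.module_axioms) (simp add: o_def)
    have "(\<Oplus>\<^bsub>K\<^esub>i\<in>{..<n}. r i \<odot>\<^bsub>K\<^esub> q i) x \<in> Ip j"
    proof (rule K.ismult_image[OF ideal_Ip A.module_axioms ev.hom Ip_submodule _ rel])
      fix a y assume "a \<in> Ip j" "y \<in> carrier K"
      then show "(a \<odot>\<^bsub>K\<^esub> y) x \<in> Ip j"
        using ideal.I_r_closed[OF ideal_Ip, of a j "y x"] fin_suppD(1)[of y B A x] by simp
    qed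
    also have "(\<Oplus>\<^bsub>K\<^esub>i\<in>{..<n}. r i \<odot>\<^bsub>K\<^esub> q i) x = (\<Oplus>\<^bsub>A\<^esub>i\<in>{..<n}. (r i \<odot>\<^bsub>K\<^esub> q i) x)"
      using r qK by (intro ev.map_finsum K.smult_closed) auto
    finally have "?h (\<lambda>t. q t x) \<in> Ip j" by simp
    moreover have "(\<lambda>t. q t x) \<in> fin_supp {..<n} A"
      using fin_suppD(2)[OF q] qx by (intro fin_suppI') auto
    ultimately show "(\<lambda>t. q t x) \<in> ?S" by simp
  qed
  then show "q \<in> lspan K {b \<in> fin_supp {..<n} A. ?h b \<in> Ip j}" by simp
qed

lemma free_pro_zero: "koszul_pro_zero R as F"
  unfolding koszul_pro_zero_def
proof (intro allI impI)
  fix q m :: nat assume "1 \<le> q" and "1 \<le> m"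
  then obtain k where k: "k \<ge> m" and pz: "\<And>z. z \<in> fin_supp (words_deg p q) A \<Longrightarrow>
      (\<forall>s. kd A (seq_pow R as k) z s = \<zero>\<^bsub>A\<^esub>) \<Longrightarrow> \<exists>y\<in>fin_supp (words_deg p (Suc q)) A.
      \<forall>s. koszul_weight R (k - m) as s \<odot>\<^bsub>A\<^esub> z s = kd A (seq_pow R as m) y s"
    using wpr unfolding koszul_pro_zero_def by meson
  have "\<exists>y\<in>fin_supp (words_deg p (Suc q)) F.
      \<forall>s. koszul_weight R (k - m) as s \<odot>\<^bsub>F\<^esub> z s = kd F (seq_pow R as m) y s"
    if z: "z \<in> fin_supp (words_deg p q) F" and dz: "\<forall>s. kd F (seq_pow R as k) z s = \<zero>\<^bsub>F\<^esub>" for z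
  proof -
    have zF: "z s \<in> fin_supp B A" for s using fin_suppD(1)[OF z, of s] by simp
    define Z where "Z = (\<Union>s\<in>words_deg p q. {x. z s x \<noteq> \<zero>\<^bsub>A\<^esub>})"
    have Z: "finite Z" "Z \<subseteq> B" using finite_words_deg fin_suppD(2,3)[OF zF] by (auto simp: Z_def)
    have zZ: "z s x = \<zero>\<^bsub>A\<^esub>" if "x \<notin> Z" for s x
      using that fin_suppD(2)[OF z, of s] by (cases "s \<in> words_deg p q") (auto simp: Z_def)
    have "\<exists>y\<in>fin_supp (words_deg p (Suc q)) A. (x \<notin> Z \<longrightarrow> y = (\<lambda>_. \<zero>\<^bsub>A\<^esub>)) \<and>
      (\<forall>s. koszul_weight R (k - m) as s \<odot>\<^bsub>A\<^esub> z s x = kd A (seq_pow R as m) y s)" for x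
    proof (cases "x \<in> Z")
      case True
      have zx: "(\<lambda>s. z s x) \<in> fin_supp (words_deg p q) A"
        using fin_suppD(1)[OF zF] fin_suppD(2)[OF z] by (intro fin_suppI'[OF finite_words_deg]) auto
      have "\<forall>s. kd A (seq_pow R as k) (\<lambda>s. z s x) s = \<zero>\<^bsub>A\<^esub>"
        by (simp add: A.kd_fun_module[OF spc zF, symmetric] dz)
      from pz[OF zx this] True show ?thesis by blast
    next
      case False
      then show ?thesis
        using A.kd_zero[OF spc] A.smult_r_null[OF koszul_weight_closed[OF as_closed]]
        by (intro bexI[of _ "\<lambda>_. \<zero>\<^bsub>A\<^esub>"] A.fin_supp_zero) (simp only: zZ simp_thms)
    qed
    then obtain y where y: "\<And>x. y x \<in> fin_supp (words_deg p (Suc q)) A"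
      and y0: "\<And>x. x \<notin> Z \<Longrightarrow> y x = (\<lambda>_. \<zero>\<^bsub>A\<^esub>)"
      and yz: "\<And>x s. koszul_weight R (k - m) as s \<odot>\<^bsub>A\<^esub> z s x = kd A (seq_pow R as m) (y x) s" by metis
    have yF: "(\<lambda>x. y x s) \<in> fin_supp B A" for s
      using fin_suppD(1)[OF y] y0 Z by (intro subsetD[OF fin_supp_mono[OF Z(2)]] fin_suppI'[OF Z(1)]) auto
    show ?thesis
    proof (intro bexI allI)
      show "(\<lambda>s x. y x s) \<in> fin_supp (words_deg p (Suc q)) F"
        using yF fin_suppD(2)[OF y] by (intro fin_suppI'[OF finite_words_deg]) auto
      show "koszul_weight R (k - m) as s \<odot>\<^bsub>F\<^esub> z s = kd F (seq_pow R as m) (\<lambda>s x. y x s) s" for s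
        using yz by (simp add: fun_eq_iff A.kd_fun_module[OF spc yF])
    qed
  qed
  then show "\<exists>k\<ge>m. \<forall>z\<in>fin_supp (words_deg p q) F. (\<forall>s. kd F (seq_pow R as k) z s = \<zero>\<^bsub>F\<^esub>) \<longrightarrow>
      (\<exists>y\<in>fin_supp (words_deg p (Suc q)) F.
        \<forall>s. koszul_weight R (k - m) as s \<odot>\<^bsub>F\<^esub> z s = kd F (seq_pow R as m) y s)"
    using k by blast
qed

text \<open>
  A cycle in \<open>K\<close> is the boundary of an \<open>F\<close>-valued chain at a lower level, and this chain can be replaced
  by a \<open>K\<close>-valued one at a still lower level.
\<close>

lemma syzygy_pro_zero: "koszul_pro_zero R as K"
  unfolding koszul_pro_zero_def
proof (intro allI impI)
  fix q m :: nat assume q: "1 \<le> q" and m: "1 \<le> m"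
  obtain l where l: "l \<ge> m" and lift: "\<And>y. y \<in> fin_supp (words_deg p (Suc q)) F \<Longrightarrow>
      (\<And>s. \<phi> (kd F (seq_pow R as l) y s) = \<zero>\<^bsub>M\<^esub>) \<Longrightarrow> \<exists>y'\<in>fin_supp (words_deg p (Suc q)) K.
      \<forall>s. kd K (seq_pow R as m) y' s = koszul_weight R (l - m) as s \<odot>\<^bsub>F\<^esub> kd F (seq_pow R as l) y s"
    using kernel_chain_lift[OF _ m, of "Suc q"] by auto
  obtain k where k: "k \<ge> l" and pz: "\<And>z. z \<in> fin_supp (words_deg p q) F \<Longrightarrow>
      (\<And>s. kd F (seq_pow R as k) z s = \<zero>\<^bsub>F\<^esub>) \<Longrightarrow> \<exists>y\<in>fin_supp (words_deg p (Suc q)) F.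
      \<forall>s. koszul_weight R (k - l) as s \<odot>\<^bsub>F\<^esub> z s = kd F (seq_pow R as l) y s"
    using free_pro_zero q l m unfolding koszul_pro_zero_def by (meson le_trans)
  note w = koszul_weight_closed[OF as_closed]
  have "\<exists>y\<in>fin_supp (words_deg p (Suc q)) K.
      \<forall>s. koszul_weight R (k - m) as s \<odot>\<^bsub>K\<^esub> z s = kd K (seq_pow R as m) y s"
    if z: "z \<in> fin_supp (words_deg p q) K" and dz: "\<forall>s. kd K (seq_pow R as k) z s = \<zero>\<^bsub>K\<^esub>" for z
  proof -
    have zK: "z s \<in> carrier K" for s by (rule fin_suppD(1)[OF z])
    then have zF: "z s \<in> carrier F" for s by simp
    have "z \<in> fin_supp (words_deg p q) F"
      using zF fin_suppD(2)[OF z] by (intro fin_suppI'[OF finite_words_deg]) (simp_all del: fun_module_simps)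
    moreover have "kd F (seq_pow R as k) z s = \<zero>\<^bsub>F\<^esub>" for s using dz kd_K[OF spc zK] by simp
    ultimately obtain y where y: "y \<in> fin_supp (words_deg p (Suc q)) F"
      "\<And>s. koszul_weight R (k - l) as s \<odot>\<^bsub>F\<^esub> z s = kd F (seq_pow R as l) y s" using pz by blast
    have "\<phi> (kd F (seq_pow R as l) y s) = \<zero>\<^bsub>M\<^esub>" for s
      unfolding y(2)[symmetric] using phi.smult[OF w zF] zK[of s] w M.smult_r_null by simp
    from lift[OF y(1) this] obtain y' where y': "y' \<in> fin_supp (words_deg p (Suc q)) K"
      "\<And>s. kd K (seq_pow R as m) y' s = koszul_weight R (l - m) as s \<odot>\<^bsub>F\<^esub> kd F (seq_pow R as l) y s" by blast
    have "k - m = (l - m) + (k - l)" using k l by simp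
    then have "koszul_weight R (k - m) as s \<odot>\<^bsub>K\<^esub> z s = kd K (seq_pow R as m) y' s" for s
      unfolding y'(2) y(2)[symmetric] using koszul_weight_add[OF as_closed] F.smult_assoc1[OF w w zF] by simp
    then show ?thesis using y'(1) by blast
  qed
  then show "\<exists>k\<ge>m. \<forall>z\<in>fin_supp (words_deg p q) K. (\<forall>s. kd K (seq_pow R as k) z s = \<zero>\<^bsub>K\<^esub>) \<longrightarrow>
      (\<exists>y\<in>fin_supp (words_deg p (Suc q)) K.
        \<forall>s. koszul_weight R (k - m) as s \<odot>\<^bsub>K\<^esub> z s = kd K (seq_pow R as m) y s)"
    using le_trans[OF l k] by blast
qed

end

section \<open>The standard free resolution\<close>

declare res_basis.simps [simp del]

context cring begin

lemma lin_comb_closed: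
  assumes "set cs \<subseteq> carrier R \<times> X" shows "lin_comb R cs \<in> fin_supp X (self_module R)"
proof -
  interpret A: module R "self_module R" by (rule self_module[OF is_cring])
  show ?thesis using assms
  proof (induct cs)
    case Nil
    show ?case using A.fin_supp_zero[of X] by simp
  next
    case (Cons c cs)
    then have "(\<lambda>y. fst c \<otimes> basis_vec R (snd c) y) \<in> fin_supp X (self_module R)"
      using A.fin_supp_smult[OF _ basis_vec_fin_supp, of "fst c" "snd c" X] by auto
    then show ?case using A.fin_supp_add[of _ X "lin_comb R cs"] Cons by simp
  qed
qed

lemma lin_comb_surj:
  assumes f: "f \<in> fin_supp X (self_module R)"
  obtains cs where "set cs \<subseteq> carrier R \<times> X" "lin_comb R cs = f"
proof -
  have *: "\<exists>cs. set cs \<subseteq> carrier R \<times> X \<and> lin_comb R cs = f"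
    if "finite S" "S \<subseteq> X" "\<And>x. f x \<in> carrier R" "\<And>x. x \<notin> S \<Longrightarrow> f x = \<zero>" for S f
    using that
  proof (induct S arbitrary: f)
    case empty
    then have "lin_comb R [] = f" by auto
    then show ?case by (intro exI[of _ "[]"]) simp
  next
    case (insert a S)
    have "\<exists>cs. set cs \<subseteq> carrier R \<times> X \<and> lin_comb R cs = f(a := \<zero>)"
      using insert.prems by (intro insert.hyps) auto
    then obtain cs where cs: "set cs \<subseteq> carrier R \<times> X" "lin_comb R cs = f(a := \<zero>)" by blast
    have "lin_comb R ((f a, a) # cs) = f"
      using cs(2) insert.prems(2) by (auto simp: basis_vec_def)
    moreover have "set ((f a, a) # cs) \<subseteq> carrier R \<times> X" using cs(1) insert.prems by auto
    ultimately show ?case by blast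
  qed
  have "{x. f x \<noteq> \<zero>} \<subseteq> X" using fin_suppD(2)[OF f] by auto
  then have "\<exists>cs. set cs \<subseteq> carrier R \<times> X \<and> lin_comb R cs = f"
    using fin_suppD(3)[OF f] fin_suppD(1)[OF f] by (intro *[of "{x. f x \<noteq> \<zero>}"]) auto
  then show ?thesis by (elim exE conjE) (rule that)
qed

end

context module begin

lemma lin_ext_submodule:
  assumes H: "submodule H R M" and f: "f \<in> fin_supp X (self_module R)" and "\<And>x. x \<in> X \<Longrightarrow> \<phi> x \<in> H"
  shows "lin_ext R M \<phi> f \<in> H"
  unfolding lin_ext_def
proof (rule submodule_finsum[OF H])
  show "finite {x. f x \<noteq> \<zero>}" using fin_suppD(3)[OF f] by simp
  fix x assume "x \<in> {x. f x \<noteq> \<zero>}"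
  then have "x \<in> X" using fin_suppD(2)[OF f] by auto
  then show "f x \<odot>\<^bsub>M\<^esub> \<phi> x \<in> H" using assms(3) fin_suppD(1)[OF f, of x] submoduleE(4)[OF H] by simp
qed

abbreviation "Fr n \<equiv> fun_module (res_basis R M n) (self_module R)"
abbreviation "aug \<equiv> lin_ext R M (cell_pt M)"

lemma res_mod_eq: "res_mod R M n = Fr n"
  by (simp add: res_mod_def free_module_eq)

lemma Fr_module: "module R (Fr n)"
  by (rule module.fun_module[OF self_module[OF R.is_cring]])

lemma res_basis_Suc: "b \<in> res_basis R M (Suc n) \<Longrightarrow> \<exists>cs. b = Syz cs \<and> set cs \<subseteq> carrier R \<times> res_basis R M n"
  by (cases n) (auto simp: res_basis.simps)

lemma cell_bd_closed: "cell_bd R \<in> res_basis R M (Suc n) \<rightarrow> carrier (Fr n)"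
proof
  fix b assume "b \<in> res_basis R M (Suc n)"
  then obtain cs where "b = Syz cs" "set cs \<subseteq> carrier R \<times> res_basis R M n" using res_basis_Suc by blast
  then show "cell_bd R b \<in> carrier (Fr n)" using R.lin_comb_closed by simp
qed

lemma res_d_map: "linear_map R (Fr (Suc n)) (Fr n) (res_d R M n)"
  using module.lin_ext_hom[OF Fr_module cell_bd_closed, of n]
  by (intro linear_mapI Fr_module) (simp add: res_d_def res_mod_eq free_module_eq)

lemma cell_pt_closed: "cell_pt M \<in> res_basis R M 0 \<rightarrow> carrier M"
  by (auto simp: res_basis.simps)

lemma aug_map: "linear_map R (Fr 0) M aug"
  using lin_ext_hom[OF cell_pt_closed]
  by (intro linear_mapI Fr_module module_axioms) (simp add: free_module_eq)

lemma aug_basis: "x \<in> carrier M \<Longrightarrow> aug (basis_vec R (Point x)) = x"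
  using lin_ext_basis_vec[OF cell_pt_closed, of "Point x"] by (simp add: res_basis.simps)

lemma aug_surj: "aug ` fin_supp (res_basis R M 0) (self_module R) = carrier M"
proof
  show "aug ` fin_supp (res_basis R M 0) (self_module R) \<subseteq> carrier M"
    using linear_map.closed[OF aug_map] by auto
  show "carrier M \<subseteq> aug ` fin_supp (res_basis R M 0) (self_module R)"
  proof
    fix x assume "x \<in> carrier M"
    then show "x \<in> aug ` fin_supp (res_basis R M 0) (self_module R)"
      using aug_basis R.basis_vec_fin_supp[of "Point x" "res_basis R M 0"]
      by (intro image_eqI[of _ _ "basis_vec R (Point x)"]) (simp_all add: res_basis.simps)
  qed
qed

text \<open>
  A cycle is a linear combination of basis elements, and the list of its terms is a basis element of
  the next module that is mapped to it.
\<close>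

lemma res_d_image:
  assumes \<phi>: "linear_map R (Fr n) N \<phi>"
    and basis: "res_basis R M (Suc n) = {Syz cs | cs. set cs \<subseteq> carrier R \<times> res_basis R M n
      \<and> \<phi> (lin_comb R cs) = \<zero>\<^bsub>N\<^esub>}"
  shows "res_d R M n ` carrier (Fr (Suc n)) = {f \<in> carrier (Fr n). \<phi> f = \<zero>\<^bsub>N\<^esub>}"
proof
  interpret F: module R "Fr n" by (rule Fr_module)
  show "res_d R M n ` carrier (Fr (Suc n)) \<subseteq> {f \<in> carrier (Fr n). \<phi> f = \<zero>\<^bsub>N\<^esub>}"
  proof
    fix y assume "y \<in> res_d R M n ` carrier (Fr (Suc n))"
    then obtain f where f: "f \<in> fin_supp (res_basis R M (Suc n)) (self_module R)" "y = res_d R M n f" by auto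
    show "y \<in> {f \<in> carrier (Fr n). \<phi> f = \<zero>\<^bsub>N\<^esub>}"
      unfolding f(2) res_d_def res_mod_eq
    proof (rule F.lin_ext_submodule[OF linear_map.kernel_submodule[OF \<phi>] f(1)])
      show "cell_bd R b \<in> {f \<in> carrier (Fr n). \<phi> f = \<zero>\<^bsub>N\<^esub>}" if "b \<in> res_basis R M (Suc n)" for b
        using that R.lin_comb_closed unfolding basis by auto
    qed
  qed
  show "{f \<in> carrier (Fr n). \<phi> f = \<zero>\<^bsub>N\<^esub>} \<subseteq> res_d R M n ` carrier (Fr (Suc n))"
  proof
    fix f assume f: "f \<in> {f \<in> carrier (Fr n). \<phi> f = \<zero>\<^bsub>N\<^esub>}"
    then have "f \<in> fin_supp (res_basis R M n) (self_module R)" by simp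
    then obtain cs where cs: "set cs \<subseteq> carrier R \<times> res_basis R M n" "lin_comb R cs = f"
      by (rule R.lin_comb_surj)
    then have b: "Syz cs \<in> res_basis R M (Suc n)" using f unfolding basis by simp
    have "res_d R M n (basis_vec R (Syz cs)) = f"
      using F.lin_ext_basis_vec[OF cell_bd_closed b] cs(2) by (simp add: res_d_def res_mod_eq)
    then show "f \<in> res_d R M n ` carrier (Fr (Suc n))"
      using R.basis_vec_fin_supp[OF b] by (intro image_eqI[of f _ "basis_vec R (Syz cs)"]) simp_all
  qed
qed

lemma res_d_image_0: "res_d R M 0 ` carrier (Fr (Suc 0)) = {f \<in> carrier (Fr 0). aug f = \<zero>\<^bsub>M\<^esub>}"
  by (rule res_d_image[OF aug_map res_basis.simps(2)])

lemma res_d_image_Suc: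
  "res_d R M (Suc n) ` carrier (Fr (Suc (Suc n))) = {f \<in> carrier (Fr (Suc n)). res_d R M n f = \<zero>\<^bsub>Fr n\<^esub>}"
  by (rule res_d_image[OF res_d_map]) (simp only: res_basis.simps(3) res_d_def res_mod_def fun_module_simps self_module_simps)

lemma res_d_res_d: "f \<in> carrier (Fr (Suc (Suc n))) \<Longrightarrow> res_d R M n (res_d R M (Suc n) f) = \<zero>\<^bsub>Fr n\<^esub>"
  using imageI[of f "carrier (Fr (Suc (Suc n)))" "res_d R M (Suc n)"] unfolding res_d_image_Suc by simp

lemma aug_res_d: "f \<in> carrier (Fr (Suc 0)) \<Longrightarrow> aug (res_d R M 0 f) = \<zero>\<^bsub>M\<^esub>"
  using imageI[of f "carrier (Fr (Suc 0))" "res_d R M 0"] unfolding res_d_image_0 by simp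

section \<open>Homology\<close>

lemma submodule_restrict:
  assumes C: "submodule C R M" and H: "submodule H R M" "H \<subseteq> C"
  shows "submodule H R (M\<lparr>carrier := C\<rparr>)"
proof -
  interpret C: module R "M\<lparr>carrier := C\<rparr>" by (rule submodule.submodule_is_module[OF C module_axioms])
  interpret inc: linear_map R "M\<lparr>carrier := C\<rparr>" M id
    by (intro linear_mapI C.module_axioms module_axioms mod_homI)
      (use submoduleE(1)[OF C] in auto)
  show ?thesis
  proof (rule C.submoduleI)
    show "\<ominus>\<^bsub>M\<lparr>carrier := C\<rparr>\<^esub> x \<in> H" if "x \<in> H" for x
      using inc.neg[of x] submoduleE(3)[OF H(1) that] H(2) that by auto
  qed (use H submodule_zero[OF H(1)] submoduleE(4,5)[OF H(1)] in auto)
qed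

end

lemma homology_trivial_iff:
  assumes d: "linear_map R (C (Suc (Suc n))) (C (Suc n)) (d (Suc n))"
    and d': "linear_map R (C (Suc n)) (C n) (d n)"
    and dd: "\<And>x. x \<in> carrier (C (Suc (Suc n))) \<Longrightarrow> d n (d (Suc n) x) = \<zero>\<^bsub>C n\<^esub>"
  shows "carrier (homology C d (Suc n)) = {\<zero>\<^bsub>homology C d (Suc n)\<^esub>} \<longleftrightarrow> cycles C d (Suc n) \<subseteq> boundaries C d (Suc n)"
proof -
  interpret d: linear_map R "C (Suc (Suc n))" "C (Suc n)" "d (Suc n)" by (rule d)
  interpret d': linear_map R "C (Suc n)" "C n" "d n" by (rule d')
  let ?Z = "(C (Suc n))\<lparr>carrier := cycles C d (Suc n)\<rparr>"
  note M = linear_map.axioms(1)[OF d']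
  have Z: "submodule (cycles C d (Suc n)) R (C (Suc n))" using d'.kernel_submodule by simp
  have B: "submodule (boundaries C d (Suc n)) R (C (Suc n))" unfolding boundaries_def by (rule d.image_submodule)
  have BZ: "boundaries C d (Suc n) \<subseteq> cycles C d (Suc n)"
    using d.closed dd by (auto simp: boundaries_def)
  interpret Z: module R ?Z by (rule submodule.submodule_is_module[OF Z M])
  interpret Q: quotient R ?Z "boundaries C d (Suc n)"
    by (intro quotient.intro quotient_axioms.intro Z.module_axioms module.submodule_restrict[OF M] Z B BZ)
  have "carrier (homology C d (Suc n)) = {\<zero>\<^bsub>homology C d (Suc n)\<^esub>}
      \<longleftrightarrow> (\<forall>x\<in>carrier ?Z. boundaries C d (Suc n) +>\<^bsub>?Z\<^esub> x = \<zero>\<^bsub>quot_module ?Z (boundaries C d (Suc n))\<^esub>)"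
    unfolding homology_def Q.quot_carrier Q.quot_zero using Z.M.zero_closed by blast
  also have "\<dots> \<longleftrightarrow> cycles C d (Suc n) \<subseteq> boundaries C d (Suc n)"
    using Q.rcos_zero_iff by auto
  finally show ?thesis .
qed

context module begin

lemma Tor_zero_iff:
  assumes N: "module R N"
  shows "carrier (Tor R (Suc n) M N) = {\<zero>\<^bsub>Tor R (Suc n) M N\<^esub>} \<longleftrightarrow>
    (\<forall>x\<in>carrier (tensor R (Fr (Suc n)) N). tensor_map R (Fr n) N (res_d R M n) id x = \<zero>\<^bsub>tensor R (Fr n) N\<^esub> \<longrightarrow>
      x \<in> tensor_map R (Fr (Suc n)) N (res_d R M (Suc n)) id ` carrier (tensor R (Fr (Suc (Suc n))) N))"
proof -
  note hom = tensor_map_hom[OF Fr_module Fr_module N N linear_map.hom[OF res_d_map] mod_hom_id]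
  note sum = tensor_map_sum[OF Fr_module Fr_module N N linear_map.hom[OF res_d_map] mod_hom_id]
  have T: "module R (tensor R (Fr k) N)" for k
    by (intro tensor_product.tensor_module tensor_product.intro Fr_module N)
  have d: "linear_map R (tensor R (Fr (Suc k)) N) (tensor R (Fr k) N) (tensor_map R (Fr k) N (res_d R M k) id)" for k
    by (intro linear_mapI T hom)
  have dd: "tensor_map R (Fr n) N (res_d R M n) id (tensor_map R (Fr (Suc n)) N (res_d R M (Suc n)) id x)
      = \<zero>\<^bsub>tensor R (Fr n) N\<^esub>" if x: "x \<in> carrier (tensor R (Fr (Suc (Suc n))) N)" for x
  proof -
    interpret T0: tensor_product R "Fr n" N by (intro tensor_product.intro Fr_module N)
    interpret T2: tensor_product R "Fr (Suc (Suc n))" N by (intro tensor_product.intro Fr_module N)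
    interpret TM: module R "tensor R (Fr n) N" by (rule T)
    obtain k :: nat and f y where f: "\<And>i. i < k \<Longrightarrow> f i \<in> carrier (Fr (Suc (Suc n)))" "\<And>i. i < k \<Longrightarrow> y i \<in> carrier N"
      "x = (\<Oplus>\<^bsub>tensor R (Fr (Suc (Suc n))) N\<^esub>i\<in>{..<k}. pure_tensor R (Fr (Suc (Suc n))) N (f i) (y i))"
      by (rule T2.tensor_elem[OF x]) blast
    have c: "res_d R M (Suc n) (f i) \<in> carrier (Fr (Suc n))" if "i < k" for i
      using linear_map.closed[OF res_d_map f(1)[OF that]] .
    have "tensor_map R (Fr n) N (res_d R M n) id (tensor_map R (Fr (Suc n)) N (res_d R M (Suc n)) id x)
      = (\<Oplus>\<^bsub>tensor R (Fr n) N\<^esub>i\<in>{..<k}. pure_tensor R (Fr n) N (res_d R M n (res_d R M (Suc n) (f i))) (id (id (y i))))"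
      unfolding f(3) using f(1,2) c by (subst sum, simp, simp, simp, subst sum) simp_all
    also have "\<dots> = (\<Oplus>\<^bsub>tensor R (Fr n) N\<^esub>i\<in>{..<k}. \<zero>\<^bsub>tensor R (Fr n) N\<^esub>)"
      using f(1,2) res_d_res_d T0.pt_zero_l by (intro TM.M.finsum_cong') (simp_all del: fun_module_simps)
    finally show ?thesis by simp
  qed
  show ?thesis
    unfolding Tor_def res_mod_eq
    by (subst homology_trivial_iff[where R = R and C = "\<lambda>n. tensor R (Fr n) N" and n = n, OF d d dd])
      (auto simp: boundaries_def)
qed

text \<open>
  The map \<open>f \<otimes> n \<mapsto> f b \<cdot> n\<close> reads off a coordinate.
\<close>

lemma tensor_free_coordinate:
  assumes T: "finite T" "\<And>i. i \<in> T \<Longrightarrow> f i \<in> fin_supp X (self_module R)" "\<And>i. i \<in> T \<Longrightarrow> n i \<in> carrier M"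
    and zero: "(\<Oplus>\<^bsub>tensor R (fun_module X (self_module R)) M\<^esub>i\<in>T.
      pure_tensor R (fun_module X (self_module R)) M (f i) (n i)) = \<zero>\<^bsub>tensor R (fun_module X (self_module R)) M\<^esub>"
  shows "(\<Oplus>\<^bsub>M\<^esub>i\<in>T. f i b \<odot>\<^bsub>M\<^esub> n i) = \<zero>\<^bsub>M\<^esub>"
proof -
  interpret A: module R "self_module R" by (rule self_module[OF R.is_cring])
  interpret TP: tensor_product R "fun_module X (self_module R)" M
    by (intro tensor_product.intro A.fun_module module_axioms)
  have fR: "f b \<in> carrier R" if "f \<in> carrier (fun_module X (self_module R))" for f
    using fin_suppD(1)[of f X "self_module R" b] that by simp
  have "(\<Oplus>\<^bsub>M\<^esub>i\<in>T. f i b \<odot>\<^bsub>M\<^esub> n i) \<in> {\<zero>\<^bsub>M\<^esub>}"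
  proof (rule TP.tensor_universal[OF module_axioms, where \<beta> = "\<lambda>f n. f b \<odot>\<^bsub>M\<^esub> n", OF _ _ _ _ _ _ T(1) _ T(3) zero])
    show "submodule {\<zero>\<^bsub>M\<^esub>} R M" by (rule submoduleI) auto
  qed (use T(2) fR diff_zero_iff in \<open>auto simp: smult_l_distr smult_r_distr smult_assoc1 smult_lcomm\<close>)
  then show ?thesis by simp
qed

end

section \<open>Vanishing of Tor\<close>

context koszul_flat begin

text \<open>
  The images of the differentials. Each is the kernel of the preceding map, which is what makes the
  induction on \<open>n\<close> work, and this form is uniform in \<open>n\<close>.
\<close>

definition syz :: "nat \<Rightarrow> ('a, ('c, 'a) cell \<Rightarrow> 'a) module"
  where "syz n = (M.Fr n)\<lparr>carrier := res_d R M n ` carrier (M.Fr (Suc n))\<rparr>"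

lemma syz_simps [simp]:
  "carrier (syz n) = res_d R M n ` carrier (M.Fr (Suc n))" "\<zero>\<^bsub>syz n\<^esub> = \<zero>\<^bsub>M.Fr n\<^esub>"
  "x \<oplus>\<^bsub>syz n\<^esub> y = x \<oplus>\<^bsub>M.Fr n\<^esub> y" "a \<odot>\<^bsub>syz n\<^esub> x = a \<odot>\<^bsub>M.Fr n\<^esub> x"
  by (simp_all add: syz_def)

lemma syzygy_0: "syzygy R as I M (res_basis R M 0) M.aug"
  by (intro syzygy.intro syzygy_axioms.intro koszul_flat_axioms linear_map.hom[OF M.aug_map] M.aug_surj)

lemma syz_0: "syzygy.K R M (res_basis R M 0) M.aug = syz 0"
  using M.res_d_image_0 by (simp add: syzygy.K_def[OF syzygy_0] syz_def)

lemma syzygy_Suc: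
  assumes "koszul_flat R as I (syz n)"
  shows "syzygy R as I (syz n) (res_basis R M (Suc n)) (res_d R M n)"
proof (intro syzygy.intro syzygy_axioms.intro assms)
  interpret d: linear_map R "M.Fr (Suc n)" "M.Fr n" "res_d R M n" by (rule M.res_d_map)
  show "res_d R M n \<in> mod_hom R (M.Fr (Suc n)) (syz n)"
    by (rule mod_homI) (simp_all add: d.add d.smult del: fun_module_simps)
qed simp

lemma syz_Suc:
  assumes "koszul_flat R as I (syz n)"
  shows "syzygy.K R (syz n) (res_basis R M (Suc n)) (res_d R M n) = syz (Suc n)"
  unfolding syzygy.K_def[OF syzygy_Suc[OF assms]] using M.res_d_image_Suc[of n] by (simp add: syz_def)

lemma syz_koszul_flat: "koszul_flat R as I (syz n)"
proof (induct n)
  case 0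
  interpret S: syzygy R as I M "res_basis R M 0" M.aug by (rule syzygy_0)
  show ?case
    using S.K.module_axioms S.syzygy_flat_eq S.syzygy_pro_zero wpr unfolding syz_0
    by (intro koszul_flat.intro koszul_flat_axioms.intro fg_ideal_axioms)
next
  case (Suc n)
  interpret S: syzygy R as I "syz n" "res_basis R M (Suc n)" "res_d R M n" by (rule syzygy_Suc[OF Suc])
  show ?case
    using S.K.module_axioms S.syzygy_flat_eq S.syzygy_pro_zero wpr unfolding syz_Suc[OF Suc]
    by (intro koszul_flat.intro koszul_flat_axioms.intro fg_ideal_axioms)
qed

lemma syz_pure:
  assumes "finite T" "k \<in> fin_supp T (syz n)" "submodule S R (fun_module T A)"
    and "\<And>c. c \<in> fin_supp T A \<Longrightarrow> (\<And>t. c t \<in> Ip m) \<Longrightarrow> c \<in> S" "\<And>x. (\<lambda>t. k t x) \<in> S"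
  shows "k \<in> lspan (syz n) S"
proof (cases n)
  case 0
  show ?thesis using syzygy.syzygy_pure[OF syzygy_0, unfolded syz_0] assms unfolding 0 by blast
next
  case (Suc n')
  show ?thesis
    using syzygy.syzygy_pure[OF syzygy_Suc[OF syz_koszul_flat], unfolded syz_Suc[OF syz_koszul_flat]] assms
    unfolding Suc by blast
qed

text \<open>
  A cycle \<open>\<Sum> f\<^sub>t \<otimes> n\<^sub>t\<close> gives the syzygies \<open>d f\<^sub>t\<close>, whose coordinates are relations between the
  \<open>n\<^sub>t\<close>. By purity they come from elements \<open>g\<^sub>t\<close> with \<open>\<Sum> g\<^sub>t \<otimes> n\<^sub>t = 0\<close>, and \<open>f\<^sub>t - g\<^sub>t\<close> is a boundary.
\<close>

theorem Tor_torsion_zero: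
  assumes N: "module R N" and tors: "\<And>x. x \<in> carrier N \<Longrightarrow> \<exists>i. \<forall>r\<in>Ip i. r \<odot>\<^bsub>N\<^esub> x = \<zero>\<^bsub>N\<^esub>"
  shows "carrier (Tor R (Suc i) M N) = {\<zero>\<^bsub>Tor R (Suc i) M N\<^esub>}"
  unfolding M.Tor_zero_iff[OF N]
proof (intro ballI impI)
  fix x assume x: "x \<in> carrier (tensor R (M.Fr (Suc i)) N)"
    and dx: "tensor_map R (M.Fr i) N (res_d R M i) id x = \<zero>\<^bsub>tensor R (M.Fr i) N\<^esub>"
  interpret N: module R N by (rule N)
  interpret d: linear_map R "M.Fr (Suc i)" "M.Fr i" "res_d R M i" by (rule M.res_d_map)
  interpret T1: tensor_product R "M.Fr (Suc i)" N by (intro tensor_product.intro M.Fr_module N)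
  interpret T2: tensor_product R "M.Fr (Suc (Suc i))" N by (intro tensor_product.intro M.Fr_module N)
  interpret TM: module R "tensor R (M.Fr (Suc i)) N" by (rule T1.tensor_module)
  interpret TM2: module R "tensor R (M.Fr (Suc (Suc i))) N" by (rule T2.tensor_module)
  let ?T = "tensor R (M.Fr (Suc i)) N" and ?T2 = "tensor R (M.Fr (Suc (Suc i))) N"
    and ?dd = "tensor_map R (M.Fr (Suc i)) N (res_d R M (Suc i)) id"
  note sum = tensor_map_sum[OF M.Fr_module M.Fr_module N N linear_map.hom[OF M.res_d_map] mod_hom_id]
  obtain k :: nat and f y where f: "\<And>t. t < k \<Longrightarrow> f t \<in> carrier (M.Fr (Suc i))" and y: "\<And>t. t < k \<Longrightarrow> y t \<in> carrier N"
    and x_sum: "x = (\<Oplus>\<^bsub>?T\<^esub>t\<in>{..<k}. T1.pt (f t) (y t))"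
    by (rule T1.tensor_elem[OF x]) blast
  have df: "res_d R M i (f t) \<in> carrier (M.Fr i)" if "t < k" for t by (rule d.closed[OF f[OF that]])
  have "(\<Oplus>\<^bsub>tensor R (M.Fr i) N\<^esub>t\<in>{..<k}. pure_tensor R (M.Fr i) N (res_d R M i (f t)) (y t)) = \<zero>\<^bsub>tensor R (M.Fr i) N\<^esub>"
    using dx f y unfolding x_sum by (subst (asm) sum) auto
  then have coord: "(\<Oplus>\<^bsub>N\<^esub>t\<in>{..<k}. res_d R M i (f t) b \<odot>\<^bsub>N\<^esub> y t) = \<zero>\<^bsub>N\<^esub>" for b
    using df y by (intro N.tensor_free_coordinate) simp_all
  define \<kappa> where "\<kappa> t = (if t < k then res_d R M i (f t) else \<zero>\<^bsub>M.Fr i\<^esub>)" for t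
  have \<kappa>: "\<kappa> \<in> fin_supp {..<k} (syz i)"
  proof (rule fin_suppI'[OF finite_lessThan])
    interpret Sy: koszul_flat R as I "syz i" by (rule syz_koszul_flat)
    show "\<kappa> t \<in> carrier (syz i)" for t
      using imageI[OF f] Sy.M.M.zero_closed by (auto simp: \<kappa>_def simp del: fun_module_simps)
  qed (simp add: \<kappa>_def)
  let ?S = "{c \<in> carrier (fun_module {..<k} A). (\<Oplus>\<^bsub>N\<^esub>t\<in>{..<k}. c t \<odot>\<^bsub>N\<^esub> y t) = \<zero>\<^bsub>N\<^esub>}"
  have "\<exists>m. \<forall>t<k. \<forall>r\<in>Ip m. r \<odot>\<^bsub>N\<^esub> y t = \<zero>\<^bsub>N\<^esub>"
  proof -
    obtain i where i: "\<And>t. t < k \<Longrightarrow> \<forall>r\<in>Ip (i t). r \<odot>\<^bsub>N\<^esub> y t = \<zero>\<^bsub>N\<^esub>" using tors[OF y] by metis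
    have "Ip (Max (i ` {..<k})) \<subseteq> Ip (i t)" if "t < k" for t using that by (intro Ip_antimono Max_ge) auto
    then show ?thesis using i by (intro exI[of _ "Max (i ` {..<k})"]) blast
  qed
  then obtain m where m: "\<And>t r. t < k \<Longrightarrow> r \<in> Ip m \<Longrightarrow> r \<odot>\<^bsub>N\<^esub> y t = \<zero>\<^bsub>N\<^esub>" by blast
  have S: "submodule ?S R (fun_module {..<k} A)"
    by (rule linear_map.kernel_submodule[OF N.combination_map]) (use y in auto)
  have SA: "?S \<subseteq> fin_supp {..<k} A" by auto
  have "\<kappa> \<in> lspan (syz i) ?S"
  proof (rule syz_pure[OF finite_lessThan \<kappa> S])
    show "c \<in> ?S" if c: "c \<in> fin_supp {..<k} A" and cm: "\<And>t. c t \<in> Ip m" for c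
    proof -
      have "(\<Oplus>\<^bsub>N\<^esub>t\<in>{..<k}. c t \<odot>\<^bsub>N\<^esub> y t) = (\<Oplus>\<^bsub>N\<^esub>t\<in>{..<k}. \<zero>\<^bsub>N\<^esub>)"
        using m[OF _ cm] by (intro N.M.finsum_cong') auto
      then show ?thesis using c by simp
    qed
    fix b
    have \<kappa>b: "\<kappa> t b \<in> carrier R" for t
      using df[of t] fin_suppD(1)[of "res_d R M i (f t)" _ A b] by (auto simp: \<kappa>_def)
    have "(\<Oplus>\<^bsub>N\<^esub>t\<in>{..<k}. \<kappa> t b \<odot>\<^bsub>N\<^esub> y t) = (\<Oplus>\<^bsub>N\<^esub>t\<in>{..<k}. res_d R M i (f t) b \<odot>\<^bsub>N\<^esub> y t)"
    proof (rule N.M.finsum_cong')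
      show "(\<lambda>t. res_d R M i (f t) b \<odot>\<^bsub>N\<^esub> y t) \<in> {..<k} \<rightarrow> carrier N"
      proof
        fix t assume "t \<in> {..<k}"
        then show "res_d R M i (f t) b \<odot>\<^bsub>N\<^esub> y t \<in> carrier N" using \<kappa>b[of t] y[of t] by (simp add: \<kappa>_def)
      qed
    qed (auto simp: \<kappa>_def)
    moreover have "(\<lambda>t. \<kappa> t b) \<in> fin_supp {..<k} A"
      using \<kappa>b by (intro fin_suppI') (auto simp: \<kappa>_def)
    ultimately show "(\<lambda>t. \<kappa> t b) \<in> ?S" using coord by simp
  qed
  moreover have \<kappa>_surj: "\<exists>w\<in>carrier (M.Fr (Suc i)). res_d R M i w = z" if "z \<in> carrier (syz i)" for z
    using that unfolding syz_simps by (elim imageE) (rule bexI, rule sym)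
  moreover have "linear_map R (M.Fr (Suc i)) (syz i) (res_d R M i)"
    using syzygy_Suc[OF syz_koszul_flat[of i]] 
    by (intro linear_mapI M.Fr_module syzygy.phi koszul_flat.axioms(2)[OF syz_koszul_flat])
  ultimately obtain g where g: "g \<in> lspan (M.Fr (Suc i)) ?S" "\<And>t. res_d R M i (g t) = \<kappa> t"
    using module.lspan_lift[OF koszul_flat.axioms(2)[OF syz_koszul_flat[of i]] _ _ SA] \<kappa>_surj by blast
  have gF: "g t \<in> carrier (M.Fr (Suc i))" for t
    using fin_suppD(1)[OF module.lspan_fin_supp[OF M.Fr_module SA g(1)]] .
  have g0: "(\<Oplus>\<^bsub>?T\<^esub>t\<in>{..<k}. T1.pt (g t) (y t)) = \<zero>\<^bsub>?T\<^esub>"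
    using y by (intro T1.sum_pt_relations[OF _ _ _ g(1)]) auto
  have "\<exists>h\<in>carrier (M.Fr (Suc (Suc i))). res_d R M (Suc i) h = f t \<ominus>\<^bsub>M.Fr (Suc i)\<^esub> g t" if t: "t < k" for t
  proof -
    have "res_d R M i (f t \<ominus>\<^bsub>M.Fr (Suc i)\<^esub> g t) = \<zero>\<^bsub>M.Fr i\<^esub>"
      unfolding d.diff[OF f[OF t] gF] g(2) \<kappa>_def using t module.diff_zero_iff[OF M.Fr_module df[OF t] df[OF t]] by simp
    then have "f t \<ominus>\<^bsub>M.Fr (Suc i)\<^esub> g t \<in> res_d R M (Suc i) ` carrier (M.Fr (Suc (Suc i)))"
      unfolding M.res_d_image_Suc using d.M.M.minus_closed[OF f[OF t] gF[of t]] by simp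
    then show ?thesis by (elim imageE) (rule bexI, rule sym)
  qed
  then obtain h where h: "\<And>t. t < k \<Longrightarrow> h t \<in> carrier (M.Fr (Suc (Suc i)))"
    "\<And>t. t < k \<Longrightarrow> res_d R M (Suc i) (h t) = f t \<ominus>\<^bsub>M.Fr (Suc i)\<^esub> g t" by metis
  let ?z = "\<Oplus>\<^bsub>?T2\<^esub>t\<in>{..<k}. T2.pt (h t) (y t)"
  have "?dd ?z
    = (\<Oplus>\<^bsub>?T\<^esub>t\<in>{..<k}. T1.pt (f t \<ominus>\<^bsub>M.Fr (Suc i)\<^esub> g t) (y t))"
  proof -
    have "?dd ?z
      = (\<Oplus>\<^bsub>?T\<^esub>t\<in>{..<k}. T1.pt (res_d R M (Suc i) (h t)) (id (y t)))"
      using h y by (intro sum) auto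
    also have "\<dots> = (\<Oplus>\<^bsub>?T\<^esub>t\<in>{..<k}. T1.pt (f t \<ominus>\<^bsub>M.Fr (Suc i)\<^esub> g t) (y t))"
    proof (rule TM.M.finsum_cong')
      show "(\<lambda>t. T1.pt (f t \<ominus>\<^bsub>M.Fr (Suc i)\<^esub> g t) (y t)) \<in> {..<k} \<rightarrow> carrier (?T)"
        by (intro Pi_I T1.pt_closed d.M.M.minus_closed f gF y) simp_all
    qed (simp_all add: h)
    finally show ?thesis .
  qed
  also have "\<dots> = (\<Oplus>\<^bsub>?T\<^esub>t\<in>{..<k}. T1.pt (f t) (y t)
      \<ominus>\<^bsub>?T\<^esub> T1.pt (g t) (y t))"
  proof (rule TM.M.finsum_cong')
    show "(\<lambda>t. T1.pt (f t) (y t) \<ominus>\<^bsub>?T\<^esub> T1.pt (g t) (y t))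
      \<in> {..<k} \<rightarrow> carrier (?T)"
      by (intro Pi_I TM.M.minus_closed T1.pt_closed f gF y) simp_all
    show "T1.pt (f t \<ominus>\<^bsub>M.Fr (Suc i)\<^esub> g t) (y t) = T1.pt (f t) (y t)
      \<ominus>\<^bsub>?T\<^esub> T1.pt (g t) (y t)" if "t \<in> {..<k}" for t
      using that by (intro T1.pt_diff_l f gF y) simp_all
  qed rule
  also have "\<dots> = x \<ominus>\<^bsub>?T\<^esub> \<zero>\<^bsub>?T\<^esub>"
    unfolding x_sum g0[symmetric] using y f gF by (intro TM.finsum_diff) (auto intro!: T1.pt_closed simp del: fun_module_simps)
  also have "\<dots> = x" using x by (simp add: a_minus_def)
  finally have "x = ?dd ?z" ..
  moreover have "?z \<in> carrier (?T2)"
    using h y by (intro TM2.M.finsum_closed) (auto intro!: T2.pt_closed simp del: fun_module_simps)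
  ultimately show "x \<in> ?dd ` carrier (?T2)"
    by (rule image_eqI)
qed

end

section \<open>Vanishing of Tor implies the equational criterion\<close>

lemma (in module) ismult_lift:
  assumes L: "linear_map R L M \<phi>" and surj: "\<And>y. y \<in> carrier M \<Longrightarrow> \<exists>w\<in>carrier L. \<phi> w = y"
    and J: "ideal J R" and x: "x \<in> ismult M J"
  shows "\<exists>w\<in>ismult L J. \<phi> w = x"
  using x
proof (induct x rule: ismult.induct)
  case zero
  show ?case by (intro bexI[OF _ ismult.zero] linear_map.zero[OF L])
next
  case (step x r y)
  interpret \<phi>: linear_map R L M \<phi> by (rule L)
  obtain v where v: "v \<in> ismult L J" "\<phi> v = x" using step(2) by blast
  obtain w where w: "w \<in> carrier L" "\<phi> w = y" using surj[OF step(4)] by blast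
  have "v \<in> carrier L" by (rule module.ismult_closed[OF linear_map.axioms(1)[OF L] J v(1)])
  then have "\<phi> (v \<oplus>\<^bsub>L\<^esub> r \<odot>\<^bsub>L\<^esub> w) = x \<oplus>\<^bsub>M\<^esub> r \<odot>\<^bsub>M\<^esub> y"
    using v w ideal.Icarr[OF J step(3)] by (simp add: \<phi>.add \<phi>.smult)
  then show ?case using ismult.step[OF v(1) step(3) w(1)] by blast
qed

context fg_ideal begin

lemma submodule_ideal:
  assumes "submodule J R A" shows "ideal J R"
proof (rule idealI[OF ring_axioms])
  show "subgroup J (add_monoid R)"
    using A.submoduleE[OF assms] A.submodule_zero[OF assms]
    by (intro subgroup.intro) (auto simp: a_inv_def[symmetric])
  fix a x assume ax: "a \<in> J" "x \<in> carrier R"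
  then have "a \<in> carrier R" using A.submoduleE(1)[OF assms] by auto
  then have "a \<otimes> x = x \<otimes> a" using ax(2) by (rule m_comm)
  then show "x \<otimes> a \<in> J" "a \<otimes> x \<in> J" using A.submoduleE(4)[OF assms ax(2,1)] by simp_all
qed

lemma ismult_coord:
  assumes "x \<in> ismult (fun_module Y A) (Ip j)" shows "x b \<in> Ip j"
proof (rule module.ismult_image[OF A.fun_module ideal_Ip A.module_axioms linear_map.hom[OF A.eval_map] Ip_submodule _ assms])
  fix r y assume "r \<in> Ip j" "y \<in> carrier (fun_module Y A)"
  then show "(r \<odot>\<^bsub>fun_module Y A\<^esub> y) b \<in> Ip j"
    using ideal.I_r_closed[OF ideal_Ip, of r j "y b"] fin_suppD(1)[of y Y A b] by simp
qed

text \<open>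
  Given \<open>\<Sum> r\<^sub>t q\<^sub>t \<in> I\<^sup>j M\<close>, let \<open>J = (r\<^sub>t) + I\<^sup>j\<close>. The syzygy \<open>\<Sum> r\<^sub>t e\<^bsub>q\<^sub>t\<^esub>\<close>, corrected by an element of
  \<open>I\<^sup>j F\<^sub>0\<close>, is \<open>d g\<close> with \<open>g \<otimes> 1\<close> a cycle in \<open>F\<^sub>1 \<otimes> R/J\<close>. As \<open>Tor\<^sub>1(M, R/J) = 0\<close>, the element \<open>g\<close> can be taken in
  \<open>J F\<^sub>1\<close>, say \<open>g = \<Sum> r\<^sub>t v\<^sub>t\<close> modulo \<open>I\<^sup>j F\<^sub>1\<close>. Then \<open>e\<^bsub>q\<^sub>t\<^esub> - d v\<^sub>t\<close> lies over \<open>q\<^sub>t\<close> and its coordinates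
  satisfy the relation.
\<close>

theorem Tor_zero_imp_flat_eq:
  fixes \<iota> :: "'a \<Rightarrow> 'u"
  assumes M: "module R M" and \<iota>: "inj_on \<iota> (carrier R)"
    and Tor: "\<And>N :: ('a, 'u) module. torsion_module R I N \<Longrightarrow>
      carrier (Tor R (Suc 0) M N) = {\<zero>\<^bsub>Tor R (Suc 0) M N\<^esub>}"
  shows "flat_eq R M (Ip j)"
  unfolding flat_eq_def
proof (intro allI impI)
  fix k :: nat and r q
  assume r: "\<forall>i<k. r i \<in> carrier R" and q: "q \<in> fin_supp {..<k} M"
    and rel: "(\<Oplus>\<^bsub>M\<^esub>i\<in>{..<k}. r i \<odot>\<^bsub>M\<^esub> q i) \<in> ismult M (Ip j)"
  interpret M: module R M by (rule M)
  let ?F0 = "M.Fr 0" and ?F1 = "M.Fr (Suc 0)" and ?F2 = "M.Fr (Suc (Suc 0))"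
  interpret F0: module R ?F0 by (rule M.Fr_module)
  interpret F1: module R ?F1 by (rule M.Fr_module)
  interpret F2: module R ?F2 by (rule M.Fr_module)
  interpret aug: linear_map R ?F0 M M.aug by (rule M.aug_map)
  interpret d: linear_map R ?F1 ?F0 "res_d R M 0" by (rule M.res_d_map)
  interpret d1: linear_map R ?F2 ?F1 "res_d R M (Suc 0)" by (rule M.res_d_map)
  let ?row = "\<lambda>b. \<Oplus>i\<in>{..<k}. r i \<otimes> b i"
  interpret row: linear_map R "fun_module {..<k} A" A ?row using A.row_map[of "{..<k}" r] r by simp
  define J where "J = {z \<in> carrier A. \<exists>u\<in>carrier (fun_module {..<k} A). z \<ominus>\<^bsub>A\<^esub> ?row u \<in> Ip j}"
  have J: "ideal J R"
    unfolding J_def by (intro submodule_ideal row.sum_submodule module.carrier_is_submodule A.fun_module Ip_submodule)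
  have IpJ: "Ip j \<subseteq> J"
    using row.zero A.fin_supp_zero[of "{..<k}"] Ip_carrier
    by (auto simp: J_def a_minus_def intro!: bexI[of _ "\<lambda>_. \<zero>"])
  have rJ: "r i \<in> J" if i: "i < k" for i
  proof -
    have "?row (basis_vec R i) = (\<Oplus>\<^bsub>A\<^esub>t\<in>{..<k}. if t = i then r i else \<zero>\<^bsub>A\<^esub>)"
      unfolding self_module_finsum self_module_simps using r i
      by (intro finsum_cong') (auto simp: basis_vec_def)
    also have "\<dots> = r i" using r i by (intro A.finsum_single) auto
    finally have "r i \<ominus>\<^bsub>A\<^esub> ?row (basis_vec R i) = \<zero>" using A.diff_zero_iff[of "r i" "r i"] r i by simp
    then show ?thesis
      using r i basis_vec_fin_supp[of i "{..<k}"] additive_subgroup.zero_closed[OF ideal.axioms(1)[OF ideal_Ip]]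
      by (auto simp: J_def intro!: bexI[of _ "basis_vec R i"])
  qed
  obtain N :: "('a, 'u) module" and \<pi> where N: "module R N" and \<pi>: "\<pi> \<in> mod_hom R A N"
    "\<pi> ` carrier R = carrier N" and ker: "\<And>x. x \<in> carrier R \<Longrightarrow> \<pi> x = \<zero>\<^bsub>N\<^esub> \<longleftrightarrow> x \<in> J"
    by (rule cyclic_module_in_type[OF J \<iota>]) blast
  have "torsion_module R I N"
    unfolding torsion_module_def
  proof (intro conjI ballI N)
    fix x assume "x \<in> carrier N"
    then obtain a where a: "a \<in> carrier R" "x = \<pi> a" using \<pi>(2) by (metis imageE)
    have "s \<odot>\<^bsub>N\<^esub> x = \<zero>\<^bsub>N\<^esub>" if s: "s \<in> Ip (max 1 j)" for s
    proof -
      have "s \<in> J" using s Ip_antimono[of j "max 1 j"] IpJ by auto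
      then have "\<pi> (s \<otimes> a) = \<zero>\<^bsub>N\<^esub>" using ker ideal.I_r_closed[OF J _ a(1)] ideal.Icarr[OF J] a(1) by simp
      then show ?thesis using mod_hom_smult[OF \<pi>(1), of s a] Ip_carrier[OF s] a by simp
    qed
    then show "\<exists>i\<ge>1. \<forall>s\<in>Ip i. s \<odot>\<^bsub>N\<^esub> x = \<zero>\<^bsub>N\<^esub>" by (intro exI[of _ "max 1 j"]) auto
  qed
  note tor = Tor[OF this, unfolded M.Tor_zero_iff[OF N], rule_format]
  interpret T0: tensor_product R ?F0 N by (intro tensor_product.intro M.Fr_module N)
  interpret T1: tensor_product R ?F1 N by (intro tensor_product.intro M.Fr_module N)
  interpret T2: tensor_product R ?F2 N by (intro tensor_product.intro M.Fr_module N)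
  interpret TM1: module R "tensor R ?F1 N" by (rule T1.tensor_module)
  have p1: "\<pi> \<one> \<in> carrier N" using mod_hom_closed[OF \<pi>(1)] by simp
  have qM: "q i \<in> carrier M" for i by (rule fin_suppD(1)[OF q])
  define e where "e i = basis_vec R (Point (q i) :: ('c, 'a) cell)" for i
  have e: "e i \<in> carrier ?F0" for i
    using basis_vec_fin_supp[of "Point (q i)" "res_basis R M 0"] qM by (simp add: e_def res_basis.simps)
  have aug_e: "M.aug (e i) = q i" for i unfolding e_def by (rule M.aug_basis[OF qM])
  have re: "r i \<odot>\<^bsub>?F0\<^esub> e i \<in> carrier ?F0" if "i \<in> {..<k}" for i using r e that by (intro F0.smult_closed) auto
  define f where "f = (\<Oplus>\<^bsub>?F0\<^esub>i\<in>{..<k}. r i \<odot>\<^bsub>?F0\<^esub> e i)"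
  have f: "f \<in> carrier ?F0" unfolding f_def using re by (intro F0.M.finsum_closed) blast
  have "M.aug f = (\<Oplus>\<^bsub>M\<^esub>i\<in>{..<k}. M.aug (r i \<odot>\<^bsub>?F0\<^esub> e i))" unfolding f_def by (rule aug.map_finsum[OF finite_lessThan re])
  also have "\<dots> = (\<Oplus>\<^bsub>M\<^esub>i\<in>{..<k}. r i \<odot>\<^bsub>M\<^esub> q i)"
    using r qM e by (intro M.M.finsum_cong') (auto simp: aug.smult aug_e simp del: fun_module_simps)
  finally have "M.aug f \<in> ismult M (Ip j)" using rel by simp
  moreover have "\<exists>w\<in>carrier ?F0. M.aug w = y" if "y \<in> carrier M" for y
    using that M.aug_surj by (metis fun_module_simps(1) imageE)
  ultimately obtain f' where f': "f' \<in> ismult ?F0 (Ip j)" "M.aug f' = M.aug f"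
    using M.ismult_lift[OF M.aug_map _ ideal_Ip] by blast
  have f'c: "f' \<in> carrier ?F0" by (rule F0.ismult_closed[OF ideal_Ip f'(1)])
  define \<kappa> where "\<kappa> = f \<ominus>\<^bsub>?F0\<^esub> f'"
  have \<kappa>c: "\<kappa> \<in> carrier ?F0" unfolding \<kappa>_def by (rule F0.M.minus_closed[OF f f'c])
  have "M.aug \<kappa> = \<zero>\<^bsub>M\<^esub>"
    unfolding \<kappa>_def aug.diff[OF f f'c] f'(2) using M.diff_zero_iff aug.closed[OF f] by simp
  then have "\<kappa> \<in> res_d R M 0 ` carrier ?F1" unfolding M.res_d_image_0 using \<kappa>c by simp
  then obtain g where g: "g \<in> carrier ?F1" "res_d R M 0 g = \<kappa>" by (elim imageE) blast
  have \<kappa>J: "\<kappa> \<in> ismult ?F0 J"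
    unfolding \<kappa>_def
  proof (rule F0.submodule_diff[OF F0.ismult_submodule[OF J]])
    show "f \<in> ismult ?F0 J" unfolding f_def using rJ e by (intro F0.ismult_finsum[OF J]) auto
    show "f' \<in> ismult ?F0 J" using f'(1) ismult_mono[OF IpJ, of ?F0] by blast
  qed
  have hom: "tensor_map R (M.Fr n) N (res_d R M n) id (pure_tensor R (M.Fr (Suc n)) N x (\<pi> \<one>))
      = pure_tensor R (M.Fr n) N (res_d R M n x) (\<pi> \<one>)" if "x \<in> carrier (M.Fr (Suc n))" for x n
    using tensor_map_hom(2)[OF M.Fr_module M.Fr_module N N linear_map.hom[OF M.res_d_map] mod_hom_id that p1] by simp
  have zero_iff: "pure_tensor R (M.Fr n) N x (\<pi> \<one>) = \<zero>\<^bsub>tensor R (M.Fr n) N\<^esub> \<longleftrightarrow> x \<in> ismult (M.Fr n) J"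
    if "x \<in> carrier (M.Fr n)" for x n
    by (rule tensor_product.tensor_cyclic_zero_iff[OF _ \<pi> J ker that]) (intro tensor_product.intro M.Fr_module N)
  have "tensor_map R ?F0 N (res_d R M 0) id (pure_tensor R ?F1 N g (\<pi> \<one>)) = \<zero>\<^bsub>tensor R ?F0 N\<^esub>"
    unfolding hom[OF g(1)] g(2) zero_iff[OF \<kappa>c] by (rule \<kappa>J)
  from tor[OF T1.pt_closed[OF g(1) p1] this]
  obtain x where x: "x \<in> carrier (tensor R ?F2 N)"
    "pure_tensor R ?F1 N g (\<pi> \<one>) = tensor_map R ?F1 N (res_d R M (Suc 0)) id x" by (elim imageE) blast
  obtain h where h: "h \<in> carrier ?F2" "x = pure_tensor R ?F2 N h (\<pi> \<one>)"
    using T2.tensor_cyclic_elem[OF \<pi> x(1)] by blast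
  have dh: "res_d R M (Suc 0) h \<in> carrier ?F1" by (rule d1.closed[OF h(1)])
  define g' where "g' = g \<ominus>\<^bsub>?F1\<^esub> res_d R M (Suc 0) h"
  have g'c: "g' \<in> carrier ?F1" unfolding g'_def by (rule F1.M.minus_closed[OF g(1) dh])
  have dg': "res_d R M 0 g' = \<kappa>"
  proof -
    have "res_d R M 0 g' = \<kappa> \<ominus>\<^bsub>?F0\<^esub> \<zero>\<^bsub>?F0\<^esub>"
      unfolding g'_def d.diff[OF g(1) dh] g(2) M.res_d_res_d[OF h(1)] ..
    then show ?thesis unfolding a_minus_def F0.M_minus_zero using F0.M.r_zero[OF \<kappa>c] by (simp only:)
  qed
  have "pure_tensor R ?F1 N g' (\<pi> \<one>) = \<zero>\<^bsub>tensor R ?F1 N\<^esub>"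
    unfolding g'_def T1.pt_diff_l[OF g(1) dh p1] x(2) h(2) hom[OF h(1)]
    using TM1.diff_zero_iff T1.pt_closed[OF dh p1] by blast
  then have g'J: "g' \<in> ismult ?F1 J" unfolding zero_iff[OF g'c] .
  let ?rF = "\<lambda>v. \<Oplus>\<^bsub>?F1\<^esub>i\<in>{..<k}. r i \<odot>\<^bsub>?F1\<^esub> v i"
  interpret rF: linear_map R "fun_module {..<k} ?F1" ?F1 ?rF using r by (intro F1.row_map) auto
  have "id g' \<in> {z \<in> carrier ?F1. \<exists>v\<in>carrier (fun_module {..<k} ?F1). z \<ominus>\<^bsub>?F1\<^esub> ?rF v \<in> ismult ?F1 (Ip j)}"
  proof (rule F1.ismult_image[OF J F1.module_axioms mod_hom_id _ _ g'J])
    show "submodule {z \<in> carrier ?F1. \<exists>v\<in>carrier (fun_module {..<k} ?F1). z \<ominus>\<^bsub>?F1\<^esub> ?rF v \<in> ismult ?F1 (Ip j)} R ?F1"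
      by (intro rF.sum_submodule module.carrier_is_submodule F1.fun_module F1.ismult_submodule ideal_Ip)
    fix c y assume c: "c \<in> J" and y: "y \<in> carrier ?F1"
    obtain u where u: "u \<in> fin_supp {..<k} A" "c \<ominus> ?row u \<in> Ip j" and cR: "c \<in> carrier R"
      using c by (auto simp: J_def a_minus_def)
    have uR: "u i \<in> carrier R" for i using fin_suppD(1)[OF u(1), of i] by simp
    have rowR: "?row u \<in> carrier R" using r uR by (intro finsum_closed) auto
    have v: "(\<lambda>t. u t \<odot>\<^bsub>?F1\<^esub> y) \<in> carrier (fun_module {..<k} ?F1)"
      using F1.fin_supp_lmult[OF u(1) y] by (simp only: fun_module_simps)
    have "?rF (\<lambda>t. u t \<odot>\<^bsub>?F1\<^esub> y) = (\<Oplus>\<^bsub>?F1\<^esub>i\<in>{..<k}. (r i \<otimes> u i) \<odot>\<^bsub>?F1\<^esub> y)"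
      using r uR y by (intro F1.M.finsum_cong') (auto simp: F1.smult_assoc1 simp del: fun_module_simps)
    also have "\<dots> = ?row u \<odot>\<^bsub>?F1\<^esub> y"
      using r uR y by (intro F1.finsum_smult_rdistr[symmetric]) auto
    finally have "c \<odot>\<^bsub>?F1\<^esub> y \<ominus>\<^bsub>?F1\<^esub> ?rF (\<lambda>t. u t \<odot>\<^bsub>?F1\<^esub> y) = (c \<ominus> ?row u) \<odot>\<^bsub>?F1\<^esub> y"
      using F1.smult_l_diff[OF cR rowR y] by (simp only:)
    also have "\<dots> \<in> ismult ?F1 (Ip j)" by (rule F1.ismult_gen[OF ideal_Ip u(2) y])
    finally show "id (c \<odot>\<^bsub>?F1\<^esub> y) \<in> {z \<in> carrier ?F1. \<exists>v\<in>carrier (fun_module {..<k} ?F1). z \<ominus>\<^bsub>?F1\<^esub> ?rF v \<in> ismult ?F1 (Ip j)}"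
      unfolding id_apply by (intro CollectI conjI bexI[OF _ v] F1.smult_closed[OF cR y])
  qed
  then obtain v where vc: "v \<in> carrier (fun_module {..<k} ?F1)" and v: "g' \<ominus>\<^bsub>?F1\<^esub> ?rF v \<in> ismult ?F1 (Ip j)"
    unfolding id_apply by blast
  have vF: "v i \<in> carrier ?F1" for i using fin_suppD(1)[of v "{..<k}" ?F1 i] vc by (simp only: fun_module_simps)
  have dv: "res_d R M 0 (v i) \<in> carrier ?F0" for i by (rule d.closed[OF vF])
  have rdv: "r i \<odot>\<^bsub>?F0\<^esub> res_d R M 0 (v i) \<in> carrier ?F0" if "i \<in> {..<k}" for i using r dv that by (intro F0.smult_closed) auto
  let ?s = "\<Oplus>\<^bsub>?F0\<^esub>i\<in>{..<k}. r i \<odot>\<^bsub>?F0\<^esub> res_d R M 0 (v i)"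
  have sc: "?s \<in> carrier ?F0" using rdv by (intro F0.M.finsum_closed) blast
  have "res_d R M 0 (?rF v) = (\<Oplus>\<^bsub>?F0\<^esub>i\<in>{..<k}. res_d R M 0 (r i \<odot>\<^bsub>?F1\<^esub> v i))"
    using r vF by (intro d.map_finsum F1.smult_closed) auto
  also have "\<dots> = ?s" using r vF rdv by (intro F0.M.finsum_cong') (auto simp: d.smult simp del: fun_module_simps)
  finally have dr: "res_d R M 0 (?rF v) = ?s" .
  have "res_d R M 0 (g' \<ominus>\<^bsub>?F1\<^esub> ?rF v) \<in> ismult ?F0 (Ip j)"
    by (rule F1.ismult_image[OF ideal_Ip F0.module_axioms d.hom F0.ismult_submodule[OF ideal_Ip] _ v])
      (use Ip_carrier d.closed in \<open>auto simp: d.smult intro!: F0.ismult_gen ideal_Ip simp del: fun_module_simps\<close>)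
  then have ks: "\<kappa> \<ominus>\<^bsub>?F0\<^esub> ?s \<in> ismult ?F0 (Ip j)"
    unfolding d.diff[OF g'c rF.closed[OF vc]] dg' dr .
  define w where "w i = e i \<ominus>\<^bsub>?F0\<^esub> res_d R M 0 (v i)" for i
  have wF: "w i \<in> carrier ?F0" for i unfolding w_def by (rule F0.M.minus_closed[OF e dv])
  then have wR: "w i b \<in> carrier R" for i b using fin_suppD(1)[of "w i" "res_basis R M 0" A b] by simp
  have aug_w: "M.aug (w i) = q i" for i
    unfolding w_def aug.diff[OF e dv] aug_e M.aug_res_d[OF vF] using qM by (simp add: a_minus_def)
  have "(\<Oplus>\<^bsub>?F0\<^esub>i\<in>{..<k}. r i \<odot>\<^bsub>?F0\<^esub> w i) = (\<Oplus>\<^bsub>?F0\<^esub>i\<in>{..<k}. r i \<odot>\<^bsub>?F0\<^esub> e i \<ominus>\<^bsub>?F0\<^esub> r i \<odot>\<^bsub>?F0\<^esub> res_d R M 0 (v i))"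
  proof (rule F0.M.finsum_cong')
    show "(\<lambda>i. r i \<odot>\<^bsub>?F0\<^esub> e i \<ominus>\<^bsub>?F0\<^esub> r i \<odot>\<^bsub>?F0\<^esub> res_d R M 0 (v i)) \<in> {..<k} \<rightarrow> carrier ?F0"
      by (intro Pi_I F0.M.minus_closed re rdv)
    show "r i \<odot>\<^bsub>?F0\<^esub> w i = r i \<odot>\<^bsub>?F0\<^esub> e i \<ominus>\<^bsub>?F0\<^esub> r i \<odot>\<^bsub>?F0\<^esub> res_d R M 0 (v i)" if "i \<in> {..<k}" for i
      unfolding w_def using r that by (intro F0.smult_r_diff e dv) simp
  qed rule
  also have "\<dots> = f \<ominus>\<^bsub>?F0\<^esub> ?s" unfolding f_def using re rdv by (intro F0.finsum_diff) blast+
  also have "\<dots> = f' \<oplus>\<^bsub>?F0\<^esub> (\<kappa> \<ominus>\<^bsub>?F0\<^esub> ?s)"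
    unfolding \<kappa>_def a_minus_def using f f'c sc
    by (simp only: F0.M.a_comm[of f] F0.M.a_assoc F0.M.r_neg2 F0.M.a_inv_closed F0.M.a_closed)
  also have "\<dots> \<in> ismult ?F0 (Ip j)" by (rule F0.ismult_add[OF ideal_Ip f'(1) ks])
  finally have "(\<Oplus>\<^bsub>?F0\<^esub>i\<in>{..<k}. r i \<odot>\<^bsub>?F0\<^esub> w i) b \<in> Ip j" for b by (rule ismult_coord)
  moreover have "(\<Oplus>\<^bsub>?F0\<^esub>i\<in>{..<k}. r i \<odot>\<^bsub>?F0\<^esub> w i) = (\<lambda>b. \<Oplus>\<^bsub>A\<^esub>i\<in>{..<k}. (r i \<odot>\<^bsub>?F0\<^esub> w i) b)"
    using r wF F0.smult_closed[OF _ wF] by (intro A.fun_module_finsum) auto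
  ultimately have wrel: "(\<Oplus>i\<in>{..<k}. r i \<otimes> w i b) \<in> Ip j" for b by (simp add: fun_eq_iff)
  let ?S = "{b \<in> fin_supp {..<k} A. ?row b \<in> Ip j}"
  have SA: "?S \<subseteq> fin_supp {..<k} A" by auto
  define B0 where "B0 = (\<Union>i\<in>{..<k}. {b. w i b \<noteq> \<zero>})"
  have wfs: "w i \<in> fin_supp (res_basis R M 0) A" for i using wF[of i] by simp
  have B0: "finite B0" "B0 \<subseteq> res_basis R M 0"
    using fin_suppD(2,3)[OF wfs] by (auto simp: B0_def)
  define c where "c b i = (if i < k then w i b else \<zero>)" for b i
  have c: "c b \<in> ?S" for b
  proof -
    have "c b \<in> fin_supp {..<k} A" using wR by (intro fin_suppI'[OF finite_lessThan]) (auto simp: c_def)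
    moreover have "?row (c b) = (\<Oplus>i\<in>{..<k}. r i \<otimes> w i b)"
      using r wR by (intro finsum_cong') (auto simp: c_def)
    ultimately show ?thesis using wrel by simp
  qed
  have pM: "cell_pt M b \<in> carrier M" if "b \<in> B0" for b using M.cell_pt_closed B0(2) that by blast
  interpret TM: module R "fun_module {..<k} M" by (rule M.fun_module)
  have gen: "(\<lambda>i. c b i \<odot>\<^bsub>M\<^esub> cell_pt M b) \<in> lspan M ?S" if "b \<in> B0" for b
    by (rule M.lspan_gen[OF SA c pM[OF that]])
  have "(\<Oplus>\<^bsub>fun_module {..<k} M\<^esub>b\<in>B0. (\<lambda>i. c b i \<odot>\<^bsub>M\<^esub> cell_pt M b)) \<in> lspan M ?S"
    by (rule TM.submodule_finsum[OF M.lspan_submodule[OF SA] B0(1) gen])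
  also have "(\<Oplus>\<^bsub>fun_module {..<k} M\<^esub>b\<in>B0. (\<lambda>i. c b i \<odot>\<^bsub>M\<^esub> cell_pt M b)) = (\<lambda>i. \<Oplus>\<^bsub>M\<^esub>b\<in>B0. c b i \<odot>\<^bsub>M\<^esub> cell_pt M b)"
    by (rule M.fun_module_finsum[OF B0(1) M.lspan_fin_supp[OF SA gen]])
  also have "\<dots> = q"
  proof
    fix i
    show "(\<Oplus>\<^bsub>M\<^esub>b\<in>B0. c b i \<odot>\<^bsub>M\<^esub> cell_pt M b) = q i"
    proof (cases "i < k")
      case True
      then have "{b. w i b \<noteq> \<zero>} \<subseteq> B0" by (auto simp: B0_def)
      from M.lin_ext_eq[OF wfs M.cell_pt_closed B0 this]
      show ?thesis using aug_w[of i] True by (simp add: c_def)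
    next
      case False
      have "(\<Oplus>\<^bsub>M\<^esub>b\<in>B0. c b i \<odot>\<^bsub>M\<^esub> cell_pt M b) = (\<Oplus>\<^bsub>M\<^esub>b\<in>B0. \<zero>\<^bsub>M\<^esub>)"
        using False pM by (intro M.M.finsum_cong') (auto simp: c_def)
      then show ?thesis using fin_suppD(2)[OF q] False by simp
    qed
  qed
  finally show "q \<in> lspan M {b \<in> fin_supp {..<k} A. ?row b \<in> Ip j}" .
qed

end

section \<open>Weak proregularity\<close>

context fg_ideal begin

lemma koszul_mod_eq: "koszul_mod R (seq_pow R as j) n = fun_module (words_deg p n) A"
  by (simp add: koszul_mod_def free_module_eq words_deg_def)

text \<open>
  The transition map sends the class of a cycle to a union of cosets that contains the coset of its
  image, so if that union is the zero class, then the image is a boundary.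
\<close>

lemma weakly_proregular_pro_zero:
  assumes wpr: "weakly_proregular_seq R as"
  shows "koszul_pro_zero R as A"
  unfolding koszul_pro_zero_def
proof (intro allI impI)
  fix q m :: nat assume q: "1 \<le> q" and m: "1 \<le> m"
  obtain q' where q': "q = Suc q'" using q by (cases q) auto
  let ?C = "\<lambda>n. fun_module (words_deg p n) A"
  let ?Z = "\<lambda>j. cycles ?C (\<lambda>_. D j) q" and ?B = "\<lambda>j. boundaries ?C (\<lambda>_. D j) q"
  have kd: "koszul_d R (seq_pow R as j) = D j" for j by (intro ext koszul_d_eq)
  let ?H = "\<lambda>j. quot_module ((?C q)\<lparr>carrier := ?Z j\<rparr>) (?B j)"
  obtain k where k: "k \<ge> m" and "\<forall>x\<in>carrier (?H k).
      quot_map ((?C q)\<lparr>carrier := ?Z m\<rparr>) (?B m) (koszul_trans R as k m) x = \<zero>\<^bsub>?H m\<^esub>"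
    using wpr q m unfolding weakly_proregular_seq_def pro_zero_def koszul_homology_def homology_def homology_map_def
      koszul_mod_eq kd by blast
  then have zero: "quot_map ((?C q)\<lparr>carrier := ?Z m\<rparr>) (?B m) (koszul_trans R as k m) x = ?B m"
    if "x \<in> carrier (?H k)" for x using that by (simp add: quot_module_def)
  have B0: "(\<lambda>_. \<zero>) \<in> ?B j" for j
    using A.kd_zero[OF spc, of j] A.fin_supp_zero
    unfolding boundaries_def by (intro image_eqI[of _ _ "\<lambda>_. \<zero>"]) (auto simp del: A.kd_zero)
  have "\<exists>y\<in>fin_supp (words_deg p (Suc q)) A.
      \<forall>s. koszul_weight R (k - m) as s \<odot>\<^bsub>A\<^esub> z s = kd A (seq_pow R as m) y s"
    if z: "z \<in> fin_supp (words_deg p q) A" and dz: "\<forall>s. kd A (seq_pow R as k) z s = \<zero>\<^bsub>A\<^esub>" for z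
  proof -
    let ?x = "?B k +>\<^bsub>(?C q)\<lparr>carrier := ?Z k\<rparr>\<^esub> z"
    have zZ: "z \<in> ?Z k" using z dz by (auto simp: q')
    have "?x \<in> carrier (quot_module ((?C q)\<lparr>carrier := ?Z k\<rparr>) (?B k))"
      using zZ by (auto simp: quot_module_def A_RCOSETS_def')
    moreover have "z \<in> ?x"
      using B0[of k] fin_suppD(1)[OF z] by (auto simp: a_r_coset_def' fun_eq_iff intro!: bexI[of _ "\<lambda>_. \<zero>"])
    ultimately have "?B m +>\<^bsub>(?C q)\<lparr>carrier := ?Z m\<rparr>\<^esub> koszul_trans R as k m z \<subseteq> ?B m"
      using zero[of ?x] unfolding quot_map_def by blast
    moreover have "koszul_trans R as k m z s \<in> carrier R" for s
      using fin_suppD(1)[OF z, of s] koszul_weight_closed[OF as_closed] by (simp add: koszul_trans_def)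
    then have "koszul_trans R as k m z \<in> ?B m +>\<^bsub>(?C q)\<lparr>carrier := ?Z m\<rparr>\<^esub> koszul_trans R as k m z"
      using B0[of m] by (auto simp: a_r_coset_def' fun_eq_iff intro!: bexI[of _ "\<lambda>_. \<zero>"])
    ultimately have "koszul_trans R as k m z \<in> ?B m" by blast
    then obtain y where "y \<in> carrier (?C (Suc q))" "koszul_trans R as k m z = D m y"
      unfolding boundaries_def by (elim imageE) blast
    then show ?thesis by (intro bexI[of _ y]) (auto simp: koszul_trans_def fun_eq_iff)
  qed
  then show "\<exists>k\<ge>m. \<forall>z\<in>fin_supp (words_deg p q) A. (\<forall>s. kd A (seq_pow R as k) z s = \<zero>\<^bsub>A\<^esub>) \<longrightarrow>
      (\<exists>y\<in>fin_supp (words_deg p (Suc q)) A.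
        \<forall>s. koszul_weight R (k - m) as s \<odot>\<^bsub>A\<^esub> z s = kd A (seq_pow R as m) y s)"
    using k by blast
qed

end

section \<open>Completeness\<close>

lemma (in tensor_product) pt_zero_swap:
  assumes m: "m \<in> carrier P" and n: "n \<in> carrier N" and zero: "pt m n = \<zero>\<^bsub>tensor R P N\<^esub>"
  shows "pure_tensor R N P n m = \<zero>\<^bsub>tensor R N P\<^esub>"
proof -
  interpret S: tensor_product R N P by (intro tensor_product.intro P.module_axioms N.module_axioms)
  interpret T: module R "tensor R P N" by (rule tensor_module)
  interpret TS: module R "tensor R N P" by (rule S.tensor_module)
  have "(\<Oplus>\<^bsub>tensor R N P\<^esub>i\<in>{()}. S.pt n m) \<in> {\<zero>\<^bsub>tensor R N P\<^esub>}"
  proof (rule tensor_universal[OF S.tensor_module, where \<beta> = "\<lambda>m n. S.pt n m" and p = "\<lambda>_. m" and n = "\<lambda>_. n"])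
    show "submodule {\<zero>\<^bsub>tensor R N P\<^esub>} R (tensor R N P)" by (rule TS.submoduleI) auto
    show "(\<Oplus>\<^bsub>tensor R P N\<^esub>i\<in>{()}. pt m n) = \<zero>\<^bsub>tensor R P N\<^esub>"
      using zero T.M.finsum_insert[of "{}" "()"] by simp
    have sub0: "x \<ominus>\<^bsub>tensor R N P\<^esub> x \<in> {\<zero>\<^bsub>tensor R N P\<^esub>}" if "x \<in> carrier (tensor R N P)" for x
      using TS.diff_zero_iff[OF that that] by simp
    note closed = S.pt_closed TS.M.a_closed TS.smult_closed
    show "S.pt y x \<in> carrier (tensor R N P)" if "x \<in> carrier P" "y \<in> carrier N" for x y
      using that by (intro closed)
    show "S.pt y (x \<oplus>\<^bsub>P\<^esub> x') \<ominus>\<^bsub>tensor R N P\<^esub> (S.pt y x \<oplus>\<^bsub>tensor R N P\<^esub> S.pt y x') \<in> {\<zero>\<^bsub>tensor R N P\<^esub>}"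
      if "x \<in> carrier P" "x' \<in> carrier P" "y \<in> carrier N" for x x' y
      unfolding S.pt_add_r[OF that(3,1,2)] using that by (intro sub0 closed)
    show "S.pt (y \<oplus>\<^bsub>N\<^esub> y') x \<ominus>\<^bsub>tensor R N P\<^esub> (S.pt y x \<oplus>\<^bsub>tensor R N P\<^esub> S.pt y' x) \<in> {\<zero>\<^bsub>tensor R N P\<^esub>}"
      if "x \<in> carrier P" "y \<in> carrier N" "y' \<in> carrier N" for x y y'
      unfolding S.pt_add_l[OF that(2,3,1)] using that by (intro sub0 closed)
    show "S.pt y (a \<odot>\<^bsub>P\<^esub> x) \<ominus>\<^bsub>tensor R N P\<^esub> a \<odot>\<^bsub>tensor R N P\<^esub> S.pt y x \<in> {\<zero>\<^bsub>tensor R N P\<^esub>}"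
      if "a \<in> carrier R" "x \<in> carrier P" "y \<in> carrier N" for a x y
      unfolding S.pt_smult_r[OF that(1,3,2)] using that by (intro sub0 closed)
    show "S.pt (a \<odot>\<^bsub>N\<^esub> y) x \<ominus>\<^bsub>tensor R N P\<^esub> a \<odot>\<^bsub>tensor R N P\<^esub> S.pt y x \<in> {\<zero>\<^bsub>tensor R N P\<^esub>}"
      if "a \<in> carrier R" "x \<in> carrier P" "y \<in> carrier N" for a x y
      unfolding S.pt_smult_l[OF that(1,3,2)] using that by (intro sub0 closed)
  qed (use m n in auto)
  then show ?thesis using TS.M.finsum_insert[of "{}" "()"] S.pt_closed[OF n m] by simp
qed

lemma a_r_coset_self_module: "H +>\<^bsub>self_module R\<^esub> x = H +>\<^bsub>R\<^esub> x"
  by (simp add: a_r_coset_def')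

locale adic_module = fg_ideal + M: module R M for M (structure)
begin

abbreviation "Q k \<equiv> quot_ring_module R I k"
abbreviation "\<pi> k x \<equiv> Ip (k + 1) +> x"
abbreviation "\<tau> k \<equiv> pure_tensor R (Q k) M (\<pi> k \<one>)"

lemma Q_quotient: "quotient R A (Ip (k + 1))"
  by (intro quotient.intro quotient_axioms.intro A.module_axioms Ip_submodule)

lemma Q_module: "module R (Q k)"
  using quotient.quot_is_module[OF Q_quotient] by (simp add: quot_ring_module_def)

lemma pi_hom: "\<pi> k \<in> mod_hom R A (Q k)"
  using quotient.quot_hom[OF Q_quotient, of k] by (simp add: quot_ring_module_def a_r_coset_self_module)

lemma pi_surj: "\<pi> k ` carrier R = carrier (Q k)"
  using quotient.quot_carrier[OF Q_quotient, of k] by (simp add: quot_ring_module_def a_r_coset_self_module)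

lemma pi_zero_iff: "x \<in> carrier R \<Longrightarrow> \<pi> k x = \<zero>\<^bsub>Q k\<^esub> \<longleftrightarrow> x \<in> Ip (k + 1)"
  using quotient.rcos_zero_iff[OF Q_quotient, of x k] by (simp add: quot_ring_module_def a_r_coset_self_module)

lemma pi_one: "\<pi> k \<one> \<in> carrier (Q k)"
  using mod_hom_closed[OF pi_hom] by simp

lemma Q_tensor: "tensor_product R (Q k) M"
  by (intro tensor_product.intro Q_module M.module_axioms)

lemma tau_map: "linear_map R M (tensor R (Q k) M) (\<tau> k)"
  by (rule tensor_product.pt_map_r[OF Q_tensor pi_one])

text \<open>
  Hence \<open>\<tau> k\<close> identifies \<open>M / I ^ (k + 1) M\<close> with \<open>R / I ^ (k + 1) \<otimes> M\<close>.
\<close>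

lemma tau_zero_iff:
  assumes x: "x \<in> carrier M" shows "\<tau> k x = \<zero>\<^bsub>tensor R (Q k) M\<^esub> \<longleftrightarrow> x \<in> ismult M (Ip (k + 1))"
proof -
  interpret S: tensor_product R M "Q k" by (intro tensor_product.intro Q_module M.module_axioms)
  have "S.pt x (\<pi> k \<one>) = \<zero>\<^bsub>tensor R M (Q k)\<^esub> \<longleftrightarrow> x \<in> ismult M (Ip (k + 1))"
    by (rule S.tensor_cyclic_zero_iff[OF pi_hom pi_surj ideal_Ip pi_zero_iff x])
  then show ?thesis
    using S.pt_zero_swap[OF x pi_one] tensor_product.pt_zero_swap[OF Q_tensor pi_one x] by blast
qed

lemma tau_surj: "\<tau> k ` carrier M = carrier (tensor R (Q k) M)"
proof
  interpret T: tensor_product R "Q k" M by (rule Q_tensor)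
  interpret S: tensor_product R M "Q k" by (intro tensor_product.intro Q_module M.module_axioms)
  show "\<tau> k ` carrier M \<subseteq> carrier (tensor R (Q k) M)" using linear_map.closed[OF tau_map] by blast
  show "carrier (tensor R (Q k) M) \<subseteq> \<tau> k ` carrier M"
  proof
    fix x assume x: "x \<in> carrier (tensor R (Q k) M)"
    show "x \<in> \<tau> k ` carrier M"
    proof (rule T.tensor_generated[OF linear_map.image_submodule[OF tau_map] _ x])
      fix n m assume "n \<in> carrier (Q k)" and m: "m \<in> carrier M"
      then obtain a where a: "a \<in> carrier R" "n = a \<odot>\<^bsub>Q k\<^esub> \<pi> k \<one>" using S.cyclic_multiple[OF pi_hom pi_surj] by blast
      show "T.pt n m \<in> \<tau> k ` carrier M"
        using a m pi_one by (intro image_eqI[of _ _ "a \<odot>\<^bsub>M\<^esub> m"]) (simp_all add: T.pt_smult_l T.pt_smult_r)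
    qed
  qed
qed

lemma completion_unit_eq: "completion_unit R I M x = (\<lambda>k. \<tau> k x)"
  by (simp add: completion_unit_def quot_ring_def FactRing_def)

lemma completion_trans_tau:
  assumes x: "x \<in> carrier M" shows "completion_trans R I M k (\<tau> (Suc k) x) = \<tau> k x"
proof -
  interpret Qk: quotient R A "Ip (k + 1)" by (rule Q_quotient)
  let ?t = "quot_map A (Ip (k + 1)) id"
  have t: "?t (\<pi> (Suc k) a) = \<pi> k a" if a: "a \<in> carrier R" for a
  proof -
    have "(\<Union>y\<in>Ip (Suc k + 1) +>\<^bsub>A\<^esub> a. Ip (k + 1) +>\<^bsub>A\<^esub> y) = Ip (k + 1) +>\<^bsub>A\<^esub> a"
    proof (rule quotient.coset_UN[OF Q_quotient])
      show "a \<in> carrier A" using a by simp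
      fix y assume ya: "y \<in> Ip (Suc k + 1) +>\<^bsub>A\<^esub> a"
      have y: "y \<in> carrier A \<and> y \<ominus>\<^bsub>A\<^esub> a \<in> Ip (Suc k + 1)" by (rule quotient.rcosD[OF Q_quotient _ ya]) (simp add: a)
      then have "y \<ominus>\<^bsub>A\<^esub> a \<in> Ip (k + 1)" using Ip_antimono[of "k + 1" "Suc k + 1"] by auto
      then show "Ip (k + 1) +>\<^bsub>A\<^esub> y = Ip (k + 1) +>\<^bsub>A\<^esub> a" using Qk.rcos_eq_iff[of y a] y a by simp
    qed
    then show ?thesis by (simp add: quot_map_def a_r_coset_self_module)
  qed
  interpret p: linear_map R A "Q k" "\<pi> k"
    by (intro linear_mapI A.module_axioms Q_module pi_hom)
  interpret p': linear_map R A "Q (Suc k)" "\<pi> (Suc k)"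
    by (intro linear_mapI A.module_axioms Q_module pi_hom)
  have "?t \<in> mod_hom R (Q (Suc k)) (Q k)"
  proof (rule mod_homI)
    fix y assume "y \<in> carrier (Q (Suc k))"
    then obtain a where a: "a \<in> carrier R" "y = \<pi> (Suc k) a" using pi_surj[of "Suc k"] by blast
    show "?t y \<in> carrier (Q k)" unfolding a(2) t[OF a(1)] using p.closed a(1) by simp
    show "?t (r \<odot>\<^bsub>Q (Suc k)\<^esub> y) = r \<odot>\<^bsub>Q k\<^esub> ?t y" if r: "r \<in> carrier R" for r
    proof -
      have "?t (r \<odot>\<^bsub>Q (Suc k)\<^esub> y) = ?t (\<pi> (Suc k) (r \<otimes> a))"
        unfolding a(2) using p'.smult[of r a] r a(1) by (simp only: self_module_simps)
      also have "\<dots> = \<pi> k (r \<otimes> a)" by (rule t[OF m_closed[OF r a(1)]])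
      also have "\<dots> = r \<odot>\<^bsub>Q k\<^esub> ?t y"
        unfolding a(2) t[OF a(1)] using p.smult[of r a] r a(1) by (simp only: self_module_simps)
      finally show ?thesis .
    qed
    fix z assume "z \<in> carrier (Q (Suc k))"
    then obtain b where b: "b \<in> carrier R" "z = \<pi> (Suc k) b" using pi_surj[of "Suc k"] by blast
    show "?t (y \<oplus>\<^bsub>Q (Suc k)\<^esub> z) = ?t y \<oplus>\<^bsub>Q k\<^esub> ?t z"
    proof -
      have "?t (y \<oplus>\<^bsub>Q (Suc k)\<^esub> z) = ?t (\<pi> (Suc k) (a \<oplus> b))"
        unfolding a(2) b(2) using p'.add[of a b] b(1) a(1) by (simp only: self_module_simps)
      also have "\<dots> = \<pi> k (a \<oplus> b)" by (rule t[OF a_closed[OF a(1) b(1)]])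
      also have "\<dots> = ?t y \<oplus>\<^bsub>Q k\<^esub> ?t z"
        unfolding a(2) b(2) t[OF a(1)] t[OF b(1)] using p.add[of a b] b(1) a(1) by (simp only: self_module_simps)
      finally show ?thesis .
    qed
  qed
  from tensor_map_hom(2)[OF Q_module Q_module M.module_axioms M.module_axioms this mod_hom_id pi_one x]
  show ?thesis unfolding completion_trans_def t[OF one_closed] by simp
qed

lemma complete_separated:
  assumes comp: "adically_complete R I M" and x: "x \<in> carrier M" "\<And>k. x \<in> ismult M (Ip k)"
  shows "x = \<zero>\<^bsub>M\<^esub>"
proof -
  have "\<tau> k x = \<tau> k \<zero>\<^bsub>M\<^esub>" for k
    unfolding linear_map.zero[OF tau_map] tau_zero_iff[OF x(1)] by (rule x(2))
  then have "completion_unit R I M x = completion_unit R I M \<zero>\<^bsub>M\<^esub>"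
    unfolding completion_unit_eq by (rule ext)
  moreover have "inj_on (completion_unit R I M) (carrier M)"
    using comp by (simp add: adically_complete_def mod_iso_def bij_betw_def)
  ultimately show ?thesis using x(1) by (auto dest: inj_onD)
qed

text \<open>
  The images of the partial sums are compatible with the transition maps, because the \<open>k\<close>-th term of
  the series vanishes modulo \<open>I\<^sup>k\<close>. So they are the components of an element of the completion.
\<close>

lemma complete_convergent:
  assumes comp: "adically_complete R I M" and u: "\<And>k. u k \<in> ismult M (Ip k)"
  shows "\<exists>x\<in>carrier M. \<forall>m. x \<ominus>\<^bsub>M\<^esub> (\<Oplus>\<^bsub>M\<^esub>k\<in>{..<m}. u k) \<in> ismult M (Ip m)"
proof -
  have uM: "u k \<in> carrier M" for k by (rule M.ismult_closed[OF ideal_Ip u])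
  define s where "s m = (\<Oplus>\<^bsub>M\<^esub>k\<in>{..<m}. u k)" for m
  have s: "s m \<in> carrier M" for m unfolding s_def using uM by (intro M.M.finsum_closed) auto
  have s_Suc: "s (Suc m) = u m \<oplus>\<^bsub>M\<^esub> s m" for m
    unfolding s_def lessThan_Suc using uM by (intro M.M.finsum_insert) auto
  have tau: "\<tau> k (s (Suc (Suc k))) = \<tau> k (s (Suc k))" for k
  proof -
    interpret t: linear_map R M "tensor R (Q k) M" "\<tau> k" by (rule tau_map)
    have "\<tau> k (u (Suc k)) = \<zero>\<^bsub>tensor R (Q k) M\<^esub>" using tau_zero_iff[OF uM, of k] u[of "Suc k"] by simp
    then show ?thesis
      unfolding s_Suc[of "Suc k"] t.add[OF uM s] using t.closed[OF s] by simp
  qed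
  have "(\<lambda>k. \<tau> k (s (Suc k))) \<in> carrier (completion R I M)"
    unfolding completion_def Let_def using linear_map.closed[OF tau_map s] completion_trans_tau[OF s] tau by simp
  also have "carrier (completion R I M) = completion_unit R I M ` carrier M"
    using comp by (simp add: adically_complete_def mod_iso_def bij_betw_def)
  finally obtain x where x: "x \<in> carrier M" "(\<lambda>k. \<tau> k (s (Suc k))) = completion_unit R I M x" by (elim imageE)
  have "x \<ominus>\<^bsub>M\<^esub> s m \<in> ismult M (Ip m)" for m
  proof (cases m)
    case 0
    have "\<one> \<in> Ip m" unfolding 0 Ip_0 by simp
    from M.ismult_gen[OF ideal_Ip this M.M.minus_closed[OF x(1) s]] show ?thesis
      unfolding M.smult_one[OF M.M.minus_closed[OF x(1) s]] .
  next
    case (Suc k)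
    interpret t: linear_map R M "tensor R (Q k) M" "\<tau> k" by (rule tau_map)
    have "\<tau> k (s (Suc k)) = \<tau> k x" using fun_cong[OF x(2), of k] by (simp add: completion_unit_eq)
    then have "\<tau> k (x \<ominus>\<^bsub>M\<^esub> s (Suc k)) = \<zero>\<^bsub>tensor R (Q k) M\<^esub>"
      unfolding t.diff[OF x(1) s] using module.diff_zero_iff[OF tensor_product.tensor_module[OF Q_tensor] t.closed[OF x(1)] t.closed[OF x(1)]] by (simp only:)
    then show ?thesis unfolding tau_zero_iff[OF M.M.minus_closed[OF x(1) s]] by (simp add: Suc)
  qed
  then show ?thesis using x(1) unfolding s_def by blast
qed

end

section \<open>Reduction modulo an ideal\<close>

context module begin

lemma ismult_zero_ideal: "x \<in> ismult M {\<zero>} \<Longrightarrow> x = \<zero>\<^bsub>M\<^esub>"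
  by (induct x rule: ismult.induct) auto

lemma flat_eq_carrier: "flat_eq R M (carrier R)"
  unfolding flat_eq_def
proof (intro allI impI)
  fix k :: nat and r q
  assume r: "\<forall>i<k. r i \<in> carrier R" and q: "q \<in> fin_supp {..<k} M"
  interpret A: module R "self_module R" by (rule self_module[OF R.is_cring])
  interpret T: module R "fun_module {..<k} M" by (rule fun_module)
  let ?S = "{b \<in> fin_supp {..<k} (self_module R). (\<Oplus>i\<in>{..<k}. r i \<otimes> b i) \<in> carrier R}"
  have S: "?S \<subseteq> fin_supp {..<k} (self_module R)" by auto
  have "basis_vec R t \<in> ?S" if "t \<in> {..<k}" for t
    using R.basis_vec_fin_supp[OF that] r by (auto intro!: R.finsum_closed)
  then have "(\<Oplus>\<^bsub>fun_module {..<k} M\<^esub>t\<in>{..<k}. (\<lambda>x. basis_vec R t x \<odot>\<^bsub>M\<^esub> q t)) \<in> lspan M ?S"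
    using fin_suppD(1)[OF q] by (intro T.submodule_finsum[OF lspan_submodule[OF S]] lspan_gen[OF S]) auto
  then show "q \<in> lspan M ?S" unfolding fun_module_expand[OF finite_lessThan q] .
qed

end

text \<open>
  The passage from \<open>M\<close> over \<open>R\<close> to \<open>M/c M\<close> over \<open>R/c\<close>, for quotients given up to isomorphism.
\<close>

locale module_reduction = M: module R M + N: module S N for R and M and S and N +
  fixes \<sigma> \<tau> c
  assumes ring_hom: "\<sigma> \<in> ring_hom R S" and \<sigma>_surj: "\<sigma> ` carrier R = carrier S"
    and c: "ideal c R" and \<sigma>_ker: "\<And>x. x \<in> carrier R \<Longrightarrow> \<sigma> x = \<zero>\<^bsub>S\<^esub> \<longleftrightarrow> x \<in> c"
    and \<tau>_surj: "\<tau> ` carrier M = carrier N"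
    and \<tau>_add: "\<And>x y. x \<in> carrier M \<Longrightarrow> y \<in> carrier M \<Longrightarrow> \<tau> (x \<oplus>\<^bsub>M\<^esub> y) = \<tau> x \<oplus>\<^bsub>N\<^esub> \<tau> y"
    and \<tau>_smult: "\<And>a x. a \<in> carrier R \<Longrightarrow> x \<in> carrier M \<Longrightarrow> \<tau> (a \<odot>\<^bsub>M\<^esub> x) = \<sigma> a \<odot>\<^bsub>N\<^esub> \<tau> x"
    and \<tau>_ker: "\<And>x. x \<in> carrier M \<Longrightarrow> \<tau> x = \<zero>\<^bsub>N\<^esub> \<longleftrightarrow> x \<in> ismult M c"
begin

lemma \<sigma>_closed: "x \<in> carrier R \<Longrightarrow> \<sigma> x \<in> carrier S"
  using \<sigma>_surj by blast

lemma \<tau>_closed: "x \<in> carrier M \<Longrightarrow> \<tau> x \<in> carrier N"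
  using \<tau>_surj by blast

lemma \<sigma>_zero: "\<sigma> \<zero>\<^bsub>R\<^esub> = \<zero>\<^bsub>S\<^esub>"
  using \<sigma>_ker additive_subgroup.zero_closed[OF ideal.axioms(1)[OF c]] by simp

lemma \<tau>_zero: "\<tau> \<zero>\<^bsub>M\<^esub> = \<zero>\<^bsub>N\<^esub>"
  using \<tau>_ker ismult.zero[of M c] by simp

lemma \<tau>_sum:
  assumes "finite T" "\<And>i. i \<in> T \<Longrightarrow> r i \<in> carrier R" "\<And>i. i \<in> T \<Longrightarrow> q i \<in> carrier M"
  shows "\<tau> (\<Oplus>\<^bsub>M\<^esub>i\<in>T. r i \<odot>\<^bsub>M\<^esub> q i) = (\<Oplus>\<^bsub>N\<^esub>i\<in>T. \<sigma> (r i) \<odot>\<^bsub>N\<^esub> \<tau> (q i))"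
  using assms
proof (induct T)
  case empty
  then show ?case by (simp add: \<tau>_zero)
next
  case (insert a T)
  have "(\<Oplus>\<^bsub>M\<^esub>i\<in>insert a T. r i \<odot>\<^bsub>M\<^esub> q i) = r a \<odot>\<^bsub>M\<^esub> q a \<oplus>\<^bsub>M\<^esub> (\<Oplus>\<^bsub>M\<^esub>i\<in>T. r i \<odot>\<^bsub>M\<^esub> q i)"
    using insert by (intro M.M.finsum_insert) auto
  moreover have "(\<Oplus>\<^bsub>N\<^esub>i\<in>insert a T. \<sigma> (r i) \<odot>\<^bsub>N\<^esub> \<tau> (q i))
      = \<sigma> (r a) \<odot>\<^bsub>N\<^esub> \<tau> (q a) \<oplus>\<^bsub>N\<^esub> (\<Oplus>\<^bsub>N\<^esub>i\<in>T. \<sigma> (r i) \<odot>\<^bsub>N\<^esub> \<tau> (q i))"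
    using insert \<sigma>_closed \<tau>_closed by (intro N.M.finsum_insert) auto
  moreover have "(\<Oplus>\<^bsub>M\<^esub>i\<in>T. r i \<odot>\<^bsub>M\<^esub> q i) \<in> carrier M" using insert by (intro M.M.finsum_closed) auto
  ultimately show ?case using insert by (simp add: \<tau>_add \<tau>_smult)
qed

lemma \<sigma>_sum:
  assumes "\<And>i. i \<in> T \<Longrightarrow> r i \<in> carrier R" "\<And>i. i \<in> T \<Longrightarrow> b i \<in> carrier R"
  shows "\<sigma> (\<Oplus>\<^bsub>R\<^esub>i\<in>T. r i \<otimes>\<^bsub>R\<^esub> b i) = (\<Oplus>\<^bsub>S\<^esub>i\<in>T. \<sigma> (r i) \<otimes>\<^bsub>S\<^esub> \<sigma> (b i))"
proof -
  interpret h: ring_hom_cring R S \<sigma>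
    by (intro ring_hom_cring.intro ring_hom_cring_axioms.intro M.R.is_cring N.R.is_cring ring_hom)
  have "\<sigma> (\<Oplus>\<^bsub>R\<^esub>i\<in>T. r i \<otimes>\<^bsub>R\<^esub> b i) = (\<Oplus>\<^bsub>S\<^esub>i\<in>T. (\<sigma> \<circ> (\<lambda>i. r i \<otimes>\<^bsub>R\<^esub> b i)) i)"
    using assms h.hom_finsum[of "\<lambda>i. r i \<otimes>\<^bsub>R\<^esub> b i" T] by auto
  also have "\<dots> = (\<Oplus>\<^bsub>S\<^esub>i\<in>T. \<sigma> (r i) \<otimes>\<^bsub>S\<^esub> \<sigma> (b i))"
    using assms \<sigma>_closed by (intro N.R.finsum_cong') auto
  finally show ?thesis .
qed

abbreviation "relations n r \<equiv> {b \<in> fin_supp {..<n} (self_module R). (\<Oplus>\<^bsub>R\<^esub>i\<in>{..<n}. r i \<otimes>\<^bsub>R\<^esub> b i) \<in> c}"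
abbreviation "relations' n r' \<equiv>
  {b \<in> fin_supp {..<n} (self_module S). (\<Oplus>\<^bsub>S\<^esub>i\<in>{..<n}. r' i \<otimes>\<^bsub>S\<^esub> b i) \<in> {\<zero>\<^bsub>S\<^esub>}}"

lemma relations_reduce:
  assumes r: "\<And>i. i < n \<Longrightarrow> r i \<in> carrier R" "\<And>i. i < n \<Longrightarrow> r' i = \<sigma> (r i)"
    and b: "\<And>i. b i \<in> carrier R" "\<And>i. i \<notin> {..<n::nat} \<Longrightarrow> b i = \<zero>\<^bsub>R\<^esub>"
  shows "(\<lambda>i. \<sigma> (b i)) \<in> relations' n r' \<longleftrightarrow> b \<in> relations n r"
proof -
  have "b \<in> fin_supp {..<n} (self_module R)" by (rule fin_suppI'[OF finite_lessThan]) (simp_all add: b del: lessThan_iff)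
  moreover have "(\<lambda>i. \<sigma> (b i)) \<in> fin_supp {..<n} (self_module S)"
    by (rule fin_suppI'[OF finite_lessThan]) (simp_all add: b \<sigma>_closed \<sigma>_zero del: lessThan_iff)
  moreover have "(\<Oplus>\<^bsub>S\<^esub>i\<in>{..<n}. r' i \<otimes>\<^bsub>S\<^esub> \<sigma> (b i)) = \<sigma> (\<Oplus>\<^bsub>R\<^esub>i\<in>{..<n}. r i \<otimes>\<^bsub>R\<^esub> b i)"
  proof -
    have "(\<Oplus>\<^bsub>S\<^esub>i\<in>{..<n}. r' i \<otimes>\<^bsub>S\<^esub> \<sigma> (b i)) = (\<Oplus>\<^bsub>S\<^esub>i\<in>{..<n}. \<sigma> (r i) \<otimes>\<^bsub>S\<^esub> \<sigma> (b i))"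
      using r b(1) \<sigma>_closed by (intro N.R.finsum_cong') auto
    then show ?thesis using r(1) b(1) by (subst \<sigma>_sum) auto
  qed
  moreover have "(\<Oplus>\<^bsub>R\<^esub>i\<in>{..<n}. r i \<otimes>\<^bsub>R\<^esub> b i) \<in> carrier R" using r b(1) by (intro M.R.finsum_closed) auto
  ultimately show ?thesis using \<sigma>_ker by simp
qed

lemma flat_eq_reduce:
  assumes flat: "flat_eq R M c" shows "flat_eq S N {\<zero>\<^bsub>S\<^esub>}"
  unfolding flat_eq_def
proof (intro allI impI)
  fix n :: nat and r' q'
  assume r': "\<forall>i<n. r' i \<in> carrier S" and q': "q' \<in> fin_supp {..<n} N"
    and rel: "(\<Oplus>\<^bsub>N\<^esub>i\<in>{..<n}. r' i \<odot>\<^bsub>N\<^esub> q' i) \<in> ismult N {\<zero>\<^bsub>S\<^esub>}"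
  have "\<exists>a\<in>carrier R. \<sigma> a = r' i" if "i < n" for i
  proof -
    have "r' i \<in> \<sigma> ` carrier R" unfolding \<sigma>_surj using r' that by blast
    then show ?thesis by auto
  qed
  then obtain r where r: "\<And>i. i < n \<Longrightarrow> r i \<in> carrier R" "\<And>i. i < n \<Longrightarrow> r' i = \<sigma> (r i)" by metis
  have "\<exists>x\<in>carrier M. \<tau> x = q' i \<and> (i \<notin> {..<n} \<longrightarrow> x = \<zero>\<^bsub>M\<^esub>)" for i
  proof (cases "i \<in> {..<n}")
    case True
    have "q' i \<in> \<tau> ` carrier M" unfolding \<tau>_surj by (rule fin_suppD(1)[OF q'])
    then show ?thesis using True by auto
  qed (use fin_suppD(2)[OF q'] \<tau>_zero in auto)
  then obtain q where q: "\<And>i. q i \<in> carrier M" "\<And>i. \<tau> (q i) = q' i" "\<And>i. i \<notin> {..<n} \<Longrightarrow> q i = \<zero>\<^bsub>M\<^esub>" by metis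
  have sumM: "(\<Oplus>\<^bsub>M\<^esub>i\<in>{..<n}. r i \<odot>\<^bsub>M\<^esub> q i) \<in> carrier M" using r q(1) by (intro M.M.finsum_closed) auto
  have "\<tau> (\<Oplus>\<^bsub>M\<^esub>i\<in>{..<n}. r i \<odot>\<^bsub>M\<^esub> q i) = (\<Oplus>\<^bsub>N\<^esub>i\<in>{..<n}. r' i \<odot>\<^bsub>N\<^esub> q' i)"
  proof -
    have "(\<Oplus>\<^bsub>N\<^esub>i\<in>{..<n}. r' i \<odot>\<^bsub>N\<^esub> q' i) = (\<Oplus>\<^bsub>N\<^esub>i\<in>{..<n}. \<sigma> (r i) \<odot>\<^bsub>N\<^esub> \<tau> (q i))"
      using r \<sigma>_closed \<tau>_closed[OF q(1)] unfolding q(2) by (intro N.M.finsum_cong') auto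
    then show ?thesis using r(1) q(1) by (subst \<tau>_sum) auto
  qed
  also have "\<dots> = \<zero>\<^bsub>N\<^esub>" by (rule N.ismult_zero_ideal[OF rel])
  finally have "(\<Oplus>\<^bsub>M\<^esub>i\<in>{..<n}. r i \<odot>\<^bsub>M\<^esub> q i) \<in> ismult M c" using \<tau>_ker[OF sumM] by simp
  then have "q \<in> lspan M (relations n r)"
    using flat r(1) fin_suppI'[of "{..<n}" q M] q(1,3) unfolding flat_eq_def by blast
  moreover have "(\<lambda>t. \<tau> (x t)) \<in> lspan N (relations' n r')" if "x \<in> lspan M (relations n r)" for x
    using that
  proof (induct x rule: lspan.induct)
    case zero
    show ?case unfolding \<tau>_zero by (rule lspan.zero)
  next
    case (step x b y)
    have S: "relations n r \<subseteq> fin_supp {..<n} (self_module R)" by auto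
    have xM: "x t \<in> carrier M" for t using fin_suppD(1)[OF M.lspan_fin_supp[OF S step(1)]] .
    have b: "b i \<in> carrier R" "i \<notin> {..<n} \<Longrightarrow> b i = \<zero>\<^bsub>R\<^esub>" for i
      using fin_suppD(1,2)[OF subsetD[OF S step(3)], of i] by simp_all
    have "(\<lambda>i. \<sigma> (b i)) \<in> relations' n r' \<longleftrightarrow> b \<in> relations n r"
      by (rule relations_reduce) (erule r, erule r, rule b, erule b)
    then have "(\<lambda>i. \<sigma> (b i)) \<in> relations' n r'" using step(3) by blast
    from lspan.step[OF step(2) this \<tau>_closed[OF step(4)]] show ?case
      using xM b(1) step(4) by (simp add: \<tau>_add \<tau>_smult)
  qed
  ultimately show "q' \<in> lspan N (relations' n r')" unfolding q(2)[symmetric] by blast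
qed

text \<open>
  Combinations over \<open>R/c\<close> lift to combinations over \<open>R\<close> up to an error with entries in \<open>c M\<close>. The error is
  itself a combination of vectors with entries in \<open>c\<close>, which satisfy every relation modulo \<open>c\<close>.
\<close>

lemma flat_eq_lift:
  assumes flat: "flat_eq S N {\<zero>\<^bsub>S\<^esub>}" shows "flat_eq R M c"
  unfolding flat_eq_def
proof (intro allI impI)
  fix n :: nat and r q
  assume r: "\<forall>i<n. r i \<in> carrier R" and q: "q \<in> fin_supp {..<n} M"
    and rel: "(\<Oplus>\<^bsub>M\<^esub>i\<in>{..<n}. r i \<odot>\<^bsub>M\<^esub> q i) \<in> ismult M c"
  have S: "relations n r \<subseteq> fin_supp {..<n} (self_module R)" by auto
  have r1: "\<And>i. i < n \<Longrightarrow> r i \<in> carrier R" using r by blast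
  have qM: "q i \<in> carrier M" for i by (rule fin_suppD(1)[OF q])
  interpret T: module R "fun_module {..<n} M" by (rule M.fun_module)
  have "(\<Oplus>\<^bsub>N\<^esub>i\<in>{..<n}. \<sigma> (r i) \<odot>\<^bsub>N\<^esub> \<tau> (q i)) = \<tau> (\<Oplus>\<^bsub>M\<^esub>i\<in>{..<n}. r i \<odot>\<^bsub>M\<^esub> q i)"
    using r qM by (intro \<tau>_sum[symmetric]) auto
  also have "\<dots> = \<zero>\<^bsub>N\<^esub>" using \<tau>_ker[OF M.ismult_closed[OF c rel]] rel by simp
  finally have "(\<Oplus>\<^bsub>N\<^esub>i\<in>{..<n}. \<sigma> (r i) \<odot>\<^bsub>N\<^esub> \<tau> (q i)) \<in> ismult N {\<zero>\<^bsub>S\<^esub>}" by (simp add: ismult.zero)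
  moreover have "(\<lambda>i. \<tau> (q i)) \<in> fin_supp {..<n} N"
    using qM \<tau>_closed fin_suppD(2)[OF q] \<tau>_zero by (intro fin_suppI') auto
  moreover have "\<forall>i<n. \<sigma> (r i) \<in> carrier S" using r \<sigma>_closed by blast
  ultimately have "(\<lambda>i. \<tau> (q i)) \<in> lspan N (relations' n (\<lambda>i. \<sigma> (r i)))"
    by (intro flat[unfolded flat_eq_def, rule_format]) simp_all
  moreover have "\<exists>g\<in>lspan M (relations n r). \<forall>t. \<tau> (g t) = x t"
    if "x \<in> lspan N (relations' n (\<lambda>i. \<sigma> (r i)))" for x
    using that
  proof (induct x rule: lspan.induct)
    case zero
    show ?case using \<tau>_zero by (intro bexI[OF _ lspan.zero]) simp
  next
    case (step x b y)
    obtain g where g: "g \<in> lspan M (relations n r)" "\<And>t. \<tau> (g t) = x t" using step(2) by blast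
    have gM: "g t \<in> carrier M" for t using fin_suppD(1)[OF M.lspan_fin_supp[OF S g(1)]] .
    have b: "b \<in> fin_supp {..<n} (self_module S)" using step(3) by simp
    have "\<exists>a\<in>carrier R. \<sigma> a = b i \<and> (i \<notin> {..<n} \<longrightarrow> a = \<zero>\<^bsub>R\<^esub>)" for i
    proof (cases "i \<in> {..<n}")
      case True
      have "b i \<in> \<sigma> ` carrier R" unfolding \<sigma>_surj using fin_suppD(1)[OF b, of i] by simp
      then show ?thesis using True by auto
    qed (use fin_suppD(2)[OF b] \<sigma>_zero in auto)
    then obtain a where a: "\<And>i. a i \<in> carrier R" "\<And>i. \<sigma> (a i) = b i" "\<And>i. i \<notin> {..<n} \<Longrightarrow> a i = \<zero>\<^bsub>R\<^esub>" by metis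
    have "(\<lambda>i. \<sigma> (a i)) \<in> relations' n (\<lambda>i. \<sigma> (r i)) \<longleftrightarrow> a \<in> relations n r"
      by (rule relations_reduce) (erule r1, rule refl, rule a, erule a)
    then have ar: "a \<in> relations n r" using step(3) unfolding a(2) by blast
    have "y \<in> \<tau> ` carrier M" unfolding \<tau>_surj by (rule step(4))
    then obtain w where w: "w \<in> carrier M" "\<tau> w = y" by auto
    show ?case
      using lspan.step[OF g(1) ar w(1)] gM w a by (intro bexI) (auto simp: \<tau>_add \<tau>_smult g(2))
  qed
  ultimately obtain g where g: "g \<in> lspan M (relations n r)" "\<And>t. \<tau> (g t) = \<tau> (q t)" by blast
  have gfs: "g \<in> fin_supp {..<n} M" by (rule M.lspan_fin_supp[OF S g(1)])
  have gM: "g t \<in> carrier M" for t by (rule fin_suppD(1)[OF gfs])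
  let ?h = "\<lambda>t. q t \<ominus>\<^bsub>M\<^esub> g t"
  have h: "?h \<in> fin_supp {..<n} M" by (rule M.fin_supp_diff[OF q gfs])
  have small: "?h t \<in> ismult M c" for t
  proof -
    have "\<tau> (?h t) \<oplus>\<^bsub>N\<^esub> \<tau> (g t) = \<tau> (q t)"
      using qM gM by (subst \<tau>_add[symmetric]) (auto simp: a_minus_def M.M.a_assoc M.M.l_neg)
    then have "\<tau> (?h t) \<oplus>\<^bsub>N\<^esub> \<tau> (q t) = \<zero>\<^bsub>N\<^esub> \<oplus>\<^bsub>N\<^esub> \<tau> (q t)" using g(2) qM \<tau>_closed by simp
    then have "\<tau> (?h t) = \<zero>\<^bsub>N\<^esub>"
      using qM gM \<tau>_closed N.M.add.right_cancel by (metis M.M.minus_closed N.M.zero_closed)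
    then show ?thesis using \<tau>_ker qM gM by simp
  qed
  have gen: "(\<lambda>x. basis_vec R t x \<odot>\<^bsub>M\<^esub> ?h t) \<in> lspan M (relations n r)" if t: "t \<in> {..<n}" for t
  proof (rule M.ismult_image[OF c M.fun_module _ M.lspan_submodule[OF S] _ small])
    show "(\<lambda>y x. basis_vec R t x \<odot>\<^bsub>M\<^esub> y) \<in> mod_hom R M (fun_module {..<n} M)"
      using basis_vec_smult_fin_supp[OF M.module_axioms t]
      by (intro mod_homI) (auto simp: M.smult_r_distr M.smult_lcomm[OF M.R.basis_vec_closed])
    fix s y assume s: "s \<in> c" and y: "y \<in> carrier M"
    have sR: "s \<in> carrier R" by (rule ideal.Icarr[OF c s])
    let ?b = "\<lambda>x. s \<otimes>\<^bsub>R\<^esub> basis_vec R t x"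
    have "?b x \<in> c" for x by (rule ideal.I_r_closed[OF c s M.R.basis_vec_closed])
    moreover have "?b \<in> fin_supp {..<n} (self_module R)"
      using module.fin_supp_smult[OF self_module[OF M.R.is_cring] sR M.R.basis_vec_fin_supp[OF t]] by simp
    moreover have "(\<Oplus>\<^bsub>R\<^esub>i\<in>{..<n}. r i \<otimes>\<^bsub>R\<^esub> ?b i) \<in> c"
    proof -
      interpret A: module R "self_module R" by (rule self_module[OF M.R.is_cring])
      from A.submodule_finsum[OF M.R.ideal_submodule[OF c], of "{..<n}" "\<lambda>i. r i \<otimes>\<^bsub>R\<^esub> ?b i"] show ?thesis
        using r1 ideal.I_l_closed[OF c] calculation(1) by simp
    qed
    ultimately have "(\<lambda>x. ?b x \<odot>\<^bsub>M\<^esub> y) \<in> lspan M (relations n r)" by (intro M.lspan_gen[OF S _ y]) simp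
    moreover have "?b x \<odot>\<^bsub>M\<^esub> y = basis_vec R t x \<odot>\<^bsub>M\<^esub> (s \<odot>\<^bsub>M\<^esub> y)" for x
      unfolding M.smult_lcomm[OF M.R.basis_vec_closed sR y] by (rule M.smult_assoc1[OF sR M.R.basis_vec_closed y])
    ultimately show "(\<lambda>x. basis_vec R t x \<odot>\<^bsub>M\<^esub> (s \<odot>\<^bsub>M\<^esub> y)) \<in> lspan M (relations n r)" by simp
  qed
  have "(\<Oplus>\<^bsub>fun_module {..<n} M\<^esub>t\<in>{..<n}. (\<lambda>x. basis_vec R t x \<odot>\<^bsub>M\<^esub> ?h t)) \<in> lspan M (relations n r)"
    by (rule T.submodule_finsum[OF M.lspan_submodule[OF S] finite_lessThan gen])
  then have "?h \<in> lspan M (relations n r)" unfolding M.fun_module_expand[OF finite_lessThan h] .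
  from M.lspan_add[OF S g(1) this] have "(\<lambda>t. g t \<oplus>\<^bsub>M\<^esub> ?h t) \<in> lspan M (relations n r)" .
  moreover have "g t \<oplus>\<^bsub>M\<^esub> ?h t = q t" for t
    unfolding a_minus_def using qM[of t] gM[of t] by (simp only: M.M.a_comm[of "q t"] M.M.r_neg2 M.M.a_inv_closed)
  ultimately show "q \<in> lspan M (relations n r)" by simp
qed

lemma flat_eq_iff: "flat_eq S N {\<zero>\<^bsub>S\<^esub>} \<longleftrightarrow> flat_eq R M c"
  using flat_eq_reduce flat_eq_lift by blast

end

section \<open>Flatness over the quotient rings and exactness on torsion modules\<close>

lemma flat_module_iff_flat_eq:
  fixes \<iota> :: "'a \<Rightarrow> 'u" and R :: "('a, 'r) ring_scheme"
  assumes Q: "module R Q" and \<iota>: "inj_on \<iota> (carrier R)"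
  shows "flat_module TYPE('u) R Q \<longleftrightarrow> flat_eq R Q {\<zero>\<^bsub>R\<^esub>}"
proof -
  interpret Q: module R Q by (rule Q)
  interpret filter: ideal_filter R "{{\<zero>\<^bsub>R\<^esub>}}"
    using Q.R.zeroideal by (intro ideal_filter.intro Q.R.is_cring ideal_filter_axioms.intro) auto
  have "ann_by R {{\<zero>\<^bsub>R\<^esub>}} = {N :: ('a, 'u) module. module R N}"
    using module.smult_l_null by (fastforce simp: ann_by_def)
  then show ?thesis using filter.exact_iff_flat_eq[OF Q \<iota>] by (simp add: flat_module_def)
qed

context adic_module begin

lemma quot_ring_cring: "cring (quot_ring R I k)"
  unfolding quot_ring_def by (rule ideal.quotient_is_cring[OF ideal_Ip is_cring])

lemma pi_ring_hom: "\<pi> k \<in> ring_hom R (quot_ring R I k)"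
  unfolding quot_ring_def by (rule ideal.rcos_ring_hom[OF ideal_Ip])

lemma quot_ring_carrier: "\<pi> k ` carrier R = carrier (quot_ring R I k)"
  by (auto simp: quot_ring_def FactRing_def A_RCOSETS_def')

lemma reduction_smult:
  assumes a: "a \<in> carrier R" and x: "x \<in> carrier M"
  shows "\<pi> k a \<odot>\<^bsub>adic_reduction R I M k\<^esub> \<tau> k x = \<tau> k (a \<odot>\<^bsub>M\<^esub> x)"
proof -
  interpret Q: module R "Q k" by (rule Q_module)
  interpret T: tensor_product R "Q k" M by (rule Q_tensor)
  have eq: "\<pi> k a \<otimes>\<^bsub>quot_ring R I k\<^esub> Y = a \<odot>\<^bsub>Q k\<^esub> Y" if Y: "Y \<in> carrier (Q k)" for Y
  proof -
    obtain y where y: "y \<in> carrier R" "Y = \<pi> k y" using Y pi_surj by blast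
    have "\<pi> k a \<otimes>\<^bsub>quot_ring R I k\<^esub> \<pi> k y = \<pi> k (a \<otimes> y)"
      using ring_hom_mult[OF pi_ring_hom a y(1)] by (rule sym)
    also have "\<dots> = a \<odot>\<^bsub>Q k\<^esub> \<pi> k y" using mod_hom_smult[OF pi_hom a] y(1) by (simp only: self_module_simps)
    finally show ?thesis unfolding y(2) .
  qed
  have "(\<lambda>Y. \<pi> k a \<otimes>\<^bsub>quot_ring R I k\<^esub> Y) \<in> mod_hom R (Q k) (Q k)"
    using a by (intro mod_homI) (simp_all only: eq Q.smult_closed Q.M.a_closed Q.smult_r_distr Q.smult_lcomm)
  from tensor_map_hom(2)[OF Q_module Q_module M.module_axioms M.module_axioms this mod_hom_id pi_one x]
  have "\<pi> k a \<odot>\<^bsub>adic_reduction R I M k\<^esub> \<tau> k x = pure_tensor R (Q k) M (a \<odot>\<^bsub>Q k\<^esub> \<pi> k \<one>) x"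
    unfolding adic_reduction_def Let_def eq[OF pi_one] id_apply by simp
  also have "\<dots> = \<tau> k (a \<odot>\<^bsub>M\<^esub> x)"
    unfolding T.pt_smult_l[OF a pi_one x] T.pt_smult_r[OF a pi_one x] ..
  finally show ?thesis .
qed

lemma reduction_simps:
  "carrier (adic_reduction R I M k) = carrier (tensor R (Q k) M)"
  "\<zero>\<^bsub>adic_reduction R I M k\<^esub> = \<zero>\<^bsub>tensor R (Q k) M\<^esub>"
  "x \<oplus>\<^bsub>adic_reduction R I M k\<^esub> y = x \<oplus>\<^bsub>tensor R (Q k) M\<^esub> y"
  by (simp_all add: adic_reduction_def Let_def)

lemma reduction: "module_reduction R M (quot_ring R I k) (adic_reduction R I M k) (\<pi> k) (\<tau> k) (Ip (k + 1))"
proof -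
  have zero: "\<zero>\<^bsub>quot_ring R I k\<^esub> = \<zero>\<^bsub>Q k\<^esub>"
    by (simp add: quot_ring_def FactRing_def quot_ring_module_def quot_module_def)
  have module: "module (quot_ring R I k) (adic_reduction R I M k)"
    by (rule module_image[OF M.module_axioms quot_ring_cring pi_ring_hom quot_ring_carrier,
          where \<pi> = "\<tau> k"])
      (simp_all only: reduction_simps tau_surj linear_map.zero[OF tau_map] linear_map.add[OF tau_map] reduction_smult)
  show ?thesis
    by (intro module_reduction.intro module_reduction_axioms.intro M.module_axioms module pi_ring_hom
        quot_ring_carrier ideal_Ip)
      (simp_all only: zero pi_zero_iff reduction_simps tau_surj linear_map.add[OF tau_map] reduction_smult tau_zero_iff)
qed

lemma reduction_flat_iff:
  fixes \<iota> :: "'a \<Rightarrow> 'u"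
  assumes \<iota>: "inj_on \<iota> (carrier R)"
  shows "flat_module TYPE('u) (quot_ring R I k) (adic_reduction R I M k) \<longleftrightarrow> flat_eq R M (Ip (k + 1))"
proof -
  interpret red: module_reduction R M "quot_ring R I k" "adic_reduction R I M k" "\<pi> k" "\<tau> k" "Ip (k + 1)"
    by (rule reduction)
  let ?s = "inv_into (carrier R) (\<pi> k)"
  \<comment> \<open>Choosing representatives embeds \<open>R / I ^ (k + 1)\<close> into \<open>R\<close>, hence into the universe.\<close>
  have "inj_on (\<iota> \<circ> ?s) (carrier (quot_ring R I k))"
    unfolding quot_ring_carrier[symmetric]
    by (intro comp_inj_on inj_on_inv_into inj_on_subset[OF \<iota>]) (auto intro: inv_into_into)
  from flat_module_iff_flat_eq[OF red.N.module_axioms this] show ?thesis using red.flat_eq_iff by simp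
qed

lemma torsion_exact_iff:
  fixes \<iota> :: "'a \<Rightarrow> 'u"
  assumes \<iota>: "inj_on \<iota> (carrier R)"
  shows "tensor_exact_on R M {N :: ('a, 'u) module. torsion_module R I N} \<longleftrightarrow> (\<forall>i\<ge>1. flat_eq R M (Ip i))"
proof -
  interpret filter: ideal_filter R "{Ip i | i. i \<ge> 1}"
  proof (intro ideal_filter.intro is_cring ideal_filter_axioms.intro)
    show "\<exists>e\<in>{Ip i | i. i \<ge> 1}. e \<subseteq> c \<and> e \<subseteq> d" if cd: "c \<in> {Ip i | i. i \<ge> 1}" "d \<in> {Ip i | i. i \<ge> 1}" for c d
    proof -
      obtain i j where "c = Ip i" "d = Ip j" "i \<ge> 1" using cd by blast
      then show ?thesis using Ip_antimono[of i "max i j"] Ip_antimono[of j "max i j"]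
        by (intro bexI[of _ "Ip (max i j)"]) auto
    qed
  qed (use ideal_Ip in auto)
  have "{N :: ('a, 'u) module. torsion_module R I N} = ann_by R {Ip i | i. i \<ge> 1}"
    unfolding ann_by_def torsion_module_def by blast
  then show ?thesis using filter.exact_iff_flat_eq[OF M.module_axioms \<iota>] by auto
qed

end

theorem theorem0p1:
  fixes A :: "('a, 'r) ring_scheme"
    and I :: "'a set"
    and P :: "('a, 'p, 's) module_scheme"
  assumes "cring A"
    and "weakly_proregular_ideal A I"
    and "module A P"
    and "adically_complete A I P"
    and universe: "\<exists>f :: 'a \<Rightarrow> 'u. inj_on f (carrier A)"
  shows "(adically_flat TYPE('u) A I P
        \<longleftrightarrow> tensor_exact_on A P {N :: ('a, 'u) module. torsion_module A I N})
    \<and> (tensor_exact_on A P {N :: ('a, 'u) module. torsion_module A I N}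
        \<longleftrightarrow> (\<forall>k. flat_module TYPE('u) (quot_ring A I k) (adic_reduction A I P k)))"
proof -
  obtain as where as: "as \<noteq> []" "set as \<subseteq> carrier A" "I = Idl\<^bsub>A\<^esub> (set as)" "weakly_proregular_seq A as"
    using assms(2) unfolding weakly_proregular_ideal_def by blast
  obtain \<iota> :: "'a \<Rightarrow> 'u" where \<iota>: "inj_on \<iota> (carrier A)" using universe by blast
  interpret adic_module A as I P
    by (intro adic_module.intro fg_ideal.intro fg_ideal_axioms.intro assms(1,3) as)
  let ?EQ = "\<forall>i\<ge>1. flat_eq A P (Ip i)"
  have "adically_flat TYPE('u) A I P \<longleftrightarrow> ?EQ"
  proof
    assume "adically_flat TYPE('u) A I P"
    then have "carrier (Tor A (Suc 0) P N) = {\<zero>\<^bsub>Tor A (Suc 0) P N\<^esub>}" if "torsion_module A I N" for N :: "('a, 'u) module"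
      using that unfolding adically_flat_def by blast
    from Tor_zero_imp_flat_eq[OF assms(3) \<iota> this] show ?EQ by blast
  next
    assume EQ: ?EQ
    \<comment> \<open>The case \<open>i = 0\<close> is trivial, because \<open>I\<^sup>0 = A\<close>.\<close>
    have flat: "flat_eq A P (Ip i)" for i
    proof (cases "i = 0")
      case True
      show ?thesis unfolding True Ip_0 by (rule M.flat_eq_carrier)
    next
      case False
      then show ?thesis using EQ by (meson less_one not_le)
    qed
    have wpr: "koszul_pro_zero A as (self_module A)" by (rule weakly_proregular_pro_zero[OF as(4)])
    interpret C: complete_flat A as I P
      by (intro complete_flat.intro complete_flat_axioms.intro fg_ideal_axioms M.module_axioms wpr flat)
        (blast intro: complete_separated[OF assms(4)] complete_convergent[OF assms(4)])+
    interpret K: koszul_flat A as I P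
      using wpr flat C.complete_pro_zero
      by (intro koszul_flat.intro koszul_flat_axioms.intro fg_ideal_axioms M.module_axioms)
    show "adically_flat TYPE('u) A I P"
      unfolding adically_flat_def
    proof (intro allI impI)
      fix N :: "('a, 'u) module" and i :: nat assume N: "torsion_module A I N" and "0 < i"
      then obtain n where i: "i = Suc n" using gr0_conv_Suc by blast
      show "carrier (Tor A i P N) = {\<zero>\<^bsub>Tor A i P N\<^esub>}"
        unfolding i by (rule K.Tor_torsion_zero) (use N in \<open>auto simp: torsion_module_def\<close>)
    qed
  qed
  moreover have "?EQ \<longleftrightarrow> (\<forall>k. flat_eq A P (Ip (k + 1)))"
  proof (intro iffI allI impI)
    show "flat_eq A P (Ip (k + 1))" if ?EQ for k by (rule that[rule_format]) simp
    show "flat_eq A P (Ip i)" if flat: "\<forall>k. flat_eq A P (Ip (k + 1))" and i: "i \<ge> 1" for i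
      using flat[rule_format, of "i - 1"] unfolding le_add_diff_inverse2[OF i] .
  qed
  ultimately show ?thesis unfolding torsion_exact_iff[OF \<iota>] reduction_flat_iff[OF \<iota>] by blast
qed

end
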